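(* Let $\mathbf k$ be a field and $(R,A,\rho)$ a crossed module of (not necessarily unital) associative $\mathbf k$-algebras. Then there are exact sequences of vector spaces $$HH_2(R,A,\rho)\to HH_2(\operatorname{Coker}\rho)\to\operatorname{Ker}\rho/[A,\operatorname{Ker}\rho]\to HH_1(R,A,\rho)\to HH_1(\operatorname{Coker}\rho)\to0,$$ $$HC_2(R,A,\rho)\to HC_2(\operatorname{Coker}\rho)\to\operatorname{Ker}\rho/[A,\operatorname{Ker}\rho]\to HC_1(R,A,\rho)\to HC_1(\operatorname{Coker}\rho)\to0,$$ and the equality $$HH_0(R,A,\rho)=HC_0(R,A,\rho)=\operatorname{Coker}\rho/[\operatorname{Coker}\rho,\operatorname{Coker}\rho].$$
   Context: All algebras are not-necessarily-unital associative algebras over a fixed field $\mathbf k$ (any characteristic); tensor products are over $\mathbf k$. Crossed modules. An action of an algebra $A$ on an algebra $R$ is an $A$-bimodule structure on $R$ with $a(rr')=(ar)r'$, $(ra)r'=r(ar')$, $(rr')a=r(r'a)$. A crossed module $(R,A,\rho)$ is an algebra homomorphism $\rho:R\to A$ with an action of $A$ on $R$ such that $\rho(ar)=a\rho(r)$, $\rho(ra)=\rho(r)a$, and $\rho(r)r'=rr'=r\rho(r')$. Then $\rho(R)$ is an ideal of $A$, $\operatorname{Coker}\rho=A/\rho(R)$ is an algebra, and $\operatorname{Ker}\rho$ is stable under the action of $A$; $[A,\operatorname{Ker}\rho]$ is the subspace spanned by $ar-ra$, $a\in A$, $r\in\operatorname{Ker}\rho$. Nerve. $R\rtimes A$ is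 $R\oplus A$ with $(r,a)(r',a')=(rr'+ar'+ra',aa')$. The nerve $\mathfrak N_*(R,A,\rho)$ is the simplicial algebra with $\mathfrak N_n=R\rtimes(\cdots(R\rtimes A)\cdots)$ ($n$ factors $R$), where a tuple $(r_1,\dots,r_n,a)$ acts on $R$ through $\rho(r_1)+\cdots+\rho(r_n)+a$; $d_0(r_1,\dots,r_n,a)=(r_2,\dots,r_n,a)$, $d_i(r_1,\dots,r_n,a)=(r_1,\dots,r_i+r_{i+1},\dots,r_n,a)$ for $0<i<n$, $d_n(r_1,\dots,r_n,a)=(r_1,\dots,r_{n-1},\rho(r_n)+a)$, $s_i$ inserts $0$ after $r_i$. Homology. For an algebra $A$, on $A^{\otimes(n+1)}$ let $b'(a_0\otimes\cdots\otimes a_n)=\sum_{i=0}^{n-1}(-1)^i a_0\otimes\cdots\otimes a_ia_{i+1}\otimes\cdots\otimes a_n$, $b=b'+(-1)^n(a_na_0\otimes a_1\otimes\cdots\otimes a_{n-1})$, $t(a_0\otimes\cdots\otimes a_n)=(-1)^na_n\otimes a_0\otimes\cdots\otimes a_{n-1}$, $N=1+t+\cdots+t^n$. $CC(A)$ is the total complex of the first-quadrant bicomplex whose even columns are $(A^{\otimes(\ast+1)},b)$, odd columns $(A^{\otimes(\ast+1)},-b')$, with horizontal differential $1-t$ from odd columns and $N$ from positive even columns; $CC^{\{2\}}(A)$ is the total complex of columns $0$ and $1$ only. $HH_n(A)=H_n(CC^{\{2\}}(A))$, $HC_n(A)=H_n(CC(A))$. For $\Phi\in\{CC,CC^{\{2\}}\}$,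 $\Phi(R,A,\rho)$ is the total complex of the bicomplex obtained by applying $\Phi$ dimension-wise to $\mathfrak N_*(R,A,\rho)$ (alternating sums of faces in the simplicial direction), and $HH_n(R,A,\rho)=H_n(CC^{\{2\}}(R,A,\rho))$, $HC_n(R,A,\rho)=H_n(CC(R,A,\rho))$. *)

theory Defs
  imports "HOL-Library.Poly_Mapping" "HOL-Algebra.QuotRing" "HOL-Algebra.Module"
begin

section \<open>Vector spaces over a field type\<close>

text \<open>A vector space over \<open>'k\<close> is a \<^locale>\<open>module\<close> over the ring record \<open>scalars\<close>.  The record
  \<^typ>\<open>('k, 'v) module\<close> also has the fields \<^const>\<open>monoid.mult\<close> and \<^const>\<open>one\<close>, which carry no
  information for a vector space; for an algebra \<^const>\<open>monoid.mult\<close> is the product, and \<^const>\<open>one\<close>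
  is never referred to, so that no unit is assumed.\<close>

definition scalars :: "'k::field ring" where
  "scalars = \<lparr>carrier = UNIV, monoid.mult = (*), one = 1, ring.zero = 0, add = (+)\<rparr>"

lemma field_scalars: "field (scalars :: 'k::field ring)"
proof (rule cring.cring_fieldI2)
  show "cring (scalars :: 'k ring)"
    by (rule cringI)
      (auto simp: scalars_def algebra_simps intro!: abelian_groupI comm_monoidI exI[of _ "- _"])
  show "\<zero>\<^bsub>scalars :: 'k ring\<^esub> \<noteq> \<one>\<^bsub>scalars\<^esub>"
    by (simp add: scalars_def)
  show "\<exists>b\<in>carrier scalars. a \<otimes>\<^bsub>scalars\<^esub> b = \<one>\<^bsub>scalars\<^esub>"
    if "a \<in> carrier scalars" "a \<noteq> \<zero>\<^bsub>scalars\<^esub>" for a :: 'k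
    using that by (auto simp: scalars_def intro!: exI[of _ "inverse a"])
qed

definition linear_map :: "('k::field, 'v) module \<Rightarrow> ('k, 'w) module \<Rightarrow> ('v \<Rightarrow> 'w) \<Rightarrow> bool" where
  "linear_map V W f \<longleftrightarrow> f \<in> hom (add_monoid V) (add_monoid W) \<and>
     (\<forall>c. \<forall>x\<in>carrier V. f (c \<odot>\<^bsub>V\<^esub> x) = c \<odot>\<^bsub>W\<^esub> f x)"

definition linear_iso :: "('k::field, 'v) module \<Rightarrow> ('k, 'w) module \<Rightarrow> ('v \<Rightarrow> 'w) \<Rightarrow> bool" where
  "linear_iso V W f \<longleftrightarrow> linear_map V W f \<and> bij_betw f (carrier V) (carrier W)"

definition exact_at ::
    "('k::field, 'u) module \<Rightarrow> ('u \<Rightarrow> 'v) \<Rightarrow> ('k, 'v) module \<Rightarrow> ('v \<Rightarrow> 'w) \<Rightarrow> ('k, 'w) module \<Rightarrow> bool" where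
  "exact_at U f V g W \<longleftrightarrow> f ` carrier U = a_kernel V W g"

text \<open>Exactness of \<open>V1 \<rightarrow> V2 \<rightarrow> V3 \<rightarrow> V4 \<rightarrow> V5 \<rightarrow> 0\<close> (no condition at \<open>V1\<close>).\<close>

definition exact_sequence5 where
  "exact_sequence5 V1 f1 V2 f2 V3 f3 V4 f4 V5 \<longleftrightarrow>
     linear_map V1 V2 f1 \<and> linear_map V2 V3 f2 \<and> linear_map V3 V4 f3 \<and> linear_map V4 V5 f4 \<and>
     exact_at V1 f1 V2 f2 V3 \<and> exact_at V2 f2 V3 f3 V4 \<and> exact_at V3 f3 V4 f4 V5 \<and>
     f4 ` carrier V4 = carrier V5"

definition lin_span :: "('k::field, 'v) module \<Rightarrow> 'v set \<Rightarrow> 'v set" where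
  "lin_span V S = \<Inter>{W. submodule W scalars V \<and> S \<subseteq> W}"

text \<open>Quotient by a subspace, or quotient algebra by an ideal; compare \<^const>\<open>FactRing\<close>.\<close>

definition quot :: "('k::field, 'v) module \<Rightarrow> 'v set \<Rightarrow> ('k, 'v set) module" where
  "quot V W = \<lparr>carrier = a_rcosets\<^bsub>V\<^esub> W, monoid.mult = rcoset_mult V W, one = undefined,
     ring.zero = W, add = set_add V, smult = (\<lambda>c U. \<Union>x\<in>U. W +>\<^bsub>V\<^esub> (c \<odot>\<^bsub>V\<^esub> x))\<rparr>"

text \<open>The map into \<open>quot V W\<close> sending the class of \<open>x\<close> to the class of \<open>f x\<close>, when well defined.\<close>

definition quot_map :: "('k::field, 'v) module \<Rightarrow> 'v set \<Rightarrow> ('u \<Rightarrow> 'v) \<Rightarrow> 'u set \<Rightarrow> 'v set" where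
  "quot_map V W f U = (\<Union>x\<in>U. W +>\<^bsub>V\<^esub> f x)"

definition zero_space :: "('k::field, 'v) module \<Rightarrow> ('k, 'v) module" where
  "zero_space V = V\<lparr>carrier := {\<zero>\<^bsub>V\<^esub>}\<rparr>"

definition direct_sum :: "'i set \<Rightarrow> ('i \<Rightarrow> ('k::field, 'v) module) \<Rightarrow> ('k, 'i \<Rightarrow> 'v) module" where
  "direct_sum I V = \<lparr>carrier = (\<Pi>\<^sub>E i\<in>I. carrier (V i)), monoid.mult = undefined, one = undefined,
     ring.zero = (\<lambda>i\<in>I. \<zero>\<^bsub>V i\<^esub>), add = (\<lambda>x y. \<lambda>i\<in>I. x i \<oplus>\<^bsub>V i\<^esub> y i),
     smult = (\<lambda>c x. \<lambda>i\<in>I. c \<odot>\<^bsub>V i\<^esub> x i)\<rparr>"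
  \<comment> \<open>only used for finite \<open>I\<close>\<close>


section \<open>Complexes and homology\<close>

text \<open>Complexes and bicomplexes are concentrated in non-negative degrees;
  \<open>diff C n\<close> is the differential from degree \<open>n\<close> to degree \<open>n - 1\<close> and is irrelevant for \<open>n = 0\<close>.\<close>

record ('k, 'v) chain_complex =
  chain_space :: "nat \<Rightarrow> ('k, 'v) module"
  diff :: "nat \<Rightarrow> 'v \<Rightarrow> 'v"

definition cycles :: "('k::field, 'v) chain_complex \<Rightarrow> nat \<Rightarrow> 'v set" where
  "cycles C n = (if n = 0 then carrier (chain_space C 0)
     else a_kernel (chain_space C n) (chain_space C (n - 1)) (diff C n))"

definition boundaries :: "('k::field, 'v) chain_complex \<Rightarrow> nat \<Rightarrow> 'v set" where
  "boundaries C n = diff C (Suc n) ` carrier (chain_space C (Suc n))"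

definition homology :: "('k::field, 'v) chain_complex \<Rightarrow> nat \<Rightarrow> ('k, 'v set) module" where
  "homology C n = quot (chain_space C n\<lparr>carrier := cycles C n\<rparr>) (boundaries C n)"

definition homology_map ::
    "('k::field, 'w) chain_complex \<Rightarrow> (nat \<Rightarrow> 'v \<Rightarrow> 'w) \<Rightarrow> nat \<Rightarrow> 'v set \<Rightarrow> 'w set" where
  "homology_map D f n = quot_map (chain_space D n) (boundaries D n) (f n)"

text \<open>\<open>hdiff B p q\<close> lowers the column index \<open>p\<close> and \<open>vdiff B p q\<close> the row index \<open>q\<close>.  The two
  are meant to anticommute, so that the total differential is their sum without further signs.\<close>

record ('k, 'v) bicomplex =
  bispace :: "nat \<Rightarrow> nat \<Rightarrow> ('k, 'v) module"
  hdiff :: "nat \<Rightarrow> nat \<Rightarrow> 'v \<Rightarrow> 'v"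
  vdiff :: "nat \<Rightarrow> nat \<Rightarrow> 'v \<Rightarrow> 'v"

text \<open>A chain of degree \<open>n\<close> is a family indexed by \<open>p \<le> n\<close> with \<open>p\<close>-th entry in bidegree \<open>(p, n - p)\<close>.\<close>

definition total_complex :: "('k::field, 'v) bicomplex \<Rightarrow> ('k, nat \<Rightarrow> 'v) chain_complex" where
  "total_complex B = \<lparr>chain_space = (\<lambda>n. direct_sum {..n} (\<lambda>p. bispace B p (n - p))),
     diff = (\<lambda>n x. \<lambda>p\<in>{..n-1}. hdiff B (p + 1) (n - 1 - p) (x (p + 1))
                       \<oplus>\<^bsub>bispace B p (n - 1 - p)\<^esub> vdiff B p (n - p) (x p))\<rparr>"


section \<open>Algebras and tensor powers\<close>

locale nonunital_algebra = module scalars A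
  for A :: "('k::field, 'a) module" (structure) +
  assumes m_closed: "\<lbrakk>x \<in> carrier A; y \<in> carrier A\<rbrakk> \<Longrightarrow> x \<otimes> y \<in> carrier A"
    and m_assoc: "\<lbrakk>x \<in> carrier A; y \<in> carrier A; z \<in> carrier A\<rbrakk> \<Longrightarrow> (x \<otimes> y) \<otimes> z = x \<otimes> (y \<otimes> z)"
    and l_distr: "\<lbrakk>x \<in> carrier A; y \<in> carrier A; z \<in> carrier A\<rbrakk> \<Longrightarrow> (x \<oplus> y) \<otimes> z = x \<otimes> z \<oplus> y \<otimes> z"
    and r_distr: "\<lbrakk>x \<in> carrier A; y \<in> carrier A; z \<in> carrier A\<rbrakk> \<Longrightarrow> z \<otimes> (x \<oplus> y) = z \<otimes> x \<oplus> z \<otimes> y"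
    and smult_l: "\<lbrakk>x \<in> carrier A; y \<in> carrier A\<rbrakk> \<Longrightarrow> (c \<odot> x) \<otimes> y = c \<odot> (x \<otimes> y)"
    and smult_r: "\<lbrakk>x \<in> carrier A; y \<in> carrier A\<rbrakk> \<Longrightarrow> x \<otimes> (c \<odot> y) = c \<odot> (x \<otimes> y)"

text \<open>The \<open>n\<close>-th tensor power is the space of formal combinations of words of length \<open>n\<close> modulo
  multilinearity.  Operators on tensor powers are given on formal combinations and then
  passed to the quotient.\<close>

definition fscale :: "'k::field \<Rightarrow> ('w \<Rightarrow>\<^sub>0 'k) \<Rightarrow> ('w \<Rightarrow>\<^sub>0 'k)" where
  "fscale c f = Poly_Mapping.map ((*) c) f"

definition free_space :: "'w set \<Rightarrow> ('k::field, 'w \<Rightarrow>\<^sub>0 'k) module" where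
  "free_space S = \<lparr>carrier = {f. Poly_Mapping.keys f \<subseteq> S}, monoid.mult = undefined, one = undefined,
     ring.zero = 0, add = (+), smult = fscale\<rparr>"

definition lin_ext :: "('w \<Rightarrow> ('v \<Rightarrow>\<^sub>0 'k::field)) \<Rightarrow> ('w \<Rightarrow>\<^sub>0 'k) \<Rightarrow> ('v \<Rightarrow>\<^sub>0 'k)" where
  "lin_ext g f = (\<Sum>w\<in>Poly_Mapping.keys f. fscale (Poly_Mapping.lookup f w) (g w))"

definition tensor_words :: "('k::field, 'a) module \<Rightarrow> nat \<Rightarrow> 'a list set" where
  "tensor_words A n = {xs. length xs = n \<and> set xs \<subseteq> carrier A}"

definition tensor_relations :: "('k::field, 'a) module \<Rightarrow> nat \<Rightarrow> ('a list \<Rightarrow>\<^sub>0 'k) set" where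
  "tensor_relations A n = lin_span (free_space (tensor_words A n))
     ({Poly_Mapping.single (xs[i := x \<oplus>\<^bsub>A\<^esub> y]) 1
         - Poly_Mapping.single (xs[i := x]) 1 - Poly_Mapping.single (xs[i := y]) 1 | xs i x y.
         xs \<in> tensor_words A n \<and> i < n \<and> x \<in> carrier A \<and> y \<in> carrier A} \<union>
      {Poly_Mapping.single (xs[i := c \<odot>\<^bsub>A\<^esub> x]) 1 - Poly_Mapping.single (xs[i := x]) c | xs i c x.
         xs \<in> tensor_words A n \<and> i < n \<and> x \<in> carrier A})"

definition tensor_power :: "('k::field, 'a) module \<Rightarrow> nat \<Rightarrow> ('k, ('a list \<Rightarrow>\<^sub>0 'k) set) module" where
  "tensor_power A n = quot (free_space (tensor_words A n)) (tensor_relations A n)"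

definition pure_tensor :: "('k::field, 'a) module \<Rightarrow> 'a list \<Rightarrow> ('a list \<Rightarrow>\<^sub>0 'k) set" where
  "pure_tensor A xs = tensor_relations A (length xs)
     +>\<^bsub>free_space (tensor_words A (length xs))\<^esub> Poly_Mapping.single xs 1"

definition tensor_op :: "('k::field, 'b) module \<Rightarrow> nat \<Rightarrow> (('a list \<Rightarrow>\<^sub>0 'k) \<Rightarrow> ('b list \<Rightarrow>\<^sub>0 'k))
    \<Rightarrow> ('a list \<Rightarrow>\<^sub>0 'k) set \<Rightarrow> ('b list \<Rightarrow>\<^sub>0 'k) set" where
  "tensor_op B m f = quot_map (free_space (tensor_words B m)) (tensor_relations B m) f"


section \<open>Hochschild and cyclic homology\<close>

definition bprime :: "('k::field, 'a) module \<Rightarrow> ('a list \<Rightarrow>\<^sub>0 'k) \<Rightarrow> ('a list \<Rightarrow>\<^sub>0 'k)" where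
  "bprime A = lin_ext (\<lambda>xs. \<Sum>i<length xs - 1.
     Poly_Mapping.single (take i xs @ (xs ! i \<otimes>\<^bsub>A\<^esub> xs ! (i + 1)) # drop (i + 2) xs) ((-1) ^ i))"

definition hochschild_b :: "('k::field, 'a) module \<Rightarrow> ('a list \<Rightarrow>\<^sub>0 'k) \<Rightarrow> ('a list \<Rightarrow>\<^sub>0 'k)" where
  "hochschild_b A f = bprime A f + lin_ext (\<lambda>xs.
     Poly_Mapping.single ((last xs \<otimes>\<^bsub>A\<^esub> hd xs) # tl (butlast xs)) ((-1) ^ (length xs - 1))) f"

definition cyclic_t :: "('a list \<Rightarrow>\<^sub>0 'k::field) \<Rightarrow> ('a list \<Rightarrow>\<^sub>0 'k)" where
  "cyclic_t = lin_ext (\<lambda>xs. Poly_Mapping.single (last xs # butlast xs) ((-1) ^ (length xs - 1)))"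

definition cyclic_N :: "nat \<Rightarrow> ('a list \<Rightarrow>\<^sub>0 'k::field) \<Rightarrow> ('a list \<Rightarrow>\<^sub>0 'k)" where
  "cyclic_N n f = (\<Sum>i\<le>n. (cyclic_t ^^ i) f)"

text \<open>The cyclic bicomplex restricted to the columns in \<open>J\<close>: \<open>J = UNIV\<close> gives \<open>CC\<close>, and
  \<open>J = {0, 1}\<close> gives \<open>CC\<^sup>{\<^sup>2\<^sup>}\<close>.  Row \<open>q\<close> consists of tensors with \<open>q + 1\<close> factors.\<close>

definition cyclic_bicomplex ::
    "nat set \<Rightarrow> ('k::field, 'a) module \<Rightarrow> ('k, ('a list \<Rightarrow>\<^sub>0 'k) set) bicomplex" where
  "cyclic_bicomplex J A = \<lparr>
     bispace = (\<lambda>p q. if p \<in> J then tensor_power A (q + 1) else zero_space (tensor_power A (q + 1))),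
     hdiff = (\<lambda>p q. tensor_op A (q + 1) (if odd p then (\<lambda>f. f - cyclic_t f) else cyclic_N q)),
     vdiff = (\<lambda>p q. tensor_op A q (if even p then hochschild_b A else (\<lambda>f. - bprime A f)))\<rparr>"

definition cyclic_total ::
    "nat set \<Rightarrow> ('k::field, 'a) module \<Rightarrow> ('k, nat \<Rightarrow> ('a list \<Rightarrow>\<^sub>0 'k) set) chain_complex" where
  "cyclic_total J A = total_complex (cyclic_bicomplex J A)"

text \<open>The chain map induced by an algebra homomorphism \<open>f\<close> into \<open>B\<close>.\<close>

definition cyclic_map :: "('k::field, 'b) module \<Rightarrow> ('a \<Rightarrow> 'b) \<Rightarrow> nat
    \<Rightarrow> (nat \<Rightarrow> ('a list \<Rightarrow>\<^sub>0 'k) set) \<Rightarrow> (nat \<Rightarrow> ('b list \<Rightarrow>\<^sub>0 'k) set)" where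
  "cyclic_map B f n x = (\<lambda>p\<in>{..n}.
     tensor_op B (n - p + 1) (lin_ext (\<lambda>xs. Poly_Mapping.single (map f xs) 1)) (x p))"

definition HH :: "('k::field, 'a) module \<Rightarrow> nat \<Rightarrow> ('k, (nat \<Rightarrow> ('a list \<Rightarrow>\<^sub>0 'k) set) set) module" where
  "HH A = homology (cyclic_total {0, 1} A)"

definition HC :: "('k::field, 'a) module \<Rightarrow> nat \<Rightarrow> ('k, (nat \<Rightarrow> ('a list \<Rightarrow>\<^sub>0 'k) set) set) module" where
  "HC A = homology (cyclic_total UNIV A)"


section \<open>Simplicial algebras\<close>

record ('k, 'a) simplicial_algebra =
  level :: "nat \<Rightarrow> ('k, 'a) module"
  face :: "nat \<Rightarrow> nat \<Rightarrow> 'a \<Rightarrow> 'a"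
  degeneracy :: "nat \<Rightarrow> nat \<Rightarrow> 'a \<Rightarrow> 'a"

text \<open>The sign \<open>(-1) ^ m\<close> turns the commuting squares of the dimension-wise complexes into
  anticommuting ones.\<close>

definition simplicial_bicomplex :: "nat set \<Rightarrow> ('k::field, 'a) simplicial_algebra
    \<Rightarrow> ('k, nat \<Rightarrow> ('a list \<Rightarrow>\<^sub>0 'k) set) bicomplex" where
  "simplicial_bicomplex J S = \<lparr>
     bispace = (\<lambda>m n. chain_space (cyclic_total J (level S m)) n),
     hdiff = (\<lambda>m n x. let V = chain_space (cyclic_total J (level S (m - 1))) n in
       finsum V (\<lambda>i. ((-1) ^ i) \<odot>\<^bsub>V\<^esub> cyclic_map (level S (m - 1)) (face S m i) n x) {..m}),
     vdiff = (\<lambda>m n x. ((-1) ^ m) \<odot>\<^bsub>chain_space (cyclic_total J (level S m)) (n - 1)\<^esub>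
       diff (cyclic_total J (level S m)) n x)\<rparr>"


section \<open>Crossed modules\<close>

record ('k, 'r, 'a) crossed_module_data =
  source :: "('k, 'r) module"
  target :: "('k, 'a) module"
  left_action :: "'a \<Rightarrow> 'r \<Rightarrow> 'r"
  right_action :: "'r \<Rightarrow> 'a \<Rightarrow> 'r"
  structure_map :: "'r \<Rightarrow> 'a"

locale algebra_action = R: nonunital_algebra R + A: nonunital_algebra A
  for R :: "('k::field, 'r) module" and A :: "('k, 'a) module"
    and l :: "'a \<Rightarrow> 'r \<Rightarrow> 'r" and r :: "'r \<Rightarrow> 'a \<Rightarrow> 'r" +
  assumes l_linear: "a \<in> carrier A \<Longrightarrow> linear_map R R (l a)"
    and l_linear': "x \<in> carrier R \<Longrightarrow> linear_map A R (\<lambda>a. l a x)"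
    and r_linear: "a \<in> carrier A \<Longrightarrow> linear_map R R (\<lambda>x. r x a)"
    and r_linear': "x \<in> carrier R \<Longrightarrow> linear_map A R (r x)"
    and l_assoc: "\<lbrakk>a \<in> carrier A; a' \<in> carrier A; x \<in> carrier R\<rbrakk>
      \<Longrightarrow> l (a \<otimes>\<^bsub>A\<^esub> a') x = l a (l a' x)"
    and r_assoc: "\<lbrakk>a \<in> carrier A; a' \<in> carrier A; x \<in> carrier R\<rbrakk>
      \<Longrightarrow> r x (a \<otimes>\<^bsub>A\<^esub> a') = r (r x a) a'"
    and lr_assoc: "\<lbrakk>a \<in> carrier A; a' \<in> carrier A; x \<in> carrier R\<rbrakk> \<Longrightarrow> r (l a x) a' = l a (r x a')"
    and l_mult: "\<lbrakk>a \<in> carrier A; x \<in> carrier R; y \<in> carrier R\<rbrakk> \<Longrightarrow> l a (x \<otimes>\<^bsub>R\<^esub> y) = l a x \<otimes>\<^bsub>R\<^esub> y"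
    and lr_mult: "\<lbrakk>a \<in> carrier A; x \<in> carrier R; y \<in> carrier R\<rbrakk> \<Longrightarrow> r x a \<otimes>\<^bsub>R\<^esub> y = x \<otimes>\<^bsub>R\<^esub> l a y"
    and r_mult: "\<lbrakk>a \<in> carrier A; x \<in> carrier R; y \<in> carrier R\<rbrakk> \<Longrightarrow> r (x \<otimes>\<^bsub>R\<^esub> y) a = x \<otimes>\<^bsub>R\<^esub> r y a"

locale crossed_module =
  algebra_action "source M" "target M" "left_action M" "right_action M"
  for M :: "('k::field, 'r, 'a) crossed_module_data" +
  assumes map_linear: "linear_map (source M) (target M) (structure_map M)"
    and map_mult: "\<lbrakk>x \<in> carrier (source M); y \<in> carrier (source M)\<rbrakk> \<Longrightarrow>
      structure_map M (x \<otimes>\<^bsub>source M\<^esub> y) = structure_map M x \<otimes>\<^bsub>target M\<^esub> structure_map M y"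
    and map_l: "\<lbrakk>a \<in> carrier (target M); x \<in> carrier (source M)\<rbrakk> \<Longrightarrow>
      structure_map M (left_action M a x) = a \<otimes>\<^bsub>target M\<^esub> structure_map M x"
    and map_r: "\<lbrakk>a \<in> carrier (target M); x \<in> carrier (source M)\<rbrakk> \<Longrightarrow>
      structure_map M (right_action M x a) = structure_map M x \<otimes>\<^bsub>target M\<^esub> a"
    and peiffer_l: "\<lbrakk>x \<in> carrier (source M); y \<in> carrier (source M)\<rbrakk> \<Longrightarrow>
      left_action M (structure_map M x) y = x \<otimes>\<^bsub>source M\<^esub> y"
    and peiffer_r: "\<lbrakk>x \<in> carrier (source M); y \<in> carrier (source M)\<rbrakk> \<Longrightarrow>
      right_action M x (structure_map M y) = x \<otimes>\<^bsub>source M\<^esub> y"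

definition image_ideal :: "('k::field, 'r, 'a) crossed_module_data \<Rightarrow> 'a set" where
  "image_ideal M = structure_map M ` carrier (source M)"

definition Coker :: "('k::field, 'r, 'a) crossed_module_data \<Rightarrow> ('k, 'a set) module" where
  "Coker M = quot (target M) (image_ideal M)"

definition Ker :: "('k::field, 'r, 'a) crossed_module_data \<Rightarrow> ('k, 'r) module" where
  "Ker M = (source M)\<lparr>carrier := a_kernel (source M) (target M) (structure_map M)\<rparr>"

definition Ker_mod_commutators :: "('k::field, 'r, 'a) crossed_module_data \<Rightarrow> ('k, 'r set) module" where
  "Ker_mod_commutators M = quot (Ker M) (lin_span (Ker M)
     {left_action M a x \<ominus>\<^bsub>source M\<^esub> right_action M x a | a x. a \<in> carrier (target M) \<and> x \<in> carrier (Ker M)})"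

definition commutator_space :: "('k::field, 'a) module \<Rightarrow> 'a set" where
  "commutator_space A = lin_span A {x \<otimes>\<^bsub>A\<^esub> y \<ominus>\<^bsub>A\<^esub> y \<otimes>\<^bsub>A\<^esub> x | x y. x \<in> carrier A \<and> y \<in> carrier A}"


section \<open>The nerve\<close>

text \<open>The element \<open>(r\<^sub>1, \<dots>, r\<^sub>n, a)\<close> of the nerve is the pair \<open>([r\<^sub>1, \<dots>, r\<^sub>n], a)\<close>.\<close>

definition anchor :: "('k::field, 'r, 'a) crossed_module_data \<Rightarrow> 'r list \<times> 'a \<Rightarrow> 'a" where
  "anchor M = (\<lambda>(rs, a). foldr (\<lambda>r s. structure_map M r \<oplus>\<^bsub>target M\<^esub> s) rs a)"

text \<open>The second equation is the product of \<open>R \<rtimes> B\<close> with \<open>B\<close> the previous level of the nerve,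
  acting on \<open>R\<close> through \<open>anchor\<close>.  The product is unspecified on tuples of different lengths.\<close>

fun nerve_mult ::
    "('k::field, 'r, 'a) crossed_module_data \<Rightarrow> 'r list \<times> 'a \<Rightarrow> 'r list \<times> 'a \<Rightarrow> 'r list \<times> 'a" where
  "nerve_mult M ([], a) ([], a') = ([], a \<otimes>\<^bsub>target M\<^esub> a')"
| "nerve_mult M (r # rs, a) (r' # rs', a') =
    (let (ts, c) = nerve_mult M (rs, a) (rs', a') in
      (((r \<otimes>\<^bsub>source M\<^esub> r' \<oplus>\<^bsub>source M\<^esub> left_action M (anchor M (rs, a)) r')
         \<oplus>\<^bsub>source M\<^esub> right_action M r (anchor M (rs', a'))) # ts, c))"

definition nerve_level :: "('k::field, 'r, 'a) crossed_module_data \<Rightarrow> nat \<Rightarrow> ('k, 'r list \<times> 'a) module" where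
  "nerve_level M n = \<lparr>
     carrier = {(rs, a). length rs = n \<and> set rs \<subseteq> carrier (source M) \<and> a \<in> carrier (target M)},
     monoid.mult = nerve_mult M, one = undefined,
     ring.zero = (replicate n \<zero>\<^bsub>source M\<^esub>, \<zero>\<^bsub>target M\<^esub>),
     add = (\<lambda>(rs, a) (rs', a'). (map2 (\<lambda>r r'. r \<oplus>\<^bsub>source M\<^esub> r') rs rs', a \<oplus>\<^bsub>target M\<^esub> a')),
     smult = (\<lambda>c (rs, a). (map (\<lambda>r. c \<odot>\<^bsub>source M\<^esub> r) rs, c \<odot>\<^bsub>target M\<^esub> a))\<rparr>"

text \<open>List positions start at \<open>0\<close>, so \<open>r\<^sub>i\<close> is \<open>rs ! (i - 1)\<close>.\<close>

definition nerve_face :: "('k::field, 'r, 'a) crossed_module_data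
    \<Rightarrow> nat \<Rightarrow> nat \<Rightarrow> 'r list \<times> 'a \<Rightarrow> 'r list \<times> 'a" where
  "nerve_face M n i = (\<lambda>(rs, a).
     if i = 0 then (tl rs, a)
     else if i = n then (butlast rs, structure_map M (last rs) \<oplus>\<^bsub>target M\<^esub> a)
     else (take (i - 1) rs @ (rs ! (i - 1) \<oplus>\<^bsub>source M\<^esub> rs ! i) # drop (i + 1) rs, a))"

definition nerve_degeneracy :: "('k::field, 'r, 'a) crossed_module_data
    \<Rightarrow> nat \<Rightarrow> nat \<Rightarrow> 'r list \<times> 'a \<Rightarrow> 'r list \<times> 'a" where
  "nerve_degeneracy M n i = (\<lambda>(rs, a). (take i rs @ \<zero>\<^bsub>source M\<^esub> # drop i rs, a))"

definition nerve ::
    "('k::field, 'r, 'a) crossed_module_data \<Rightarrow> ('k, 'r list \<times> 'a) simplicial_algebra" where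
  "nerve M = \<lparr>level = nerve_level M, face = nerve_face M, degeneracy = nerve_degeneracy M\<rparr>"


section \<open>Homology of crossed modules\<close>

definition crossed_total :: "nat set \<Rightarrow> ('k::field, 'r, 'a) crossed_module_data
    \<Rightarrow> ('k, nat \<Rightarrow> nat \<Rightarrow> (('r list \<times> 'a) list \<Rightarrow>\<^sub>0 'k) set) chain_complex" where
  "crossed_total J M = total_complex (simplicial_bicomplex J (nerve M))"

definition HH_crossed :: "('k::field, 'r, 'a) crossed_module_data \<Rightarrow> nat
    \<Rightarrow> ('k, (nat \<Rightarrow> nat \<Rightarrow> (('r list \<times> 'a) list \<Rightarrow>\<^sub>0 'k) set) set) module" where
  "HH_crossed M = homology (crossed_total {0, 1} M)"

definition HC_crossed :: "('k::field, 'r, 'a) crossed_module_data \<Rightarrow> nat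
    \<Rightarrow> ('k, (nat \<Rightarrow> nat \<Rightarrow> (('r list \<times> 'a) list \<Rightarrow>\<^sub>0 'k) set) set) module" where
  "HC_crossed M = homology (crossed_total UNIV M)"

text \<open>The augmentation of the nerve, the projection of \<open>A\<close> onto \<open>Coker M\<close> in simplicial degree
  \<open>0\<close>, and the natural maps it induces on chains and on homology.\<close>

definition coker_chain_map :: "('k::field, 'r, 'a) crossed_module_data \<Rightarrow> nat
    \<Rightarrow> (nat \<Rightarrow> nat \<Rightarrow> (('r list \<times> 'a) list \<Rightarrow>\<^sub>0 'k) set) \<Rightarrow> (nat \<Rightarrow> ('a set list \<Rightarrow>\<^sub>0 'k) set)" where
  "coker_chain_map M n x = cyclic_map (Coker M) (\<lambda>(rs, a). image_ideal M +>\<^bsub>target M\<^esub> a) n (x 0)"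

definition HH_coker_map where
  "HH_coker_map M = homology_map (cyclic_total {0, 1} (Coker M)) (coker_chain_map M)"

definition HC_coker_map where
  "HC_coker_map M = homology_map (cyclic_total UNIV (Coker M)) (coker_chain_map M)"

text \<open>The class of an element \<open>a\<close> of \<open>A\<close>, that is of \<open>([], a)\<close> in level \<open>0\<close>, in degree \<open>0\<close>.\<close>

definition class0 :: "nat set \<Rightarrow> ('k::field, 'r, 'a) crossed_module_data \<Rightarrow> 'a
    \<Rightarrow> (nat \<Rightarrow> nat \<Rightarrow> (('r list \<times> 'a) list \<Rightarrow>\<^sub>0 'k) set) set" where
  "class0 J M a = boundaries (crossed_total J M) 0 +>\<^bsub>chain_space (crossed_total J M) 0\<^esub>
     (\<lambda>m\<in>{..0}. \<lambda>p\<in>{..0}. pure_tensor (nerve_level M 0) [([], a)])"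

end

theory Submission
  imports "HOL.Vector_Spaces" Defs
begin

text \<open>The nerve is augmented by the projection of \<open>A\<close> onto \<open>C = Coker \<rho>\<close>, which identifies the
  two faces of level \<open>1\<close>.  It induces a surjective chain map from the total complex of the crossed
  module onto that of \<open>C\<close>.  The two sequences are the end of the long exact homology sequence of
  this map, once its kernel \<open>K\<close> is known to satisfy \<open>H\<^sub>0(K) = 0\<close> and \<open>H\<^sub>1(K) = Ker \<rho> / [A, Ker \<rho>]\<close>
  (\<open>long_exact_piece\<close>).

  Over a field, \<open>\<rho>\<close> has a linear generalised inverse \<open>s\<close>, with \<open>\<rho> \<circ> s \<circ> \<rho> = \<rho>\<close>.  The linear map
  \<open>h(a) = (s a, a - \<rho>(s a))\<close> from level \<open>0\<close> to level \<open>1\<close> satisfies \<open>d\<^sub>1 (h a) = a\<close>, while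
  \<open>d\<^sub>0 (h a) = a - \<rho>(s a)\<close> depends only on the class of \<open>a\<close> in \<open>C\<close>.  It need not be multiplicative, but
  being linear it can be applied to all tensor factors at once, so on tensors that vanish in \<open>C\<close>
  the map \<open>- h\<close> is a right inverse of \<open>d\<^sub>0 - d\<^sub>1\<close> (\<open>hdiff_homotopy\<close>): the rows of the bicomplex,
  augmented by \<open>C\<close>, are exact in simplicial degree \<open>0\<close>.  This gives \<open>H\<^sub>0(K) = 0\<close>, and it presents
  \<open>H\<^sub>1(K)\<close> by the horizontal cycles in bidegree \<open>(1, 0)\<close>, modulo the image of level \<open>2\<close> and modulo
  the vertical boundaries of the horizontal cycles in bidegree \<open>(1, 1)\<close> (\<open>five_term_exact\<close>).

  A horizontal cycle in bidegree \<open>(1, 0)\<close> is an element \<open>(r, a)\<close> of level \<open>1\<close> with \<open>\<rho> r = 0\<close>, and the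
  image of level \<open>2\<close> consists of the elements \<open>(0, a)\<close>.  So \<open>H\<^sub>1(K)\<close> is a quotient of \<open>Ker \<rho>\<close>, by the
  \<open>R\<close>-components of \<open>b x\<close> for the tensors \<open>x\<close> of two factors in level \<open>1\<close> with \<open>d\<^sub>0 x = d\<^sub>1 x\<close>.
  Every commutator \<open>a k - k a\<close> with \<open>k\<close> in \<open>Ker \<rho>\<close> arises, from \<open>(k, 0) \<otimes> (0, a)\<close>
  (\<open>commutator_is_vdiff\<close>).  Conversely such an \<open>x\<close> equals \<open>x + h (d\<^sub>0 x - d\<^sub>1 x)\<close>, and for every \<open>x\<close>
  the \<open>R\<close>-component of \<open>b\<close> of the latter lies in \<open>[A, Ker \<rho>]\<close>: on pure tensors this is an
  identity between brackets, resting on the antisymmetry \<open>[\<rho> x, y] = - [\<rho> y, x]\<close> that the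
  conditions \<open>\<rho>(x) y = x y = x \<rho>(y)\<close> impose (\<open>bracket_homotopy\<close>).  The contraction acts on
  each column separately, the calculation of \<open>H\<^sub>1(K)\<close> concerns tensors with at most two factors,
  and \<open>1 - t\<close> is zero on a single factor; the argument is therefore the same for Hochschild and for
  cyclic chains, and it is given once, for the columns in a set \<open>J\<close> closed downwards that contains
  \<open>0\<close>.

  In degree \<open>0\<close> the total complex is \<open>A\<close>, and its boundaries are the sums of elements of \<open>\<rho>(R)\<close>,
  coming from level \<open>1\<close>, and of commutators (\<open>total0_value_kernel\<close>).\<close>


section \<open>Vector spaces with a carrier\<close>

lemma scalars_simps [simp]:
  "carrier scalars = UNIV" "\<zero>\<^bsub>scalars\<^esub> = 0" "\<one>\<^bsub>scalars\<^esub> = 1"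
  "a \<oplus>\<^bsub>scalars\<^esub> b = a + b" "a \<otimes>\<^bsub>scalars\<^esub> b = a * b"
  by (simp_all add: scalars_def)

lemma cring_scalars: "cring (scalars :: 'k::field ring)"
  using field_scalars by (rule field.axioms(1)[THEN domain.axioms(1)])

lemma a_inv_scalars [simp]: "\<ominus>\<^bsub>scalars\<^esub> a = - (a::'k::field)"
proof -
  interpret cring "scalars :: 'k ring" by (rule cring_scalars)
  show ?thesis by (rule minus_equality) simp_all
qed

lemma module_scalarsI:
  assumes "abelian_group V"
    and "\<And>c x. x \<in> carrier V \<Longrightarrow> c \<odot>\<^bsub>V\<^esub> x \<in> carrier V"
    and "\<And>b c x. x \<in> carrier V \<Longrightarrow> (b + c) \<odot>\<^bsub>V\<^esub> x = b \<odot>\<^bsub>V\<^esub> x \<oplus>\<^bsub>V\<^esub> c \<odot>\<^bsub>V\<^esub> x"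
    and "\<And>c x y. x \<in> carrier V \<Longrightarrow> y \<in> carrier V \<Longrightarrow>
      c \<odot>\<^bsub>V\<^esub> (x \<oplus>\<^bsub>V\<^esub> y) = c \<odot>\<^bsub>V\<^esub> x \<oplus>\<^bsub>V\<^esub> c \<odot>\<^bsub>V\<^esub> y"
    and "\<And>b c x. x \<in> carrier V \<Longrightarrow> (b * c) \<odot>\<^bsub>V\<^esub> x = b \<odot>\<^bsub>V\<^esub> (c \<odot>\<^bsub>V\<^esub> x)"
    and "\<And>x. x \<in> carrier V \<Longrightarrow> 1 \<odot>\<^bsub>V\<^esub> x = x"
  shows "module (scalars :: 'k::field ring) V"
  using assms by (intro moduleI cring_scalars) auto

lemma module_simps:
  assumes "module (scalars :: 'k::field ring) V" and "x \<in> carrier V"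
  shows "c \<odot>\<^bsub>V\<^esub> x \<in> carrier V" "1 \<odot>\<^bsub>V\<^esub> x = x" "0 \<odot>\<^bsub>V\<^esub> x = \<zero>\<^bsub>V\<^esub>"
    "(b + c) \<odot>\<^bsub>V\<^esub> x = b \<odot>\<^bsub>V\<^esub> x \<oplus>\<^bsub>V\<^esub> c \<odot>\<^bsub>V\<^esub> x"
    "(b * c) \<odot>\<^bsub>V\<^esub> x = b \<odot>\<^bsub>V\<^esub> (c \<odot>\<^bsub>V\<^esub> x)"
    "(- c) \<odot>\<^bsub>V\<^esub> x = \<ominus>\<^bsub>V\<^esub> (c \<odot>\<^bsub>V\<^esub> x)"
proof -
  interpret module "scalars :: 'k ring" V by fact
  show "c \<odot>\<^bsub>V\<^esub> x \<in> carrier V" "1 \<odot>\<^bsub>V\<^esub> x = x" "0 \<odot>\<^bsub>V\<^esub> x = \<zero>\<^bsub>V\<^esub>"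
    "(b + c) \<odot>\<^bsub>V\<^esub> x = b \<odot>\<^bsub>V\<^esub> x \<oplus>\<^bsub>V\<^esub> c \<odot>\<^bsub>V\<^esub> x"
    "(b * c) \<odot>\<^bsub>V\<^esub> x = b \<odot>\<^bsub>V\<^esub> (c \<odot>\<^bsub>V\<^esub> x)"
    "(- c) \<odot>\<^bsub>V\<^esub> x = \<ominus>\<^bsub>V\<^esub> (c \<odot>\<^bsub>V\<^esub> x)"
    using smult_closed[of c x] smult_one[of x] smult_l_null[of x] smult_l_distr[of b c x]
      smult_assoc1[of b c x] smult_l_minus[of c x] \<open>x \<in> carrier V\<close>
    by simp_all
qed

lemma module_smult_add:
  assumes "module (scalars :: 'k::field ring) V" "x \<in> carrier V" "y \<in> carrier V"
  shows "c \<odot>\<^bsub>V\<^esub> (x \<oplus>\<^bsub>V\<^esub> y) = c \<odot>\<^bsub>V\<^esub> x \<oplus>\<^bsub>V\<^esub> c \<odot>\<^bsub>V\<^esub> y"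
  using module.smult_r_distr[OF assms(1), of c x y] assms by simp

lemma module_smult_zero:
  assumes "module (scalars :: 'k::field ring) V"
  shows "c \<odot>\<^bsub>V\<^esub> \<zero>\<^bsub>V\<^esub> = \<zero>\<^bsub>V\<^esub>"
  using module.smult_r_null[OF assms, of c] by simp

lemma module_abelian_group:
  "module (scalars :: 'k::field ring) V \<Longrightarrow> abelian_group V"
  by (rule module.axioms(2))

lemma zero_mem: "module (scalars :: 'k::field ring) V \<Longrightarrow> \<zero>\<^bsub>V\<^esub> \<in> carrier V"
  by (simp add: abelian_group.axioms(1) abelian_monoid.zero_closed module_abelian_group)

lemma add_mem: "module (scalars :: 'k::field ring) V \<Longrightarrow> x \<in> carrier V \<Longrightarrow> y \<in> carrier V \<Longrightarrow>
    x \<oplus>\<^bsub>V\<^esub> y \<in> carrier V"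
  by (simp add: abelian_group.axioms(1) abelian_monoid.a_closed module_abelian_group)

lemma diff_eq_zero_iff:
  assumes V: "module (scalars :: 'k::field ring) V" and "x \<in> carrier V" "y \<in> carrier V"
  shows "x \<ominus>\<^bsub>V\<^esub> y = \<zero>\<^bsub>V\<^esub> \<longleftrightarrow> x = y"
proof -
  interpret V: module "scalars :: 'k ring" V by fact
  show ?thesis
    using assms V.minus_equality[of x "\<ominus>\<^bsub>V\<^esub> y"] by (auto simp: a_minus_def V.r_neg)
qed


subsection \<open>Linear maps\<close>

lemma linear_mapI:
  assumes "\<And>x. x \<in> carrier V \<Longrightarrow> f x \<in> carrier W"
    and "\<And>x y. x \<in> carrier V \<Longrightarrow> y \<in> carrier V \<Longrightarrow> f (x \<oplus>\<^bsub>V\<^esub> y) = f x \<oplus>\<^bsub>W\<^esub> f y"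
    and "\<And>c x. x \<in> carrier V \<Longrightarrow> f (c \<odot>\<^bsub>V\<^esub> x) = c \<odot>\<^bsub>W\<^esub> f x"
  shows "linear_map V W f"
  using assms by (auto simp: linear_map_def hom_def)

lemma linear_mapD:
  assumes "linear_map V W f"
  shows "x \<in> carrier V \<Longrightarrow> f x \<in> carrier W"
    and "x \<in> carrier V \<Longrightarrow> y \<in> carrier V \<Longrightarrow> f (x \<oplus>\<^bsub>V\<^esub> y) = f x \<oplus>\<^bsub>W\<^esub> f y"
    and "x \<in> carrier V \<Longrightarrow> f (c \<odot>\<^bsub>V\<^esub> x) = c \<odot>\<^bsub>W\<^esub> f x"
  using assms by (auto simp: linear_map_def hom_def)

lemma linear_map_zero:
  assumes "module scalars V" "module scalars W" "linear_map V W f"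
  shows "f \<zero>\<^bsub>V\<^esub> = \<zero>\<^bsub>W\<^esub>"
  using linear_mapD(3)[OF assms(3) zero_mem[OF assms(1)], of 0]
    linear_mapD(1)[OF assms(3) zero_mem[OF assms(1)]]
  by (simp add: module_simps(3)[OF assms(1) zero_mem[OF assms(1)]] module_simps(3)[OF assms(2)])

lemma minus_conv_smult:
  assumes "module (scalars :: 'k::field ring) V" "x \<in> carrier V"
  shows "\<ominus>\<^bsub>V\<^esub> x = (- 1) \<odot>\<^bsub>V\<^esub> x"
  using assms by (simp add: module_simps)

lemma linear_map_minus:
  assumes "module scalars V" "module scalars W" "linear_map V W f" "x \<in> carrier V"
  shows "f (\<ominus>\<^bsub>V\<^esub> x) = \<ominus>\<^bsub>W\<^esub> (f x)"
  using linear_mapD(3)[OF assms(3,4), of "- 1"] assms linear_mapD(1)[OF assms(3,4)]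
  by (simp add: minus_conv_smult)

lemma linear_map_diff:
  assumes "module scalars V" "module scalars W" "linear_map V W f" "x \<in> carrier V" "y \<in> carrier V"
  shows "f (x \<ominus>\<^bsub>V\<^esub> y) = f x \<ominus>\<^bsub>W\<^esub> f y"
  using assms abelian_group.a_inv_closed[OF module_abelian_group[OF assms(1)], of y]
  by (simp add: a_minus_def linear_mapD(2)[OF assms(3)] linear_map_minus)

lemma linear_map_comp:
  assumes "linear_map U V g" "linear_map V W f"
  shows "linear_map U W (\<lambda>x. f (g x))"
  by (rule linear_mapI) (simp_all add: linear_mapD[OF assms(1)] linear_mapD[OF assms(2)])

lemma linear_map_cong:
  assumes "linear_map V W f" "\<And>x. x \<in> carrier V \<Longrightarrow> g x = f x" "module scalars V"
  shows "linear_map V W g"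
  using linear_mapD[OF assms(1)] assms(2) add_mem[OF assms(3)] module_simps(1)[OF assms(3)]
  by (auto intro!: linear_mapI)

lemma linear_map_add:
  assumes "module scalars V" "module scalars W" "linear_map V W f" "linear_map V W g"
  shows "linear_map V W (\<lambda>x. f x \<oplus>\<^bsub>W\<^esub> g x)"
proof -
  interpret W: module scalars W by fact
  note f = linear_mapD[OF assms(3)] and g = linear_mapD[OF assms(4)]
  show ?thesis
    by (rule linear_mapI) (simp_all add: f g W.a_ac module_smult_add[OF assms(2)])
qed

lemma linear_map_smult:
  assumes "module scalars W" "linear_map V W f"
  shows "linear_map V W (\<lambda>x. c \<odot>\<^bsub>W\<^esub> f x)"
  using linear_mapD[OF assms(2)] module_simps[OF assms(1)] module_smult_add[OF assms(1)]
  by (auto intro!: linear_mapI simp flip: module_simps(5)[OF assms(1)] simp: mult.commute)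

subsection \<open>Subspaces and spans\<close>

lemma subspaceI:
  assumes "module (scalars :: 'k::field ring) V" "W \<subseteq> carrier V" "\<zero>\<^bsub>V\<^esub> \<in> W"
    and "\<And>x y. x \<in> W \<Longrightarrow> y \<in> W \<Longrightarrow> x \<oplus>\<^bsub>V\<^esub> y \<in> W"
    and "\<And>c x. x \<in> W \<Longrightarrow> c \<odot>\<^bsub>V\<^esub> x \<in> W"
  shows "submodule W (scalars :: 'k ring) V"
proof -
  interpret module "scalars :: 'k ring" V by fact
  show ?thesis
  proof (rule submoduleI)
    show "\<ominus>\<^bsub>V\<^esub> x \<in> W" if "x \<in> W" for x
      using assms(5)[OF that, of "- 1"] that assms(2) minus_conv_smult[OF assms(1), of x] by auto
  qed (use assms in auto)
qed

lemma subspaceD: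
  assumes "module (scalars :: 'k::field ring) V" "submodule W (scalars :: 'k ring) V"
  shows "x \<in> W \<Longrightarrow> x \<in> carrier V" "\<zero>\<^bsub>V\<^esub> \<in> W"
    and "x \<in> W \<Longrightarrow> y \<in> W \<Longrightarrow> x \<oplus>\<^bsub>V\<^esub> y \<in> W"
    and "x \<in> W \<Longrightarrow> c \<odot>\<^bsub>V\<^esub> x \<in> W"
    and "x \<in> W \<Longrightarrow> \<ominus>\<^bsub>V\<^esub> x \<in> W"
    and "x \<in> W \<Longrightarrow> y \<in> W \<Longrightarrow> x \<ominus>\<^bsub>V\<^esub> y \<in> W"
  using module.submoduleE[OF assms] subgroup.one_closed[OF submodule.axioms(1)[OF assms(2)]]
  by (auto simp: a_minus_def)

lemma subspace_module:
  assumes "module (scalars :: 'k::field ring) V" "submodule W (scalars :: 'k ring) V"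
  shows "module (scalars :: 'k ring) (V\<lparr>carrier := W\<rparr>)"
  by (rule submodule.submodule_is_module[OF assms(2,1)])

lemma a_inv_subspace:
  assumes V: "module (scalars :: 'k::field ring) V" and W: "submodule W (scalars :: 'k ring) V"
    and x: "x \<in> W"
  shows "\<ominus>\<^bsub>V\<lparr>carrier := W\<rparr>\<^esub> x = \<ominus>\<^bsub>V\<^esub> x"
  using minus_conv_smult[OF subspace_module[OF V W], of x] minus_conv_smult[OF V, of x]
    subspaceD(1)[OF V W x] x by simp

lemma subspace_kernel:
  assumes "module scalars V" "module scalars W" "linear_map V W f"
  shows "submodule {x \<in> carrier V. f x = \<zero>\<^bsub>W\<^esub>} scalars V"
proof -
  interpret V: module scalars V by fact
  interpret W: module scalars W by fact
  show ?thesis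
    using assms by (intro subspaceI)
      (auto simp: linear_mapD[OF assms(3)] linear_map_zero module_simps module_smult_zero)
qed

lemma subspace_image:
  assumes "module scalars V" "module scalars W" "linear_map V W f"
    and U: "submodule U scalars V"
  shows "submodule (f ` U) scalars W"
proof (rule subspaceI[OF assms(2)])
  note U = subspaceD[OF assms(1) U]
  show "f ` U \<subseteq> carrier W" using U(1) linear_mapD(1)[OF assms(3)] by auto
  show "\<zero>\<^bsub>W\<^esub> \<in> f ` U" using U(2) linear_map_zero[OF assms(1-3)] by (metis image_eqI)
  show "x \<oplus>\<^bsub>W\<^esub> y \<in> f ` U" if "x \<in> f ` U" "y \<in> f ` U" for x y
    using that U(1,3) linear_mapD(2)[OF assms(3)] by (auto simp flip: linear_mapD(2)[OF assms(3)])
  show "c \<odot>\<^bsub>W\<^esub> x \<in> f ` U" if "x \<in> f ` U" for c x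
    using that U(1,4) by (auto simp flip: linear_mapD(3)[OF assms(3)])
qed

lemma subspace_carrier:
  "module (scalars :: 'k::field ring) V \<Longrightarrow> submodule (carrier V) (scalars :: 'k ring) V"
  by (rule module.carrier_is_submodule)

lemma subspace_lin_span:
  assumes "module (scalars :: 'k::field ring) V" "S \<subseteq> carrier V"
  shows "submodule (lin_span V S) (scalars :: 'k ring) V"
proof (rule subspaceI[OF assms(1)])
  show "lin_span V S \<subseteq> carrier V"
    using subspace_carrier[OF assms(1)] assms(2) by (auto simp: lin_span_def)
qed (use subspaceD[OF assms(1)] in \<open>auto simp: lin_span_def\<close>)

lemma lin_span_superset: "x \<in> S \<Longrightarrow> x \<in> lin_span V S"
  by (auto simp: lin_span_def)

lemma lin_span_minimal:
  "submodule W (scalars :: 'k::field ring) V \<Longrightarrow> S \<subseteq> W \<Longrightarrow> lin_span V S \<subseteq> W"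
  by (auto simp: lin_span_def)

lemma linear_map_lin_span:
  assumes "module scalars V" "module scalars W" "linear_map V W f"
    and "submodule U scalars W" "S \<subseteq> carrier V" "\<And>x. x \<in> S \<Longrightarrow> f x \<in> U"
    and "x \<in> lin_span V S"
  shows "f x \<in> U"
proof -
  note U = subspaceD[OF assms(2,4)]
  have "submodule {x \<in> carrier V. f x \<in> U} scalars V"
    by (rule subspaceI[OF assms(1)])
      (use U zero_mem[OF assms(1)] add_mem[OF assms(1)] in
        \<open>auto simp: linear_map_zero[OF assms(1-3)] linear_mapD[OF assms(3)] module_simps[OF assms(1)]\<close>)
  then have "lin_span V S \<subseteq> {x \<in> carrier V. f x \<in> U}"
    using assms(5,6) by (intro lin_span_minimal) auto
  then show ?thesis using assms(7) by auto
qed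


subsection \<open>Quotient spaces\<close>

lemma subspace_abelian_subgroup:
  assumes "module (scalars :: 'k::field ring) V" "submodule W (scalars :: 'k ring) V"
  shows "abelian_subgroup W V"
  using assms by (intro abelian_subgroupI3 additive_subgroupI module_abelian_group submodule.axioms(1))

lemma mem_coset_iff:
  assumes V: "module (scalars :: 'k::field ring) V" and W: "submodule W (scalars :: 'k ring) V"
    and "x \<in> carrier V"
  shows "y \<in> W +>\<^bsub>V\<^esub> x \<longleftrightarrow> y \<in> carrier V \<and> y \<ominus>\<^bsub>V\<^esub> x \<in> W"
proof -
  interpret abelian_subgroup W V by (rule subspace_abelian_subgroup[OF V W])
  show ?thesis
    using a_rcos_module[of x y] a_elemrcos_carrier[of x y] assms by (auto simp: a_minus_def)
qed

lemma coset_eq_iff: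
  assumes V: "module (scalars :: 'k::field ring) V" and W: "submodule W (scalars :: 'k ring) V"
    and "x \<in> carrier V" "y \<in> carrier V"
  shows "W +>\<^bsub>V\<^esub> x = W +>\<^bsub>V\<^esub> y \<longleftrightarrow> x \<ominus>\<^bsub>V\<^esub> y \<in> W"
proof -
  interpret abelian_subgroup W V by (rule subspace_abelian_subgroup[OF V W])
  show ?thesis
    using mem_coset_iff[OF V W, of y x] a_repr_independence'[of x y]
      a_repr_independenceD[of x y] assms by metis
qed

lemma coset_self:
  assumes "module (scalars :: 'k::field ring) V" "submodule W (scalars :: 'k ring) V"
    and "x \<in> carrier V"
  shows "x \<in> W +>\<^bsub>V\<^esub> x"
proof -
  interpret abelian_subgroup W V by (rule subspace_abelian_subgroup[OF assms(1,2)])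
  show ?thesis using a_rcos_self assms by blast
qed

lemma coset_zero:
  assumes "module (scalars :: 'k::field ring) V" "submodule W (scalars :: 'k ring) V"
  shows "W +>\<^bsub>V\<^esub> \<zero>\<^bsub>V\<^esub> = W"
proof -
  interpret abelian_subgroup W V by (rule subspace_abelian_subgroup[OF assms])
  show ?thesis by (simp add: a_subset)
qed

lemma coset_eq_subspace_iff:
  assumes V: "module (scalars :: 'k::field ring) V" and W: "submodule W (scalars :: 'k ring) V"
    and "x \<in> carrier V"
  shows "W +>\<^bsub>V\<^esub> x = W \<longleftrightarrow> x \<in> W"
proof -
  interpret V: module "scalars :: 'k ring" V by fact
  have "\<ominus>\<^bsub>V\<^esub> \<zero>\<^bsub>V\<^esub> = \<zero>\<^bsub>V\<^esub>"
    by (simp add: minus_conv_smult[OF V] module_smult_zero[OF V])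
  then have 0: "x \<ominus>\<^bsub>V\<^esub> \<zero>\<^bsub>V\<^esub> = x"
    unfolding a_minus_def by (simp only: V.r_zero[OF \<open>x \<in> carrier V\<close>])
  show ?thesis
    using coset_eq_iff[OF V W \<open>x \<in> carrier V\<close> zero_mem[OF V]]
    unfolding 0 coset_zero[OF V W] .
qed

text \<open>The operations of \<^const>\<open>quot\<close> and \<^const>\<open>quot_map\<close> are unions over cosets, which this evaluates.\<close>

lemma UN_coset:
  assumes "module (scalars :: 'k::field ring) V" "submodule W (scalars :: 'k ring) V"
    and "x \<in> carrier V" and "\<And>y. y \<in> W +>\<^bsub>V\<^esub> x \<Longrightarrow> F y = F x"
  shows "(\<Union>y\<in>W +>\<^bsub>V\<^esub> x. F y) = F x"
proof -
  have "F ` (W +>\<^bsub>V\<^esub> x) = {F x}" using coset_self[OF assms(1-3)] assms(4) by blast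
  then show ?thesis by simp
qed

lemma quot_carrier: "carrier (quot V W) = (\<lambda>x. W +>\<^bsub>V\<^esub> x) ` carrier V"
  by (auto simp: quot_def A_RCOSETS_def')

lemma quot_zero: "\<zero>\<^bsub>quot V W\<^esub> = W"
  by (simp add: quot_def)

lemma quot_add:
  assumes "module (scalars :: 'k::field ring) V" "submodule W (scalars :: 'k ring) V"
    and "x \<in> carrier V" "y \<in> carrier V"
  shows "(W +>\<^bsub>V\<^esub> x) \<oplus>\<^bsub>quot V W\<^esub> (W +>\<^bsub>V\<^esub> y) = W +>\<^bsub>V\<^esub> (x \<oplus>\<^bsub>V\<^esub> y)"
proof -
  interpret abelian_subgroup W V by (rule subspace_abelian_subgroup[OF assms(1,2)])
  show ?thesis using a_rcos_sum[of x y] assms by (simp add: quot_def)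
qed

lemma quot_smult:
  assumes V: "module (scalars :: 'k::field ring) V" and W: "submodule W (scalars :: 'k ring) V"
    and x: "x \<in> carrier V"
  shows "c \<odot>\<^bsub>quot V W\<^esub> (W +>\<^bsub>V\<^esub> x) = W +>\<^bsub>V\<^esub> (c \<odot>\<^bsub>V\<^esub> x)"
proof -
  have "W +>\<^bsub>V\<^esub> (c \<odot>\<^bsub>V\<^esub> y) = W +>\<^bsub>V\<^esub> (c \<odot>\<^bsub>V\<^esub> x)" if y: "y \<in> W +>\<^bsub>V\<^esub> x" for y
  proof -
    have y': "y \<in> carrier V" "y \<ominus>\<^bsub>V\<^esub> x \<in> W" using mem_coset_iff[OF V W x] y by auto
    have lin: "linear_map V V (\<lambda>x. c \<odot>\<^bsub>V\<^esub> x)"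
      using linear_map_smult[OF V, of V "\<lambda>x. x" c] by (auto simp: linear_map_def hom_def)
    have "c \<odot>\<^bsub>V\<^esub> (y \<ominus>\<^bsub>V\<^esub> x) \<in> W" using subspaceD(4)[OF V W y'(2)] .
    then show ?thesis
      using coset_eq_iff[OF V W] linear_map_diff[OF V V lin y'(1) x] module_simps(1)[OF V] x y' by simp
  qed
  then show ?thesis
    using UN_coset[OF V W x, of "\<lambda>y. W +>\<^bsub>V\<^esub> (c \<odot>\<^bsub>V\<^esub> y)"] by (simp add: quot_def)
qed

lemma quot_module:
  assumes V: "module (scalars :: 'k::field ring) V" and W: "submodule W (scalars :: 'k ring) V"
  shows "module (scalars :: 'k ring) (quot V W)"
proof -
  interpret V: module "scalars :: 'k ring" V by fact
  note a = quot_add[OF V W] and s = quot_smult[OF V W] and m = module_simps[OF V]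
  have z: "\<zero>\<^bsub>quot V W\<^esub> = W +>\<^bsub>V\<^esub> \<zero>\<^bsub>V\<^esub>" by (simp add: quot_zero coset_zero[OF V W])
  have "abelian_group (quot V W)"
  proof (rule abelian_groupI)
    show "\<zero>\<^bsub>quot V W\<^esub> \<in> carrier (quot V W)"
      by (simp add: z quot_carrier)
    fix x x' x'' assume "x \<in> carrier (quot V W)" "x' \<in> carrier (quot V W)" "x'' \<in> carrier (quot V W)"
    then obtain u u' u'' where u: "u \<in> carrier V" "x = W +>\<^bsub>V\<^esub> u"
        and u': "u' \<in> carrier V" "x' = W +>\<^bsub>V\<^esub> u'" and u'': "u'' \<in> carrier V" "x'' = W +>\<^bsub>V\<^esub> u''"
      by (auto simp: quot_carrier)
    show "x \<oplus>\<^bsub>quot V W\<^esub> x' \<in> carrier (quot V W)"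
      using u u' by (simp add: a quot_carrier)
    show "(x \<oplus>\<^bsub>quot V W\<^esub> x') \<oplus>\<^bsub>quot V W\<^esub> x'' = x \<oplus>\<^bsub>quot V W\<^esub> (x' \<oplus>\<^bsub>quot V W\<^esub> x'')"
      using u u' u'' by (simp add: a V.a_assoc)
    show "x \<oplus>\<^bsub>quot V W\<^esub> x' = x' \<oplus>\<^bsub>quot V W\<^esub> x"
      using u u' V.a_comm[of u u'] by (simp add: a)
    show "\<zero>\<^bsub>quot V W\<^esub> \<oplus>\<^bsub>quot V W\<^esub> x = x"
      using u a[of "\<zero>\<^bsub>V\<^esub>" u] by (simp add: z)
    have "(W +>\<^bsub>V\<^esub> (\<ominus>\<^bsub>V\<^esub> u)) \<oplus>\<^bsub>quot V W\<^esub> x = \<zero>\<^bsub>quot V W\<^esub>"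
      using u a[of "\<ominus>\<^bsub>V\<^esub> u" u] by (simp add: z V.l_neg)
    then show "\<exists>y\<in>carrier (quot V W). y \<oplus>\<^bsub>quot V W\<^esub> x = \<zero>\<^bsub>quot V W\<^esub>"
      using u by (auto simp: quot_carrier)
  qed
  then show ?thesis
  proof (rule module_scalarsI)
    fix b c x x' assume "x \<in> carrier (quot V W)" "x' \<in> carrier (quot V W)"
    then obtain u u' where u: "u \<in> carrier V" "x = W +>\<^bsub>V\<^esub> u"
        and u': "u' \<in> carrier V" "x' = W +>\<^bsub>V\<^esub> u'"
      by (auto simp: quot_carrier)
    show "c \<odot>\<^bsub>quot V W\<^esub> x \<in> carrier (quot V W)"
      using u m(1) by (simp add: s quot_carrier)
    show "(b + c) \<odot>\<^bsub>quot V W\<^esub> x = b \<odot>\<^bsub>quot V W\<^esub> x \<oplus>\<^bsub>quot V W\<^esub> c \<odot>\<^bsub>quot V W\<^esub> x"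
      using u m(1,4) by (simp add: s a)
    show "c \<odot>\<^bsub>quot V W\<^esub> (x \<oplus>\<^bsub>quot V W\<^esub> x') =
        c \<odot>\<^bsub>quot V W\<^esub> x \<oplus>\<^bsub>quot V W\<^esub> c \<odot>\<^bsub>quot V W\<^esub> x'"
      using u u' m(1) module_smult_add[OF V] by (simp add: s a)
    show "(b * c) \<odot>\<^bsub>quot V W\<^esub> x = b \<odot>\<^bsub>quot V W\<^esub> (c \<odot>\<^bsub>quot V W\<^esub> x)"
      using u m(1,5) by (simp add: s)
    show "1 \<odot>\<^bsub>quot V W\<^esub> x = x"
      using u m(2) by (simp add: s)
  qed
qed

lemma linear_map_coset:
  assumes V: "module scalars V" and W: "submodule W scalars V"
  shows "linear_map V (quot V W) (\<lambda>x. W +>\<^bsub>V\<^esub> x)"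
  by (rule linear_mapI) (auto simp: quot_carrier quot_add[OF V W] quot_smult[OF V W])

lemma quot_map_coset:
  assumes "module scalars V" "module scalars V'" "linear_map V' V f"
    and W: "submodule W scalars V" and W': "submodule W' scalars V'"
    and "\<And>x. x \<in> W' \<Longrightarrow> f x \<in> W" and x: "x \<in> carrier V'"
  shows "quot_map V W f (W' +>\<^bsub>V'\<^esub> x) = W +>\<^bsub>V\<^esub> f x"
proof -
  have "W +>\<^bsub>V\<^esub> f y = W +>\<^bsub>V\<^esub> f x" if "y \<in> W' +>\<^bsub>V'\<^esub> x" for y
  proof -
    have y: "y \<in> carrier V'" "y \<ominus>\<^bsub>V'\<^esub> x \<in> W'" using mem_coset_iff[OF assms(2) W' x] that by auto
    then have "f (y \<ominus>\<^bsub>V'\<^esub> x) \<in> W" using assms(6) by simp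
    then show ?thesis
      using coset_eq_iff[OF assms(1) W] linear_map_diff[OF assms(2,1,3) y(1) x]
        linear_mapD(1)[OF assms(3)] x y by simp
  qed
  then show ?thesis
    using UN_coset[OF assms(2) W' x, of "\<lambda>y. W +>\<^bsub>V\<^esub> f y"] by (simp add: quot_map_def)
qed

lemma linear_map_quotI:
  assumes V: "module scalars V" and W: "submodule W scalars V" and X: "module scalars X"
    and f: "linear_map V X f" and "\<And>x. x \<in> carrier V \<Longrightarrow> g (W +>\<^bsub>V\<^esub> x) = f x"
  shows "linear_map (quot V W) X g"
  by (rule linear_mapI)
    (auto simp: quot_carrier quot_add[OF V W] quot_smult[OF V W] assms(5) linear_mapD[OF f]
      add_mem[OF V] module_simps[OF V])

text \<open>The map on a quotient induced by a linear map \<open>f\<close> that vanishes on the subspace.\<close>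

definition quot_lift :: "('v \<Rightarrow> 'w) \<Rightarrow> 'v set \<Rightarrow> 'w" where
  "quot_lift f U = the_elem (f ` U)"

lemma quot_lift_coset:
  assumes V: "module scalars V" and W: "submodule W scalars V" and X: "module scalars X"
    and f: "linear_map V X f" and "\<And>x. x \<in> W \<Longrightarrow> f x = \<zero>\<^bsub>X\<^esub>" and x: "x \<in> carrier V"
  shows "quot_lift f (W +>\<^bsub>V\<^esub> x) = f x"
proof -
  interpret X: module scalars X by fact
  have "f y = f x" if "y \<in> W +>\<^bsub>V\<^esub> x" for y
  proof -
    have y: "y \<in> carrier V" "y \<ominus>\<^bsub>V\<^esub> x \<in> W" using mem_coset_iff[OF V W x] that by auto
    then have "f y \<ominus>\<^bsub>X\<^esub> f x = \<zero>\<^bsub>X\<^esub>"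
      using assms(5)[OF y(2)] linear_map_diff[OF V X f y(1) x] by simp
    then show ?thesis using linear_mapD(1)[OF f] x y(1) by (simp add: diff_eq_zero_iff[OF X])
  qed
  then have "f ` (W +>\<^bsub>V\<^esub> x) = {f x}" using coset_self[OF V W x] by blast
  then show ?thesis by (simp add: quot_lift_def)
qed

lemma linear_map_quot_lift:
  assumes "module scalars V" "submodule W scalars V" "module scalars X"
    and "linear_map V X f" and "\<And>x. x \<in> W \<Longrightarrow> f x = \<zero>\<^bsub>X\<^esub>"
  shows "linear_map (quot V W) X (quot_lift f)"
  by (rule linear_map_quotI[OF assms(1-4)], rule quot_lift_coset[OF assms])

lemma linear_iso_quot_lift:
  assumes V: "module scalars V" and W: "submodule W scalars V" and X: "module scalars X"
    and f: "linear_map V X f" and ker: "W = {x \<in> carrier V. f x = \<zero>\<^bsub>X\<^esub>}"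
    and surj: "f ` carrier V = carrier X"
  shows "linear_iso (quot V W) X (quot_lift f)"
proof -
  interpret X: module scalars X by fact
  have 0: "\<And>x. x \<in> W \<Longrightarrow> f x = \<zero>\<^bsub>X\<^esub>" using ker by auto
  note lift = quot_lift_coset[OF V W X f 0]
  have "inj_on (quot_lift f) (carrier (quot V W))"
  proof (rule inj_onI)
    fix u v assume "u \<in> carrier (quot V W)" "v \<in> carrier (quot V W)"
      and eq: "quot_lift f u = quot_lift f v"
    then obtain x y where xy: "x \<in> carrier V" "y \<in> carrier V" "u = W +>\<^bsub>V\<^esub> x" "v = W +>\<^bsub>V\<^esub> y"
      by (auto simp: quot_carrier)
    then have "f x = f y" using eq by (simp add: lift)
    then have "f (x \<ominus>\<^bsub>V\<^esub> y) = \<zero>\<^bsub>X\<^esub>"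
      using xy linear_mapD(1)[OF f]
      by (simp add: linear_map_diff[OF V X f] diff_eq_zero_iff[OF X])
    moreover have "x \<ominus>\<^bsub>V\<^esub> y \<in> carrier V"
      using xy subspaceD(6)[OF V subspace_carrier[OF V]] by simp
    ultimately show "u = v" using xy coset_eq_iff[OF V W] ker by simp
  qed
  moreover have "quot_lift f ` carrier (quot V W) = carrier X"
    using surj by (simp add: quot_carrier image_image lift cong: image_cong)
  ultimately show ?thesis
    using linear_map_quot_lift[OF V W X f 0] by (simp add: linear_iso_def bij_betw_def)
qed


subsection \<open>Finite direct sums\<close>

lemma direct_sum_simps:
  "carrier (direct_sum I V) = (\<Pi>\<^sub>E i\<in>I. carrier (V i))"
  "\<zero>\<^bsub>direct_sum I V\<^esub> = (\<lambda>i\<in>I. \<zero>\<^bsub>V i\<^esub>)"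
  "x \<oplus>\<^bsub>direct_sum I V\<^esub> y = (\<lambda>i\<in>I. x i \<oplus>\<^bsub>V i\<^esub> y i)"
  "c \<odot>\<^bsub>direct_sum I V\<^esub> x = (\<lambda>i\<in>I. c \<odot>\<^bsub>V i\<^esub> x i)"
  by (simp_all add: direct_sum_def)

lemma direct_sum_module:
  assumes "\<And>i. i \<in> I \<Longrightarrow> module (scalars :: 'k::field ring) (V i)"
  shows "module (scalars :: 'k ring) (direct_sum I V)"
proof -
  have mem: "x i \<in> carrier (V i)" if "x \<in> carrier (direct_sum I V)" "i \<in> I" for x i
    using that by (auto simp: direct_sum_simps)
  have memI: "(\<lambda>i\<in>I. f i) \<in> carrier (direct_sum I V)" if "\<And>i. i \<in> I \<Longrightarrow> f i \<in> carrier (V i)" for f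
    using that by (simp add: direct_sum_simps)
  have g: "abelian_group (V i)" if "i \<in> I" for i
    using assms[OF that] by (rule module_abelian_group)
  note closed = add_mem[OF assms] zero_mem[OF assms] abelian_group.a_inv_closed[OF g]
    module_simps(1)[OF assms]
  have mon: "abelian_monoid (V i)" if "i \<in> I" for i
    using g[OF that] by (rule abelian_group.axioms(1))
  have ext: "(\<lambda>i\<in>I. f i) = x" if "x \<in> carrier (direct_sum I V)" "\<And>i. i \<in> I \<Longrightarrow> f i = x i" for f x
    using that by (intro extensionalityI[of _ I]) (auto simp: direct_sum_simps PiE_iff)
  have "abelian_group (direct_sum I V)"
  proof (rule abelian_groupI)
    show "\<zero>\<^bsub>direct_sum I V\<^esub> \<in> carrier (direct_sum I V)"
      unfolding direct_sum_simps(2) by (intro memI closed)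
    fix x y z assume x: "x \<in> carrier (direct_sum I V)" and y: "y \<in> carrier (direct_sum I V)"
      and z: "z \<in> carrier (direct_sum I V)"
    note xyz = mem[OF x] mem[OF y] mem[OF z]
    show "x \<oplus>\<^bsub>direct_sum I V\<^esub> y \<in> carrier (direct_sum I V)"
      unfolding direct_sum_simps(3) by (intro memI closed xyz)
    show "(x \<oplus>\<^bsub>direct_sum I V\<^esub> y) \<oplus>\<^bsub>direct_sum I V\<^esub> z = x \<oplus>\<^bsub>direct_sum I V\<^esub> (y \<oplus>\<^bsub>direct_sum I V\<^esub> z)"
      unfolding direct_sum_simps(3)
      by (rule restrict_ext) (simp add: xyz abelian_monoid.a_assoc[OF mon])
    show "x \<oplus>\<^bsub>direct_sum I V\<^esub> y = y \<oplus>\<^bsub>direct_sum I V\<^esub> x"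
      unfolding direct_sum_simps(3)
      by (rule restrict_ext) (rule abelian_monoid.a_comm[OF mon xyz(1) xyz(2)])
    show "\<zero>\<^bsub>direct_sum I V\<^esub> \<oplus>\<^bsub>direct_sum I V\<^esub> x = x"
      unfolding direct_sum_simps(2,3)
      by (rule ext[OF x]) (simp add: xyz abelian_monoid.l_zero[OF mon])
    have "(\<lambda>i\<in>I. \<ominus>\<^bsub>V i\<^esub> x i) \<oplus>\<^bsub>direct_sum I V\<^esub> x = \<zero>\<^bsub>direct_sum I V\<^esub>"
      unfolding direct_sum_simps(2,3)
      by (rule restrict_ext) (simp add: xyz abelian_group.l_neg[OF g])
    moreover have "(\<lambda>i\<in>I. \<ominus>\<^bsub>V i\<^esub> x i) \<in> carrier (direct_sum I V)"
      by (intro memI closed xyz)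
    ultimately show "\<exists>y\<in>carrier (direct_sum I V). y \<oplus>\<^bsub>direct_sum I V\<^esub> x = \<zero>\<^bsub>direct_sum I V\<^esub>"
      by blast
  qed
  then show ?thesis
  proof (rule module_scalarsI)
    fix b c x y assume x: "x \<in> carrier (direct_sum I V)" and y: "y \<in> carrier (direct_sum I V)"
    note xy = mem[OF x] mem[OF y]
    show "c \<odot>\<^bsub>direct_sum I V\<^esub> x \<in> carrier (direct_sum I V)"
      unfolding direct_sum_simps(4) by (intro memI closed xy)
    show "(b + c) \<odot>\<^bsub>direct_sum I V\<^esub> x = b \<odot>\<^bsub>direct_sum I V\<^esub> x \<oplus>\<^bsub>direct_sum I V\<^esub> c \<odot>\<^bsub>direct_sum I V\<^esub> x"
      unfolding direct_sum_simps(3,4)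
      by (rule restrict_ext) (simp add: module_simps(4)[OF assms] xy)
    show "c \<odot>\<^bsub>direct_sum I V\<^esub> (x \<oplus>\<^bsub>direct_sum I V\<^esub> y) =
        c \<odot>\<^bsub>direct_sum I V\<^esub> x \<oplus>\<^bsub>direct_sum I V\<^esub> c \<odot>\<^bsub>direct_sum I V\<^esub> y"
      unfolding direct_sum_simps(3,4)
      by (rule restrict_ext) (simp add: module_smult_add[OF assms] xy)
    show "(b * c) \<odot>\<^bsub>direct_sum I V\<^esub> x = b \<odot>\<^bsub>direct_sum I V\<^esub> (c \<odot>\<^bsub>direct_sum I V\<^esub> x)"
      unfolding direct_sum_simps(4)
      by (rule restrict_ext) (simp add: module_simps(5)[OF assms] xy)
    show "1 \<odot>\<^bsub>direct_sum I V\<^esub> x = x"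
      unfolding direct_sum_simps(4)
      by (rule ext[OF x]) (simp add: module_simps(2)[OF assms] xy)
  qed
qed

lemma linear_map_component:
  assumes "i \<in> I"
  shows "linear_map (direct_sum I V) (V i) (\<lambda>x. x i)"
  using assms by (auto intro!: linear_mapI simp: direct_sum_simps)

lemma linear_map_direct_sumI:
  assumes "\<And>i. i \<in> I \<Longrightarrow> linear_map U (V i) (\<lambda>x. f x i)" "module scalars U"
    and "\<And>x. x \<in> carrier U \<Longrightarrow> f x \<in> extensional I"
  shows "linear_map U (direct_sum I V) f"
proof (rule linear_mapI)
  note f = linear_mapD[OF assms(1)]
  note U = module_simps[OF assms(2)] add_mem[OF assms(2)]
  show "f x \<in> carrier (direct_sum I V)" if "x \<in> carrier U" for x
    using that assms(3) f(1) by (auto simp: direct_sum_simps PiE_iff)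
  show "f (x \<oplus>\<^bsub>U\<^esub> y) = f x \<oplus>\<^bsub>direct_sum I V\<^esub> f y" if "x \<in> carrier U" "y \<in> carrier U" for x y
    using that assms(3)[of "x \<oplus>\<^bsub>U\<^esub> y"] f(2) U
    by (intro extensionalityI[of _ I]) (auto simp: direct_sum_simps)
  show "f (c \<odot>\<^bsub>U\<^esub> x) = c \<odot>\<^bsub>direct_sum I V\<^esub> f x" if "x \<in> carrier U" for c x
    using that assms(3)[of "c \<odot>\<^bsub>U\<^esub> x"] f(3) U
    by (intro extensionalityI[of _ I]) (auto simp: direct_sum_simps)
qed

lemma zero_space_module:
  assumes "module (scalars :: 'k::field ring) V"
  shows "module (scalars :: 'k ring) (zero_space V)"
proof -
  interpret module "scalars :: 'k ring" V by fact
  have "submodule {\<zero>\<^bsub>V\<^esub>} (scalars :: 'k ring) V"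
    by (rule subspaceI[OF assms]) (auto simp: module_smult_zero[OF assms])
  then show ?thesis unfolding zero_space_def by (rule subspace_module[OF assms])
qed


section \<open>Complexes and bicomplexes\<close>

definition is_complex :: "('k::field, 'v) chain_complex \<Rightarrow> bool" where
  "is_complex C \<longleftrightarrow> (\<forall>n. module (scalars :: 'k ring) (chain_space C n)) \<and>
     (\<forall>n. linear_map (chain_space C (Suc n)) (chain_space C n) (diff C (Suc n))) \<and>
     (\<forall>n. \<forall>x\<in>carrier (chain_space C (Suc (Suc n))).
        diff C (Suc n) (diff C (Suc (Suc n)) x) = \<zero>\<^bsub>chain_space C n\<^esub>)"

lemma is_complexD:
  assumes "is_complex (C :: ('k::field, 'v) chain_complex)"
  shows "module (scalars :: 'k ring) (chain_space C n)"
    and "linear_map (chain_space C (Suc n)) (chain_space C n) (diff C (Suc n))"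
    and "x \<in> carrier (chain_space C (Suc (Suc n))) \<Longrightarrow>
      diff C (Suc n) (diff C (Suc (Suc n)) x) = \<zero>\<^bsub>chain_space C n\<^esub>"
  using assms by (auto simp: is_complex_def)

definition is_bicomplex :: "('k::field, 'v) bicomplex \<Rightarrow> bool" where
  "is_bicomplex B \<longleftrightarrow> (\<forall>p q. module (scalars :: 'k ring) (bispace B p q)) \<and>
     (\<forall>p q. linear_map (bispace B (Suc p) q) (bispace B p q) (hdiff B (Suc p) q)) \<and>
     (\<forall>p q. linear_map (bispace B p (Suc q)) (bispace B p q) (vdiff B p (Suc q))) \<and>
     (\<forall>p q. \<forall>x\<in>carrier (bispace B (Suc (Suc p)) q).
        hdiff B (Suc p) q (hdiff B (Suc (Suc p)) q x) = \<zero>\<^bsub>bispace B p q\<^esub>) \<and>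
     (\<forall>p q. \<forall>x\<in>carrier (bispace B p (Suc (Suc q))).
        vdiff B p (Suc q) (vdiff B p (Suc (Suc q)) x) = \<zero>\<^bsub>bispace B p q\<^esub>) \<and>
     (\<forall>p q. \<forall>x\<in>carrier (bispace B (Suc p) (Suc q)).
        hdiff B (Suc p) q (vdiff B (Suc p) (Suc q) x) \<oplus>\<^bsub>bispace B p q\<^esub>
          vdiff B p (Suc q) (hdiff B (Suc p) (Suc q) x) = \<zero>\<^bsub>bispace B p q\<^esub>)"

lemma is_bicomplexD:
  assumes "is_bicomplex (B :: ('k::field, 'v) bicomplex)"
  shows "module (scalars :: 'k ring) (bispace B p q)"
    and "linear_map (bispace B (Suc p) q) (bispace B p q) (hdiff B (Suc p) q)"
    and "linear_map (bispace B p (Suc q)) (bispace B p q) (vdiff B p (Suc q))"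
    and "x \<in> carrier (bispace B (Suc (Suc p)) q) \<Longrightarrow>
        hdiff B (Suc p) q (hdiff B (Suc (Suc p)) q x) = \<zero>\<^bsub>bispace B p q\<^esub>"
    and "y \<in> carrier (bispace B p (Suc (Suc q))) \<Longrightarrow>
        vdiff B p (Suc q) (vdiff B p (Suc (Suc q)) y) = \<zero>\<^bsub>bispace B p q\<^esub>"
    and "z \<in> carrier (bispace B (Suc p) (Suc q)) \<Longrightarrow>
        hdiff B (Suc p) q (vdiff B (Suc p) (Suc q) z) \<oplus>\<^bsub>bispace B p q\<^esub>
          vdiff B p (Suc q) (hdiff B (Suc p) (Suc q) z) = \<zero>\<^bsub>bispace B p q\<^esub>"
  using assms unfolding is_bicomplex_def by auto

lemma total_space: "chain_space (total_complex B) n = direct_sum {..n} (\<lambda>p. bispace B p (n - p))"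
  by (simp add: total_complex_def)

lemma total_diff:
  "diff (total_complex B) (Suc n) x = (\<lambda>p\<in>{..n}. hdiff B (Suc p) (n - p) (x (Suc p))
      \<oplus>\<^bsub>bispace B p (n - p)\<^esub> vdiff B p (Suc n - p) (x p))"
  by (simp add: total_complex_def)

lemma total_component:
  assumes "x \<in> carrier (chain_space (total_complex B) n)" "p + q = n"
  shows "x p \<in> carrier (bispace B p q)"
proof -
  have "p \<in> {..n}" "n - p = q" using assms(2) by auto
  then show ?thesis using assms(1) PiE_mem[of x "{..n}" _ p] by (auto simp: total_space direct_sum_simps)
qed

lemma is_complex_total:
  assumes B: "is_bicomplex (B :: ('k::field, 'v) bicomplex)"
  shows "is_complex (total_complex B)"
proof -
  note mod = is_bicomplexD(1)[OF B] and hlin = is_bicomplexD(2)[OF B]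
    and vlin = is_bicomplexD(3)[OF B]
  have space: "module (scalars :: 'k ring) (chain_space (total_complex B) n)" for n
    unfolding total_space by (rule direct_sum_module) (rule mod)
  have comp: "linear_map (chain_space (total_complex B) n) (bispace B p q) (\<lambda>x. x p)"
    if "p + q = n" for n p q
    using linear_map_component[of p "{..n}" "\<lambda>p. bispace B p (n - p)"] that
    by (auto simp: total_space)
  have lin: "linear_map (chain_space (total_complex B) (Suc n)) (chain_space (total_complex B) n)
      (diff (total_complex B) (Suc n))" for n
    unfolding total_space[of _ n]
  proof (rule linear_map_direct_sumI[OF _ space])
    fix p assume p: "p \<in> {..n}"
    then have S: "Suc n - p = Suc (n - p)" by auto
    have "linear_map (chain_space (total_complex B) (Suc n)) (bispace B p (n - p))
      (\<lambda>x. hdiff B (Suc p) (n - p) (x (Suc p)) \<oplus>\<^bsub>bispace B p (n - p)\<^esub> vdiff B p (Suc (n - p)) (x p))"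
      using p by (intro linear_map_add[OF space mod] linear_map_comp[OF comp hlin]
          linear_map_comp[OF comp vlin]) auto
    then show "linear_map (chain_space (total_complex B) (Suc n)) (bispace B p (n - p))
      (\<lambda>x. diff (total_complex B) (Suc n) x p)"
      using p by (simp add: total_diff S)
  qed (simp add: total_diff)
  have sq: "diff (total_complex B) (Suc n) (diff (total_complex B) (Suc (Suc n)) x) =
      \<zero>\<^bsub>chain_space (total_complex B) n\<^esub>"
    if x: "x \<in> carrier (chain_space (total_complex B) (Suc (Suc n)))" for n x
    unfolding total_diff[of _ n] total_space direct_sum_simps
  proof (rule restrict_ext)
    fix p assume "p \<in> {..n}"
    define q where "q = n - p"
    then have q: "n = p + q" using \<open>p \<in> {..n}\<close> by simp
    let ?W = "bispace B p q"
    interpret W: module "scalars :: 'k ring" ?W by (rule mod)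
    have x0: "x p \<in> carrier (bispace B p (Suc (Suc q)))"
      and x1: "x (Suc p) \<in> carrier (bispace B (Suc p) (Suc q))"
      and x2: "x (Suc (Suc p)) \<in> carrier (bispace B (Suc (Suc p)) q)"
      using total_component[OF x] q by auto
    note h = linear_mapD[OF hlin] and v = linear_mapD[OF vlin]
    note zero = is_bicomplexD(4)[OF B x2] is_bicomplexD(5)[OF B x0] is_bicomplexD(6)[OF B x1]
    have "hdiff B (Suc p) q (diff (total_complex B) (Suc (Suc n)) x (Suc p)) \<oplus>\<^bsub>?W\<^esub>
        vdiff B p (Suc q) (diff (total_complex B) (Suc (Suc n)) x p) =
      hdiff B (Suc p) q (vdiff B (Suc p) (Suc q) (x (Suc p))) \<oplus>\<^bsub>?W\<^esub>
        vdiff B p (Suc q) (hdiff B (Suc p) (Suc q) (x (Suc p)))"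
      using x0 x1 x2 h v zero by (simp add: total_diff q)
    then show "hdiff B (Suc p) (n - p) (diff (total_complex B) (Suc (Suc n)) x (Suc p))
        \<oplus>\<^bsub>bispace B p (n - p)\<^esub> vdiff B p (Suc n - p) (diff (total_complex B) (Suc (Suc n)) x p) =
        \<zero>\<^bsub>bispace B p (n - p)\<^esub>"
      using zero by (simp add: q)
  qed
  show ?thesis using space lin sq by (auto simp: is_complex_def)
qed


section \<open>Formal linear combinations\<close>

lemma lookup_fscale [simp]: "Poly_Mapping.lookup (fscale c f) w = c * Poly_Mapping.lookup f w"
  by (simp add: fscale_def map.rep_eq when_def)

lemma fscale_simps [simp]:
  "fscale c (0 :: 'w \<Rightarrow>\<^sub>0 'k::field) = 0" "fscale 0 f = 0" "fscale 1 f = f"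
  "fscale b (fscale c f) = fscale (b * c) f"
  "fscale c (Poly_Mapping.single w d) = Poly_Mapping.single w (c * d)"
  "fscale (- c) f = - fscale c f" "fscale c (- f) = - fscale c f"
  by (auto intro!: poly_mapping_eqI simp: lookup_single when_def)

lemma fscale_add: "fscale c (f + g) = fscale c f + fscale c g"
  and fscale_diff: "fscale c (f - g) = fscale c f - fscale c g"
  and fscale_add_left: "fscale (b + c) f = fscale b f + fscale c f"
  by (auto intro!: poly_mapping_eqI simp: lookup_add lookup_minus algebra_simps)

interpretation formal: vector_space "fscale :: 'k::field \<Rightarrow> ('w \<Rightarrow>\<^sub>0 'k) \<Rightarrow> ('w \<Rightarrow>\<^sub>0 'k)"
  by unfold_locales (simp_all add: fscale_add fscale_add_left)

lemma fscale_sum: "fscale c (sum g I) = (\<Sum>i\<in>I. fscale c (g i))"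
  by (rule formal.scale_sum_right)

lemma keys_fscale: "Poly_Mapping.keys (fscale c f) \<subseteq> Poly_Mapping.keys f"
  by (auto simp: in_keys_iff)

lemma keys_sum_subset:
  assumes "\<And>i. i \<in> I \<Longrightarrow> Poly_Mapping.keys (g i) \<subseteq> S"
  shows "Poly_Mapping.keys (sum g I) \<subseteq> S"
  using assms
proof (induction I rule: infinite_finite_induct)
  case (insert i I)
  then show ?case using Poly_Mapping.keys_add[of "g i" "sum g I"] by auto
qed simp_all

lemma free_space_simps:
  "carrier (free_space S) = {f. Poly_Mapping.keys f \<subseteq> S}"
  "\<zero>\<^bsub>free_space S\<^esub> = 0" "x \<oplus>\<^bsub>free_space S\<^esub> y = x + y" "c \<odot>\<^bsub>free_space S\<^esub> x = fscale c x"
  by (simp_all add: free_space_def)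

lemma free_space_module: "module (scalars :: 'k::field ring) (free_space S :: ('k, 'w \<Rightarrow>\<^sub>0 'k) module)"
proof (rule module_scalarsI)
  show "abelian_group (free_space S :: ('k, 'w \<Rightarrow>\<^sub>0 'k) module)"
  proof (rule abelian_groupI)
    fix f :: "'w \<Rightarrow>\<^sub>0 'k" assume "f \<in> carrier (free_space S)"
    then show "\<exists>g\<in>carrier (free_space S). g \<oplus>\<^bsub>free_space S\<^esub> f = \<zero>\<^bsub>free_space S\<^esub>"
      by (intro bexI[of _ "- f"]) (auto simp: free_space_simps)
  qed (use Poly_Mapping.keys_add in \<open>fastforce simp: free_space_simps algebra_simps\<close>)+
qed (use keys_fscale in \<open>fastforce simp: free_space_simps fscale_add fscale_add_left\<close>)+

lemma free_space_diff:
  fixes f g :: "'w \<Rightarrow>\<^sub>0 'k::field"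
  assumes "Poly_Mapping.keys f \<subseteq> S" "Poly_Mapping.keys g \<subseteq> S"
  shows "f \<ominus>\<^bsub>free_space S\<^esub> g = f - g"
proof -
  have "\<ominus>\<^bsub>free_space S\<^esub> g = - g"
    using minus_conv_smult[OF free_space_module, of g S] assms
    by (simp add: free_space_simps)
  then show ?thesis by (simp add: a_minus_def free_space_simps)
qed


subsection \<open>Linear operators\<close>

definition lin_op :: "(('v \<Rightarrow>\<^sub>0 'k::field) \<Rightarrow> ('w \<Rightarrow>\<^sub>0 'k)) \<Rightarrow> bool" where
  "lin_op G \<longleftrightarrow> (\<forall>f g. G (f + g) = G f + G g) \<and> (\<forall>c f. G (fscale c f) = fscale c (G f))"

lemma lin_opD:
  assumes "lin_op G"
  shows "G (f + g) = G f + G g" "G (fscale c f) = fscale c (G f)" "G 0 = 0" "G (- f) = - G f"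
    "G (f - g) = G f - G g"
proof -
  show add: "G (f + g) = G f + G g" and scale: "G (fscale c f) = fscale c (G f)" for f g c
    using assms by (auto simp: lin_op_def)
  show "G 0 = 0" using scale[of 0 0] by simp
  show neg: "G (- f) = - G f" for f using scale[of "- 1" f] by simp
  show "G (f - g) = G f - G g" using add[of f "- g"] neg[of g] by simp
qed

lemma lin_op_sum:
  assumes "lin_op G"
  shows "G (sum h I) = (\<Sum>i\<in>I. G (h i))"
  by (induction I rule: infinite_finite_induct) (simp_all add: lin_opD[OF assms])

lemma lin_op_id: "lin_op (\<lambda>f. f)"
  by (simp add: lin_op_def)

lemma lin_op_comp: "lin_op G \<Longrightarrow> lin_op H \<Longrightarrow> lin_op (\<lambda>f. G (H f))"
  by (simp add: lin_op_def)

lemma lin_op_add: "lin_op G \<Longrightarrow> lin_op H \<Longrightarrow> lin_op (\<lambda>f. G f + H f)"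
  by (simp add: lin_op_def fscale_add algebra_simps)

lemma lin_op_uminus: "lin_op G \<Longrightarrow> lin_op (\<lambda>f. - G f)"
  by (simp add: lin_op_def algebra_simps)

lemma lin_op_fscale: "lin_op G \<Longrightarrow> lin_op (\<lambda>f. fscale c (G f))"
  by (simp add: lin_op_def fscale_add mult.commute)

lemma lin_op_sumI:
  assumes "\<And>i. i \<in> I \<Longrightarrow> lin_op (G i)"
  shows "lin_op (\<lambda>f. \<Sum>i\<in>I. G i f)"
  using assms
  by (simp add: lin_op_def sum.distrib fscale_sum)

lemma lin_op_funpow:
  fixes G :: "('w \<Rightarrow>\<^sub>0 'k::field) \<Rightarrow> ('w \<Rightarrow>\<^sub>0 'k)"
  shows "lin_op G \<Longrightarrow> lin_op (\<lambda>f. (G ^^ n) f)"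
  by (induction n) (simp_all add: lin_op_def)

lemma lin_ext_superset:
  assumes "finite T" "Poly_Mapping.keys f \<subseteq> T"
  shows "lin_ext g f = (\<Sum>w\<in>T. fscale (Poly_Mapping.lookup f w) (g w))"
  unfolding lin_ext_def
  by (rule sum.mono_neutral_left) (use assms in \<open>auto simp: in_keys_iff\<close>)

lemma lin_op_lin_ext:
  fixes g :: "'w \<Rightarrow> ('v \<Rightarrow>\<^sub>0 'k::field)"
  shows "lin_op (lin_ext g)"
  unfolding lin_op_def
proof (intro conjI allI)
  fix f h :: "'w \<Rightarrow>\<^sub>0 'k" and c
  let ?T = "Poly_Mapping.keys f \<union> Poly_Mapping.keys h"
  show "lin_ext g (f + h) = lin_ext g f + lin_ext g h"
    using lin_ext_superset[of ?T "f + h" g] lin_ext_superset[of ?T f g] lin_ext_superset[of ?T h g]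
      Poly_Mapping.keys_add[of f h]
    by (simp add: lookup_add fscale_add_left sum.distrib)
  show "lin_ext g (fscale c f) = fscale c (lin_ext g f)"
    using lin_ext_superset[of "Poly_Mapping.keys f" "fscale c f" g] keys_fscale[of c f]
    by (simp add: lin_ext_def fscale_sum)
qed

lemmas lin_ext_simps = lin_opD[OF lin_op_lin_ext]

lemma lin_ext_single [simp]: "lin_ext g (Poly_Mapping.single w c) = fscale c (g w)"
  by (cases "c = 0") (simp_all add: lin_ext_def)

lemma formal_expansion:
  "f = (\<Sum>w\<in>Poly_Mapping.keys f. fscale (Poly_Mapping.lookup f w) (Poly_Mapping.single w 1))"
  by (rule poly_mapping_eqI)
    (simp add: lookup_sum lookup_single when_def in_keys_iff)

lemma lin_op_eqI:
  assumes "lin_op G" "lin_op H" "Poly_Mapping.keys f \<subseteq> S"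
    and "\<And>w. w \<in> S \<Longrightarrow> G (Poly_Mapping.single w 1) = H (Poly_Mapping.single w 1)"
  shows "G f = H f"
proof -
  have "G f = (\<Sum>w\<in>Poly_Mapping.keys f. fscale (Poly_Mapping.lookup f w) (G (Poly_Mapping.single w 1)))"
    by (subst formal_expansion) (simp only: lin_op_sum[OF assms(1)] lin_opD(2)[OF assms(1)])
  also have "\<dots> = (\<Sum>w\<in>Poly_Mapping.keys f. fscale (Poly_Mapping.lookup f w) (H (Poly_Mapping.single w 1)))"
    using assms(3,4) by (intro sum.cong) (auto simp: subset_iff)
  also have "\<dots> = H f"
    by (subst (3) formal_expansion) (simp only: lin_op_sum[OF assms(2)] lin_opD(2)[OF assms(2)])
  finally show ?thesis .
qed

lemma lin_op_keys:
  assumes "lin_op G" "Poly_Mapping.keys f \<subseteq> S"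
    and "\<And>w. w \<in> S \<Longrightarrow> Poly_Mapping.keys (G (Poly_Mapping.single w 1)) \<subseteq> T"
  shows "Poly_Mapping.keys (G f) \<subseteq> T"
proof -
  have eq: "G f = (\<Sum>w\<in>Poly_Mapping.keys f. fscale (Poly_Mapping.lookup f w) (G (Poly_Mapping.single w 1)))"
    by (subst formal_expansion) (simp only: lin_op_sum[OF assms(1)] lin_opD(2)[OF assms(1)])
  show ?thesis
    unfolding eq using assms(2,3)
    by (intro keys_sum_subset subset_trans[OF keys_fscale]) blast
qed


subsection \<open>Evaluating formal combinations in a vector space\<close>

definition free_ext :: "('k::field, 'v) module \<Rightarrow> ('w \<Rightarrow> 'v) \<Rightarrow> ('w \<Rightarrow>\<^sub>0 'k) \<Rightarrow> 'v" where
  "free_ext X \<phi> f = finsum X (\<lambda>w. Poly_Mapping.lookup f w \<odot>\<^bsub>X\<^esub> \<phi> w) (Poly_Mapping.keys f)"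

lemma free_ext_superset:
  assumes X: "module scalars X" and "\<And>w. w \<in> S \<Longrightarrow> \<phi> w \<in> carrier X"
    and "finite T" "Poly_Mapping.keys f \<subseteq> T" "T \<subseteq> S"
  shows "free_ext X \<phi> f = finsum X (\<lambda>w. Poly_Mapping.lookup f w \<odot>\<^bsub>X\<^esub> \<phi> w) T"
proof -
  interpret X: module scalars X by fact
  have \<phi>: "\<phi> w \<in> carrier X" if "w \<in> T" for w using that assms(2,5) by auto
  show ?thesis
    unfolding free_ext_def
  proof (rule X.add.finprod_mono_neutral_cong_left)
    show "Poly_Mapping.lookup f w \<odot>\<^bsub>X\<^esub> \<phi> w = \<zero>\<^bsub>X\<^esub>"
      if "w \<in> T - Poly_Mapping.keys f" for w
      using \<phi> that by (auto simp: in_keys_iff module_simps(3)[OF X])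
  qed (use assms(3,4) \<phi> in \<open>auto simp: module_simps(1)[OF X]\<close>)
qed

lemma linear_map_free_ext:
  fixes X :: "('k::field, 'v) module" and S :: "'w set"
  assumes X: "module scalars X" and \<phi>: "\<And>w. w \<in> S \<Longrightarrow> \<phi> w \<in> carrier X"
  shows "linear_map (free_space S) X (free_ext X \<phi>)"
proof (rule linear_mapI)
  interpret X: module scalars X by fact
  have s: "c \<odot>\<^bsub>X\<^esub> \<phi> w \<in> carrier X" if "w \<in> S" for c w
    using \<phi>[OF that] module_simps(1)[OF X] by simp
  fix f :: "'w \<Rightarrow>\<^sub>0 'k" and c assume f: "f \<in> carrier (free_space S)"
  then show "free_ext X \<phi> f \<in> carrier X"
    unfolding free_ext_def by (intro X.finsum_closed) (use s in \<open>auto simp: free_space_simps\<close>)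
  show "free_ext X \<phi> (c \<odot>\<^bsub>free_space S\<^esub> f) = c \<odot>\<^bsub>X\<^esub> free_ext X \<phi> f"
  proof -
    have "free_ext X \<phi> (fscale c f) =
        finsum X (\<lambda>w. (c * Poly_Mapping.lookup f w) \<odot>\<^bsub>X\<^esub> \<phi> w) (Poly_Mapping.keys f)"
      using f free_ext_superset[OF X \<phi>, where T = "Poly_Mapping.keys f" and f = "fscale c f" and S = S]
        keys_fscale[of c f] by (simp add: free_space_simps)
    also have "\<dots> = finsum X (\<lambda>w. c \<odot>\<^bsub>X\<^esub> (Poly_Mapping.lookup f w \<odot>\<^bsub>X\<^esub> \<phi> w)) (Poly_Mapping.keys f)"
      using f \<phi> s by (intro X.finsum_cong') (auto simp: free_space_simps module_simps[OF X])
    also have "\<dots> = c \<odot>\<^bsub>X\<^esub> free_ext X \<phi> f"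
      unfolding free_ext_def using f s
      by (subst X.finsum_smult_ldistr) (auto simp: free_space_simps)
    finally show ?thesis by (simp add: free_space_simps)
  qed
next
  interpret X: module scalars X by fact
  have s: "c \<odot>\<^bsub>X\<^esub> \<phi> w \<in> carrier X" if "w \<in> S" for c w
    using \<phi>[OF that] module_simps(1)[OF X] by simp
  fix f g :: "'w \<Rightarrow>\<^sub>0 'k" assume fg: "f \<in> carrier (free_space S)" "g \<in> carrier (free_space S)"
  let ?T = "Poly_Mapping.keys f \<union> Poly_Mapping.keys g"
  have T: "?T \<subseteq> S" "Poly_Mapping.keys (f + g) \<subseteq> ?T"
    using fg Poly_Mapping.keys_add[of f g] by (auto simp: free_space_simps)
  note sup = free_ext_superset[OF X \<phi>, where T = ?T and S = S]
  have "free_ext X \<phi> (f + g) =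
      finsum X (\<lambda>w. Poly_Mapping.lookup f w \<odot>\<^bsub>X\<^esub> \<phi> w \<oplus>\<^bsub>X\<^esub> Poly_Mapping.lookup g w \<odot>\<^bsub>X\<^esub> \<phi> w) ?T"
    using T s by (subst sup)
      (auto simp: lookup_add module_simps(4)[OF X \<phi>] intro!: X.finsum_cong')
  also have "\<dots> = free_ext X \<phi> f \<oplus>\<^bsub>X\<^esub> free_ext X \<phi> g"
    using T s by (subst (1 2) sup) (auto intro!: X.finsum_addf)
  finally show "free_ext X \<phi> (f \<oplus>\<^bsub>free_space S\<^esub> g) = free_ext X \<phi> f \<oplus>\<^bsub>X\<^esub> free_ext X \<phi> g"
    by (simp add: free_space_simps)
qed

lemma free_ext_single:
  assumes X: "module scalars X" and "\<phi> w \<in> carrier X"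
  shows "free_ext X \<phi> (Poly_Mapping.single w c) = c \<odot>\<^bsub>X\<^esub> \<phi> w"
proof -
  interpret X: module scalars X by fact
  show ?thesis
    using assms by (cases "c = 0") (simp_all add: free_ext_def module_simps)
qed


subsection \<open>Consequences of the existence of bases\<close>

text \<open>Connects operators on formal combinations with \<^theory>\<open>HOL.Vector_Spaces\<close>, whose results rest on
  the existence of bases.\<close>

lemma linear_formal_iff: "Vector_Spaces.linear fscale fscale G \<longleftrightarrow> lin_op G"
  by (auto simp: lin_op_def Vector_Spaces.linear_def module_hom_def module_hom_axioms_def
      formal.module_axioms formal.vector_space_axioms)

text \<open>Every vector space on a carrier embeds into a space of formal combinations: take a
  projection of the formal combinations of its elements along those that evaluate to zero.
  Identities between sums can therefore be checked in an additive group on a whole type, where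
  the simplifier knows how to cancel.\<close>

definition embedding :: "('k::field, 'v) module \<Rightarrow> ('v \<Rightarrow> ('w \<Rightarrow>\<^sub>0 'k)) \<Rightarrow> bool" where
  "embedding V j \<longleftrightarrow> inj_on j (carrier V) \<and>
     (\<forall>x\<in>carrier V. \<forall>y\<in>carrier V. j (x \<oplus>\<^bsub>V\<^esub> y) = j x + j y) \<and>
     (\<forall>c. \<forall>x\<in>carrier V. j (c \<odot>\<^bsub>V\<^esub> x) = fscale c (j x))"

lemma ex_embedding:
  fixes V :: "('k::field, 'v) module"
  assumes V: "module scalars V"
  shows "\<exists>j :: 'v \<Rightarrow> ('v \<Rightarrow>\<^sub>0 'k). embedding V j"
proof -
  define \<phi> where "\<phi> v = (if v \<in> carrier V then v else \<zero>\<^bsub>V\<^esub>)" for v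
  have \<phi>: "\<phi> v \<in> carrier V" for v by (simp add: \<phi>_def zero_mem[OF V])
  \<comment> \<open>\<open>P\<close> below projects along \<open>K\<close>: extend a basis of \<open>K\<close> to one of the whole space and kill the former.\<close>
  define K where "K = {f. free_ext V \<phi> f = \<zero>\<^bsub>V\<^esub>}"
  have lin: "linear_map (free_space UNIV) V (free_ext V \<phi>)"
    by (rule linear_map_free_ext[OF V \<phi>])
  note e = linear_mapD[OF lin, simplified free_space_simps, simplified]
    and e0 = linear_map_zero[OF free_space_module V lin, simplified free_space_simps, simplified]
  interpret V: module scalars V by fact
  have e_neg: "free_ext V \<phi> (f - g) = free_ext V \<phi> f \<ominus>\<^bsub>V\<^esub> free_ext V \<phi> g" for f g
    using linear_map_diff[OF free_space_module V lin, of f g] free_space_diff[of f UNIV g]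
    by (simp add: free_space_simps)
  have K: "formal.subspace K"
    by (rule formal.subspaceI) (auto simp: K_def e e0 module_smult_zero[OF V])
  obtain B0 where B0: "B0 \<subseteq> K" "formal.independent B0" "K \<subseteq> formal.span B0"
    using formal.maximal_independent_subset[of K] by blast
  obtain B where B: "B0 \<subseteq> B" "formal.independent B" "UNIV \<subseteq> formal.span B"
    using formal.maximal_independent_subset_extend[OF _ B0(2), of UNIV] by auto
  interpret pair: vector_space_pair "fscale :: 'k \<Rightarrow> ('v \<Rightarrow>\<^sub>0 'k) \<Rightarrow> _" "fscale :: 'k \<Rightarrow> ('v \<Rightarrow>\<^sub>0 'k) \<Rightarrow> _"
    by unfold_locales
  obtain P where "Vector_Spaces.linear fscale fscale P"
    and PB: "\<And>b. b \<in> B \<Longrightarrow> P b = (if b \<in> B0 then 0 else b)"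
    using pair.linear_independent_extend[OF B(2), of "\<lambda>b. if b \<in> B0 then 0 else b"] by auto
  then have P: "lin_op P" by (simp add: linear_formal_iff)
  have K_span: "formal.span B0 = K"
    using B0 K formal.span_minimal by blast
  have ker: "P f = 0" if "f \<in> K" for f
  proof -
    have "f \<in> formal.span B0" using that K_span by simp
    then show ?thesis
      by (induction rule: formal.span_induct_alt)
        (use PB B(1) in \<open>auto simp: lin_opD[OF P]\<close>)
  qed
  have diff: "f - P f \<in> K" for f
  proof -
    have "f \<in> formal.span B" using B(3) by auto
    then show ?thesis
    proof (induction rule: formal.span_induct_alt)
      case base
      then show ?case using formal.subspace_0[OF K] by (simp add: lin_opD[OF P])
    next
      case (step c x y)
      have "x - P x \<in> K"
        using PB[OF step(1)] B0(1) formal.subspace_0[OF K] by auto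
      then have "fscale c (x - P x) + (y - P y) \<in> K"
        using step formal.subspace_add[OF K] formal.subspace_scale[OF K] by blast
      then show ?case by (simp add: lin_opD[OF P] fscale_diff algebra_simps)
    qed
  qed
  have P_eq: "P f = P g \<longleftrightarrow> free_ext V \<phi> f = free_ext V \<phi> g" for f g
  proof -
    have "P f = P g \<longleftrightarrow> P (f - g) = 0" by (simp add: lin_opD[OF P])
    also have "\<dots> \<longleftrightarrow> f - g \<in> K" using ker diff[of "f - g"] by auto
    also have "\<dots> \<longleftrightarrow> free_ext V \<phi> f = free_ext V \<phi> g"
      by (simp add: K_def e_neg diff_eq_zero_iff[OF V] e)
    finally show ?thesis .
  qed
  have single: "free_ext V \<phi> (Poly_Mapping.single v c) = c \<odot>\<^bsub>V\<^esub> v" if "v \<in> carrier V" for v c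
    using free_ext_single[of V \<phi> v c, OF V \<phi>] that by (simp add: \<phi>_def)
  have "embedding V (\<lambda>v. P (Poly_Mapping.single v 1))"
    unfolding embedding_def
  proof (intro conjI ballI allI inj_onI)
    fix x y c assume x: "x \<in> carrier V"
    show "P (Poly_Mapping.single (c \<odot>\<^bsub>V\<^esub> x) 1) = fscale c (P (Poly_Mapping.single x 1))"
      using x by (simp add: P_eq single module_simps[OF V] flip: lin_opD(2)[OF P])
    assume y: "y \<in> carrier V"
    show "P (Poly_Mapping.single (x \<oplus>\<^bsub>V\<^esub> y) 1) = P (Poly_Mapping.single x 1) + P (Poly_Mapping.single y 1)"
      using x y by (simp add: P_eq single e module_simps[OF V] flip: lin_opD(1)[OF P])
    assume "P (Poly_Mapping.single x 1) = P (Poly_Mapping.single y 1)"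
    then show "x = y" using x y by (simp add: P_eq single module_simps[OF V])
  qed
  then show ?thesis by blast
qed

lemma embeddingD:
  assumes j: "embedding V j" and V: "module scalars V"
  shows "x \<in> carrier V \<Longrightarrow> y \<in> carrier V \<Longrightarrow> j x = j y \<longleftrightarrow> x = y"
    and "x \<in> carrier V \<Longrightarrow> y \<in> carrier V \<Longrightarrow> j (x \<oplus>\<^bsub>V\<^esub> y) = j x + j y"
    and "x \<in> carrier V \<Longrightarrow> j (c \<odot>\<^bsub>V\<^esub> x) = fscale c (j x)"
    and "x \<in> carrier V \<Longrightarrow> j (\<ominus>\<^bsub>V\<^esub> x) = - j x"
    and "x \<in> carrier V \<Longrightarrow> y \<in> carrier V \<Longrightarrow> j (x \<ominus>\<^bsub>V\<^esub> y) = j x - j y"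
    and "j \<zero>\<^bsub>V\<^esub> = 0"
proof -
  interpret V: module scalars V by fact
  show "j x = j y \<longleftrightarrow> x = y" if "x \<in> carrier V" "y \<in> carrier V"
    using j that by (auto simp: embedding_def dest: inj_onD)
  show add: "j (x \<oplus>\<^bsub>V\<^esub> y) = j x + j y" if "x \<in> carrier V" "y \<in> carrier V" for x y
    using j that by (auto simp: embedding_def)
  show s: "j (c \<odot>\<^bsub>V\<^esub> x) = fscale c (j x)" if "x \<in> carrier V" for c x
    using j that by (auto simp: embedding_def)
  show neg: "j (\<ominus>\<^bsub>V\<^esub> x) = - j x" if "x \<in> carrier V" for x
    using s[OF that, of "- 1"] that by (simp add: minus_conv_smult[OF V])
  show "j (x \<ominus>\<^bsub>V\<^esub> y) = j x - j y" if "x \<in> carrier V" "y \<in> carrier V"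
    using that by (simp add: a_minus_def add neg)
  show "j \<zero>\<^bsub>V\<^esub> = 0" using add[of "\<zero>\<^bsub>V\<^esub>" "\<zero>\<^bsub>V\<^esub>"] by simp
qed

text \<open>Formal combinations of the elements of \<open>V\<close> map onto \<open>V\<close>, and \<open>W\<close> embeds into formal
  combinations of its elements; between spaces of formal combinations the inverse exists because
  bases do.\<close>

lemma ex_generalized_inverse:
  fixes V :: "('k::field, 'v) module" and W :: "('k, 'w) module"
  assumes V: "module scalars V" and W: "module scalars W" and \<rho>: "linear_map V W \<rho>"
  shows "\<exists>s. linear_map W V s \<and> (\<forall>x\<in>carrier V. \<rho> (s (\<rho> x)) = \<rho> x)"
proof -
  obtain j :: "'w \<Rightarrow> ('w \<Rightarrow>\<^sub>0 'k)" where j: "embedding W j" using ex_embedding[OF W] by blast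
  note j = embeddingD[OF j W]
  define \<phi> where "\<phi> v = (if v \<in> carrier V then v else \<zero>\<^bsub>V\<^esub>)" for v
  have \<phi>: "\<phi> v \<in> carrier V" for v by (simp add: \<phi>_def zero_mem[OF V])
  have lin: "linear_map (free_space UNIV) V (free_ext V \<phi>)"
    by (rule linear_map_free_ext[OF V \<phi>])
  note e = linear_mapD[OF lin, simplified free_space_simps, simplified]
  define h where "h f = j (\<rho> (free_ext V \<phi> f))" for f
  interpret pair: vector_space_pair "fscale :: 'k \<Rightarrow> ('v \<Rightarrow>\<^sub>0 'k) \<Rightarrow> _" "fscale :: 'k \<Rightarrow> ('w \<Rightarrow>\<^sub>0 'k) \<Rightarrow> _"
    by unfold_locales
  have "lin_op h"
    by (simp add: lin_op_def h_def e linear_mapD[OF \<rho>] j)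
  then obtain g where "Vector_Spaces.linear fscale fscale g" and hg: "\<And>f. h (g (h f)) = h f"
    using pair.linear_exists_right_inverse_on[of h UNIV] by (auto simp: linear_formal_iff)
  then have g: "lin_op g" by (simp add: linear_formal_iff)
  define s where "s w = free_ext V \<phi> (g (j w))" for w
  have "linear_map W V s"
    by (rule linear_mapI) (simp_all add: s_def e j lin_opD[OF g])
  moreover have "\<rho> (s (\<rho> x)) = \<rho> x" if x: "x \<in> carrier V" for x
  proof -
    have "free_ext V \<phi> (Poly_Mapping.single x 1) = x"
      using free_ext_single[of V \<phi> x 1, OF V \<phi>] x by (simp add: \<phi>_def module_simps[OF V])
    then have "h (Poly_Mapping.single x 1) = j (\<rho> x)" by (simp add: h_def)
    then have "j (\<rho> (s (\<rho> x))) = j (\<rho> x)"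
      using hg[of "Poly_Mapping.single x 1"] by (simp add: s_def) (simp add: h_def)
    then show ?thesis
      using x by (simp add: j linear_mapD[OF \<rho>] s_def e)
  qed
  ultimately show ?thesis by blast
qed


section \<open>Homology and a five-term exact sequence\<close>

lemma diff_mem:
  assumes "module (scalars :: 'k::field ring) V" "x \<in> carrier V" "y \<in> carrier V"
  shows "x \<ominus>\<^bsub>V\<^esub> y \<in> carrier V"
  using subspaceD(6)[OF assms(1) subspace_carrier[OF assms(1)]] assms(2,3) .

lemma a_r_coset_update [simp]: "W +>\<^bsub>V\<lparr>carrier := Z\<rparr>\<^esub> x = W +>\<^bsub>V\<^esub> x"
  by (simp add: a_r_coset_def')

lemma a_kernel_eq: "a_kernel V W f = {x \<in> carrier V. f x = \<zero>\<^bsub>W\<^esub>}"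
  by (simp add: a_kernel_def')

lemma cycles_Suc:
  "cycles C (Suc n) = {x \<in> carrier (chain_space C (Suc n)). diff C (Suc n) x = \<zero>\<^bsub>chain_space C n\<^esub>}"
  by (simp add: cycles_def a_kernel_eq)

context
  fixes C :: "('k::field, 'v) chain_complex"
  assumes C: "is_complex C"
begin

lemma cycles_subspace: "submodule (cycles C n) (scalars :: 'k ring) (chain_space C n)"
proof (cases n)
  case 0
  then show ?thesis by (simp add: cycles_def subspace_carrier is_complexD(1)[OF C])
next
  case (Suc m)
  then show ?thesis
    using subspace_kernel[OF is_complexD(1)[OF C] is_complexD(1)[OF C] is_complexD(2)[OF C, of m]]
    by (simp add: cycles_Suc)
qed

lemma boundaries_subspace: "submodule (boundaries C n) (scalars :: 'k ring) (chain_space C n)"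
  unfolding boundaries_def
  by (rule subspace_image[OF is_complexD(1)[OF C] is_complexD(1)[OF C] is_complexD(2)[OF C]
        subspace_carrier[OF is_complexD(1)[OF C]]])

lemma boundaries_cycles: "boundaries C n \<subseteq> cycles C n"
proof (cases n)
  case 0
  then show ?thesis
    using linear_mapD(1)[OF is_complexD(2)[OF C]] by (auto simp: boundaries_def cycles_def)
next
  case (Suc m)
  then show ?thesis
    using linear_mapD(1)[OF is_complexD(2)[OF C]] is_complexD(3)[OF C]
    by (auto simp: boundaries_def cycles_Suc)
qed

lemma cycles_module: "module (scalars :: 'k ring) (chain_space C n\<lparr>carrier := cycles C n\<rparr>)"
  by (rule subspace_module[OF is_complexD(1)[OF C] cycles_subspace])

lemma boundaries_subspace_cycles:
  "submodule (boundaries C n) (scalars :: 'k ring) (chain_space C n\<lparr>carrier := cycles C n\<rparr>)"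
  using boundaries_cycles subspaceD[OF is_complexD(1)[OF C] boundaries_subspace]
  by (intro subspaceI[OF cycles_module]) auto

lemma homology_module: "module (scalars :: 'k ring) (homology C n)"
  unfolding homology_def by (rule quot_module[OF cycles_module boundaries_subspace_cycles])

lemma homology_carrier:
  "carrier (homology C n) = (\<lambda>x. boundaries C n +>\<^bsub>chain_space C n\<^esub> x) ` cycles C n"
  by (simp add: homology_def quot_carrier)

lemma homology_class_eq_iff:
  assumes "x \<in> cycles C n" "y \<in> cycles C n"
  shows "boundaries C n +>\<^bsub>chain_space C n\<^esub> x = boundaries C n +>\<^bsub>chain_space C n\<^esub> y \<longleftrightarrow>
    x \<ominus>\<^bsub>chain_space C n\<^esub> y \<in> boundaries C n"
  using assms subspaceD(1)[OF is_complexD(1)[OF C] cycles_subspace]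
  by (intro coset_eq_iff[OF is_complexD(1)[OF C] boundaries_subspace]) auto

lemma homology_class_zero_iff:
  assumes "x \<in> cycles C n"
  shows "boundaries C n +>\<^bsub>chain_space C n\<^esub> x = \<zero>\<^bsub>homology C n\<^esub> \<longleftrightarrow> x \<in> boundaries C n"
  using assms subspaceD(1)[OF is_complexD(1)[OF C] cycles_subspace]
    coset_eq_subspace_iff[OF is_complexD(1)[OF C] boundaries_subspace]
  by (auto simp: homology_def quot_zero)

lemma linear_map_homology_class:
  "linear_map (chain_space C n\<lparr>carrier := cycles C n\<rparr>) (homology C n)
     (\<lambda>x. boundaries C n +>\<^bsub>chain_space C n\<^esub> x)"
  using linear_map_coset[OF cycles_module boundaries_subspace_cycles] by (simp add: homology_def)

end

definition is_chain_map ::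
    "('k::field, 'v) chain_complex \<Rightarrow> ('k, 'w) chain_complex \<Rightarrow> (nat \<Rightarrow> 'v \<Rightarrow> 'w) \<Rightarrow> bool" where
  "is_chain_map C D f \<longleftrightarrow> (\<forall>n. linear_map (chain_space C n) (chain_space D n) (f n)) \<and>
     (\<forall>n. \<forall>x\<in>carrier (chain_space C (Suc n)). f n (diff C (Suc n) x) = diff D (Suc n) (f (Suc n) x))"

lemma is_chain_mapD:
  assumes "is_chain_map C D f"
  shows "linear_map (chain_space C n) (chain_space D n) (f n)"
    and "x \<in> carrier (chain_space C (Suc n)) \<Longrightarrow> f n (diff C (Suc n) x) = diff D (Suc n) (f (Suc n) x)"
  using assms by (auto simp: is_chain_map_def)

context
  fixes C :: "('k::field, 'v) chain_complex" and D :: "('k, 'w) chain_complex" and f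
  assumes C: "is_complex C" and D: "is_complex D" and f: "is_chain_map C D f"
begin

lemma chain_map_cycles: "x \<in> cycles C n \<Longrightarrow> f n x \<in> cycles D n"
proof (cases n)
  case 0
  then show "x \<in> cycles C n \<Longrightarrow> f n x \<in> cycles D n"
    using linear_mapD(1)[OF is_chain_mapD(1)[OF f]] by (simp add: cycles_def)
next
  case (Suc m)
  then show "x \<in> cycles C n \<Longrightarrow> f n x \<in> cycles D n"
    using linear_mapD(1)[OF is_chain_mapD(1)[OF f]] is_chain_mapD(2)[OF f, of x m]
      linear_map_zero[OF is_complexD(1)[OF C] is_complexD(1)[OF D] is_chain_mapD(1)[OF f, of m]]
    by (simp add: cycles_Suc)
qed

lemma chain_map_boundaries: "x \<in> boundaries C n \<Longrightarrow> f n x \<in> boundaries D n"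
  using is_chain_mapD(2)[OF f] linear_mapD(1)[OF is_chain_mapD(1)[OF f]]
  by (auto simp: boundaries_def)

lemma linear_map_cycles:
  "linear_map (chain_space C n\<lparr>carrier := cycles C n\<rparr>) (chain_space D n) (f n)"
  using linear_mapD[OF is_chain_mapD(1)[OF f]] subspaceD(1)[OF is_complexD(1)[OF C] cycles_subspace[OF C]]
  by (intro linear_mapI) auto

lemma homology_map_class:
  assumes "x \<in> cycles C n"
  shows "homology_map D f n (boundaries C n +>\<^bsub>chain_space C n\<^esub> x) =
    boundaries D n +>\<^bsub>chain_space D n\<^esub> f n x"
  using quot_map_coset[OF is_complexD(1)[OF D] cycles_module[OF C] linear_map_cycles
      boundaries_subspace[OF D] boundaries_subspace_cycles[OF C] chain_map_boundaries, where x = x] assms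
  by (simp add: homology_map_def)

lemma linear_map_homology_map: "linear_map (homology C n) (homology D n) (homology_map D f n)"
proof -
  have "linear_map (chain_space C n\<lparr>carrier := cycles C n\<rparr>)
      (chain_space D n\<lparr>carrier := cycles D n\<rparr>) (f n)"
    using linear_mapD[OF linear_map_cycles] chain_map_cycles by (intro linear_mapI) auto
  then have "linear_map (chain_space C n\<lparr>carrier := cycles C n\<rparr>) (homology D n)
      (\<lambda>x. boundaries D n +>\<^bsub>chain_space D n\<^esub> f n x)"
    by (rule linear_map_comp) (rule linear_map_homology_class[OF D])
  then have "linear_map (quot (chain_space C n\<lparr>carrier := cycles C n\<rparr>) (boundaries C n))
      (homology D n) (homology_map D f n)"
    by (rule linear_map_quotI[OF cycles_module[OF C] boundaries_subspace_cycles[OF C]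
          homology_module[OF D]]) (simp add: homology_map_class)
  then show ?thesis by (simp add: homology_def)
qed

end

text \<open>The long exact sequence of \<open>0 \<rightarrow> Ker f \<rightarrow> C \<rightarrow> D \<rightarrow> 0\<close> from degree \<open>n + 2\<close> to degree \<open>n + 1\<close>,
  when \<open>Ker f\<close> has no homology in degree \<open>n\<close> (which gives surjectivity at the end) and \<open>\<theta>\<close>
  identifies its homology in degree \<open>n + 1\<close> with \<open>Q\<close>. The connecting map sends the class of \<open>f x\<close>
  to \<open>\<theta> (d x)\<close>.\<close>

lemma long_exact_piece:
  fixes C :: "('k::field, 'v) chain_complex" and D :: "('k, 'w) chain_complex"
    and Q :: "('k, 'q) module"
  assumes C: "is_complex C" and D: "is_complex D" and f: "is_chain_map C D f"
    and surj: "\<And>m. f m ` carrier (chain_space C m) = carrier (chain_space D m)"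
    and acyclic: "\<And>z. z \<in> boundaries C n \<Longrightarrow> f n z = \<zero>\<^bsub>chain_space D n\<^esub> \<Longrightarrow>
      \<exists>x\<in>carrier (chain_space C (Suc n)). f (Suc n) x = \<zero>\<^bsub>chain_space D (Suc n)\<^esub> \<and> diff C (Suc n) x = z"
    and Q: "module scalars Q"
    and K: "K = {z \<in> cycles C (Suc n). f (Suc n) z = \<zero>\<^bsub>chain_space D (Suc n)\<^esub>}"
    and \<theta>: "linear_map (chain_space C (Suc n)\<lparr>carrier := K\<rparr>) Q \<theta>" "\<theta> ` K = carrier Q"
    and ker: "{z \<in> K. \<theta> z = \<zero>\<^bsub>Q\<^esub>} = diff C (Suc (Suc n)) `
      {x \<in> carrier (chain_space C (Suc (Suc n))). f (Suc (Suc n)) x = \<zero>\<^bsub>chain_space D (Suc (Suc n))\<^esub>}"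
  shows "\<exists>\<delta> \<epsilon>. exact_sequence5
    (homology C (Suc (Suc n))) (homology_map D f (Suc (Suc n))) (homology D (Suc (Suc n))) \<delta> Q \<epsilon>
    (homology C (Suc n)) (homology_map D f (Suc n)) (homology D (Suc n))"
proof -
  let ?C0 = "chain_space C n" and ?C1 = "chain_space C (Suc n)" and ?C2 = "chain_space C (Suc (Suc n))"
  let ?D0 = "chain_space D n" and ?D1 = "chain_space D (Suc n)" and ?D2 = "chain_space D (Suc (Suc n))"
  let ?d1 = "diff C (Suc n)" and ?d2 = "diff C (Suc (Suc n))"
  let ?f1 = "f (Suc n)" and ?f2 = "f (Suc (Suc n))"
  let ?B1 = "boundaries C (Suc n)" and ?B2 = "boundaries C (Suc (Suc n))"
  let ?E1 = "boundaries D (Suc n)" and ?E2 = "boundaries D (Suc (Suc n))"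
  note mC = is_complexD(1)[OF C] and mD = is_complexD(1)[OF D]
  note dC = linear_mapD[OF is_complexD(2)[OF C]] and dD = linear_mapD[OF is_complexD(2)[OF D]]
  note ddC = is_complexD(3)[OF C]
  note fl = linear_mapD[OF is_chain_mapD(1)[OF f]] and fd = is_chain_mapD(2)[OF f]
  note f_diff = linear_map_diff[OF mC mD is_chain_mapD(1)[OF f]]
    and d_diff = linear_map_diff[OF mC mC is_complexD(2)[OF C]]
  note f_zero = linear_map_zero[OF mC mD is_chain_mapD(1)[OF f]]
  note K_mem = K[unfolded cycles_Suc]
  have K_sub: "submodule K scalars ?C1"
    using subspaceD[OF mC cycles_subspace[OF C, of "Suc n"]] unfolding K
    by (intro subspaceI[OF mC])
      (auto simp: fl f_zero module_simps(1)[OF mC] zero_mem[OF mD] module_smult_zero[OF mD]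
        abelian_monoid.l_zero[OF abelian_group.axioms(1)[OF module_abelian_group[OF mD]]])
  note K_mod = subspace_module[OF mC K_sub]
  note \<theta>l = linear_mapD[OF \<theta>(1), simplified]
  have \<theta>_zero: "\<theta> \<zero>\<^bsub>?C1\<^esub> = \<zero>\<^bsub>Q\<^esub>" using linear_map_zero[OF K_mod Q \<theta>(1)] by simp
  have \<theta>_diff: "\<theta> (x \<ominus>\<^bsub>?C1\<^esub> y) = \<theta> x \<ominus>\<^bsub>Q\<^esub> \<theta> y" if "x \<in> K" "y \<in> K" for x y
    using linear_map_diff[OF K_mod Q \<theta>(1), of x y] that a_inv_subspace[OF mC K_sub that(2)]
    by (simp add: a_minus_def)
  have ddD: "diff D (Suc n) (diff D (Suc (Suc n)) y) = \<zero>\<^bsub>?D0\<^esub>" if "y \<in> carrier ?D2" for y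
    using is_complexD(3)[OF D that] .
  have dK: "?d2 x \<in> K" if "x \<in> carrier ?C2" "?f2 x \<in> cycles D (Suc (Suc n))" for x
    using that by (auto simp: K_mem dC ddC fd cycles_Suc)
  have same: "\<theta> (?d2 x) = \<theta> (?d2 x')"
    if x: "x \<in> carrier ?C2" "?f2 x \<in> cycles D (Suc (Suc n))"
      and x': "x' \<in> carrier ?C2" "?f2 x' = ?f2 x" for x x'
  proof -
    have "?f2 (x \<ominus>\<^bsub>?C2\<^esub> x') = \<zero>\<^bsub>?D2\<^esub>" using x x' by (simp add: f_diff diff_eq_zero_iff[OF mD] fl)
    then have "?d2 (x \<ominus>\<^bsub>?C2\<^esub> x') \<in> {z \<in> K. \<theta> z = \<zero>\<^bsub>Q\<^esub>}"
      using x x' diff_mem[OF mC] unfolding ker by auto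
    then have "\<theta> (?d2 x \<ominus>\<^bsub>?C1\<^esub> ?d2 x') = \<zero>\<^bsub>Q\<^esub>" using x x' by (simp add: d_diff)
    then show ?thesis using dK x x' by (simp add: \<theta>_diff diff_eq_zero_iff[OF Q] \<theta>l)
  qed
  define \<sigma> where "\<sigma> y = (SOME x. x \<in> carrier ?C2 \<and> ?f2 x = y)" for y
  have \<sigma>: "\<sigma> y \<in> carrier ?C2 \<and> ?f2 (\<sigma> y) = y" if "y \<in> carrier ?D2" for y
    unfolding \<sigma>_def by (rule someI_ex) (use surj[of "Suc (Suc n)"] that in \<open>metis imageE\<close>)
  \<comment> \<open>The connecting map on cycles; by \<open>same\<close> it does not depend on the chosen lift.\<close>
  define F where "F y = \<theta> (?d2 (\<sigma> y))" for y
  have cycD: "y \<in> carrier ?D2" if "y \<in> cycles D (Suc (Suc n))" for y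
    using that by (simp add: cycles_Suc)
  have F: "F (?f2 x) = \<theta> (?d2 x)" if x: "x \<in> carrier ?C2" "?f2 x \<in> cycles D (Suc (Suc n))" for x
    using same[OF x, of "\<sigma> (?f2 x)"] \<sigma>[OF cycD[OF x(2)]] by (simp add: F_def)
  have lift: "\<exists>x\<in>carrier ?C2. ?f2 x = y" if "y \<in> carrier ?D2" for y
    using \<sigma>[OF that] by blast
  let ?ZD = "?D2\<lparr>carrier := cycles D (Suc (Suc n))\<rparr>"
  note ZD = subspaceD[OF mD cycles_subspace[OF D]]
  have F_lin: "linear_map ?ZD Q F"
  proof (rule linear_mapI)
    fix y y' c assume "y \<in> carrier ?ZD"
    then have y: "y \<in> cycles D (Suc (Suc n))" by simp
    obtain x where x: "x \<in> carrier ?C2" "?f2 x = y" using lift[OF cycD[OF y]] by blast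
    show "F y \<in> carrier Q" using F[of x] x y dK[of x] by (simp add: \<theta>l)
    show "F (c \<odot>\<^bsub>?ZD\<^esub> y) = c \<odot>\<^bsub>Q\<^esub> F y"
      using F[of x] F[of "c \<odot>\<^bsub>?C2\<^esub> x"] x y dK[of x] ZD(4)[OF y]
      by (simp add: fl module_simps[OF mC] dC \<theta>l)
    assume "y' \<in> carrier ?ZD"
    then have y': "y' \<in> cycles D (Suc (Suc n))" by simp
    obtain x' where x': "x' \<in> carrier ?C2" "?f2 x' = y'" using lift[OF cycD[OF y']] by blast
    show "F (y \<oplus>\<^bsub>?ZD\<^esub> y') = F y \<oplus>\<^bsub>Q\<^esub> F y'"
      using F[of x] F[of x'] F[of "x \<oplus>\<^bsub>?C2\<^esub> x'"] x y x' y' dK[of x] dK[of x'] ZD(3)[OF y y']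
      by (simp add: fl add_mem[OF mC] dC \<theta>l)
  qed
  have F_bd: "F y = \<zero>\<^bsub>Q\<^esub>" if y: "y \<in> ?E2" for y
  proof -
    from y obtain y' where "y' \<in> carrier (chain_space D (Suc (Suc (Suc n))))"
      and y': "y = diff D (Suc (Suc (Suc n))) y'"
      by (auto simp: boundaries_def)
    then obtain x where x: "x \<in> carrier (chain_space C (Suc (Suc (Suc n))))"
      and "y' = f (Suc (Suc (Suc n))) x"
      using surj[of "Suc (Suc (Suc n))"] by (metis imageE)
    with y' have "y = diff D (Suc (Suc (Suc n))) (f (Suc (Suc (Suc n))) x)" by simp
    then have "y = ?f2 (diff C (Suc (Suc (Suc n))) x)" using x by (simp add: fd)
    moreover have "y \<in> cycles D (Suc (Suc n))" using boundaries_cycles[OF D] y by auto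
    ultimately show ?thesis using F[of "diff C (Suc (Suc (Suc n))) x"] x by (simp add: dC ddC \<theta>_zero)
  qed
  have \<theta>_surj: "\<exists>z\<in>K. q = \<theta> z" if "q \<in> carrier Q" for q
    using that \<theta>(2) by (metis imageE)
  define \<delta> where "\<delta> = quot_lift F"
  have \<delta>_lin: "linear_map (homology D (Suc (Suc n))) Q \<delta>"
    unfolding \<delta>_def homology_def
    by (rule linear_map_quot_lift[OF cycles_module[OF D] boundaries_subspace_cycles[OF D] Q F_lin F_bd])
  have \<delta>: "\<delta> (?E2 +>\<^bsub>?D2\<^esub> ?f2 x) = \<theta> (?d2 x)"
    if "x \<in> carrier ?C2" "?f2 x \<in> cycles D (Suc (Suc n))" for x
    using quot_lift_coset[OF cycles_module[OF D] boundaries_subspace_cycles[OF D] Q F_lin F_bd, of "?f2 x"]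
      that F by (simp add: \<delta>_def)
  define \<epsilon> where "\<epsilon> q = ?B1 +>\<^bsub>?C1\<^esub> (SOME z. z \<in> K \<and> \<theta> z = q)" for q
  have K_cyc: "z \<in> cycles C (Suc n)" "z \<in> carrier ?C1" if "z \<in> K" for z
    using that by (auto simp: K cycles_Suc)
  have ker_bd: "z \<in> ?B1" if "z \<in> K" "\<theta> z = \<zero>\<^bsub>Q\<^esub>" for z
    using that ker by (auto simp: boundaries_def)
  have \<epsilon>: "\<epsilon> (\<theta> z) = ?B1 +>\<^bsub>?C1\<^esub> z" if z: "z \<in> K" for z
  proof -
    define z' where "z' = (SOME z'. z' \<in> K \<and> \<theta> z' = \<theta> z)"
    have z': "z' \<in> K \<and> \<theta> z' = \<theta> z" unfolding z'_def by (rule someI) (use z in auto)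
    have "z' \<ominus>\<^bsub>?C1\<^esub> z \<in> ?B1"
      using z z' subspaceD(6)[OF mC K_sub] by (intro ker_bd) (auto simp: \<theta>_diff diff_eq_zero_iff[OF Q] \<theta>l)
    then show ?thesis
      using homology_class_eq_iff[OF C] K_cyc z z' by (simp add: \<epsilon>_def z'_def)
  qed
  have \<epsilon>_lin: "linear_map Q (homology C (Suc n)) \<epsilon>"
  proof (rule linear_mapI)
    fix q q' c assume "q \<in> carrier Q"
    then obtain z where z: "z \<in> K" "q = \<theta> z" using \<theta>_surj by blast
    note cls = linear_mapD[OF linear_map_homology_class[OF C], simplified]
    show "\<epsilon> q \<in> carrier (homology C (Suc n))" using z K_cyc by (simp add: \<epsilon> cls)
    show "\<epsilon> (c \<odot>\<^bsub>Q\<^esub> q) = c \<odot>\<^bsub>homology C (Suc n)\<^esub> \<epsilon> q"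
      using z K_cyc \<epsilon>[OF subspaceD(4)[OF mC K_sub z(1)], of c] by (simp add: \<epsilon> cls \<theta>l)
    assume "q' \<in> carrier Q"
    then obtain z' where z': "z' \<in> K" "q' = \<theta> z'" using \<theta>_surj by blast
    show "\<epsilon> (q \<oplus>\<^bsub>Q\<^esub> q') = \<epsilon> q \<oplus>\<^bsub>homology C (Suc n)\<^esub> \<epsilon> q'"
      using z z' K_cyc \<epsilon>[OF subspaceD(3)[OF mC K_sub z(1) z'(1)]] by (simp add: \<epsilon> cls \<theta>l)
  qed
  note hcl = homology_map_class[OF C D f]
  note hzD = homology_class_zero_iff[OF D] and hzC = homology_class_zero_iff[OF C]
  have ex2: "exact_at (homology C (Suc (Suc n))) (homology_map D f (Suc (Suc n)))
      (homology D (Suc (Suc n))) \<delta> Q"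
    unfolding exact_at_def a_kernel_eq
  proof (intro equalityI subsetI)
    fix u assume "u \<in> homology_map D f (Suc (Suc n)) ` carrier (homology C (Suc (Suc n)))"
    then obtain x where x: "x \<in> cycles C (Suc (Suc n))" and u: "u = ?E2 +>\<^bsub>?D2\<^esub> ?f2 x"
      by (auto simp: homology_carrier[OF C] hcl)
    have "?f2 x \<in> cycles D (Suc (Suc n))" using chain_map_cycles[OF C D f] x .
    then show "u \<in> {u \<in> carrier (homology D (Suc (Suc n))). \<delta> u = \<zero>\<^bsub>Q\<^esub>}"
      using x \<delta>[of x] by (auto simp: u homology_carrier[OF D] \<theta>_zero cycles_Suc)
  next
    fix u assume "u \<in> {u \<in> carrier (homology D (Suc (Suc n))). \<delta> u = \<zero>\<^bsub>Q\<^esub>}"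
    then obtain y where y: "y \<in> cycles D (Suc (Suc n))" "u = ?E2 +>\<^bsub>?D2\<^esub> y" "\<delta> u = \<zero>\<^bsub>Q\<^esub>"
      by (auto simp: homology_carrier[OF D])
    obtain x where x: "x \<in> carrier ?C2" "?f2 x = y" using lift[OF cycD[OF y(1)]] by blast
    then have "?d2 x \<in> {z \<in> K. \<theta> z = \<zero>\<^bsub>Q\<^esub>}" using \<delta>[of x] y dK[of x] by simp
    then obtain x' where x': "x' \<in> carrier ?C2" "?f2 x' = \<zero>\<^bsub>?D2\<^esub>" "?d2 x' = ?d2 x"
      unfolding ker by force
    have "x \<ominus>\<^bsub>?C2\<^esub> x' \<in> cycles C (Suc (Suc n))"
      using x x' by (simp add: cycles_Suc diff_mem[OF mC] d_diff diff_eq_zero_iff[OF mC] dC)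
    moreover have "?f2 (x \<ominus>\<^bsub>?C2\<^esub> x') = y"
    proof -
      interpret D2: module scalars ?D2 by (rule mD)
      have "y \<ominus>\<^bsub>?D2\<^esub> \<zero>\<^bsub>?D2\<^esub> = y"
        using cycD[OF y(1)] D2.add.inv_one unfolding a_minus_def by simp
      then show ?thesis using x x' by (simp add: f_diff)
    qed
    ultimately show "u \<in> homology_map D f (Suc (Suc n)) ` carrier (homology C (Suc (Suc n)))"
      using y by (auto simp: homology_carrier[OF C] hcl image_iff)
  qed
  have ex3: "exact_at (homology D (Suc (Suc n))) \<delta> Q \<epsilon> (homology C (Suc n))"
    unfolding exact_at_def a_kernel_eq
  proof (intro equalityI subsetI)
    fix q assume "q \<in> \<delta> ` carrier (homology D (Suc (Suc n)))"
    then obtain y where y: "y \<in> cycles D (Suc (Suc n))" "q = \<delta> (?E2 +>\<^bsub>?D2\<^esub> y)"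
      by (auto simp: homology_carrier[OF D])
    obtain x where x: "x \<in> carrier ?C2" "?f2 x = y" using lift[OF cycD[OF y(1)]] by blast
    have q: "q = \<theta> (?d2 x)" and xK: "?d2 x \<in> K" using \<delta>[of x] dK[of x] x y by simp_all
    have "\<epsilon> q = \<zero>\<^bsub>homology C (Suc n)\<^esub>"
      using \<epsilon>[OF xK] hzC[OF K_cyc(1)[OF xK]] q x by (auto simp: boundaries_def)
    then show "q \<in> {q \<in> carrier Q. \<epsilon> q = \<zero>\<^bsub>homology C (Suc n)\<^esub>}" using q xK by (simp add: \<theta>l)
  next
    fix q assume q: "q \<in> {q \<in> carrier Q. \<epsilon> q = \<zero>\<^bsub>homology C (Suc n)\<^esub>}"
    then obtain z where z: "z \<in> K" "q = \<theta> z" using \<theta>_surj by blast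
    with q have "z \<in> ?B1" using \<epsilon>[OF z(1)] hzC[OF K_cyc(1)[OF z(1)]] by simp
    then obtain x where x: "x \<in> carrier ?C2" "z = ?d2 x" by (auto simp: boundaries_def)
    have "?f2 x \<in> cycles D (Suc (Suc n))"
      using x z(1) fd[of x "Suc n"] by (simp add: cycles_Suc fl K)
    then have "q = \<delta> (?E2 +>\<^bsub>?D2\<^esub> ?f2 x)" "?E2 +>\<^bsub>?D2\<^esub> ?f2 x \<in> carrier (homology D (Suc (Suc n)))"
      using \<delta>[of x] x z by (auto simp: homology_carrier[OF D])
    then show "q \<in> \<delta> ` carrier (homology D (Suc (Suc n)))" by blast
  qed
  have ex4: "exact_at Q \<epsilon> (homology C (Suc n)) (homology_map D f (Suc n)) (homology D (Suc n))"
    unfolding exact_at_def a_kernel_eq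
  proof (intro equalityI subsetI)
    fix u assume "u \<in> \<epsilon> ` carrier Q"
    then obtain z where z: "z \<in> K" "u = ?B1 +>\<^bsub>?C1\<^esub> z" using \<theta>_surj \<epsilon> by blast
    have "?f1 z \<in> cycles D (Suc n)" "?f1 z \<in> ?E1"
      using chain_map_cycles[OF C D f K_cyc(1)[OF z(1)]] z(1) subspaceD(2)[OF mD boundaries_subspace[OF D]]
      by (auto simp: K)
    then show "u \<in> {u \<in> carrier (homology C (Suc n)). homology_map D f (Suc n) u = \<zero>\<^bsub>homology D (Suc n)\<^esub>}"
      using z K_cyc hzD hcl[OF K_cyc(1)[OF z(1)]] by (auto simp: homology_carrier[OF C])
  next
    fix u assume "u \<in> {u \<in> carrier (homology C (Suc n)). homology_map D f (Suc n) u = \<zero>\<^bsub>homology D (Suc n)\<^esub>}"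
    then obtain z where z: "z \<in> cycles C (Suc n)" "u = ?B1 +>\<^bsub>?C1\<^esub> z"
      and "homology_map D f (Suc n) u = \<zero>\<^bsub>homology D (Suc n)\<^esub>"
      by (auto simp: homology_carrier[OF C])
    then have "?f1 z \<in> ?E1" using hcl[OF z(1)] hzD[OF chain_map_cycles[OF C D f z(1)]] by simp
    then obtain y where y: "y \<in> carrier ?D2" "?f1 z = diff D (Suc (Suc n)) y"
      by (auto simp: boundaries_def)
    obtain x where x: "x \<in> carrier ?C2" "?f2 x = y" using lift[OF y(1)] by blast
    have zc: "z \<in> carrier ?C1" "?d1 z = \<zero>\<^bsub>?C0\<^esub>" using z by (auto simp: cycles_Suc)
    have w: "z \<ominus>\<^bsub>?C1\<^esub> ?d2 x \<in> K"
      using zc x y fd[of x "Suc n"] dC(1)[of x "Suc n"]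
      by (simp add: K_mem diff_mem[OF mC] d_diff ddC f_diff diff_eq_zero_iff[OF mC]
          diff_eq_zero_iff[OF mD] fl dC dD zero_mem[OF mC])
    have bd: "?d2 x \<in> ?B1" using x by (auto simp: boundaries_def)
    have "(z \<ominus>\<^bsub>?C1\<^esub> ?d2 x) \<ominus>\<^bsub>?C1\<^esub> z = \<ominus>\<^bsub>?C1\<^esub> ?d2 x"
    proof -
      interpret C1: module scalars ?C1 by (rule mC)
      show ?thesis using zc dC(1)[OF x(1)] by (simp add: a_minus_def C1.a_ac C1.r_neg1 C1.r_neg2)
    qed
    then have "?B1 +>\<^bsub>?C1\<^esub> (z \<ominus>\<^bsub>?C1\<^esub> ?d2 x) = u"
      using homology_class_eq_iff[OF C K_cyc(1)[OF w] z(1)] z(2)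
        subspaceD(5)[OF mC boundaries_subspace[OF C] bd] by simp
    then have "u = \<epsilon> (\<theta> (z \<ominus>\<^bsub>?C1\<^esub> ?d2 x))" using \<epsilon>[OF w] by simp
    then show "u \<in> \<epsilon> ` carrier Q" using w \<theta>l(1) by blast
  qed
  have ex5: "homology_map D f (Suc n) ` carrier (homology C (Suc n)) = carrier (homology D (Suc n))"
  proof (intro equalityI subsetI)
    fix u assume "u \<in> carrier (homology D (Suc n))"
    then obtain y where y: "y \<in> cycles D (Suc n)" "u = ?E1 +>\<^bsub>?D1\<^esub> y" by (auto simp: homology_carrier[OF D])
    then obtain x where x: "x \<in> carrier ?C1" "?f1 x = y"
      using surj[of "Suc n"] by (metis (no_types, lifting) cycles_Suc imageE mem_Collect_eq)
    have "f n (?d1 x) = \<zero>\<^bsub>?D0\<^esub>" using x y by (simp add: fd cycles_Suc)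
    moreover have "?d1 x \<in> boundaries C n" using x by (auto simp: boundaries_def)
    ultimately obtain x' where x': "x' \<in> carrier ?C1" "?f1 x' = \<zero>\<^bsub>?D1\<^esub>" "?d1 x' = ?d1 x"
      using acyclic by blast
    have "x \<ominus>\<^bsub>?C1\<^esub> x' \<in> cycles C (Suc n)"
      using x x' by (simp add: cycles_Suc diff_mem[OF mC] d_diff diff_eq_zero_iff[OF mC] dC)
    moreover have "?f1 (x \<ominus>\<^bsub>?C1\<^esub> x') = y"
    proof -
      interpret D1: module scalars ?D1 by (rule mD)
      have "y \<ominus>\<^bsub>?D1\<^esub> \<zero>\<^bsub>?D1\<^esub> = y"
        using y(1) D1.add.inv_one unfolding a_minus_def by (simp add: cycles_Suc)
      then show ?thesis using x x' by (simp add: f_diff)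
    qed
    ultimately show "u \<in> homology_map D f (Suc n) ` carrier (homology C (Suc n))"
      using y by (auto simp: homology_carrier[OF C] hcl image_iff)
  qed (use linear_mapD(1)[OF linear_map_homology_map[OF C D f]] in auto)
  show ?thesis
    unfolding exact_sequence5_def
    using linear_map_homology_map[OF C D f] \<delta>_lin \<epsilon>_lin ex2 ex3 ex4 ex5 by blast
qed

text \<open>The five-term exact sequence of a first-quadrant bicomplex \<open>B\<close> augmented to a complex \<open>D\<close>.
  If each row \<open>B 1 q \<rightarrow> B 0 q \<rightarrow> D q \<rightarrow> 0\<close> is exact, with \<open>- \<eta>\<close> inverting the horizontal
  differential on the kernel of \<open>g\<close>, the kernel of the augmentation of the total complex has no
  homology in degree \<open>0\<close>; a cycle \<open>(u, v)\<close> of degree \<open>1\<close> in it is homologous to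
  \<open>(0, v + vdiff (\<eta> u))\<close>, so that its first homology is the quotient computed by \<open>\<kappa>\<close>.\<close>

lemma five_term_exact:
  fixes B :: "('k::field, 'v) bicomplex" and D :: "('k, 'w) chain_complex" and Q :: "('k, 'q) module"
  assumes B: "is_bicomplex B" and D: "is_complex D"
    and g: "\<And>n. linear_map (bispace B 0 n) (chain_space D n) (g n)"
    and g_vdiff: "\<And>n x. x \<in> carrier (bispace B 0 (Suc n)) \<Longrightarrow>
      g n (vdiff B 0 (Suc n) x) = diff D (Suc n) (g (Suc n) x)"
    and g_hdiff: "\<And>n x. x \<in> carrier (bispace B (Suc 0) n) \<Longrightarrow>
      g n (hdiff B (Suc 0) n x) = \<zero>\<^bsub>chain_space D n\<^esub>"
    and g_surj: "\<And>n. g n ` carrier (bispace B 0 n) = carrier (chain_space D n)"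
    and \<eta>: "\<And>n. linear_map (bispace B 0 n) (bispace B (Suc 0) n) (\<eta> n)"
    and \<eta>_hdiff: "\<And>n x. x \<in> carrier (bispace B 0 n) \<Longrightarrow> g n x = \<zero>\<^bsub>chain_space D n\<^esub> \<Longrightarrow>
      hdiff B (Suc 0) n (\<eta> n x) = \<ominus>\<^bsub>bispace B 0 n\<^esub> x"
    and Q: "module scalars Q"
    and Z: "Z = {v \<in> carrier (bispace B (Suc 0) 0). hdiff B (Suc 0) 0 v = \<zero>\<^bsub>bispace B 0 0\<^esub>}"
    and \<kappa>: "linear_map (bispace B (Suc 0) 0\<lparr>carrier := Z\<rparr>) Q \<kappa>" "\<kappa> ` Z = carrier Q"
    and ker: "{v \<in> Z. \<kappa> v = \<zero>\<^bsub>Q\<^esub>} =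
      {hdiff B (Suc (Suc 0)) 0 y \<oplus>\<^bsub>bispace B (Suc 0) 0\<^esub> vdiff B (Suc 0) (Suc 0) x | x y.
         y \<in> carrier (bispace B (Suc (Suc 0)) 0) \<and> x \<in> carrier (bispace B (Suc 0) (Suc 0)) \<and>
         hdiff B (Suc 0) (Suc 0) x = \<zero>\<^bsub>bispace B 0 (Suc 0)\<^esub>}"
  defines "T \<equiv> total_complex B" and "G \<equiv> (\<lambda>n x. g n (x 0))"
  shows "\<exists>\<delta> \<epsilon>. exact_sequence5
    (homology T (Suc (Suc 0))) (homology_map D G (Suc (Suc 0))) (homology D (Suc (Suc 0))) \<delta> Q \<epsilon>
    (homology T (Suc 0)) (homology_map D G (Suc 0)) (homology D (Suc 0))"
proof -
  have T: "is_complex T" unfolding T_def by (rule is_complex_total[OF B])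
  note mB = is_bicomplexD(1)[OF B] and mT = is_complexD(1)[OF T] and mD = is_complexD(1)[OF D]
  note hl = linear_mapD[OF is_bicomplexD(2)[OF B]] and vl = linear_mapD[OF is_bicomplexD(3)[OF B]]
  note gl = linear_mapD[OF g] and \<eta>l = linear_mapD[OF \<eta>]
  note h0 = linear_map_zero[OF mB mB is_bicomplexD(2)[OF B]]
    and v0 = linear_map_zero[OF mB mB is_bicomplexD(3)[OF B]]
    and g0 = linear_map_zero[OF mB mD g]
  have comp: "linear_map (chain_space T n) (bispace B p q) (\<lambda>x. x p)" if "p + q = n" for n p q
    using linear_map_component[of p "{..n}" "\<lambda>p. bispace B p (n - p)"] that
    by (auto simp: T_def total_space)
  note compl = linear_mapD[OF comp]
  have G: "is_chain_map T D G"
    unfolding is_chain_map_def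
  proof (intro conjI allI ballI)
    show "linear_map (chain_space T n) (chain_space D n) (G n)" for n
      unfolding G_def by (rule linear_map_comp[OF comp g]) simp
    show "G n (diff T (Suc n) x) = diff D (Suc n) (G (Suc n) x)"
      if x: "x \<in> carrier (chain_space T (Suc n))" for n x
    proof -
      have x': "x 0 \<in> carrier (bispace B 0 (Suc n))" "x (Suc 0) \<in> carrier (bispace B (Suc 0) n)"
        using compl(1)[of _ _ "Suc n", OF _ x] by auto
      interpret Dn: module scalars "chain_space D n" by (rule mD)
      show ?thesis
        using x' linear_mapD(1)[OF is_complexD(2)[OF D]]
        by (simp add: G_def T_def total_diff gl hl vl g_vdiff g_hdiff)
    qed
  qed
  \<comment> \<open>An element of bidegree \<open>(p, n - p)\<close>, as a chain of the total complex.\<close>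
  define \<iota> where "\<iota> n p u = (\<lambda>i\<in>{..n}. if i = p then u else \<zero>\<^bsub>bispace B i (n - i)\<^esub>)" for n p u
  have \<iota>: "\<iota> n p u \<in> carrier (chain_space T n)" if "u \<in> carrier (bispace B p q)" "p + q = n" for n p q u
    using that zero_mem[OF mB] by (auto simp: \<iota>_def T_def total_space direct_sum_simps)
  have \<iota>_at: "\<iota> n p u i = (if i = p then u else \<zero>\<^bsub>bispace B i (n - i)\<^esub>)" if "i \<le> n" for n p u i
    using that by (simp add: \<iota>_def)
  have surj: "G n ` carrier (chain_space T n) = carrier (chain_space D n)" for n
  proof (intro equalityI subsetI)
    fix y assume "y \<in> carrier (chain_space D n)"
    then obtain x where x: "x \<in> carrier (bispace B 0 n)" "y = g n x" using g_surj by (metis imageE)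
    then have "y = G n (\<iota> n 0 x)" by (simp add: G_def \<iota>_at)
    then show "y \<in> G n ` carrier (chain_space T n)" using \<iota>[of x 0 n n] x(1) by auto
  qed (use linear_mapD(1)[OF is_chain_mapD(1)[OF G]] in auto)
  let ?B10 = "bispace B (Suc 0) 0" and ?B01 = "bispace B 0 (Suc 0)" and ?B11 = "bispace B (Suc 0) (Suc 0)"
  \<comment> \<open>Subtracting the boundary of \<open>- \<eta> u\<close> moves a cycle \<open>(u, v)\<close> to bidegree \<open>(1, 0)\<close>.\<close>
  define \<theta> where "\<theta> z = \<kappa> (z (Suc 0) \<oplus>\<^bsub>?B10\<^esub> vdiff B (Suc 0) (Suc 0) (\<eta> (Suc 0) (z 0)))" for z
  define K where "K = {z \<in> cycles T (Suc 0). G (Suc 0) z = \<zero>\<^bsub>chain_space D (Suc 0)\<^esub>}"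
  have T1: "x \<in> carrier (chain_space T (Suc 0)) \<longleftrightarrow> x \<in> extensional {..Suc 0} \<and>
      x 0 \<in> carrier ?B01 \<and> x (Suc 0) \<in> carrier ?B10" for x
    by (simp add: T_def total_space direct_sum_simps PiE_iff atMost_Suc) auto
  have T0: "x \<in> carrier (chain_space T 0) \<longleftrightarrow> x \<in> extensional {..0} \<and> x 0 \<in> carrier (bispace B 0 0)" for x
    by (auto simp: T_def total_space direct_sum_simps PiE_iff)
  have T0_zero: "\<zero>\<^bsub>chain_space T 0\<^esub> = (\<lambda>i\<in>{..0}. \<zero>\<^bsub>bispace B i (0 - i)\<^esub>)"
    by (simp add: T_def total_space direct_sum_simps)
  have T0_eq: "x = y \<longleftrightarrow> x 0 = y 0" if "x \<in> extensional {..0}" "y \<in> extensional {..0}" for x y :: "nat \<Rightarrow> 'v"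
    using that by (auto intro!: extensionalityI[of _ "{..0::nat}"])
  have d1: "diff T (Suc 0) x 0 = hdiff B (Suc 0) 0 (x (Suc 0)) \<oplus>\<^bsub>bispace B 0 0\<^esub> vdiff B 0 (Suc 0) (x 0)"
    "diff T (Suc 0) x \<in> extensional {..0}" for x
    by (simp_all add: T_def total_diff)
  have K: "z \<in> K \<longleftrightarrow> z \<in> extensional {..Suc 0} \<and> z 0 \<in> carrier ?B01 \<and> z (Suc 0) \<in> carrier ?B10 \<and>
      hdiff B (Suc 0) 0 (z (Suc 0)) \<oplus>\<^bsub>bispace B 0 0\<^esub> vdiff B 0 (Suc 0) (z 0) = \<zero>\<^bsub>bispace B 0 0\<^esub> \<and>
      g (Suc 0) (z 0) = \<zero>\<^bsub>chain_space D (Suc 0)\<^esub>" for z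
    using T0_eq[OF d1(2)[of z], of "\<zero>\<^bsub>chain_space T 0\<^esub>"]
    by (auto simp: K_def cycles_Suc T1 T0_zero d1 G_def)
  have hv: "hdiff B (Suc p) q (vdiff B (Suc p) (Suc q) x) =
      \<ominus>\<^bsub>bispace B p q\<^esub> vdiff B p (Suc q) (hdiff B (Suc p) (Suc q) x)"
    if "x \<in> carrier (bispace B (Suc p) (Suc q))" for p q x
  proof -
    interpret W: module scalars "bispace B p q" by (rule mB)
    show ?thesis
      using is_bicomplexD(6)[OF B that] that hl vl W.minus_equality by (metis (no_types, lifting))
  qed
  have ZI: "z (Suc 0) \<oplus>\<^bsub>?B10\<^esub> vdiff B (Suc 0) (Suc 0) (\<eta> (Suc 0) (z 0)) \<in> Z" if z: "z \<in> K" for z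
  proof -
    interpret W: module scalars "bispace B 0 0" by (rule mB)
    interpret W1: module scalars ?B10 by (rule mB)
    have "hdiff B (Suc 0) 0 (vdiff B (Suc 0) (Suc 0) (\<eta> (Suc 0) (z 0))) = vdiff B 0 (Suc 0) (z 0)"
      using z linear_map_minus[OF mB mB is_bicomplexD(3)[OF B], of "z 0" 0 0]
      by (simp add: K hv \<eta>l \<eta>_hdiff vl)
    then show ?thesis
      using z by (simp add: K Z hl vl \<eta>l)
  qed
  have Z_sub: "submodule Z scalars ?B10"
    unfolding Z by (rule subspace_kernel[OF mB mB is_bicomplexD(2)[OF B]])
  note \<kappa>l = linear_mapD[OF \<kappa>(1), simplified]
  have K_carrier: "z \<in> carrier (chain_space T (Suc 0))" if "z \<in> K" for z
    using that by (simp add: K T1)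
  have \<theta>_lin: "linear_map (chain_space T (Suc 0)\<lparr>carrier := K\<rparr>) Q \<theta>"
  proof -
    have "linear_map (chain_space T (Suc 0)) ?B10
        (\<lambda>z. z (Suc 0) \<oplus>\<^bsub>?B10\<^esub> vdiff B (Suc 0) (Suc 0) (\<eta> (Suc 0) (z 0)))"
      by (intro linear_map_add[OF mT mB] linear_map_comp[OF linear_map_comp[OF comp \<eta>] is_bicomplexD(3)[OF B]]
          comp) auto
    note l = linear_mapD[OF this]
    have "linear_map (chain_space T (Suc 0)\<lparr>carrier := K\<rparr>) (?B10\<lparr>carrier := Z\<rparr>)
        (\<lambda>z. z (Suc 0) \<oplus>\<^bsub>?B10\<^esub> vdiff B (Suc 0) (Suc 0) (\<eta> (Suc 0) (z 0)))"
      using ZI l(2,3) K_carrier by (intro linear_mapI) auto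
    then show ?thesis unfolding \<theta>_def by (rule linear_map_comp[OF _ \<kappa>(1)])
  qed
  have \<theta>_surj: "\<theta> ` K = carrier Q"
  proof (intro equalityI subsetI)
    fix q assume "q \<in> carrier Q"
    then obtain v where v: "v \<in> Z" "q = \<kappa> v" using \<kappa>(2) by (metis imageE)
    then have v': "v \<in> carrier ?B10" by (simp add: Z)
    interpret W: module scalars "bispace B 0 0" by (rule mB)
    interpret W1: module scalars ?B10 by (rule mB)
    let ?z = "\<iota> (Suc 0) (Suc 0) v"
    have z: "?z 0 = \<zero>\<^bsub>?B01\<^esub>" "?z (Suc 0) = v" "?z \<in> extensional {..Suc 0}"
      by (simp_all add: \<iota>_at) (simp add: \<iota>_def)
    have "?z \<in> K" using v v' by (simp add: K z zero_mem[OF mB] v0 g0 Z)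
    moreover have "\<theta> ?z = q"
      using v v' by (simp add: \<theta>_def z linear_map_zero[OF mB mB \<eta>] v0)
    ultimately show "q \<in> \<theta> ` K" by blast
  qed (use linear_mapD(1)[OF \<theta>_lin] in auto)
  have d2: "diff T (Suc (Suc 0)) x 0 = hdiff B (Suc 0) (Suc 0) (x (Suc 0)) \<oplus>\<^bsub>?B01\<^esub> vdiff B 0 (Suc (Suc 0)) (x 0)"
    "diff T (Suc (Suc 0)) x (Suc 0) = hdiff B (Suc (Suc 0)) 0 (x (Suc (Suc 0))) \<oplus>\<^bsub>?B10\<^esub> vdiff B (Suc 0) (Suc 0) (x (Suc 0))"
    "diff T (Suc (Suc 0)) x \<in> extensional {..Suc 0}" for x
    by (simp_all add: T_def total_diff)
  obtain j01 :: "'v \<Rightarrow> ('v \<Rightarrow>\<^sub>0 'k)" where "embedding ?B01 j01" using ex_embedding[OF mB] by blast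
  note j01 = embeddingD[OF this mB]
  obtain j10 :: "'v \<Rightarrow> ('v \<Rightarrow>\<^sub>0 'k)" where "embedding ?B10 j10" using ex_embedding[OF mB] by blast
  note j10 = embeddingD[OF this mB]
  note v_diff = linear_map_diff[OF mB mB is_bicomplexD(3)[OF B]]
    and h_diff = linear_map_diff[OF mB mB is_bicomplexD(2)[OF B]]
  have \<theta>_ker: "{z \<in> K. \<theta> z = \<zero>\<^bsub>Q\<^esub>} = diff T (Suc (Suc 0)) `
    {x \<in> carrier (chain_space T (Suc (Suc 0))). G (Suc (Suc 0)) x = \<zero>\<^bsub>chain_space D (Suc (Suc 0))\<^esub>}"
  proof (intro equalityI subsetI)
    fix z assume "z \<in> {z \<in> K. \<theta> z = \<zero>\<^bsub>Q\<^esub>}"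
    then have z: "z \<in> K" "\<theta> z = \<zero>\<^bsub>Q\<^esub>" by auto
    then have "z (Suc 0) \<oplus>\<^bsub>?B10\<^esub> vdiff B (Suc 0) (Suc 0) (\<eta> (Suc 0) (z 0)) \<in> {v \<in> Z. \<kappa> v = \<zero>\<^bsub>Q\<^esub>}"
      using ZI[OF z(1)] by (simp add: \<theta>_def)
    then obtain x y where y: "y \<in> carrier (bispace B (Suc (Suc 0)) 0)" and x: "x \<in> carrier ?B11"
      and hx: "hdiff B (Suc 0) (Suc 0) x = \<zero>\<^bsub>?B01\<^esub>"
      and eq: "z (Suc 0) \<oplus>\<^bsub>?B10\<^esub> vdiff B (Suc 0) (Suc 0) (\<eta> (Suc 0) (z 0)) =
        hdiff B (Suc (Suc 0)) 0 y \<oplus>\<^bsub>?B10\<^esub> vdiff B (Suc 0) (Suc 0) x"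
      unfolding ker by blast
    have zK: "z 0 \<in> carrier ?B01" "z (Suc 0) \<in> carrier ?B10" "z \<in> extensional {..Suc 0}"
      "g (Suc 0) (z 0) = \<zero>\<^bsub>chain_space D (Suc 0)\<^esub>" using z(1) by (auto simp: K)
    \<comment> \<open>The chain \<open>(0, x', y)\<close> has boundary \<open>z\<close>: by the choice of \<open>x'\<close> its component in bidegree
      \<open>(0, 1)\<close> is \<open>z 0\<close>.\<close>
    define x' where "x' = x \<ominus>\<^bsub>?B11\<^esub> \<eta> (Suc 0) (z 0)"
    have x': "x' \<in> carrier ?B11" using x zK by (simp add: x'_def diff_mem[OF mB] \<eta>l)
    have hx': "hdiff B (Suc 0) (Suc 0) x' = z 0"
    proof -
      interpret W: module scalars ?B01 by (rule mB)
      have "j01 (hdiff B (Suc 0) (Suc 0) x') = j01 (z 0)"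
        using x hx zK by (simp add: x'_def h_diff \<eta>l \<eta>_hdiff j01 zero_mem[OF mB])
      then show ?thesis using zK x' by (simp add: j01 hl)
    qed
    have vx': "hdiff B (Suc (Suc 0)) 0 y \<oplus>\<^bsub>?B10\<^esub> vdiff B (Suc 0) (Suc 0) x' = z (Suc 0)"
    proof -
      have "j10 (z (Suc 0)) + j10 (vdiff B (Suc 0) (Suc 0) (\<eta> (Suc 0) (z 0))) =
          j10 (hdiff B (Suc (Suc 0)) 0 y) + j10 (vdiff B (Suc 0) (Suc 0) x)"
        using arg_cong[OF eq, of j10] x y zK by (simp add: j10 hl vl \<eta>l)
      then have "j10 (hdiff B (Suc (Suc 0)) 0 y \<oplus>\<^bsub>?B10\<^esub> vdiff B (Suc 0) (Suc 0) x') = j10 (z (Suc 0))"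
        using x y zK x' by (simp add: x'_def v_diff \<eta>l hl vl j10 diff_mem[OF mB] algebra_simps)
      then show ?thesis
        by (rule iffD1[OF j10(1), rotated 2]) (use zK x' y in \<open>simp_all add: hl vl add_mem[OF mB]\<close>)
    qed
    interpret W: module scalars ?B01 by (rule mB)
    define X where "X = (\<lambda>i\<in>{..Suc (Suc 0)}.
      if i = 0 then \<zero>\<^bsub>bispace B 0 (Suc (Suc 0))\<^esub> else if i = Suc 0 then x' else y)"
    have X: "X 0 = \<zero>\<^bsub>bispace B 0 (Suc (Suc 0))\<^esub>" "X (Suc 0) = x'" "X (Suc (Suc 0)) = y"
      by (simp_all add: X_def)
    have "X \<in> carrier (chain_space T (Suc (Suc 0)))"
      using x' y zero_mem[OF mB, of 0 "Suc (Suc 0)"]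
      by (auto simp: T_def total_space direct_sum_simps X_def atMost_Suc)
    moreover have "G (Suc (Suc 0)) X = \<zero>\<^bsub>chain_space D (Suc (Suc 0))\<^esub>"
      by (simp add: G_def X g0)
    moreover have "diff T (Suc (Suc 0)) X = z"
    proof (rule extensionalityI[OF d2(3) zK(3)])
      fix i assume "i \<in> {..Suc 0}"
      then have "i = 0 \<or> i = Suc 0" by auto
      then show "diff T (Suc (Suc 0)) X i = z i"
        using zK(1) by (auto simp: d2 X hx' vx' v0)
    qed
    ultimately show "z \<in> diff T (Suc (Suc 0)) ` {x \<in> carrier (chain_space T (Suc (Suc 0))).
        G (Suc (Suc 0)) x = \<zero>\<^bsub>chain_space D (Suc (Suc 0))\<^esub>}"
      by blast
  next
    fix z assume "z \<in> diff T (Suc (Suc 0)) ` {x \<in> carrier (chain_space T (Suc (Suc 0))).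
        G (Suc (Suc 0)) x = \<zero>\<^bsub>chain_space D (Suc (Suc 0))\<^esub>}"
    then obtain X where X: "X \<in> carrier (chain_space T (Suc (Suc 0)))" "z = diff T (Suc (Suc 0)) X"
      and GX: "G (Suc (Suc 0)) X = \<zero>\<^bsub>chain_space D (Suc (Suc 0))\<^esub>" by blast
    have X0: "X 0 \<in> carrier (bispace B 0 (Suc (Suc 0)))" and X1: "X (Suc 0) \<in> carrier ?B11"
      and X2: "X (Suc (Suc 0)) \<in> carrier (bispace B (Suc (Suc 0)) 0)"
      using compl(1)[of _ _ "Suc (Suc 0)", OF _ X(1)] by auto
    have gX: "g (Suc (Suc 0)) (X 0) = \<zero>\<^bsub>chain_space D (Suc (Suc 0))\<^esub>" using GX by (simp add: G_def)
    have "z \<in> cycles T (Suc 0)" using X boundaries_cycles[OF T] by (auto simp: boundaries_def)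
    moreover have "G (Suc 0) z = \<zero>\<^bsub>chain_space D (Suc 0)\<^esub>"
      using X GX is_chain_mapD(2)[OF G, of X "Suc 0"] linear_map_zero[OF mD mD is_complexD(2)[OF D]] by simp
    ultimately have zK: "z \<in> K" by (simp add: K_def)
    then have z: "z 0 \<in> carrier ?B01" "z (Suc 0) \<in> carrier ?B10"
      "g (Suc 0) (z 0) = \<zero>\<^bsub>chain_space D (Suc 0)\<^esub>" by (auto simp: K)
    \<comment> \<open>\<open>w\<close> is \<open>X 1\<close> made horizontally closed; the added boundary of \<open>\<eta> (X 0)\<close> is vertically closed.\<close>
    define w where "w = X (Suc 0) \<oplus>\<^bsub>?B11\<^esub> \<eta> (Suc 0) (z 0) \<oplus>\<^bsub>?B11\<^esub>
      vdiff B (Suc 0) (Suc (Suc 0)) (\<eta> (Suc (Suc 0)) (X 0))"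
    have w: "w \<in> carrier ?B11" using X0 X1 z by (simp add: w_def \<eta>l vl add_mem[OF mB])
    have "hdiff B (Suc 0) (Suc 0) w = \<zero>\<^bsub>?B01\<^esub>"
    proof -
      have "hdiff B (Suc 0) (Suc 0) (vdiff B (Suc 0) (Suc (Suc 0)) (\<eta> (Suc (Suc 0)) (X 0))) =
          \<ominus>\<^bsub>?B01\<^esub> vdiff B 0 (Suc (Suc 0)) (\<ominus>\<^bsub>bispace B 0 (Suc (Suc 0))\<^esub> X 0)"
        using X0 gX by (simp add: hv \<eta>l \<eta>_hdiff)
      then have "j01 (hdiff B (Suc 0) (Suc 0) w) = j01 (hdiff B (Suc 0) (Suc 0) (X (Suc 0))) - j01 (z 0) +
          j01 (vdiff B 0 (Suc (Suc 0)) (X 0))"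
        using X0 X1 z
        by (simp add: w_def \<eta>l vl hl add_mem[OF mB] j01 \<eta>_hdiff linear_map_minus[OF mB mB is_bicomplexD(3)[OF B]]
            abelian_group.a_inv_closed[OF module_abelian_group[OF mB]])
      also have "\<dots> = j01 \<zero>\<^bsub>?B01\<^esub>"
        using X0 X1 by (simp add: X(2) d2 j01 hl vl)
      finally show ?thesis
        by (rule iffD1[OF j01(1), rotated 2]) (use w in \<open>simp_all add: hl zero_mem[OF mB]\<close>)
    qed
    moreover have "z (Suc 0) \<oplus>\<^bsub>?B10\<^esub> vdiff B (Suc 0) (Suc 0) (\<eta> (Suc 0) (z 0)) =
        hdiff B (Suc (Suc 0)) 0 (X (Suc (Suc 0))) \<oplus>\<^bsub>?B10\<^esub> vdiff B (Suc 0) (Suc 0) w"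
    proof -
      interpret W: module scalars ?B10 by (rule mB)
      show ?thesis
        using X0 X1 X2 z
        by (simp add: w_def \<eta>l vl hl add_mem[OF mB] is_bicomplexD(5)[OF B] W.a_assoc)
          (simp add: X(2) d2 W.a_assoc hl vl \<eta>l)
    qed
    ultimately have "z (Suc 0) \<oplus>\<^bsub>?B10\<^esub> vdiff B (Suc 0) (Suc 0) (\<eta> (Suc 0) (z 0)) \<in> {v \<in> Z. \<kappa> v = \<zero>\<^bsub>Q\<^esub>}"
      unfolding ker using w X2 by blast
    then show "z \<in> {z \<in> K. \<theta> z = \<zero>\<^bsub>Q\<^esub>}" using zK by (simp add: \<theta>_def)
  qed
  have acyclic: "\<exists>x\<in>carrier (chain_space T (Suc 0)). G (Suc 0) x = \<zero>\<^bsub>chain_space D (Suc 0)\<^esub> \<and> diff T (Suc 0) x = z"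
    if z: "z \<in> boundaries T 0" "G 0 z = \<zero>\<^bsub>chain_space D 0\<^esub>" for z
  proof -
    have "z \<in> carrier (chain_space T 0)"
      using z(1) subspaceD(1)[OF mT boundaries_subspace[OF T]] by blast
    then have z': "z 0 \<in> carrier (bispace B 0 0)" "z \<in> extensional {..0}" "g 0 (z 0) = \<zero>\<^bsub>chain_space D 0\<^esub>"
      using z(2) by (auto simp: T0 G_def)
    define v where "v = \<ominus>\<^bsub>?B10\<^esub> \<eta> 0 (z 0)"
    have v: "v \<in> carrier ?B10"
      using z' by (simp add: v_def \<eta>l abelian_group.a_inv_closed[OF module_abelian_group[OF mB]])
    interpret W: module scalars "bispace B 0 0" by (rule mB)
    have hv: "hdiff B (Suc 0) 0 v = z 0"
      using z' by (simp add: v_def \<eta>l linear_map_minus[OF mB mB is_bicomplexD(2)[OF B]] \<eta>_hdiff)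
    have "diff T (Suc 0) (\<iota> (Suc 0) (Suc 0) v) = z"
      using z' by (simp add: T0_eq[OF d1(2)] d1 \<iota>_at hv v0)
    moreover have "G (Suc 0) (\<iota> (Suc 0) (Suc 0) v) = \<zero>\<^bsub>chain_space D (Suc 0)\<^esub>"
      by (simp add: G_def \<iota>_at g0)
    ultimately show ?thesis using \<iota>[of v "Suc 0" 0 "Suc 0"] v by auto
  qed
  show ?thesis
    by (rule long_exact_piece[OF T D G surj acyclic Q K_def \<theta>_lin \<theta>_surj \<theta>_ker])
qed


section \<open>Tensor powers\<close>

lemma linear_map_lin_op:
  assumes "lin_op G" "\<And>f. Poly_Mapping.keys f \<subseteq> S \<Longrightarrow> Poly_Mapping.keys (G f) \<subseteq> T"
  shows "linear_map (free_space S) (free_space T) G"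
  using assms by (intro linear_mapI) (auto simp: free_space_simps lin_opD[OF assms(1)])

lemma free_space_induct:
  fixes F :: "('w \<Rightarrow>\<^sub>0 'k::field) \<Rightarrow> 'v"
  assumes X: "module scalars X" and F: "linear_map (free_space S) X F" and U: "submodule U scalars X"
    and "\<And>w. w \<in> S \<Longrightarrow> F (Poly_Mapping.single w 1) \<in> U" and f: "Poly_Mapping.keys f \<subseteq> S"
  shows "F f \<in> U"
proof -
  note F' = linear_mapD[OF F, simplified free_space_simps, simplified]
  have sum: "Poly_Mapping.keys (\<Sum>w\<in>T. fscale (c w) (Poly_Mapping.single w 1)) \<subseteq> S \<and>
      F (\<Sum>w\<in>T. fscale (c w) (Poly_Mapping.single w 1)) \<in> U" if "finite T" "T \<subseteq> S" for T and c :: "'w \<Rightarrow> 'k"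
    using that
  proof (induction T rule: finite_induct)
    case empty
    then show ?case
      using linear_map_zero[OF free_space_module X F] subspaceD(2)[OF X U] by (simp add: free_space_simps)
  next
    case (insert w T)
    have w: "Poly_Mapping.keys (Poly_Mapping.single w 1 :: 'w \<Rightarrow>\<^sub>0 'k) \<subseteq> S" using insert by simp
    have cw: "Poly_Mapping.keys (fscale (c w) (Poly_Mapping.single w 1)) \<subseteq> S"
      by (rule subset_trans[OF keys_fscale w])
    let ?u = "fscale (c w) (Poly_Mapping.single w 1)" and ?r = "\<Sum>w\<in>T. fscale (c w) (Poly_Mapping.single w 1)"
    have "w \<in> S" and r: "Poly_Mapping.keys ?r \<subseteq> S" "F ?r \<in> U" using insert by auto
    have u: "F ?u \<in> U"
      unfolding F'(3)[OF w] by (rule subspaceD(4)[OF X U assms(4)[OF \<open>w \<in> S\<close>]])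
    have "Poly_Mapping.keys (?u + ?r) \<subseteq> S"
      by (rule subset_trans[OF Poly_Mapping.keys_add Un_least[OF cw r(1)]])
    moreover have "F (?u + ?r) \<in> U"
      unfolding F'(2)[OF cw r(1)] by (rule subspaceD(3)[OF X U u r(2)])
    ultimately show ?case
      unfolding sum.insert[OF insert(1,2)] by (rule conjI)
  qed
  show ?thesis
    using sum[of "Poly_Mapping.keys f" "Poly_Mapping.lookup f"] f formal_expansion[of f] by simp
qed

definition tensor_class :: "('k::field, 'a) module \<Rightarrow> nat \<Rightarrow> ('a list \<Rightarrow>\<^sub>0 'k) \<Rightarrow> ('a list \<Rightarrow>\<^sub>0 'k) set" where
  "tensor_class A n f = tensor_relations A n +>\<^bsub>free_space (tensor_words A n)\<^esub> f"

text \<open>Names the generating set in the definition of \<^const>\<open>tensor_relations\<close>, so that it can be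
  analysed by cases.\<close>

definition tensor_generators :: "('k::field, 'a) module \<Rightarrow> nat \<Rightarrow> ('a list \<Rightarrow>\<^sub>0 'k) set" where
  "tensor_generators A n = {Poly_Mapping.single (xs[i := x \<oplus>\<^bsub>A\<^esub> y]) 1
         - Poly_Mapping.single (xs[i := x]) 1 - Poly_Mapping.single (xs[i := y]) 1 | xs i x y.
         xs \<in> tensor_words A n \<and> i < n \<and> x \<in> carrier A \<and> y \<in> carrier A} \<union>
      {Poly_Mapping.single (xs[i := c \<odot>\<^bsub>A\<^esub> x]) 1 - Poly_Mapping.single (xs[i := x]) c | xs i c x.
         xs \<in> tensor_words A n \<and> i < n \<and> x \<in> carrier A}"

lemma tensor_relations_span:
  "tensor_relations A n = lin_span (free_space (tensor_words A n)) (tensor_generators A n)"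
  by (simp only: tensor_relations_def tensor_generators_def)

lemma tensor_generators_cases:
  assumes "f \<in> tensor_generators A n"
  obtains (add) xs i x y where "xs \<in> tensor_words A n" "i < n" "x \<in> carrier A" "y \<in> carrier A"
      "f = Poly_Mapping.single (xs[i := x \<oplus>\<^bsub>A\<^esub> y]) 1
         - Poly_Mapping.single (xs[i := x]) 1 - Poly_Mapping.single (xs[i := y]) 1"
    | (smult) xs i b x where "xs \<in> tensor_words A n" "i < n" "x \<in> carrier A"
      "f = Poly_Mapping.single (xs[i := b \<odot>\<^bsub>A\<^esub> x]) 1 - Poly_Mapping.single (xs[i := x]) b"
  using assms unfolding tensor_generators_def by blast

context
  fixes A :: "('k::field, 'a) module"
  assumes A: "module scalars A"
begin

lemma tensor_words_update:
  "xs \<in> tensor_words A n \<Longrightarrow> x \<in> carrier A \<Longrightarrow> xs[i := x] \<in> tensor_words A n"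
  by (auto simp: tensor_words_def dest: set_update_subset_insert[THEN subsetD])

lemma tensor_generators_subset: "tensor_generators A n \<subseteq> carrier (free_space (tensor_words A n))"
proof
  fix f assume "f \<in> tensor_generators A n"
  then have "Poly_Mapping.keys f \<subseteq> tensor_words A n"
  proof (cases rule: tensor_generators_cases)
    case (add xs i x y)
    then show ?thesis
      unfolding add(5) using tensor_words_update[OF add(1)] add_mem[OF A]
      by (intro Poly_Mapping.keys_diff[THEN subset_trans] Un_least) auto
  next
    case (smult xs i b x)
    then show ?thesis
      unfolding smult(4) using tensor_words_update[OF smult(1)] module_simps(1)[OF A]
      by (intro Poly_Mapping.keys_diff[THEN subset_trans] Un_least) auto
  qed
  then show "f \<in> carrier (free_space (tensor_words A n))" by (simp add: free_space_simps)
qed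

lemma tensor_relations_subspace:
  "submodule (tensor_relations A n) (scalars :: 'k ring) (free_space (tensor_words A n))"
  unfolding tensor_relations_span
  by (rule subspace_lin_span[OF free_space_module tensor_generators_subset])

lemma tensor_relations_keys: "f \<in> tensor_relations A n \<Longrightarrow> Poly_Mapping.keys f \<subseteq> tensor_words A n"
  using subspaceD(1)[OF free_space_module tensor_relations_subspace] by (auto simp: free_space_simps)

lemma tensor_power_module: "module (scalars :: 'k ring) (tensor_power A n)"
  unfolding tensor_power_def by (rule quot_module[OF free_space_module tensor_relations_subspace])

lemma tensor_class_eq_iff:
  assumes "Poly_Mapping.keys f \<subseteq> tensor_words A n" "Poly_Mapping.keys g \<subseteq> tensor_words A n"
  shows "tensor_class A n f = tensor_class A n g \<longleftrightarrow> f - g \<in> tensor_relations A n"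
  using assms coset_eq_iff[OF free_space_module tensor_relations_subspace, of f n g]
  by (simp add: tensor_class_def free_space_simps free_space_diff)

lemma linear_map_tensor_class:
  "linear_map (free_space (tensor_words A n)) (tensor_power A n) (tensor_class A n)"
  using linear_map_coset[OF free_space_module tensor_relations_subspace]
  by (simp add: tensor_class_def[abs_def] tensor_power_def)

lemma tensor_class_zero: "tensor_class A n 0 = \<zero>\<^bsub>tensor_power A n\<^esub>"
  using linear_map_zero[OF free_space_module tensor_power_module linear_map_tensor_class]
  by (simp add: free_space_simps)

lemma tensor_class_add:
  assumes "Poly_Mapping.keys f \<subseteq> tensor_words A n" "Poly_Mapping.keys g \<subseteq> tensor_words A n"
  shows "tensor_class A n f \<oplus>\<^bsub>tensor_power A n\<^esub> tensor_class A n g = tensor_class A n (f + g)"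
  using linear_mapD(2)[OF linear_map_tensor_class, of f n g] assms by (simp add: free_space_simps)

lemma tensor_class_smult:
  assumes "Poly_Mapping.keys f \<subseteq> tensor_words A n"
  shows "c \<odot>\<^bsub>tensor_power A n\<^esub> tensor_class A n f = tensor_class A n (fscale c f)"
  using linear_mapD(3)[OF linear_map_tensor_class, of f n c] assms by (simp add: free_space_simps)

lemma tensor_class_mem:
  "Poly_Mapping.keys f \<subseteq> tensor_words A n \<Longrightarrow> tensor_class A n f \<in> carrier (tensor_power A n)"
  by (auto simp: tensor_power_def tensor_class_def quot_carrier free_space_simps)

lemma tensor_power_cases:
  assumes "x \<in> carrier (tensor_power A n)"
  obtains f where "Poly_Mapping.keys f \<subseteq> tensor_words A n" "x = tensor_class A n f"
  using assms by (auto simp: tensor_power_def tensor_class_def quot_carrier free_space_simps)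

text \<open>With \<open>U\<close> the zero space this compares linear maps; with \<open>U\<close> a span of commutators it bounds
  brackets.\<close>

lemma tensor_power_induct:
  assumes X: "module scalars X" and F: "linear_map (tensor_power A n) X F"
    and U: "submodule U scalars X"
    and "\<And>w. w \<in> tensor_words A n \<Longrightarrow> F (tensor_class A n (Poly_Mapping.single w 1)) \<in> U"
    and x: "x \<in> carrier (tensor_power A n)"
  shows "F x \<in> U"
proof -
  obtain f where f: "Poly_Mapping.keys f \<subseteq> tensor_words A n" "x = tensor_class A n f"
    using tensor_power_cases[OF x] .
  show ?thesis
    unfolding f(2)
    by (rule free_space_induct[OF X linear_map_comp[OF linear_map_tensor_class F] U assms(4) f(1)])
qed

lemma linear_map_tensor_eqI:
  assumes X: "module scalars X" and F: "linear_map (tensor_power A n) X F"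
    and G: "linear_map (tensor_power A n) X G"
    and "\<And>w. w \<in> tensor_words A n \<Longrightarrow>
      F (tensor_class A n (Poly_Mapping.single w 1)) = G (tensor_class A n (Poly_Mapping.single w 1))"
    and x: "x \<in> carrier (tensor_power A n)"
  shows "F x = G x"
proof -
  interpret X: module scalars X by fact
  have "linear_map (tensor_power A n) X (\<lambda>x. (- 1) \<odot>\<^bsub>X\<^esub> G x)"
    by (rule linear_map_smult[OF X G])
  then have lin: "linear_map (tensor_power A n) X (\<lambda>x. F x \<oplus>\<^bsub>X\<^esub> (- 1) \<odot>\<^bsub>X\<^esub> G x)"
    by (rule linear_map_add[OF tensor_power_module X F])
  have sub: "submodule {\<zero>\<^bsub>X\<^esub>} scalars X"
    by (rule subspaceI[OF X]) (auto simp: module_smult_zero[OF X])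
  have mem: "F y \<in> carrier X" "G y \<in> carrier X" if "y \<in> carrier (tensor_power A n)" for y
    using linear_mapD(1)[OF F that] linear_mapD(1)[OF G that] .
  have w: "tensor_class A n (Poly_Mapping.single w 1) \<in> carrier (tensor_power A n)"
    if "w \<in> tensor_words A n" for w
    using that by (intro tensor_class_mem) simp
  have minus: "u \<oplus>\<^bsub>X\<^esub> (- 1) \<odot>\<^bsub>X\<^esub> v = u \<ominus>\<^bsub>X\<^esub> v" if "v \<in> carrier X" for u v
    using minus_conv_smult[OF X that] by (simp add: a_minus_def)
  have "F x \<oplus>\<^bsub>X\<^esub> (- 1) \<odot>\<^bsub>X\<^esub> G x \<in> {\<zero>\<^bsub>X\<^esub>}"
    by (rule tensor_power_induct[OF X lin sub _ x])
      (use assms(4) mem w in \<open>simp add: minus diff_eq_zero_iff[OF X]\<close>)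
  then show ?thesis using mem[OF x] by (simp add: minus diff_eq_zero_iff[OF X])
qed

end


subsection \<open>Operators on tensor powers\<close>

text \<open>An operator on formal combinations of words that descends to tensor powers.\<close>

definition tensor_operator :: "('k::field, 'a) module \<Rightarrow> nat \<Rightarrow> ('k, 'b) module \<Rightarrow> nat
    \<Rightarrow> (('a list \<Rightarrow>\<^sub>0 'k) \<Rightarrow> ('b list \<Rightarrow>\<^sub>0 'k)) \<Rightarrow> bool" where
  "tensor_operator A n B m G \<longleftrightarrow> lin_op G \<and>
     (\<forall>f. Poly_Mapping.keys f \<subseteq> tensor_words A n \<longrightarrow> Poly_Mapping.keys (G f) \<subseteq> tensor_words B m) \<and>
     (\<forall>f\<in>tensor_relations A n. G f \<in> tensor_relations B m)"

lemma tensor_operatorD: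
  assumes "tensor_operator A n B m G"
  shows "lin_op G"
    and "Poly_Mapping.keys f \<subseteq> tensor_words A n \<Longrightarrow> Poly_Mapping.keys (G f) \<subseteq> tensor_words B m"
    and "f \<in> tensor_relations A n \<Longrightarrow> G f \<in> tensor_relations B m"
  using assms by (auto simp: tensor_operator_def)

lemma tensor_operator_id: "tensor_operator A n A n (\<lambda>f. f)"
  by (simp add: tensor_operator_def lin_op_id)

lemma tensor_operator_comp:
  "tensor_operator B m C l G \<Longrightarrow> tensor_operator A n B m H \<Longrightarrow> tensor_operator A n C l (\<lambda>f. G (H f))"
  by (simp add: tensor_operator_def lin_op_comp)

lemma tensor_operator_funpow:
  fixes G :: "('a list \<Rightarrow>\<^sub>0 'k::field) \<Rightarrow> ('a list \<Rightarrow>\<^sub>0 'k)"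
  assumes "tensor_operator A n A n G"
  shows "tensor_operator A n A n (G ^^ i)"
  by (induction i) (use assms in \<open>simp_all add: tensor_operator_def lin_op_def\<close>)

lemma tensor_operator_fscale:
  assumes "module scalars B" "tensor_operator A n B m G"
  shows "tensor_operator A n B m (\<lambda>f. fscale c (G f))"
  unfolding tensor_operator_def
proof (intro conjI allI impI ballI)
  show "Poly_Mapping.keys (fscale c (G f)) \<subseteq> tensor_words B m"
    if "Poly_Mapping.keys f \<subseteq> tensor_words A n" for f
    by (rule subset_trans[OF keys_fscale tensor_operatorD(2)[OF assms(2) that]])
  show "fscale c (G f) \<in> tensor_relations B m" if "f \<in> tensor_relations A n" for f
    using subspaceD(4)[OF free_space_module tensor_relations_subspace[OF assms(1)]
        tensor_operatorD(3)[OF assms(2) that], of c] by (simp add: free_space_simps)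
qed (rule lin_op_fscale[OF tensor_operatorD(1)[OF assms(2)]])

lemma tensor_operator_uminus:
  assumes "module scalars B" "tensor_operator A n B m G"
  shows "tensor_operator A n B m (\<lambda>f. - G f)"
  using tensor_operator_fscale[OF assms, of "- 1"] by simp

lemma tensor_operator_add:
  assumes "module scalars B" "tensor_operator A n B m G" "tensor_operator A n B m H"
  shows "tensor_operator A n B m (\<lambda>f. G f + H f)"
  unfolding tensor_operator_def
proof (intro conjI allI impI ballI)
  show "Poly_Mapping.keys (G f + H f) \<subseteq> tensor_words B m"
    if "Poly_Mapping.keys f \<subseteq> tensor_words A n" for f
    by (rule subset_trans[OF Poly_Mapping.keys_add Un_least[OF tensor_operatorD(2)[OF assms(2) that]
          tensor_operatorD(2)[OF assms(3) that]]])
  show "G f + H f \<in> tensor_relations B m" if "f \<in> tensor_relations A n" for f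
    using subspaceD(3)[OF free_space_module tensor_relations_subspace[OF assms(1)]
        tensor_operatorD(3)[OF assms(2) that] tensor_operatorD(3)[OF assms(3) that]]
    by (simp add: free_space_simps)
qed (rule lin_op_add[OF tensor_operatorD(1)[OF assms(2)] tensor_operatorD(1)[OF assms(3)]])

lemma tensor_operator_diff:
  assumes "module scalars B" "tensor_operator A n B m G" "tensor_operator A n B m H"
  shows "tensor_operator A n B m (\<lambda>f. G f - H f)"
  using tensor_operator_add[OF assms(1,2) tensor_operator_uminus[OF assms(1,3)]] by simp

lemma tensor_operator_zero:
  assumes "module scalars B"
  shows "tensor_operator A n B m (\<lambda>f. 0)"
  using subspaceD(2)[OF free_space_module tensor_relations_subspace[OF assms]]
  by (auto simp: tensor_operator_def lin_op_def free_space_simps)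

lemma tensor_operator_sum:
  assumes "module scalars B" "\<And>i. i \<in> I \<Longrightarrow> tensor_operator A n B m (G i)"
  shows "tensor_operator A n B m (\<lambda>f. \<Sum>i\<in>I. G i f)"
  using assms(2)
proof (induction I rule: infinite_finite_induct)
  case (insert i I)
  then show ?case using tensor_operator_add[OF assms(1), of A n m "G i" "\<lambda>f. \<Sum>i\<in>I. G i f"] by simp
qed (simp_all add: tensor_operator_zero[OF assms(1)])

text \<open>Being an operator on tensor powers only depends on the values on words of the given length.
  Formulas that hold for such words alone, for instance of \<open>b\<close> as an alternating sum of faces, can
  thus replace definitions.\<close>

lemma tensor_operator_cong:
  assumes "module scalars A" "tensor_operator A n B m G" "lin_op H"
    and "\<And>w. w \<in> tensor_words A n \<Longrightarrow> H (Poly_Mapping.single w 1) = G (Poly_Mapping.single w 1)"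
  shows "tensor_operator A n B m H"
proof -
  have eq: "H f = G f" if "Poly_Mapping.keys f \<subseteq> tensor_words A n" for f
    by (rule lin_op_eqI[OF assms(3) tensor_operatorD(1)[OF assms(2)] that]) (rule assms(4))
  show ?thesis
    using tensor_operatorD[OF assms(2)] tensor_relations_keys[OF assms(1)] assms(3) eq
    by (auto simp: tensor_operator_def)
qed

context
  fixes A :: "('k::field, 'a) module" and B :: "('k, 'b) module"
  assumes A: "module scalars A" and B: "module scalars B"
begin

lemma tensor_op_class:
  assumes G: "tensor_operator A n B m G" and f: "Poly_Mapping.keys f \<subseteq> tensor_words A n"
  shows "tensor_op B m G (tensor_class A n f) = tensor_class B m (G f)"
  unfolding tensor_op_def tensor_class_def
  using f tensor_operatorD(3)[OF G]
  by (intro quot_map_coset[OF free_space_module free_space_module linear_map_lin_op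
        tensor_relations_subspace[OF B] tensor_relations_subspace[OF A]]
      tensor_operatorD(1,2)[OF G]) (auto simp: free_space_simps)

lemma linear_map_tensor_op:
  assumes G: "tensor_operator A n B m G"
  shows "linear_map (tensor_power A n) (tensor_power B m) (tensor_op B m G)"
  unfolding tensor_power_def[of A]
proof (rule linear_map_quotI[OF free_space_module tensor_relations_subspace[OF A] tensor_power_module[OF B]])
  show "linear_map (free_space (tensor_words A n)) (tensor_power B m) (\<lambda>f. tensor_class B m (G f))"
    by (rule linear_map_comp[OF linear_map_lin_op linear_map_tensor_class[OF B]])
      (rule tensor_operatorD[OF G], assumption?)+
qed (use tensor_op_class[OF G] in \<open>simp add: tensor_class_def free_space_simps\<close>)

text \<open>A map between words that depends linearly on every slot induces an operator on tensor
  powers: it sends the multilinearity relations to such relations.\<close>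

definition slotwise_linear :: "nat \<Rightarrow> nat \<Rightarrow> ('a list \<Rightarrow> 'b list) \<Rightarrow> bool" where
  "slotwise_linear n m \<phi> \<longleftrightarrow> (\<forall>xs\<in>tensor_words A n. \<phi> xs \<in> tensor_words B m) \<and>
     (\<forall>xs\<in>tensor_words A n. \<forall>i<n. \<exists>ys\<in>tensor_words B m. \<exists>i'<m. \<exists>h. linear_map A B h \<and>
        (\<forall>z\<in>carrier A. \<phi> (xs[i := z]) = ys[i' := h z]))"

lemma tensor_operator_slotwise:
  assumes \<phi>: "slotwise_linear n m \<phi>"
  shows "tensor_operator A n B m (lin_ext (\<lambda>xs. Poly_Mapping.single (\<phi> xs) c))"
proof -
  let ?G = "lin_ext (\<lambda>xs. Poly_Mapping.single (\<phi> xs) c)"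
  have keys: "Poly_Mapping.keys (?G f) \<subseteq> tensor_words B m" if "Poly_Mapping.keys f \<subseteq> tensor_words A n" for f
    by (rule lin_op_keys[OF lin_op_lin_ext that]) (use \<phi> in \<open>auto simp: slotwise_linear_def\<close>)
  have lin: "linear_map (free_space (tensor_words A n)) (free_space (tensor_words B m)) ?G"
    by (rule linear_map_lin_op[OF lin_op_lin_ext keys])
  note R = subspaceD(4)[OF free_space_module tensor_relations_subspace[OF B], simplified free_space_simps]
  have "?G f \<in> tensor_relations B m" if f: "f \<in> tensor_relations A n" for f
  proof (rule linear_map_lin_span[OF free_space_module free_space_module lin tensor_relations_subspace[OF B]
        _ _ f[unfolded tensor_relations_span]])
    fix f assume "f \<in> tensor_generators A n"
    then show "?G f \<in> tensor_relations B m"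
    proof (cases rule: tensor_generators_cases)
      case (add xs i x y)
      then obtain ys i' h where ys: "ys \<in> tensor_words B m" "i' < m" and h: "linear_map A B h"
        and eq: "\<And>z. z \<in> carrier A \<Longrightarrow> \<phi> (xs[i := z]) = ys[i' := h z]"
        using \<phi> unfolding slotwise_linear_def by metis
      have "Poly_Mapping.single (ys[i' := h x \<oplus>\<^bsub>B\<^esub> h y]) 1 - Poly_Mapping.single (ys[i' := h x]) 1
          - Poly_Mapping.single (ys[i' := h y]) 1 \<in> tensor_relations B m"
        unfolding tensor_relations_span tensor_generators_def
        using ys linear_mapD(1)[OF h] add by (intro lin_span_superset UnI1 CollectI) blast
      from R[OF this, of c] show ?thesis
        using add by (simp add: lin_ext_simps eq linear_mapD(2)[OF h] add_mem[OF A] fscale_diff)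
    next
      case (smult xs i b x)
      then obtain ys i' h where ys: "ys \<in> tensor_words B m" "i' < m" and h: "linear_map A B h"
        and eq: "\<And>z. z \<in> carrier A \<Longrightarrow> \<phi> (xs[i := z]) = ys[i' := h z]"
        using \<phi> unfolding slotwise_linear_def by metis
      have "Poly_Mapping.single (ys[i' := b \<odot>\<^bsub>B\<^esub> h x]) 1 - Poly_Mapping.single (ys[i' := h x]) b
          \<in> tensor_relations B m"
        unfolding tensor_relations_span tensor_generators_def
        using ys linear_mapD(1)[OF h] smult by (intro lin_span_superset UnI2 CollectI) blast
      from R[OF this, of c] show ?thesis
        using smult by (simp add: lin_ext_simps eq linear_mapD(3)[OF h] module_simps(1)[OF A]
            fscale_diff mult.commute)
    qed
  next
    show "tensor_generators A n \<subseteq> carrier (free_space (tensor_words A n))"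
      by (rule tensor_generators_subset[OF A])
  qed
  then show ?thesis using keys by (simp add: tensor_operator_def lin_op_lin_ext)
qed

end

definition map_op :: "('a \<Rightarrow> 'b) \<Rightarrow> ('a list \<Rightarrow>\<^sub>0 'k::field) \<Rightarrow> ('b list \<Rightarrow>\<^sub>0 'k)" where
  "map_op f = lin_ext (\<lambda>xs. Poly_Mapping.single (map f xs) 1)"

lemma map_op_single [simp]: "map_op f (Poly_Mapping.single xs c) = Poly_Mapping.single (map f xs) c"
  by (simp add: map_op_def)

lemma lin_op_map_op: "lin_op (map_op f)"
  unfolding map_op_def by (rule lin_op_lin_ext)

lemma tensor_operator_map_op:
  assumes A: "module scalars A" and B: "module scalars B" and f: "linear_map A B f"
  shows "tensor_operator A n B n (map_op f)"
  unfolding map_op_def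
proof (rule tensor_operator_slotwise[OF A B])
  have words: "map f xs \<in> tensor_words B n" if "xs \<in> tensor_words A n" for xs
    using that linear_mapD(1)[OF f] by (auto simp: tensor_words_def)
  then show "slotwise_linear A B n n (map f)"
    unfolding slotwise_linear_def[OF A B] using f by (auto simp: map_update)
qed

lemma tensor_op_cong:
  assumes A: "module scalars A" and B: "module scalars B"
    and G: "tensor_operator A n B m G" and H: "tensor_operator A n B m H"
    and "\<And>w. w \<in> tensor_words A n \<Longrightarrow> G (Poly_Mapping.single w 1) = H (Poly_Mapping.single w 1)"
    and "x \<in> carrier (tensor_power A n)"
  shows "tensor_op B m G x = tensor_op B m H x"
proof -
  obtain f where f: "Poly_Mapping.keys f \<subseteq> tensor_words A n" "x = tensor_class A n f"
    using tensor_power_cases[OF A assms(6)] .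
  have "G f = H f"
    by (rule lin_op_eqI[OF tensor_operatorD(1)[OF G] tensor_operatorD(1)[OF H] f(1)]) (rule assms(5))
  then show ?thesis
    using tensor_op_class[OF A B G f(1)] tensor_op_class[OF A B H f(1)] f(2) by simp
qed

lemma tensor_op_comp:
  assumes A: "module scalars A" and B: "module scalars B" and C: "module scalars C"
    and G: "tensor_operator B m C l G" and H: "tensor_operator A n B m H"
    and "x \<in> carrier (tensor_power A n)"
  shows "tensor_op C l G (tensor_op B m H x) = tensor_op C l (\<lambda>f. G (H f)) x"
proof -
  obtain f where f: "Poly_Mapping.keys f \<subseteq> tensor_words A n" "x = tensor_class A n f"
    using tensor_power_cases[OF A assms(6)] .
  show ?thesis
    using tensor_op_class[OF A B H f(1)] tensor_op_class[OF B C G tensor_operatorD(2)[OF H f(1)]]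
      tensor_op_class[OF A C tensor_operator_comp[OF G H] f(1)] f(2) by simp
qed


subsection \<open>Multilinear maps\<close>

definition multilinear :: "('k::field, 'a) module \<Rightarrow> nat \<Rightarrow> ('k, 'v) module \<Rightarrow> ('a list \<Rightarrow> 'v) \<Rightarrow> bool" where
  "multilinear A n X \<phi> \<longleftrightarrow> (\<forall>xs\<in>tensor_words A n. \<forall>i<n. linear_map A X (\<lambda>z. \<phi> (xs[i := z]))) \<and>
     (\<forall>xs\<in>tensor_words A n. \<phi> xs \<in> carrier X)"

text \<open>The linear map out of a tensor power given by its universal property.\<close>

definition tensor_lift :: "('k::field, 'v) module \<Rightarrow> ('a list \<Rightarrow> 'v) \<Rightarrow> ('a list \<Rightarrow>\<^sub>0 'k) set \<Rightarrow> 'v" where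
  "tensor_lift X \<phi> = quot_lift (free_ext X \<phi>)"

context
  fixes A :: "('k::field, 'a) module" and X :: "('k, 'v) module" and n \<phi>
  assumes A: "module scalars A" and X: "module scalars X" and \<phi>: "multilinear A n X \<phi>"
begin

lemma free_ext_relations: "f \<in> tensor_relations A n \<Longrightarrow> free_ext X \<phi> f = \<zero>\<^bsub>X\<^esub>"
proof -
  interpret X: module scalars X by (rule X)
  have \<phi>X: "\<phi> w \<in> carrier X" if "w \<in> tensor_words A n" for w
    using \<phi> that by (simp add: multilinear_def)
  have lin: "linear_map (free_space (tensor_words A n)) X (free_ext X \<phi>)"
    by (rule linear_map_free_ext[OF X \<phi>X])
  have diff: "free_ext X \<phi> (f - g) = free_ext X \<phi> f \<ominus>\<^bsub>X\<^esub> free_ext X \<phi> g"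
    if "Poly_Mapping.keys f \<subseteq> tensor_words A n" "Poly_Mapping.keys g \<subseteq> tensor_words A n" for f g
    using linear_map_diff[OF free_space_module X lin, of f g] that
    by (simp add: free_space_simps free_space_diff)
  have sub: "submodule {\<zero>\<^bsub>X\<^esub>} scalars X"
    by (rule subspaceI[OF X]) (auto simp: module_smult_zero[OF X])
  have ext: "free_ext X \<phi> (Poly_Mapping.single w c) = c \<odot>\<^bsub>X\<^esub> \<phi> w" if "w \<in> tensor_words A n" for w c
    by (rule free_ext_single[of X \<phi> w c, OF X \<phi>X[OF that]])
  note w = tensor_words_update[OF A]
  note keysd = Poly_Mapping.keys_diff[THEN subset_trans]
  assume f: "f \<in> tensor_relations A n"
  have "free_ext X \<phi> f \<in> {\<zero>\<^bsub>X\<^esub>}"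
  proof (rule linear_map_lin_span[OF free_space_module X lin sub _ _ f[unfolded tensor_relations_span]])
    fix f assume "f \<in> tensor_generators A n"
    then show "free_ext X \<phi> f \<in> {\<zero>\<^bsub>X\<^esub>}"
    proof (cases rule: tensor_generators_cases)
      case (add xs i x y)
      then have l: "linear_map A X (\<lambda>z. \<phi> (xs[i := z]))" using \<phi> by (simp add: multilinear_def)
      have k: "Poly_Mapping.keys (Poly_Mapping.single (xs[i := x \<oplus>\<^bsub>A\<^esub> y]) 1 - Poly_Mapping.single (xs[i := x]) (1::'k))
          \<subseteq> tensor_words A n"
        using w[OF add(1)] add add_mem[OF A] by (intro keysd) auto
      note lx = linear_mapD(1)[OF l add(3)] and ly = linear_mapD(1)[OF l add(4)]
      show ?thesis
        using add k w[OF add(1)] add_mem[OF A add(3,4)] linear_mapD(2)[OF l add(3,4)] lx ly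
        by (simp add: diff ext module_simps(2)[OF X] a_minus_def
            X.a_comm[of "\<phi> (xs[i := x])" "\<phi> (xs[i := y])"] X.a_assoc X.r_neg)
    next
      case (smult xs i b x)
      then have l: "linear_map A X (\<lambda>z. \<phi> (xs[i := z]))" using \<phi> by (simp add: multilinear_def)
      show ?thesis
        using smult w[OF smult(1)] module_simps(1)[OF A smult(3)] linear_mapD(3)[OF l smult(3)]
          linear_mapD(1)[OF l smult(3)]
        by (simp add: diff ext module_simps(1,2)[OF X] diff_eq_zero_iff[OF X])
    qed
  next
    show "tensor_generators A n \<subseteq> carrier (free_space (tensor_words A n))"
      by (rule tensor_generators_subset[OF A])
  qed
  then show "free_ext X \<phi> f = \<zero>\<^bsub>X\<^esub>" by simp
qed

lemma linear_map_tensor_lift: "linear_map (tensor_power A n) X (tensor_lift X \<phi>)"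
  unfolding tensor_lift_def tensor_power_def
proof (rule linear_map_quot_lift[OF free_space_module tensor_relations_subspace[OF A] X])
  show "linear_map (free_space (tensor_words A n)) X (free_ext X \<phi>)"
    by (rule linear_map_free_ext[OF X]) (use \<phi> in \<open>simp add: multilinear_def\<close>)
qed (rule free_ext_relations)

lemma tensor_lift_word:
  assumes "xs \<in> tensor_words A n"
  shows "tensor_lift X \<phi> (tensor_class A n (Poly_Mapping.single xs 1)) = \<phi> xs"
proof -
  have \<phi>X: "\<phi> w \<in> carrier X" if "w \<in> tensor_words A n" for w
    using \<phi> that by (simp add: multilinear_def)
  have "tensor_lift X \<phi> (tensor_class A n (Poly_Mapping.single xs 1)) = free_ext X \<phi> (Poly_Mapping.single xs 1)"
    unfolding tensor_lift_def tensor_class_def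
    using assms
    by (intro quot_lift_coset[OF free_space_module tensor_relations_subspace[OF A] X
          linear_map_free_ext[OF X \<phi>X] free_ext_relations]) (auto simp: free_space_simps)
  then show ?thesis
    using free_ext_single[of X \<phi> xs 1, OF X \<phi>X[OF assms]] module_simps(2)[OF X \<phi>X[OF assms]] by simp
qed

end


section \<open>The cyclic bicomplex\<close>

text \<open>The common reason for \<open>b \<circ> b = 0\<close>, \<open>b' \<circ> b' = 0\<close> and the vanishing of the square of the
  simplicial differential: by the simplicial identities the terms \<open>(i, j)\<close> with \<open>i < j\<close> and
  \<open>(j - 1, i)\<close> cancel in pairs.\<close>

lemma presimplicial_sum_zero:
  fixes F :: "nat \<Rightarrow> nat \<Rightarrow> 'b::ab_group_add"
  assumes F: "\<And>i j. i < j \<Longrightarrow> j \<le> Suc m \<Longrightarrow> F i j = - F (j - 1) i"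
  shows "(\<Sum>j\<le>Suc m. \<Sum>i\<le>m. F i j) = 0"
proof -
  let ?I = "{..Suc m} \<times> {..m}"
  let ?P = "{(j, i) \<in> ?I. i < j}" and ?Q = "{(j, i) \<in> ?I. j \<le> i}"
  have "(\<Sum>j\<le>Suc m. \<Sum>i\<le>m. F i j) = (\<Sum>(j, i)\<in>?I. F i j)"
    by (simp add: sum.cartesian_product)
  also have "?I = ?P \<union> ?Q" by auto
  also have "(\<Sum>(j, i)\<in>?P \<union> ?Q. F i j) = (\<Sum>(j, i)\<in>?P. F i j) + (\<Sum>(j, i)\<in>?Q. F i j)"
    by (rule sum.union_disjoint) (auto intro: finite_subset[of _ ?I])
  also have "(\<Sum>(j, i)\<in>?P. F i j) = (\<Sum>(j, i)\<in>?Q. - F i j)"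
    by (rule sum.reindex_bij_witness[of _ "\<lambda>(j, i). (i + 1, j)" "\<lambda>(j, i). (i, j - 1)"])
      (auto simp: F)
  finally show ?thesis by (simp add: sum_negf case_prod_unfold)
qed


subsection \<open>Faces and rotations of words\<close>

text \<open>The faces of the cyclic module of an algebra. For a word of length \<open>n + 1\<close> the last face,
  which multiplies cyclically, has index \<open>n\<close>; then \<open>b\<close> is the alternating sum of all faces and
  \<open>b'\<close> that of the inner ones.\<close>

definition word_face :: "('k::field, 'a) module \<Rightarrow> nat \<Rightarrow> 'a list \<Rightarrow> 'a list" where
  "word_face A i xs = (if i < length xs - 1
     then take i xs @ (xs ! i \<otimes>\<^bsub>A\<^esub> xs ! (i + 1)) # drop (i + 2) xs
     else (last xs \<otimes>\<^bsub>A\<^esub> hd xs) # tl (butlast xs))"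

definition rot :: "'a list \<Rightarrow> 'a list" where
  "rot xs = last xs # butlast xs"

lemma length_word_face:
  assumes "length xs = Suc n" "0 < n"
  shows "length (word_face A i xs) = n"
  using assms by (auto simp: word_face_def)

lemma nth_word_face:
  assumes "length xs = Suc n" "i \<le> n" "k < n"
  shows "word_face A i xs ! k =
    (if i < n then if k < i then xs ! k else if k = i then xs ! i \<otimes>\<^bsub>A\<^esub> xs ! Suc i else xs ! Suc k
     else if k = 0 then xs ! n \<otimes>\<^bsub>A\<^esub> xs ! 0 else xs ! k)"
proof -
  have "xs \<noteq> []" using assms by auto
  then show ?thesis
    using assms
    by (auto simp: word_face_def nth_append nth_Cons' nth_tl nth_butlast last_conv_nth hd_conv_nth
        min_def Suc_diff_Suc)
qed

lemma length_rot: "length xs = Suc n \<Longrightarrow> length (rot xs) = Suc n"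
  by (simp add: rot_def)

lemma nth_rot:
  assumes "length xs = Suc n" "k \<le> n"
  shows "rot xs ! k = (if k = 0 then xs ! n else xs ! (k - 1))"
proof -
  have "xs \<noteq> []" using assms by auto
  then show ?thesis
    using assms by (auto simp: rot_def nth_Cons' nth_butlast last_conv_nth)
qed

lemma words_nth: "xs \<in> tensor_words A n \<Longrightarrow> i < n \<Longrightarrow> xs ! i \<in> carrier A"
  by (auto simp: tensor_words_def)

lemma wordsI: "length xs = n \<Longrightarrow> (\<And>i. i < n \<Longrightarrow> xs ! i \<in> carrier A) \<Longrightarrow> xs \<in> tensor_words A n"
  by (auto simp: tensor_words_def in_set_conv_nth)

lemma words_length: "xs \<in> tensor_words A n \<Longrightarrow> length xs = n"
  by (simp add: tensor_words_def)

text \<open>Together with the next lemma, the relations \<open>d\<^sub>0 t = d\<^sub>n\<close> and \<open>d\<^sub>i\<^sub>+\<^sub>1 t = t d\<^sub>i\<close> of a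
  cyclic object, without signs. They reduce statements about all faces to the face of index \<open>0\<close>.\<close>

lemma word_face_rot_0:
  assumes "length xs = Suc n" "0 < n"
  shows "word_face A 0 (rot xs) = word_face A n xs"
  by (rule nth_equalityI)
    (use assms in \<open>auto simp: length_word_face[of _ n] length_rot nth_word_face[of _ n] nth_rot[of _ n]\<close>)

lemma word_face_rot_Suc:
  assumes "length xs = Suc n" "i < n"
  shows "word_face A (Suc i) (rot xs) = rot (word_face A i xs)"
proof (cases n)
  case (Suc m)
  note len = length_word_face[of _ n] length_rot[of _ n] length_rot[of _ m]
  have "length (word_face A i xs) = Suc m" using assms Suc by (simp add: length_word_face[of _ n])
  moreover have "i < m \<or> i = m" using assms Suc by auto
  ultimately show ?thesis
    by (elim disjE; intro nth_equalityI)
      (use assms Suc in \<open>auto simp: len nth_word_face[of _ n] nth_rot[of _ n] nth_rot[of _ m]\<close>)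
qed (use assms in simp)

lemma rot_rot: "length xs = Suc n \<Longrightarrow> (rot ^^ Suc n) xs = xs"
proof -
  assume len: "length xs = Suc n"
  have l: "length ((rot ^^ k) xs) = Suc n" for k
    by (induction k) (simp_all add: len length_rot)
  have r: "rotate1 (rot ys) = ys" if "length ys = Suc n" for ys :: "'a list"
    using that by (cases "ys = []") (auto simp: rot_def)
  have "(rotate1 ^^ k) ((rot ^^ k) xs) = xs" for k
  proof (induction k)
    case (Suc k)
    then show ?case
      by (simp only: funpow_Suc_right[of k rotate1] funpow.simps(2)[of k rot] o_apply r[OF l])
  qed simp
  from this[of "Suc n"] show ?thesis
    using rotate_id[of "Suc n" "(rot ^^ Suc n) xs"] l[of "Suc n"] by (simp add: rotate_def)
qed

context
  fixes A :: "('k::field, 'a) module"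
  assumes A: "nonunital_algebra A"
begin

interpretation A: nonunital_algebra A by (rule A)

lemma algebra_module: "module (scalars :: 'k ring) A" by unfold_locales

lemma word_face_words:
  assumes "xs \<in> tensor_words A (Suc n)" "i \<le> n" "0 < n"
  shows "word_face A i xs \<in> tensor_words A n"
proof -
  have "length xs = Suc n" using assms(1) by (rule words_length)
  then show ?thesis
    using assms words_nth[OF assms(1)]
    by (intro wordsI) (auto simp: length_word_face[of _ n] nth_word_face[of _ n] intro!: A.m_closed)
qed

lemma word_face_word_face_inner:
  assumes xs: "xs \<in> tensor_words A (Suc (Suc m))" and "i \<le> j" "j < m"
  shows "word_face A i (word_face A (Suc j) xs) = word_face A j (word_face A i xs)"
proof (rule nth_equalityI)
  have len: "length xs = Suc (Suc m)" using xs by (rule words_length)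
  have len': "length (word_face A p xs) = Suc m" for p
    using len by (simp add: length_word_face[of _ "Suc m"])
  then show "length (word_face A i (word_face A (Suc j) xs)) = length (word_face A j (word_face A i xs))"
    using assms(3) by (simp add: length_word_face[of _ m])
  fix k assume "k < length (word_face A i (word_face A (Suc j) xs))"
  then have k: "k < m" using len' assms(3) by (simp add: length_word_face[of _ m])
  have once: "word_face A p xs ! q =
      (if q < p then xs ! q else if q = p then xs ! p \<otimes>\<^bsub>A\<^esub> xs ! Suc p else xs ! Suc q)"
    if "p \<le> m" "q \<le> m" for p q
    using nth_word_face[OF len, where A = A and i = p and k = q] that by simp
  have twice: "word_face A p (word_face A p' xs) ! q = (if q < p then word_face A p' xs ! q
      else if q = p then word_face A p' xs ! p \<otimes>\<^bsub>A\<^esub> word_face A p' xs ! Suc p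
      else word_face A p' xs ! Suc q)" if "p < m" "q < m" for p p' q
    using nth_word_face[OF len', where A = A and i = p and k = q] that by simp
  have mem: "xs ! q \<in> carrier A" if "q \<le> Suc m" for q using words_nth[OF xs, of q] that by simp
  consider "i < j" | "i = j" using assms(2) by linarith
  then show "word_face A i (word_face A (Suc j) xs) ! k = word_face A j (word_face A i xs) ! k"
  proof cases
    case 1
    consider "k < i" | "k = i" | "i < k" "k < j" | "k = j" | "j < k" by linarith
    then show ?thesis
      using 1 assms(3) k by cases (simp_all add: twice once)
  next
    case 2
    consider "k < i" | "k = i" | "i < k" by linarith
    then show ?thesis
      using 2 assms(3) k by cases (simp_all add: twice once mem A.m_assoc)
  qed
qed

lemma rot_words: "xs \<in> tensor_words A (Suc n) \<Longrightarrow> rot xs \<in> tensor_words A (Suc n)"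
  using words_length[of xs A "Suc n"]
  by (intro wordsI) (auto simp: length_rot nth_rot[of _ n] words_nth)

text \<open>A rotation makes the cyclic face an inner one, so that the identity for inner faces
  suffices.\<close>

lemma word_face_word_face:
  assumes xs: "xs \<in> tensor_words A (Suc (Suc (Suc m)))" and "i \<le> j" "j \<le> Suc m"
  shows "word_face A i (word_face A (Suc j) xs) = word_face A j (word_face A i xs)"
proof (cases "j < Suc m")
  case True
  then show ?thesis using word_face_word_face_inner[OF xs assms(2)] by simp
next
  case False
  then have j: "j = Suc m" using assms(3) by simp
  have len: "length ys = Suc (Suc (Suc m))" if "ys \<in> tensor_words A (Suc (Suc (Suc m)))" for ys :: "'a list"
    using that by (rule words_length)
  have last: "word_face A (Suc (Suc m)) ys = word_face A 0 (rot ys)"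
    if "ys \<in> tensor_words A (Suc (Suc (Suc m)))" for ys
    using word_face_rot_0[OF len[OF that], of A] by simp
  have last': "word_face A (Suc m) (word_face A p ys) = word_face A 0 (word_face A (Suc p) (rot ys))"
    if "ys \<in> tensor_words A (Suc (Suc (Suc m)))" "p \<le> Suc m" for p ys
    using word_face_rot_0[OF length_word_face[OF len[OF that(1)]], of A A p]
      word_face_rot_Suc[OF len[OF that(1)], of p A] that(2) by simp
  note rxs = rot_words[OF xs]
  have "word_face A i (word_face A 0 (rot xs)) = word_face A 0 (word_face A (Suc i) (rot xs))"
  proof (cases "i < Suc m")
    case True
    then show ?thesis using word_face_word_face_inner[OF rxs, of 0 i] by simp
  next
    case False
    then have "i = Suc m" using assms(2) j by simp
    then show ?thesis
      using last[OF rxs] last'[OF rxs, of 0] word_face_word_face_inner[OF rot_words[OF rxs], of 0 0]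
      by simp
  qed
  then show ?thesis using last[OF xs] last'[OF xs, of i] assms(2) j by simp
qed

lemma linear_map_id: "linear_map A A (\<lambda>z. z)"
  by (rule linear_mapI) simp_all

lemma linear_map_mult_left: "y \<in> carrier A \<Longrightarrow> linear_map A A (\<lambda>z. y \<otimes>\<^bsub>A\<^esub> z)"
  by (rule linear_mapI) (simp_all add: A.m_closed A.r_distr A.smult_r)

lemma linear_map_mult_right: "y \<in> carrier A \<Longrightarrow> linear_map A A (\<lambda>z. z \<otimes>\<^bsub>A\<^esub> y)"
  by (rule linear_mapI) (simp_all add: A.m_closed A.l_distr A.smult_l)

lemma slotwise_rot: "slotwise_linear A A (Suc n) (Suc n) rot"
  unfolding slotwise_linear_def[OF algebra_module algebra_module]
proof (intro conjI ballI allI impI)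
  fix xs i assume xs: "xs \<in> tensor_words A (Suc n)" and i: "i < Suc n"
  have len: "length xs = Suc n" using xs by (rule words_length)
  define i' where "i' = (if i = n then 0 else Suc i)"
  have "rot (xs[i := z]) = (rot xs)[i' := z]" for z
    by (rule nth_equalityI)
      (use len i in \<open>auto simp: length_rot nth_rot[of _ n] nth_list_update i'_def\<close>)
  moreover have "i' < Suc n" using i by (auto simp: i'_def)
  ultimately show "\<exists>ys\<in>tensor_words A (Suc n). \<exists>i'<Suc n. \<exists>h. linear_map A A h \<and>
      (\<forall>z\<in>carrier A. rot (xs[i := z]) = ys[i' := h z])"
    using rot_words[OF xs] linear_map_id by blast
qed (rule rot_words)

lemma slotwise_face_0: "slotwise_linear A A (Suc (Suc n)) (Suc n) (word_face A 0)"
  unfolding slotwise_linear_def[OF algebra_module algebra_module]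
proof (intro conjI ballI allI impI)
  fix xs i assume xs: "xs \<in> tensor_words A (Suc (Suc n))" and i: "i < Suc (Suc n)"
  have len: "length xs = Suc (Suc n)" using xs by (rule words_length)
  define h where "h = (\<lambda>z. if i = 0 then z \<otimes>\<^bsub>A\<^esub> xs ! 1 else if i = 1 then xs ! 0 \<otimes>\<^bsub>A\<^esub> z else z)"
  have h: "linear_map A A h"
    using words_nth[OF xs, of 0] words_nth[OF xs, of 1]
    by (cases "i = 0"; cases "i = 1")
      (simp_all add: h_def linear_map_id linear_map_mult_left linear_map_mult_right)
  have "word_face A 0 (xs[i := z]) = (word_face A 0 xs)[i - 1 := h z]" for z
    by (rule nth_equalityI)
      (use len i in \<open>auto simp: length_word_face[of _ "Suc n"] nth_word_face[of _ "Suc n"]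
        nth_list_update h_def split: if_splits\<close>)
  moreover have "i - 1 < Suc n" using i by auto
  moreover have "word_face A 0 xs \<in> tensor_words A (Suc n)" by (rule word_face_words[OF xs]) auto
  ultimately show "\<exists>ys\<in>tensor_words A (Suc n). \<exists>i'<Suc n. \<exists>h. linear_map A A h \<and>
      (\<forall>z\<in>carrier A. word_face A 0 (xs[i := z]) = ys[i' := h z])"
    using h by blast
qed (rule word_face_words; simp)


subsection \<open>The operators on formal combinations\<close>

text \<open>The sign belongs to the face, so that \<open>b\<close> and \<open>b'\<close> are plain sums.\<close>

definition face_op :: "nat \<Rightarrow> ('a list \<Rightarrow>\<^sub>0 'k) \<Rightarrow> ('a list \<Rightarrow>\<^sub>0 'k)" where
  "face_op i = lin_ext (\<lambda>xs. Poly_Mapping.single (word_face A i xs) ((-1) ^ i))"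

lemma lin_op_face_op: "lin_op (face_op i)"
  unfolding face_op_def by (rule lin_op_lin_ext)

lemma lin_op_cyclic_t: "lin_op (cyclic_t :: ('a list \<Rightarrow>\<^sub>0 'k) \<Rightarrow> _)"
  unfolding cyclic_t_def by (rule lin_op_lin_ext)

lemma lin_op_cyclic_N: "lin_op (cyclic_N n :: ('a list \<Rightarrow>\<^sub>0 'k) \<Rightarrow> _)"
  unfolding cyclic_N_def[abs_def] by (intro lin_op_sumI lin_op_funpow lin_op_cyclic_t)

lemma lin_op_bprime: "lin_op (bprime A)"
  unfolding bprime_def by (rule lin_op_lin_ext)

lemma lin_op_hochschild_b: "lin_op (hochschild_b A)"
  unfolding hochschild_b_def[abs_def] by (intro lin_op_add lin_op_bprime lin_op_lin_ext)

lemma face_op_single [simp]: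
  "face_op i (Poly_Mapping.single xs c) = Poly_Mapping.single (word_face A i xs) (c * (-1) ^ i)"
  by (simp add: face_op_def)

lemma cyclic_t_single:
  "cyclic_t (Poly_Mapping.single xs c) = Poly_Mapping.single (rot xs) (c * (-1 :: 'k) ^ (length xs - 1))"
  by (simp add: cyclic_t_def rot_def)

lemma bprime_eq:
  assumes "Poly_Mapping.keys f \<subseteq> tensor_words A (Suc n)"
  shows "bprime A f = (\<Sum>i<n. face_op i f)"
  by (rule lin_op_eqI[OF lin_op_bprime lin_op_sumI[OF lin_op_face_op] assms])
    (auto simp: bprime_def tensor_words_def word_face_def)

lemma hochschild_b_eq:
  assumes "Poly_Mapping.keys f \<subseteq> tensor_words A (Suc n)"
  shows "hochschild_b A f = (\<Sum>i\<le>n. face_op i f)"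
proof -
  have "hochschild_b A f = (\<Sum>i<n. face_op i f) + face_op n f"
    unfolding hochschild_b_def bprime_eq[OF assms] face_op_def
    by (rule arg_cong2[where f = "(+)", OF refl], rule lin_op_eqI[OF lin_op_lin_ext lin_op_lin_ext assms])
      (auto simp: tensor_words_def word_face_def)
  then show ?thesis by (simp add: lessThan_Suc_atMost[symmetric])
qed

lemma tensor_operator_cyclic_t: "tensor_operator A (Suc n) A (Suc n) cyclic_t"
  by (rule tensor_operator_cong[OF algebra_module
        tensor_operator_slotwise[OF algebra_module algebra_module slotwise_rot, of n "(-1) ^ n"]
        lin_op_cyclic_t])
    (simp add: cyclic_t_single words_length)

lemma keys_cyclic_t_pow:
  fixes f :: "'a list \<Rightarrow>\<^sub>0 'k"
  shows "Poly_Mapping.keys f \<subseteq> tensor_words A (Suc n) \<Longrightarrow> Poly_Mapping.keys ((cyclic_t ^^ i) f) \<subseteq> tensor_words A (Suc n)"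
  by (rule tensor_operatorD(2)[OF tensor_operator_funpow[OF tensor_operator_cyclic_t]])

lemma keys_face_op:
  "i \<le> Suc n \<Longrightarrow> Poly_Mapping.keys f \<subseteq> tensor_words A (Suc (Suc n)) \<Longrightarrow>
    Poly_Mapping.keys (face_op i f) \<subseteq> tensor_words A (Suc n)"
  by (rule lin_op_keys[OF lin_op_face_op]) (auto simp: word_face_words)

lemma face_op_cyclic_t_0:
  assumes "Poly_Mapping.keys f \<subseteq> tensor_words A (Suc (Suc n))"
  shows "face_op 0 (cyclic_t f) = face_op (Suc n) f"
  by (rule lin_op_eqI[OF lin_op_comp[OF lin_op_face_op lin_op_cyclic_t] lin_op_face_op assms])
    (simp add: cyclic_t_single words_length word_face_rot_0[of _ "Suc n"])

lemma face_op_cyclic_t_Suc: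
  assumes "Poly_Mapping.keys f \<subseteq> tensor_words A (Suc (Suc n))" "i \<le> n"
  shows "face_op (Suc i) (cyclic_t f) = cyclic_t (face_op i f)"
  by (rule lin_op_eqI[OF lin_op_comp[OF lin_op_face_op lin_op_cyclic_t]
        lin_op_comp[OF lin_op_cyclic_t lin_op_face_op] assms(1)])
    (use assms(2) in \<open>simp add: cyclic_t_single words_length length_word_face[of _ "Suc n"]
      word_face_rot_Suc[of _ "Suc n"] ac_simps\<close>)

lemma cyclic_t_pow_Suc:
  fixes f :: "'a list \<Rightarrow>\<^sub>0 'k"
  assumes "Poly_Mapping.keys f \<subseteq> tensor_words A (Suc n)"
  shows "(cyclic_t ^^ Suc n) f = f"
proof (rule lin_op_eqI[OF lin_op_funpow[OF lin_op_cyclic_t] lin_op_id assms])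
  fix xs :: "'a list" assume "xs \<in> tensor_words A (Suc n)"
  then have len: "length xs = Suc n" by (rule words_length)
  have l: "length ((rot ^^ k) xs) = Suc n" for k
    by (induction k) (simp_all add: len length_rot)
  have "(cyclic_t ^^ k) (Poly_Mapping.single xs 1) = Poly_Mapping.single ((rot ^^ k) xs) (((-1 :: 'k) ^ n) ^ k)" for k
    by (induction k) (simp_all add: cyclic_t_single l ac_simps)
  moreover have "((-1 :: 'k) ^ n) ^ Suc n = 1"
    by (simp add: power_mult[symmetric] del: power_Suc)
  ultimately show "(cyclic_t ^^ Suc n) (Poly_Mapping.single xs 1) = Poly_Mapping.single xs (1 :: 'k)"
    using rot_rot[OF len] by metis
qed

lemma face_op_cyclic_t_pow:
  assumes f: "Poly_Mapping.keys f \<subseteq> tensor_words A (Suc (Suc n))" and "i \<le> Suc n"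
  shows "face_op i ((cyclic_t ^^ i) f) = (cyclic_t ^^ i) (face_op 0 f)"
  using assms(2)
proof (induction i)
  case (Suc i)
  then show ?case
    using face_op_cyclic_t_Suc[OF keys_cyclic_t_pow[OF f], of i i] by simp
qed simp

lemma hochschild_b_square:
  assumes f: "Poly_Mapping.keys f \<subseteq> tensor_words A (Suc (Suc (Suc n)))"
  shows "hochschild_b A (hochschild_b A f) = 0" and "bprime A (bprime A f) = 0"
proof -
  have sq: "face_op i (face_op j f) = - face_op (j - 1) (face_op i f)" if "i < j" "j \<le> Suc (Suc n)" for i j
  proof (rule lin_op_eqI[OF lin_op_comp[OF lin_op_face_op lin_op_face_op]
        lin_op_uminus[OF lin_op_comp[OF lin_op_face_op lin_op_face_op]] f])
    fix xs assume "xs \<in> tensor_words A (Suc (Suc (Suc n)))"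
    then show "face_op i (face_op j (Poly_Mapping.single xs 1)) =
        - face_op (j - 1) (face_op i (Poly_Mapping.single xs 1))"
      using that word_face_word_face[of xs n i "j - 1"]
      by (cases j) (simp_all add: single_uminus[symmetric] ac_simps)
  qed
  have k: "Poly_Mapping.keys (face_op j f) \<subseteq> tensor_words A (Suc (Suc n))" if "j \<le> Suc (Suc n)" for j
    by (rule keys_face_op[OF that f])
  have "hochschild_b A (hochschild_b A f) = (\<Sum>j\<le>Suc (Suc n). hochschild_b A (face_op j f))"
    by (simp only: hochschild_b_eq[OF f] lin_op_sum[OF lin_op_hochschild_b])
  also have "\<dots> = (\<Sum>j\<le>Suc (Suc n). \<Sum>i\<le>Suc n. face_op i (face_op j f))"
    by (intro sum.cong refl hochschild_b_eq k) simp
  also have "\<dots> = 0" by (rule presimplicial_sum_zero) (rule sq)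
  finally show "hochschild_b A (hochschild_b A f) = 0" .
  have "bprime A (bprime A f) = (\<Sum>j<Suc (Suc n). bprime A (face_op j f))"
    by (simp only: bprime_eq[OF f] lin_op_sum[OF lin_op_bprime])
  also have "\<dots> = (\<Sum>j<Suc (Suc n). \<Sum>i<Suc n. face_op i (face_op j f))"
    by (intro sum.cong refl bprime_eq k) simp
  also have "\<dots> = 0"
    unfolding lessThan_Suc_atMost by (rule presimplicial_sum_zero) (use sq in simp)
  finally show "bprime A (bprime A f) = 0" .
qed

text \<open>Rotating shifts the faces by one: the sum of the faces of \<open>t f\<close> is the last face of \<open>f\<close> plus
  \<open>t\<close> applied to the inner faces of \<open>f\<close>.\<close>

lemma hochschild_b_cyclic_t:
  assumes f: "Poly_Mapping.keys f \<subseteq> tensor_words A (Suc (Suc n))"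
  shows "hochschild_b A (f - cyclic_t f) = bprime A f - cyclic_t (bprime A f)"
proof -
  have tf: "Poly_Mapping.keys (cyclic_t f) \<subseteq> tensor_words A (Suc (Suc n))"
    using keys_cyclic_t_pow[OF f, of 1] by simp
  have "hochschild_b A (cyclic_t f) = (\<Sum>i\<le>Suc n. face_op i (cyclic_t f))"
    by (rule hochschild_b_eq[OF tf])
  also have "\<dots> = face_op 0 (cyclic_t f) + (\<Sum>i\<le>n. face_op (Suc i) (cyclic_t f))"
    by (rule sum.atMost_Suc_shift)
  also have "\<dots> = face_op (Suc n) f + (\<Sum>i\<le>n. cyclic_t (face_op i f))"
    by (simp add: face_op_cyclic_t_0[OF f] face_op_cyclic_t_Suc[OF f])
  also have "(\<Sum>i\<le>n. cyclic_t (face_op i f)) = cyclic_t (bprime A f)"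
    by (simp add: bprime_eq[OF f] lin_op_sum[OF lin_op_cyclic_t] lessThan_Suc_atMost)
  finally show ?thesis
    by (simp add: lin_opD(5)[OF lin_op_hochschild_b] hochschild_b_eq[OF f] bprime_eq[OF f]
        lessThan_Suc_atMost)
qed

lemma cyclic_t_N:
  fixes f :: "'a list \<Rightarrow>\<^sub>0 'k"
  assumes f: "Poly_Mapping.keys f \<subseteq> tensor_words A (Suc n)"
  shows "cyclic_t (cyclic_N n f) = cyclic_N n f" "cyclic_N n (cyclic_t f) = cyclic_N n f"
proof -
  have "cyclic_t (cyclic_N n f) = (\<Sum>i\<le>n. (cyclic_t ^^ Suc i) f)"
    by (simp add: cyclic_N_def lin_op_sum[OF lin_op_cyclic_t])
  also have "\<dots> = (\<Sum>i\<le>Suc n. (cyclic_t ^^ i) f) - f"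
    by (subst sum.atMost_Suc_shift) simp
  also have "\<dots> = cyclic_N n f"
    using cyclic_t_pow_Suc[OF f] by (simp add: cyclic_N_def)
  finally show "cyclic_t (cyclic_N n f) = cyclic_N n f" .
  then show "cyclic_N n (cyclic_t f) = cyclic_N n f"
    by (simp add: cyclic_N_def lin_op_sum[OF lin_op_cyclic_t] funpow_swap1)
qed

lemma cyclic_t_pow_N:
  fixes f :: "'a list \<Rightarrow>\<^sub>0 'k"
  assumes f: "Poly_Mapping.keys f \<subseteq> tensor_words A (Suc n)"
  shows "(cyclic_t ^^ i) (cyclic_N n f) = cyclic_N n f" "cyclic_N n ((cyclic_t ^^ i) f) = cyclic_N n f"
  by (induction i) (use cyclic_t_N(1)[OF f] cyclic_t_N(2)[OF keys_cyclic_t_pow[OF f]] in simp_all)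

lemma keys_cyclic_N:
  fixes f :: "'a list \<Rightarrow>\<^sub>0 'k"
  assumes f: "Poly_Mapping.keys f \<subseteq> tensor_words A (Suc n)"
  shows "Poly_Mapping.keys (cyclic_N n f) \<subseteq> tensor_words A (Suc n)"
  unfolding cyclic_N_def by (intro keys_sum_subset keys_cyclic_t_pow f)

text \<open>Since \<open>face_op i\<close> is conjugate to \<open>face_op 0\<close> by \<open>cyclic_t ^^ i\<close> and the norm absorbs powers
  of \<open>cyclic_t\<close>, both sides are equal to \<open>N \<circ> face_op 0 \<circ> N\<close>.\<close>

lemma cyclic_N_hochschild_b:
  assumes f: "Poly_Mapping.keys f \<subseteq> tensor_words A (Suc (Suc n))"
  shows "cyclic_N n (hochschild_b A f) = bprime A (cyclic_N (Suc n) f)"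
proof -
  let ?g = "face_op 0 (cyclic_N (Suc n) f)"
  have "bprime A (cyclic_N (Suc n) f) = (\<Sum>i\<le>n. face_op i ((cyclic_t ^^ i) (cyclic_N (Suc n) f)))"
    by (simp add: bprime_eq[OF keys_cyclic_N[OF f]] cyclic_t_pow_N[OF f] lessThan_Suc_atMost)
  also have "\<dots> = cyclic_N n ?g"
    by (simp add: face_op_cyclic_t_pow[OF keys_cyclic_N[OF f]] cyclic_N_def[of n])
  finally have rhs: "bprime A (cyclic_N (Suc n) f) = cyclic_N n ?g" .
  have summand: "cyclic_N n (face_op i f) = cyclic_N n (face_op 0 ((cyclic_t ^^ (Suc (Suc n) - i)) f))"
    if "i \<le> Suc n" for i
  proof -
    let ?h = "(cyclic_t ^^ (Suc (Suc n) - i)) f"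
    have h: "Poly_Mapping.keys ?h \<subseteq> tensor_words A (Suc (Suc n))" by (rule keys_cyclic_t_pow[OF f])
    have "(cyclic_t ^^ i) ?h = (cyclic_t ^^ (i + (Suc (Suc n) - i))) f" by (simp only: funpow_add o_apply)
    also have "\<dots> = f" using that cyclic_t_pow_Suc[OF f] by simp
    finally have "face_op i f = (cyclic_t ^^ i) (face_op 0 ?h)"
      using face_op_cyclic_t_pow[OF h that] by simp
    then show ?thesis
      using cyclic_t_pow_N(2)[OF keys_face_op[OF _ h], of 0 i] by simp
  qed
  have "cyclic_N n (hochschild_b A f) = (\<Sum>i\<le>Suc n. cyclic_N n (face_op i f))"
    by (simp only: hochschild_b_eq[OF f] lin_op_sum[OF lin_op_cyclic_N])
  also have "\<dots> = cyclic_N n (face_op 0 (\<Sum>i\<le>Suc n. (cyclic_t ^^ (Suc (Suc n) - i)) f))"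
    by (simp add: summand lin_op_sum[OF lin_op_cyclic_N] lin_op_sum[OF lin_op_face_op]
        del: sum.atMost_Suc)
  also have "(\<Sum>i\<le>Suc n. (cyclic_t ^^ (Suc (Suc n) - i)) f) = (\<Sum>i\<le>Suc n. (cyclic_t ^^ Suc i) f)"
    by (rule sum.reindex_bij_witness[of _ "\<lambda>i. Suc n - i" "\<lambda>i. Suc n - i"]) (auto simp: Suc_diff_le)
  also have "\<dots> = cyclic_t (cyclic_N (Suc n) f)"
    by (simp add: cyclic_N_def lin_op_sum[OF lin_op_cyclic_t] lin_opD(1)[OF lin_op_cyclic_t])
  finally show ?thesis using rhs cyclic_t_N(1)[OF f] by simp
qed

text \<open>The face of index \<open>0\<close> is linear in every slot; the others are conjugate to it by rotations.\<close>

lemma tensor_operator_face_op: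
  assumes "i \<le> Suc n"
  shows "tensor_operator A (Suc (Suc n)) A (Suc n) (face_op i)"
proof -
  have 0: "tensor_operator A (Suc (Suc n)) A (Suc n) (face_op 0)"
    unfolding face_op_def
    by (rule tensor_operator_slotwise[OF algebra_module algebra_module slotwise_face_0])
  have conj: "tensor_operator A (Suc (Suc n)) A (Suc n)
      (\<lambda>f. (cyclic_t ^^ i) (face_op 0 ((cyclic_t ^^ (Suc (Suc n) - i)) f)))"
    by (rule tensor_operator_comp[OF tensor_operator_funpow[OF tensor_operator_cyclic_t]
          tensor_operator_comp[OF 0 tensor_operator_funpow[OF tensor_operator_cyclic_t]]])
  show ?thesis
  proof (rule tensor_operator_cong[OF algebra_module conj lin_op_face_op])
    fix xs assume "xs \<in> tensor_words A (Suc (Suc n))"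
    then have w: "Poly_Mapping.keys (Poly_Mapping.single xs (1 :: 'k)) \<subseteq> tensor_words A (Suc (Suc n))" by simp
    let ?h = "(cyclic_t ^^ (Suc (Suc n) - i)) (Poly_Mapping.single xs (1 :: 'k))"
    have "(cyclic_t ^^ i) ?h = (cyclic_t ^^ (i + (Suc (Suc n) - i))) (Poly_Mapping.single xs 1)"
      by (simp only: funpow_add o_apply)
    also have "\<dots> = Poly_Mapping.single xs 1" using assms cyclic_t_pow_Suc[OF w] by simp
    finally show "face_op i (Poly_Mapping.single xs 1) =
        (cyclic_t ^^ i) (face_op 0 ((cyclic_t ^^ (Suc (Suc n) - i)) (Poly_Mapping.single xs 1)))"
      using face_op_cyclic_t_pow[OF keys_cyclic_t_pow[OF w] assms, of "Suc (Suc n) - i"] by metis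
  qed
qed

lemma tensor_operator_hochschild_b: "tensor_operator A (Suc (Suc n)) A (Suc n) (hochschild_b A)"
proof (rule tensor_operator_cong[OF algebra_module _ lin_op_hochschild_b])
  show "tensor_operator A (Suc (Suc n)) A (Suc n) (\<lambda>f. \<Sum>i\<in>{..Suc n}. face_op i f)"
    by (rule tensor_operator_sum[OF algebra_module]) (simp add: tensor_operator_face_op)
  show "hochschild_b A (Poly_Mapping.single w 1) = (\<Sum>i\<in>{..Suc n}. face_op i (Poly_Mapping.single w 1))"
    if "w \<in> tensor_words A (Suc (Suc n))" for w
    by (rule hochschild_b_eq) (use that in simp)
qed

lemma tensor_operator_bprime: "tensor_operator A (Suc (Suc n)) A (Suc n) (bprime A)"
proof (rule tensor_operator_cong[OF algebra_module _ lin_op_bprime])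
  show "tensor_operator A (Suc (Suc n)) A (Suc n) (\<lambda>f. \<Sum>i\<in>{..<Suc n}. face_op i f)"
    by (rule tensor_operator_sum[OF algebra_module]) (simp add: tensor_operator_face_op)
  show "bprime A (Poly_Mapping.single w 1) = (\<Sum>i\<in>{..<Suc n}. face_op i (Poly_Mapping.single w 1))"
    if "w \<in> tensor_words A (Suc (Suc n))" for w
    by (rule bprime_eq) (use that in simp)
qed

lemma tensor_operator_cyclic_N: "tensor_operator A (Suc n) A (Suc n) (cyclic_N n)"
  unfolding cyclic_N_def[abs_def]
  by (intro tensor_operator_sum[OF algebra_module] tensor_operator_funpow tensor_operator_cyclic_t)

end

subsection \<open>The cyclic bicomplex of an algebra\<close>

lemma tensor_op_add:
  assumes A: "module scalars A" and B: "module scalars B"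
    and G: "tensor_operator A n B m G" and H: "tensor_operator A n B m H"
    and x: "x \<in> carrier (tensor_power A n)"
  shows "tensor_op B m G x \<oplus>\<^bsub>tensor_power B m\<^esub> tensor_op B m H x = tensor_op B m (\<lambda>f. G f + H f) x"
proof -
  obtain f where f: "Poly_Mapping.keys f \<subseteq> tensor_words A n" "x = tensor_class A n f"
    using tensor_power_cases[OF A x] .
  show ?thesis
    using tensor_class_add[OF B tensor_operatorD(2)[OF G f(1)] tensor_operatorD(2)[OF H f(1)]] f
    by (simp add: tensor_op_class[OF A B G] tensor_op_class[OF A B H]
        tensor_op_class[OF A B tensor_operator_add[OF B G H]])
qed

lemma tensor_op_zero:
  assumes A: "module scalars A" and B: "module scalars B" and G: "tensor_operator A n B m G"
    and "\<And>f. Poly_Mapping.keys f \<subseteq> tensor_words A n \<Longrightarrow> G f = 0"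
    and x: "x \<in> carrier (tensor_power A n)"
  shows "tensor_op B m G x = \<zero>\<^bsub>tensor_power B m\<^esub>"
proof -
  obtain f where f: "Poly_Mapping.keys f \<subseteq> tensor_words A n" "x = tensor_class A n f"
    using tensor_power_cases[OF A x] .
  show ?thesis using assms(4)[OF f(1)] by (simp add: f tensor_op_class[OF A B G f(1)] tensor_class_zero[OF B])
qed

text \<open>Outside \<open>J\<close> the bicomplex has zero spaces but keeps its maps; a linear map from column to
  column remains one if the second is retained whenever the first is.\<close>

lemma linear_map_zero_space:
  assumes V: "module scalars V" and W: "module scalars W" and f: "linear_map V W f" and PQ: "P \<Longrightarrow> Q"
  shows "linear_map (if P then V else zero_space V) (if Q then W else zero_space W) f"
proof -
  interpret V: module scalars V by fact
  interpret W: module scalars W by fact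
  show ?thesis
    using PQ linear_mapD[OF f] linear_map_zero[OF V W f]
    by (cases P; cases Q; intro linear_mapI) (auto simp: zero_space_def module_smult_zero[OF V] module_smult_zero[OF W])
qed

definition column_op :: "('k::field, 'a) module \<Rightarrow> nat \<Rightarrow> ('a list \<Rightarrow>\<^sub>0 'k) \<Rightarrow> ('a list \<Rightarrow>\<^sub>0 'k)" where
  "column_op A p = (if even p then hochschild_b A else (\<lambda>f. - bprime A f))"

definition row_op :: "nat \<Rightarrow> nat \<Rightarrow> ('a list \<Rightarrow>\<^sub>0 'k::field) \<Rightarrow> ('a list \<Rightarrow>\<^sub>0 'k)" where
  "row_op p q = (if odd p then (\<lambda>f. f - cyclic_t f) else cyclic_N q)"

lemma cyclic_bicomplex_simps:
  "bispace (cyclic_bicomplex J A) p q =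
     (if p \<in> J then tensor_power A (Suc q) else zero_space (tensor_power A (Suc q)))"
  "hdiff (cyclic_bicomplex J A) p q = tensor_op A (Suc q) (row_op p q)"
  "vdiff (cyclic_bicomplex J A) p q = tensor_op A q (column_op A p)"
  by (simp_all add: cyclic_bicomplex_def column_op_def row_op_def)

context
  fixes A :: "('k::field, 'a) module"
  assumes A: "nonunital_algebra A"
begin

lemma tensor_operator_column_op: "tensor_operator A (Suc (Suc q)) A (Suc q) (column_op A p)"
  by (simp add: column_op_def tensor_operator_hochschild_b[OF A]
      tensor_operator_uminus[OF algebra_module[OF A] tensor_operator_bprime[OF A]])

lemma tensor_operator_row_op: "tensor_operator A (Suc q) A (Suc q) (row_op p q)"
  by (simp add: row_op_def tensor_operator_cyclic_N[OF A]
      tensor_operator_diff[OF algebra_module[OF A] tensor_operator_id tensor_operator_cyclic_t[OF A]])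

lemma row_op_row_op:
  fixes f :: "'a list \<Rightarrow>\<^sub>0 'k"
  assumes "Poly_Mapping.keys f \<subseteq> tensor_words A (Suc q)"
  shows "row_op p q (row_op (Suc p) q f) = 0"
  using cyclic_t_N[OF A assms] by (simp add: row_op_def lin_opD[OF lin_op_cyclic_N[OF A]])

lemma column_op_column_op:
  assumes "Poly_Mapping.keys f \<subseteq> tensor_words A (Suc (Suc (Suc q)))"
  shows "column_op A p (column_op A p f) = 0"
  using hochschild_b_square[OF A assms] by (simp add: column_op_def lin_opD[OF lin_op_bprime[OF A]])

text \<open>For odd columns this is \<open>b (1 - t) = (1 - t) b'\<close>, for even ones \<open>N b = b' N\<close>; the sign of
  the odd columns turns commutation into anticommutation.\<close>

lemma row_op_column_op:
  assumes "Poly_Mapping.keys f \<subseteq> tensor_words A (Suc (Suc q))"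
  shows "row_op (Suc p) q (column_op A (Suc p) f) + column_op A p (row_op (Suc p) (Suc q) f) = 0"
  using hochschild_b_cyclic_t[OF A assms] cyclic_N_hochschild_b[OF A assms]
  by (simp add: row_op_def column_op_def lin_opD[OF lin_op_cyclic_t[OF A]])

lemma cyclic_space_module:
  "module (scalars :: 'k ring) (bispace (cyclic_bicomplex J A) p q)"
  using tensor_power_module[OF algebra_module[OF A]]
  by (simp add: cyclic_bicomplex_simps zero_space_module)

lemma cyclic_space_subset:
  "x \<in> carrier (bispace (cyclic_bicomplex J A) p q) \<Longrightarrow> x \<in> carrier (tensor_power A (Suc q))"
  using zero_mem[OF tensor_power_module[OF algebra_module[OF A]]]
  by (simp add: cyclic_bicomplex_simps zero_space_def split: if_splits)

lemma cyclic_space_add: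
  "x \<oplus>\<^bsub>bispace (cyclic_bicomplex J A) p q\<^esub> y = x \<oplus>\<^bsub>tensor_power A (Suc q)\<^esub> y"
  "\<zero>\<^bsub>bispace (cyclic_bicomplex J A) p q\<^esub> = \<zero>\<^bsub>tensor_power A (Suc q)\<^esub>"
  "c \<odot>\<^bsub>bispace (cyclic_bicomplex J A) p q\<^esub> x = c \<odot>\<^bsub>tensor_power A (Suc q)\<^esub> x"
  by (simp_all add: cyclic_bicomplex_simps zero_space_def)

lemma is_bicomplex_cyclic:
  assumes J: "\<And>p. Suc p \<in> J \<Longrightarrow> p \<in> J"
  shows "is_bicomplex (cyclic_bicomplex J A)"
  unfolding is_bicomplex_def
proof (intro conjI allI ballI)
  note mod = algebra_module[OF A] and tmod = tensor_power_module[OF algebra_module[OF A]]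
  note col = tensor_operator_column_op and row = tensor_operator_row_op
  fix p q
  show "module (scalars :: 'k ring) (bispace (cyclic_bicomplex J A) p q)"
    by (rule cyclic_space_module)
  show "linear_map (bispace (cyclic_bicomplex J A) (Suc p) q) (bispace (cyclic_bicomplex J A) p q)
      (hdiff (cyclic_bicomplex J A) (Suc p) q)"
    unfolding cyclic_bicomplex_simps
    by (rule linear_map_zero_space[OF tmod tmod linear_map_tensor_op[OF mod mod row]]) (rule J)
  show "linear_map (bispace (cyclic_bicomplex J A) p (Suc q)) (bispace (cyclic_bicomplex J A) p q)
      (vdiff (cyclic_bicomplex J A) p (Suc q))"
    unfolding cyclic_bicomplex_simps
    by (rule linear_map_zero_space[OF tmod tmod linear_map_tensor_op[OF mod mod col]])
  show "hdiff (cyclic_bicomplex J A) (Suc p) q (hdiff (cyclic_bicomplex J A) (Suc (Suc p)) q x) =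
      \<zero>\<^bsub>bispace (cyclic_bicomplex J A) p q\<^esub>"
    if "x \<in> carrier (bispace (cyclic_bicomplex J A) (Suc (Suc p)) q)" for x
    using tensor_op_comp[OF mod mod mod row row cyclic_space_subset[OF that]]
      tensor_op_zero[OF mod mod tensor_operator_comp[OF row row] row_op_row_op cyclic_space_subset[OF that]]
    by (simp only: cyclic_space_add cyclic_bicomplex_simps(2,3))
  show "vdiff (cyclic_bicomplex J A) p (Suc q) (vdiff (cyclic_bicomplex J A) p (Suc (Suc q)) x) =
      \<zero>\<^bsub>bispace (cyclic_bicomplex J A) p q\<^esub>"
    if "x \<in> carrier (bispace (cyclic_bicomplex J A) p (Suc (Suc q)))" for x
    using tensor_op_comp[OF mod mod mod col col cyclic_space_subset[OF that]]
      tensor_op_zero[OF mod mod tensor_operator_comp[OF col col] column_op_column_op cyclic_space_subset[OF that]]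
    by (simp only: cyclic_space_add cyclic_bicomplex_simps(2,3))
  show "hdiff (cyclic_bicomplex J A) (Suc p) q (vdiff (cyclic_bicomplex J A) (Suc p) (Suc q) x)
      \<oplus>\<^bsub>bispace (cyclic_bicomplex J A) p q\<^esub>
      vdiff (cyclic_bicomplex J A) p (Suc q) (hdiff (cyclic_bicomplex J A) (Suc p) (Suc q) x) =
      \<zero>\<^bsub>bispace (cyclic_bicomplex J A) p q\<^esub>"
    if "x \<in> carrier (bispace (cyclic_bicomplex J A) (Suc p) (Suc q))" for x
    using tensor_op_comp[OF mod mod mod row col cyclic_space_subset[OF that]]
      tensor_op_comp[OF mod mod mod col row cyclic_space_subset[OF that]]
      tensor_op_add[OF mod mod tensor_operator_comp[OF row col] tensor_operator_comp[OF col row]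
        cyclic_space_subset[OF that]]
      tensor_op_zero[OF mod mod tensor_operator_add[OF mod tensor_operator_comp[OF row col]
          tensor_operator_comp[OF col row]] row_op_column_op cyclic_space_subset[OF that]]
    by (simp only: cyclic_space_add cyclic_bicomplex_simps(2,3))
qed

end

text \<open>For such \<open>J\<close> the columns in \<open>J\<close> form a subcomplex, as the horizontal differential lowers the
  column. Both \<open>UNIV\<close> and \<open>{0, 1}\<close> are of this kind.\<close>

definition lower_closed :: "nat set \<Rightarrow> bool" where
  "lower_closed J \<longleftrightarrow> (\<forall>p. Suc p \<in> J \<longrightarrow> p \<in> J)"

lemma is_complex_cyclic_total:
  assumes "nonunital_algebra A" "lower_closed J"
  shows "is_complex (cyclic_total J A)"
  unfolding cyclic_total_def
  using assms(2) by (intro is_complex_total is_bicomplex_cyclic[OF assms(1)]) (auto simp: lower_closed_def)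

lemma cyclic_total_space:
  "chain_space (cyclic_total J A) n = direct_sum {..n} (\<lambda>p. bispace (cyclic_bicomplex J A) p (n - p))"
  by (simp add: cyclic_total_def total_space)

lemma cyclic_total_diff:
  "diff (cyclic_total J A) (Suc n) x = (\<lambda>p\<in>{..n}. tensor_op A (Suc (n - p)) (row_op (Suc p) (n - p)) (x (Suc p))
      \<oplus>\<^bsub>bispace (cyclic_bicomplex J A) p (n - p)\<^esub> tensor_op A (Suc n - p) (column_op A p) (x p))"
  by (simp add: cyclic_total_def total_diff cyclic_bicomplex_simps)


subsection \<open>Operators applied in every tensor degree\<close>

text \<open>Like \<^const>\<open>cyclic_map\<close>, for operators that need not be induced by an algebra homomorphism:
  alternating sums of faces and the linear contraction of the rows are of this form.\<close>

definition levelwise :: "('k::field, 'b) module \<Rightarrow> (('a list \<Rightarrow>\<^sub>0 'k) \<Rightarrow> ('b list \<Rightarrow>\<^sub>0 'k)) \<Rightarrow> nat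
    \<Rightarrow> (nat \<Rightarrow> ('a list \<Rightarrow>\<^sub>0 'k) set) \<Rightarrow> (nat \<Rightarrow> ('b list \<Rightarrow>\<^sub>0 'k) set)" where
  "levelwise B G n x = (\<lambda>p\<in>{..n}. tensor_op B (Suc (n - p)) G (x p))"

lemma cyclic_map_levelwise: "cyclic_map B f = levelwise B (map_op f)"
  by (intro ext) (simp add: cyclic_map_def levelwise_def map_op_def)

text \<open>The condition for \<open>levelwise B G\<close> to map the spaces of one total complex to those of
  the other, without compatibility with the differentials.\<close>

definition graded_operator ::
    "('k::field, 'a) module \<Rightarrow> ('k, 'b) module \<Rightarrow> (('a list \<Rightarrow>\<^sub>0 'k) \<Rightarrow> ('b list \<Rightarrow>\<^sub>0 'k)) \<Rightarrow> bool" where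
  "graded_operator A B G \<longleftrightarrow> (\<forall>n. tensor_operator A n B n G)"

text \<open>The differentials of the cyclic bicomplex are built from \<open>b\<close>, \<open>b'\<close> and \<open>t\<close>, so that such operators
  induce chain maps.\<close>

definition cyclic_operator ::
    "('k::field, 'a) module \<Rightarrow> ('k, 'b) module \<Rightarrow> (('a list \<Rightarrow>\<^sub>0 'k) \<Rightarrow> ('b list \<Rightarrow>\<^sub>0 'k)) \<Rightarrow> bool" where
  "cyclic_operator A B G \<longleftrightarrow> graded_operator A B G \<and>
     (\<forall>n f. Poly_Mapping.keys f \<subseteq> tensor_words A (Suc n) \<longrightarrow>
        G (hochschild_b A f) = hochschild_b B (G f) \<and> G (bprime A f) = bprime B (G f) \<and>
        G (cyclic_t f) = cyclic_t (G f))"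

lemma graded_operator_map_op:
  assumes "module scalars A" "module scalars B" "linear_map A B f"
  shows "graded_operator A B (map_op f)"
  by (simp add: graded_operator_def tensor_operator_map_op[OF assms])

lemma cyclic_operator_map_op:
  fixes A :: "('k::field, 'a) module" and B :: "('k, 'b) module"
  assumes A: "nonunital_algebra A" and B: "nonunital_algebra B" and f: "linear_map A B f"
    and mult: "\<And>x y. x \<in> carrier A \<Longrightarrow> y \<in> carrier A \<Longrightarrow> f (x \<otimes>\<^bsub>A\<^esub> y) = f x \<otimes>\<^bsub>B\<^esub> f y"
  shows "cyclic_operator A B (map_op f)"
  unfolding cyclic_operator_def
proof (intro conjI allI impI)
  note mA = algebra_module[OF A] and mB = algebra_module[OF B]
  show gr: "graded_operator A B (map_op f)" by (rule graded_operator_map_op[OF mA mB f])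
  fix n and g :: "'a list \<Rightarrow>\<^sub>0 'k" assume g: "Poly_Mapping.keys g \<subseteq> tensor_words A (Suc n)"
  have mg: "Poly_Mapping.keys (map_op f g) \<subseteq> tensor_words B (Suc n)"
    using gr g by (auto simp: graded_operator_def dest!: tensor_operatorD(2))
  have face: "map_op f (face_op A i g) = face_op B i (map_op f g)" for i
  proof (rule lin_op_eqI[OF lin_op_comp[OF lin_op_map_op lin_op_face_op[OF A]]
        lin_op_comp[OF lin_op_face_op[OF B] lin_op_map_op] g])
    fix xs assume xs: "xs \<in> tensor_words A (Suc n)"
    then have ne: "xs \<noteq> []" and mem: "set xs \<subseteq> carrier A" by (auto simp: tensor_words_def)
    have "last xs \<in> carrier A" "hd xs \<in> carrier A" using ne mem by auto
    moreover have "xs ! i \<in> carrier A" "xs ! Suc i \<in> carrier A" if "Suc i < length xs"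
      using that mem by (auto simp: subset_iff)
    ultimately have "map f (word_face A i xs) = word_face B i (map f xs)"
      using ne by (auto simp: word_face_def mult last_map hd_map map_tl map_butlast take_map drop_map)
    then show "map_op f (face_op A i (Poly_Mapping.single xs 1)) =
        face_op B i (map_op f (Poly_Mapping.single xs 1))"
      by (simp add: face_op_single[OF A] face_op_single[OF B])
  qed
  show "map_op f (hochschild_b A g) = hochschild_b B (map_op f g)"
    by (simp add: hochschild_b_eq[OF A g] hochschild_b_eq[OF B mg] lin_op_sum[OF lin_op_map_op] face)
  show "map_op f (bprime A g) = bprime B (map_op f g)"
    by (simp add: bprime_eq[OF A g] bprime_eq[OF B mg] lin_op_sum[OF lin_op_map_op] face)
  show "map_op f (cyclic_t g) = cyclic_t (map_op f g)"
  proof (rule lin_op_eqI[OF lin_op_comp[OF lin_op_map_op lin_op_cyclic_t[OF A]]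
        lin_op_comp[OF lin_op_cyclic_t[OF B] lin_op_map_op] g])
    fix xs assume "xs \<in> tensor_words A (Suc n)"
    then have "xs \<noteq> []" by (auto simp: tensor_words_def)
    then show "map_op f (cyclic_t (Poly_Mapping.single xs (1 :: 'k))) =
        cyclic_t (map_op f (Poly_Mapping.single xs 1))"
      by (simp add: cyclic_t_single[OF A] cyclic_t_single[OF B] rot_def last_map map_butlast)
  qed
qed

lemma cyclic_operator_fscale:
  assumes A: "nonunital_algebra A" and B: "nonunital_algebra B" and G: "cyclic_operator A B G"
  shows "cyclic_operator A B (\<lambda>f. fscale c (G f))"
  using G unfolding cyclic_operator_def graded_operator_def
  by (auto simp: lin_opD(2)[OF lin_op_hochschild_b[OF B]] lin_opD(2)[OF lin_op_bprime[OF B]]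
      lin_opD(2)[OF lin_op_cyclic_t[OF B]] intro!: tensor_operator_fscale[OF algebra_module[OF B]])

lemma cyclic_operator_sum:
  assumes A: "nonunital_algebra A" and B: "nonunital_algebra B"
    and G: "\<And>i. i \<in> I \<Longrightarrow> cyclic_operator A B (G i)"
  shows "cyclic_operator A B (\<lambda>f. \<Sum>i\<in>I. G i f)"
  using G unfolding cyclic_operator_def graded_operator_def
  by (auto simp: lin_op_sum[OF lin_op_hochschild_b[OF B]] lin_op_sum[OF lin_op_bprime[OF B]]
      lin_op_sum[OF lin_op_cyclic_t[OF B]] intro!: tensor_operator_sum[OF algebra_module[OF B]])

lemma levelwise_component: "p \<le> n \<Longrightarrow> levelwise B G n x p = tensor_op B (Suc (n - p)) G (x p)"
  by (simp add: levelwise_def)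

lemma cyclic_total_component:
  assumes A: "nonunital_algebra A" and "x \<in> carrier (chain_space (cyclic_total J A) n)" "p \<le> n"
  shows "x p \<in> carrier (bispace (cyclic_bicomplex J A) p (n - p))"
    and "x p \<in> carrier (tensor_power A (Suc (n - p)))"
proof -
  show "x p \<in> carrier (bispace (cyclic_bicomplex J A) p (n - p))"
    using assms by (auto simp: cyclic_total_space direct_sum_simps PiE_iff)
  then show "x p \<in> carrier (tensor_power A (Suc (n - p)))" by (rule cyclic_space_subset[OF A])
qed

context
  fixes A :: "('k::field, 'a) module" and B :: "('k, 'b) module" and J :: "nat set"
  assumes A: "nonunital_algebra A" and B: "nonunital_algebra B"
begin

lemma linear_map_levelwise:
  assumes G: "graded_operator A B G"
  shows "linear_map (chain_space (cyclic_total J A) n) (chain_space (cyclic_total J B) n) (levelwise B G n)"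
  unfolding cyclic_total_space[of J B]
proof (rule linear_map_direct_sumI)
  note mA = algebra_module[OF A] and mB = algebra_module[OF B]
  show "module (scalars :: 'k ring) (chain_space (cyclic_total J A) n)"
    unfolding cyclic_total_space by (rule direct_sum_module) (rule cyclic_space_module[OF A])
  fix p assume p: "p \<in> {..n}"
  have "linear_map (tensor_power A (Suc (n - p))) (tensor_power B (Suc (n - p))) (tensor_op B (Suc (n - p)) G)"
    using G by (intro linear_map_tensor_op[OF mA mB]) (simp add: graded_operator_def)
  then have "linear_map (bispace (cyclic_bicomplex J A) p (n - p)) (bispace (cyclic_bicomplex J B) p (n - p))
      (tensor_op B (Suc (n - p)) G)"
    unfolding cyclic_bicomplex_simps
    by (rule linear_map_zero_space[OF tensor_power_module[OF mA] tensor_power_module[OF mB]])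
  moreover have "linear_map (chain_space (cyclic_total J A) n) (bispace (cyclic_bicomplex J A) p (n - p)) (\<lambda>x. x p)"
    unfolding cyclic_total_space using p by (rule linear_map_component)
  ultimately have "linear_map (chain_space (cyclic_total J A) n) (bispace (cyclic_bicomplex J B) p (n - p))
      (\<lambda>x. tensor_op B (Suc (n - p)) G (x p))"
    by (rule linear_map_comp[rotated])
  then show "linear_map (chain_space (cyclic_total J A) n) (bispace (cyclic_bicomplex J B) p (n - p))
      (\<lambda>x. levelwise B G n x p)"
    using p by (simp add: levelwise_def)
qed (simp add: levelwise_def)

lemma levelwise_diff:
  assumes G: "cyclic_operator A B G" and x: "x \<in> carrier (chain_space (cyclic_total J A) (Suc n))"
  shows "levelwise B G n (diff (cyclic_total J A) (Suc n) x) = diff (cyclic_total J B) (Suc n) (levelwise B G (Suc n) x)"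
  unfolding cyclic_total_diff levelwise_def
proof (rule restrict_ext)
  note mA = algebra_module[OF A] and mB = algebra_module[OF B]
  fix p assume "p \<in> {..n}"
  then have p: "p \<le> n" "Suc n - p = Suc (n - p)" by auto
  define q where "q = n - p"
  have Gt: "tensor_operator A m B m G" for m using G by (simp add: cyclic_operator_def graded_operator_def)
  have x1: "x (Suc p) \<in> carrier (tensor_power A (Suc q))" and x0: "x p \<in> carrier (tensor_power A (Suc (Suc q)))"
    using cyclic_total_component(2)[OF A x, of "Suc p"] cyclic_total_component(2)[OF A x, of p] p
    by (simp_all add: q_def)
  note l = linear_mapD[OF linear_map_tensor_op[OF mA mB Gt]]
  note rowA = tensor_operator_row_op[OF A] and colA = tensor_operator_column_op[OF A]
    and rowB = tensor_operator_row_op[OF B] and colB = tensor_operator_column_op[OF B]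
  note lr = linear_mapD(1)[OF linear_map_tensor_op[OF mA mA rowA]]
    and lc = linear_mapD(1)[OF linear_map_tensor_op[OF mA mA colA]]
  have Nw: "Poly_Mapping.keys ((cyclic_t ^^ i) f) \<subseteq> tensor_words A (Suc m) \<and> G ((cyclic_t ^^ i) f) = (cyclic_t ^^ i) (G f)"
    if "Poly_Mapping.keys f \<subseteq> tensor_words A (Suc m)" for f m i
  proof (induction i)
    case (Suc i)
    then show ?case
      using G keys_cyclic_t_pow[OF A that, of "Suc i"] by (auto simp: cyclic_operator_def)
  qed (use that in simp)
  have row: "G (row_op (Suc p) q f) = row_op (Suc p) q (G f)" if "Poly_Mapping.keys f \<subseteq> tensor_words A (Suc q)" for f
  proof -
    have "G (cyclic_N q f) = cyclic_N q (G f)"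
      unfolding cyclic_N_def lin_op_sum[OF tensor_operatorD(1)[OF Gt]]
      by (intro sum.cong refl conjunct2[OF Nw[OF that]])
    then show ?thesis
      using G that lin_opD(5)[OF tensor_operatorD(1)[OF Gt]]
      by (auto simp: row_op_def cyclic_operator_def)
  qed
  have col: "G (column_op A p f) = column_op B p (G f)" if "Poly_Mapping.keys f \<subseteq> tensor_words A (Suc (Suc q))" for f
    using G that lin_opD(4)[OF tensor_operatorD(1)[OF Gt]]
    by (auto simp: column_op_def cyclic_operator_def)
  have "tensor_op B (Suc q) G (tensor_op A (Suc q) (row_op (Suc p) q) (x (Suc p))) =
      tensor_op B (Suc q) (row_op (Suc p) q) (tensor_op B (Suc q) G (x (Suc p)))"
    unfolding tensor_op_comp[OF mA mA mB Gt rowA x1] tensor_op_comp[OF mA mB mB rowB Gt x1]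
    by (rule tensor_op_cong[OF mA mB tensor_operator_comp[OF Gt rowA] tensor_operator_comp[OF rowB Gt] _ x1])
      (rule row, simp)
  moreover have "tensor_op B (Suc q) G (tensor_op A (Suc q) (column_op A p) (x p)) =
      tensor_op B (Suc q) (column_op B p) (tensor_op B (Suc (Suc q)) G (x p))"
    unfolding tensor_op_comp[OF mA mA mB Gt colA x0] tensor_op_comp[OF mA mB mB colB Gt x0]
    by (rule tensor_op_cong[OF mA mB tensor_operator_comp[OF Gt colA] tensor_operator_comp[OF colB Gt] _ x0])
      (rule col, simp)
  ultimately show "tensor_op B (Suc (n - p)) G ((\<lambda>p\<in>{..n}. tensor_op A (Suc (n - p)) (row_op (Suc p) (n - p)) (x (Suc p))
      \<oplus>\<^bsub>bispace (cyclic_bicomplex J A) p (n - p)\<^esub> tensor_op A (Suc n - p) (column_op A p) (x p)) p) =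
    tensor_op B (Suc (n - p)) (row_op (Suc p) (n - p)) ((\<lambda>p\<in>{..Suc n}. tensor_op B (Suc (Suc n - p)) G (x p)) (Suc p))
      \<oplus>\<^bsub>bispace (cyclic_bicomplex J B) p (n - p)\<^esub>
      tensor_op B (Suc n - p) (column_op B p) ((\<lambda>p\<in>{..Suc n}. tensor_op B (Suc (Suc n - p)) G (x p)) p)"
    using p lr[OF x1] lc[OF x0]
    by (simp add: cyclic_space_add[OF A] cyclic_space_add[OF B] l(2) flip: q_def)
qed

end

lemma levelwise_comp:
  assumes A: "nonunital_algebra A" and B: "nonunital_algebra B" and C: "nonunital_algebra C"
    and G: "graded_operator B C G" and H: "graded_operator A B H"
    and x: "x \<in> carrier (chain_space (cyclic_total J A) n)"
  shows "levelwise C G n (levelwise B H n x) = levelwise C (\<lambda>f. G (H f)) n x"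
  unfolding levelwise_def
proof (rule restrict_ext)
  fix p assume "p \<in> {..n}"
  then show "tensor_op C (Suc (n - p)) G ((\<lambda>p\<in>{..n}. tensor_op B (Suc (n - p)) H (x p)) p) =
      tensor_op C (Suc (n - p)) (\<lambda>f. G (H f)) (x p)"
    using tensor_op_comp[OF algebra_module[OF A] algebra_module[OF B] algebra_module[OF C]
        G[unfolded graded_operator_def, rule_format] H[unfolded graded_operator_def, rule_format]
        cyclic_total_component(2)[OF A x, of p]] by simp
qed

lemma levelwise_cong:
  assumes A: "nonunital_algebra A" and B: "nonunital_algebra B"
    and G: "graded_operator A B G" and H: "graded_operator A B H"
    and "\<And>n w. w \<in> tensor_words A n \<Longrightarrow> G (Poly_Mapping.single w 1) = H (Poly_Mapping.single w 1)"
    and x: "x \<in> carrier (chain_space (cyclic_total J A) n)"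
  shows "levelwise B G n x = levelwise B H n x"
  unfolding levelwise_def
proof (rule restrict_ext)
  fix p assume "p \<in> {..n}"
  then show "tensor_op B (Suc (n - p)) G (x p) = tensor_op B (Suc (n - p)) H (x p)"
    using G H cyclic_total_component(2)[OF A x]
    by (intro tensor_op_cong[OF algebra_module[OF A] algebra_module[OF B]] assms(5))
      (auto simp: graded_operator_def)
qed

lemma levelwise_id:
  assumes A: "nonunital_algebra A" and x: "x \<in> carrier (chain_space (cyclic_total J A) n)"
  shows "levelwise A (\<lambda>f. f) n x = x"
proof (rule extensionalityI[of _ "{..n}"])
  note mA = algebra_module[OF A]
  fix p assume "p \<in> {..n}"
  moreover have "tensor_op A (Suc (n - p)) (\<lambda>f. f) y = y" if "y \<in> carrier (tensor_power A (Suc (n - p)))" for y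
    by (rule tensor_power_cases[OF mA that]) (simp add: tensor_op_class[OF mA mA tensor_operator_id])
  ultimately show "levelwise A (\<lambda>f. f) n x p = x p"
    using cyclic_total_component(2)[OF A x] by (simp add: levelwise_def)
qed (use x in \<open>auto simp: levelwise_def cyclic_total_space direct_sum_simps PiE_iff\<close>)


section \<open>The bicomplex of a simplicial algebra\<close>

lemma tensor_op_smult:
  assumes A: "module scalars A" and B: "module scalars B" and G: "tensor_operator A n B m G"
    and x: "x \<in> carrier (tensor_power A n)"
  shows "c \<odot>\<^bsub>tensor_power B m\<^esub> tensor_op B m G x = tensor_op B m (\<lambda>f. fscale c (G f)) x"
proof -
  obtain f where f: "Poly_Mapping.keys f \<subseteq> tensor_words A n" "x = tensor_class A n f"
    using tensor_power_cases[OF A x] .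
  show ?thesis
    using f tensor_class_smult[OF B tensor_operatorD(2)[OF G f(1)], of c]
    by (simp add: tensor_op_class[OF A B G] tensor_op_class[OF A B tensor_operator_fscale[OF B G]])
qed

lemma graded_operatorD: "graded_operator A B G \<Longrightarrow> tensor_operator A n B n G"
  by (simp add: graded_operator_def)

lemma graded_operator_fscale:
  "module scalars B \<Longrightarrow> graded_operator A B G \<Longrightarrow> graded_operator A B (\<lambda>f. fscale c (G f))"
  by (simp add: graded_operator_def tensor_operator_fscale)

lemma graded_operator_sum:
  "module scalars B \<Longrightarrow> (\<And>i. i \<in> I \<Longrightarrow> graded_operator A B (G i)) \<Longrightarrow>
    graded_operator A B (\<lambda>f. \<Sum>i\<in>I. G i f)"
  by (simp add: graded_operator_def tensor_operator_sum)

lemma graded_operator_add: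
  "module scalars B \<Longrightarrow> graded_operator A B G \<Longrightarrow> graded_operator A B H \<Longrightarrow>
    graded_operator A B (\<lambda>f. G f + H f)"
  by (simp add: graded_operator_def tensor_operator_add)

lemma graded_operator_zero: "module scalars B \<Longrightarrow> graded_operator A B (\<lambda>f. 0)"
  by (simp add: graded_operator_def tensor_operator_zero)

lemma graded_operator_comp:
  "graded_operator B C G \<Longrightarrow> graded_operator A B H \<Longrightarrow> graded_operator A C (\<lambda>f. G (H f))"
  unfolding graded_operator_def by (intro allI tensor_operator_comp[where G = G and H = H]) auto

lemma cyclic_operator_graded: "cyclic_operator A B G \<Longrightarrow> graded_operator A B G"
  by (simp add: cyclic_operator_def)

lemma cyclic_total_module:
  fixes A :: "('k::field, 'a) module"
  assumes "nonunital_algebra A"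
  shows "module (scalars :: 'k ring) (chain_space (cyclic_total J A) n)"
  unfolding cyclic_total_space by (rule direct_sum_module) (rule cyclic_space_module[OF assms])

context
  fixes A :: "('k::field, 'a) module" and B :: "('k, 'b) module" and J :: "nat set"
  assumes A: "nonunital_algebra A" and B: "nonunital_algebra B"
begin

lemma levelwise_zero:
  assumes "x \<in> carrier (chain_space (cyclic_total J A) n)"
  shows "levelwise B (\<lambda>f. 0) n x = \<zero>\<^bsub>chain_space (cyclic_total J B) n\<^esub>"
  unfolding levelwise_def cyclic_total_space direct_sum_simps cyclic_space_add[OF B]
proof (rule restrict_ext)
  fix p assume "p \<in> {..n}"
  then show "tensor_op B (Suc (n - p)) (\<lambda>f. 0) (x p) = \<zero>\<^bsub>tensor_power B (Suc (n - p))\<^esub>"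
    using tensor_op_zero[OF algebra_module[OF A] algebra_module[OF B]
        tensor_operator_zero[OF algebra_module[OF B]] refl cyclic_total_component(2)[OF A assms, of p]]
    by simp
qed

lemma levelwise_add:
  assumes G: "graded_operator A B G" and H: "graded_operator A B H"
    and x: "x \<in> carrier (chain_space (cyclic_total J A) n)"
  shows "levelwise B G n x \<oplus>\<^bsub>chain_space (cyclic_total J B) n\<^esub> levelwise B H n x =
    levelwise B (\<lambda>f. G f + H f) n x"
  unfolding cyclic_total_space direct_sum_simps cyclic_space_add[OF B]
    levelwise_def[of B "\<lambda>f. G f + H f"]
proof (rule restrict_ext)
  fix p assume "p \<in> {..n}"
  then show "levelwise B G n x p \<oplus>\<^bsub>tensor_power B (Suc (n - p))\<^esub> levelwise B H n x p =
      tensor_op B (Suc (n - p)) (\<lambda>f. G f + H f) (x p)"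
    using tensor_op_add[OF algebra_module[OF A] algebra_module[OF B] graded_operatorD[OF G]
        graded_operatorD[OF H] cyclic_total_component(2)[OF A x, of p]]
    by (simp add: levelwise_component)
qed

lemma levelwise_smult:
  assumes G: "graded_operator A B G" and x: "x \<in> carrier (chain_space (cyclic_total J A) n)"
  shows "c \<odot>\<^bsub>chain_space (cyclic_total J B) n\<^esub> levelwise B G n x = levelwise B (\<lambda>f. fscale c (G f)) n x"
  unfolding cyclic_total_space direct_sum_simps cyclic_space_add[OF B]
    levelwise_def[of B "\<lambda>f. fscale c (G f)"]
proof (rule restrict_ext)
  fix p assume "p \<in> {..n}"
  then show "c \<odot>\<^bsub>tensor_power B (Suc (n - p))\<^esub> levelwise B G n x p =
      tensor_op B (Suc (n - p)) (\<lambda>f. fscale c (G f)) (x p)"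
    using tensor_op_smult[OF algebra_module[OF A] algebra_module[OF B] graded_operatorD[OF G]
        cyclic_total_component(2)[OF A x, of p]]
    by (simp add: levelwise_component)
qed

end

lemma levelwise_finsum:
  fixes A :: "('k::field, 'a) module" and B :: "('k, 'b) module"
  assumes A: "nonunital_algebra A" and B: "nonunital_algebra B" and "finite I"
    and "\<And>i. i \<in> I \<Longrightarrow> graded_operator A B (G i)"
    and x: "x \<in> carrier (chain_space (cyclic_total J A) n)"
  shows "finsum (chain_space (cyclic_total J B) n)
      (\<lambda>i. c i \<odot>\<^bsub>chain_space (cyclic_total J B) n\<^esub> levelwise B (G i) n x) I =
    levelwise B (\<lambda>f. \<Sum>i\<in>I. fscale (c i) (G i f)) n x"
  using assms(3,4)
proof (induction I rule: finite_induct)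
  case empty
  interpret V: module "scalars :: 'k ring" "chain_space (cyclic_total J B) n"
    by (rule cyclic_total_module[OF B])
  show ?case using levelwise_zero[OF A B x] by simp
next
  case (insert i I)
  interpret V: module "scalars :: 'k ring" "chain_space (cyclic_total J B) n"
    by (rule cyclic_total_module[OF B])
  note mB = algebra_module[OF B]
  have mem: "c j \<odot>\<^bsub>chain_space (cyclic_total J B) n\<^esub> levelwise B (G j) n x \<in>
      carrier (chain_space (cyclic_total J B) n)" if "j \<in> insert i I" for j
    using linear_mapD(1)[OF linear_map_levelwise[OF A B insert.prems[OF that]] x]
    by (rule module_simps(1)[OF cyclic_total_module[OF B]])
  have Gi: "graded_operator A B (\<lambda>f. fscale (c j) (G j f))" if "j \<in> insert i I" for j
    by (rule graded_operator_fscale[OF mB insert.prems[OF that]])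
  have GI: "graded_operator A B (\<lambda>f. \<Sum>j\<in>I. fscale (c j) (G j f))"
    by (rule graded_operator_sum[OF mB]) (use Gi in auto)
  have "finsum (chain_space (cyclic_total J B) n)
      (\<lambda>i. c i \<odot>\<^bsub>chain_space (cyclic_total J B) n\<^esub> levelwise B (G i) n x) (insert i I) =
    levelwise B (\<lambda>f. fscale (c i) (G i f)) n x \<oplus>\<^bsub>chain_space (cyclic_total J B) n\<^esub>
      levelwise B (\<lambda>f. \<Sum>i\<in>I. fscale (c i) (G i f)) n x"
    using insert mem by (subst V.finsum_insert) (auto simp: levelwise_smult[OF A B _ x])
  also have "\<dots> = levelwise B (\<lambda>f. fscale (c i) (G i f) + (\<Sum>i\<in>I. fscale (c i) (G i f))) n x"
    by (rule levelwise_add[OF A B Gi GI x]) simp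
  finally show ?case using insert(1,2) by simp
qed

definition is_presimplicial :: "('k::field, 'a) simplicial_algebra \<Rightarrow> bool" where
  "is_presimplicial S \<longleftrightarrow> (\<forall>m. nonunital_algebra (level S m)) \<and>
     (\<forall>m. \<forall>i\<le>Suc m. linear_map (level S (Suc m)) (level S m) (face S (Suc m) i)) \<and>
     (\<forall>m. \<forall>i\<le>Suc m. \<forall>x\<in>carrier (level S (Suc m)). \<forall>y\<in>carrier (level S (Suc m)).
        face S (Suc m) i (x \<otimes>\<^bsub>level S (Suc m)\<^esub> y) =
        face S (Suc m) i x \<otimes>\<^bsub>level S m\<^esub> face S (Suc m) i y) \<and>
     (\<forall>m i j. \<forall>x\<in>carrier (level S (Suc (Suc m))). i \<le> j \<longrightarrow> j \<le> Suc m \<longrightarrow>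
        face S (Suc m) i (face S (Suc (Suc m)) (Suc j) x) = face S (Suc m) j (face S (Suc (Suc m)) i x))"

text \<open>The horizontal differential as a single operator on formal combinations, so that identities
  between sums of faces become identities between values on words.\<close>

definition simplicial_op :: "('k::field, 'a) simplicial_algebra \<Rightarrow> nat
    \<Rightarrow> ('a list \<Rightarrow>\<^sub>0 'k) \<Rightarrow> ('a list \<Rightarrow>\<^sub>0 'k)" where
  "simplicial_op S m f = (\<Sum>i\<le>m. fscale ((-1) ^ i) (map_op (face S m i) f))"

lemma simplicial_bicomplex_simps:
  "bispace (simplicial_bicomplex J S) m n = chain_space (cyclic_total J (level S m)) n"
  "vdiff (simplicial_bicomplex J S) m (Suc n) x =
     ((-1) ^ m) \<odot>\<^bsub>chain_space (cyclic_total J (level S m)) n\<^esub> diff (cyclic_total J (level S m)) (Suc n) x"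
  by (simp_all add: simplicial_bicomplex_def)

context
  fixes S :: "('k::field, 'a) simplicial_algebra"
  assumes S: "is_presimplicial S"
begin

lemma level_algebra: "nonunital_algebra (level S m)"
  using S by (simp add: is_presimplicial_def)

lemma cyclic_operator_face:
  "i \<le> Suc m \<Longrightarrow> cyclic_operator (level S (Suc m)) (level S m) (map_op (face S (Suc m) i))"
  using S by (intro cyclic_operator_map_op level_algebra) (auto simp: is_presimplicial_def)

lemma cyclic_operator_simplicial_op:
  "cyclic_operator (level S (Suc m)) (level S m) (simplicial_op S (Suc m))"
  unfolding simplicial_op_def[abs_def]
  by (intro cyclic_operator_sum cyclic_operator_fscale level_algebra cyclic_operator_face) simp

lemma simplicial_hdiff:
  assumes x: "x \<in> carrier (bispace (simplicial_bicomplex J S) (Suc m) n)"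
  shows "hdiff (simplicial_bicomplex J S) (Suc m) n x = levelwise (level S m) (simplicial_op S (Suc m)) n x"
  using levelwise_finsum[OF level_algebra level_algebra, of "{..Suc m}" "Suc m" m
      "\<lambda>i. map_op (face S (Suc m) i)" x J n "\<lambda>i. (-1) ^ i"] x cyclic_operator_face
  by (simp add: simplicial_bicomplex_def cyclic_map_levelwise Let_def simplicial_op_def[abs_def]
      cyclic_operator_graded del: sum.atMost_Suc)

lemma simplicial_op_square:
  assumes w: "w \<in> tensor_words (level S (Suc (Suc m))) n"
  shows "simplicial_op S (Suc m) (simplicial_op S (Suc (Suc m)) (Poly_Mapping.single w 1)) = 0"
proof -
  let ?F = "\<lambda>i j. Poly_Mapping.single (map (face S (Suc m) i) (map (face S (Suc (Suc m)) j) w)) ((-1 :: 'k) ^ (i + j))"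
  have "simplicial_op S (Suc m) (simplicial_op S (Suc (Suc m)) (Poly_Mapping.single w 1)) =
      (\<Sum>i\<le>Suc m. \<Sum>j\<le>Suc (Suc m). ?F i j)"
    by (simp only: simplicial_op_def lin_op_sum[OF lin_op_map_op] fscale_sum map_op_single fscale_simps
        power_add mult_1_right)
  also have "\<dots> = (\<Sum>j\<le>Suc (Suc m). \<Sum>i\<le>Suc m. ?F i j)" by (rule sum.swap)
  also have "\<dots> = 0"
  proof (rule presimplicial_sum_zero)
    fix i j assume ij: "i < j" "j \<le> Suc (Suc m)"
    then obtain j' where j': "j = Suc j'" by (cases j) auto
    have "face S (Suc m) i (face S (Suc (Suc m)) j x) = face S (Suc m) j' (face S (Suc (Suc m)) i x)"
      if "x \<in> set w" for x
      using S that ij j' w unfolding is_presimplicial_def by (auto simp: tensor_words_def subset_iff)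
    then have eq: "map (face S (Suc m) i) (map (face S (Suc (Suc m)) (Suc j')) w) =
        map (face S (Suc m) j') (map (face S (Suc (Suc m)) i) w)" by (simp add: j')
    show "?F i j = - ?F (j - 1) i"
      unfolding j' diff_Suc_1 eq by (simp add: single_uminus[symmetric] ac_simps)
  qed
  finally show ?thesis .
qed

lemma is_bicomplex_simplicial:
  assumes J: "lower_closed J"
  shows "is_bicomplex (simplicial_bicomplex J S)"
  unfolding is_bicomplex_def
proof (intro conjI allI ballI)
  fix m n
  let ?B = "simplicial_bicomplex J S"
  let ?op = "\<lambda>m. simplicial_op S (Suc m)"
  note mod = cyclic_total_module[OF level_algebra, where J = J]
  note cx = is_complex_cyclic_total[OF level_algebra J]
  note lw = linear_map_levelwise[OF level_algebra level_algebra
      cyclic_operator_graded[OF cyclic_operator_simplicial_op], where J = J]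
  show md: "module (scalars :: 'k ring) (bispace ?B m n)" for m n
    unfolding simplicial_bicomplex_simps by (rule mod)
  have hlin: "linear_map (bispace ?B (Suc m) n) (bispace ?B m n) (hdiff ?B (Suc m) n)" for m n
    by (rule linear_map_cong[OF _ simplicial_hdiff md]) (simp_all add: simplicial_bicomplex_simps lw)
  then show "linear_map (bispace ?B (Suc m) n) (bispace ?B m n) (hdiff ?B (Suc m) n)" .
  have vlin: "linear_map (bispace ?B m (Suc n)) (bispace ?B m n) (vdiff ?B m (Suc n))" for m n
    by (rule linear_map_cong[OF linear_map_smult[OF md is_complexD(2)[OF cx, unfolded simplicial_bicomplex_simps(1)[symmetric]]] _ md])
      (simp add: simplicial_bicomplex_simps)
  then show "linear_map (bispace ?B m (Suc n)) (bispace ?B m n) (vdiff ?B m (Suc n))" .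
  note h = linear_mapD[OF hlin] and v = linear_mapD[OF vlin]
  show "hdiff ?B (Suc m) n (hdiff ?B (Suc (Suc m)) n x) = \<zero>\<^bsub>bispace ?B m n\<^esub>"
    if x: "x \<in> carrier (bispace ?B (Suc (Suc m)) n)" for x
  proof -
    note gr = cyclic_operator_graded[OF cyclic_operator_simplicial_op]
    have x': "x \<in> carrier (chain_space (cyclic_total J (level S (Suc (Suc m)))) n)"
      using x by (simp add: simplicial_bicomplex_simps)
    have "hdiff ?B (Suc m) n (hdiff ?B (Suc (Suc m)) n x) =
        levelwise (level S m) (?op m) n (levelwise (level S (Suc m)) (?op (Suc m)) n x)"
      using simplicial_hdiff[OF h(1)[OF x]] simplicial_hdiff[OF x] by simp
    also have "\<dots> = levelwise (level S m) (\<lambda>f. ?op m (?op (Suc m) f)) n x"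
      by (rule levelwise_comp[OF level_algebra level_algebra level_algebra gr gr x'])
    also have "\<dots> = levelwise (level S m) (\<lambda>f. 0) n x"
      by (rule levelwise_cong[OF level_algebra level_algebra graded_operator_comp[OF gr gr]
            graded_operator_zero[OF algebra_module[OF level_algebra]] _ x'])
        (rule simplicial_op_square)
    also have "\<dots> = \<zero>\<^bsub>bispace ?B m n\<^esub>"
      unfolding simplicial_bicomplex_simps by (rule levelwise_zero[OF level_algebra level_algebra x'])
    finally show ?thesis .
  qed
  show "vdiff ?B m (Suc n) (vdiff ?B m (Suc (Suc n)) x) = \<zero>\<^bsub>bispace ?B m n\<^esub>"
    if "x \<in> carrier (bispace ?B m (Suc (Suc n)))" for x
    using that is_complexD(3)[OF cx] linear_mapD[OF is_complexD(2)[OF cx]]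
    by (simp add: simplicial_bicomplex_simps module_smult_zero[OF mod])
  show "hdiff ?B (Suc m) n (vdiff ?B (Suc m) (Suc n) x) \<oplus>\<^bsub>bispace ?B m n\<^esub>
      vdiff ?B m (Suc n) (hdiff ?B (Suc m) (Suc n) x) = \<zero>\<^bsub>bispace ?B m n\<^esub>"
    if x: "x \<in> carrier (bispace ?B (Suc m) (Suc n))" for x
  proof -
    let ?C = "\<lambda>m. cyclic_total J (level S m)"
    have x': "x \<in> carrier (chain_space (?C (Suc m)) (Suc n))"
      using x by (simp add: simplicial_bicomplex_simps)
    have dx: "diff (?C (Suc m)) (Suc n) x \<in> carrier (chain_space (?C (Suc m)) n)"
      using linear_mapD(1)[OF is_complexD(2)[OF cx] x'] .
    define y where "y = levelwise (level S m) (?op m) n (diff (?C (Suc m)) (Suc n) x)"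
    have y: "y \<in> carrier (chain_space (?C m) n)" unfolding y_def by (rule linear_mapD(1)[OF lw dx])
    have "hdiff ?B (Suc m) n (diff (?C (Suc m)) (Suc n) x) = y"
      unfolding y_def using simplicial_hdiff dx by (simp add: simplicial_bicomplex_simps)
    then have "hdiff ?B (Suc m) n (vdiff ?B (Suc m) (Suc n) x) = ((-1) ^ Suc m) \<odot>\<^bsub>chain_space (?C m) n\<^esub> y"
      using h(3)[of "diff (?C (Suc m)) (Suc n) x" m n] dx by (simp add: simplicial_bicomplex_simps)
    moreover have "vdiff ?B m (Suc n) (hdiff ?B (Suc m) (Suc n) x) = ((-1) ^ m) \<odot>\<^bsub>chain_space (?C m) n\<^esub> y"
      using levelwise_diff[OF level_algebra level_algebra cyclic_operator_simplicial_op x']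
      by (simp add: simplicial_bicomplex_simps simplicial_hdiff[OF x] y_def)
    moreover have "((-1) ^ Suc m) \<odot>\<^bsub>chain_space (?C m) n\<^esub> y \<oplus>\<^bsub>chain_space (?C m) n\<^esub>
        ((-1) ^ m) \<odot>\<^bsub>chain_space (?C m) n\<^esub> y = \<zero>\<^bsub>chain_space (?C m) n\<^esub>"
      using module_simps(4)[OF mod y, of "(-1) ^ Suc m" "(-1) ^ m"] module_simps(3)[OF mod y] by simp
    ultimately show ?thesis by (simp add: simplicial_bicomplex_simps)
  qed
qed

end


section \<open>The nerve of a crossed module\<close>

text \<open>Prefixing a component; this turns the recursion \<open>R \<rtimes> (\<dots>)\<close> defining the nerve into an
  induction principle.\<close>

definition tuple_cons :: "'r \<Rightarrow> 'r list \<times> 'a \<Rightarrow> 'r list \<times> 'a" where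
  "tuple_cons r x = (r # fst x, snd x)"

lemma tuple_cons_inject [simp]: "tuple_cons r x = tuple_cons r' x' \<longleftrightarrow> r = r' \<and> x = x'"
  by (auto simp: tuple_cons_def prod_eq_iff)

context crossed_module
begin

abbreviation "R \<equiv> source M"
abbreviation "A \<equiv> target M"
abbreviation "l \<equiv> left_action M"
abbreviation "r \<equiv> right_action M"
abbreviation "\<rho> \<equiv> structure_map M"
abbreviation "N \<equiv> nerve_level M"

lemma R_algebra: "nonunital_algebra R" and A_algebra: "nonunital_algebra A"
  by unfold_locales

lemmas R_module = algebra_module[OF R_algebra] and A_module = algebra_module[OF A_algebra]

lemma R_ac:
  assumes "x \<in> carrier R" "y \<in> carrier R"
  shows "x \<oplus>\<^bsub>R\<^esub> y = y \<oplus>\<^bsub>R\<^esub> x"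
    and "z \<in> carrier R \<Longrightarrow> (x \<oplus>\<^bsub>R\<^esub> y) \<oplus>\<^bsub>R\<^esub> z = x \<oplus>\<^bsub>R\<^esub> (y \<oplus>\<^bsub>R\<^esub> z)"
    and "z \<in> carrier R \<Longrightarrow> x \<oplus>\<^bsub>R\<^esub> (y \<oplus>\<^bsub>R\<^esub> z) = y \<oplus>\<^bsub>R\<^esub> (x \<oplus>\<^bsub>R\<^esub> z)"
proof -
  have V: "abelian_monoid R"
    by (rule abelian_group.axioms(1)[OF module_abelian_group[OF R_module]])
  show "x \<oplus>\<^bsub>R\<^esub> y = y \<oplus>\<^bsub>R\<^esub> x"
    and "z \<in> carrier R \<Longrightarrow> (x \<oplus>\<^bsub>R\<^esub> y) \<oplus>\<^bsub>R\<^esub> z = x \<oplus>\<^bsub>R\<^esub> (y \<oplus>\<^bsub>R\<^esub> z)"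
    and "z \<in> carrier R \<Longrightarrow> x \<oplus>\<^bsub>R\<^esub> (y \<oplus>\<^bsub>R\<^esub> z) = y \<oplus>\<^bsub>R\<^esub> (x \<oplus>\<^bsub>R\<^esub> z)"
    using assms abelian_monoid.a_comm[OF V] abelian_monoid.a_assoc[OF V] abelian_monoid.a_lcomm[OF V]
    by auto
qed

lemma A_ac:
  assumes "x \<in> carrier A" "y \<in> carrier A"
  shows "x \<oplus>\<^bsub>A\<^esub> y = y \<oplus>\<^bsub>A\<^esub> x"
    and "z \<in> carrier A \<Longrightarrow> (x \<oplus>\<^bsub>A\<^esub> y) \<oplus>\<^bsub>A\<^esub> z = x \<oplus>\<^bsub>A\<^esub> (y \<oplus>\<^bsub>A\<^esub> z)"
    and "z \<in> carrier A \<Longrightarrow> x \<oplus>\<^bsub>A\<^esub> (y \<oplus>\<^bsub>A\<^esub> z) = y \<oplus>\<^bsub>A\<^esub> (x \<oplus>\<^bsub>A\<^esub> z)"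
proof -
  have V: "abelian_monoid A"
    by (rule abelian_group.axioms(1)[OF module_abelian_group[OF A_module]])
  show "x \<oplus>\<^bsub>A\<^esub> y = y \<oplus>\<^bsub>A\<^esub> x"
    and "z \<in> carrier A \<Longrightarrow> (x \<oplus>\<^bsub>A\<^esub> y) \<oplus>\<^bsub>A\<^esub> z = x \<oplus>\<^bsub>A\<^esub> (y \<oplus>\<^bsub>A\<^esub> z)"
    and "z \<in> carrier A \<Longrightarrow> x \<oplus>\<^bsub>A\<^esub> (y \<oplus>\<^bsub>A\<^esub> z) = y \<oplus>\<^bsub>A\<^esub> (x \<oplus>\<^bsub>A\<^esub> z)"
    using assms abelian_monoid.a_comm[OF V] abelian_monoid.a_assoc[OF V] abelian_monoid.a_lcomm[OF V]
    by auto
qed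

lemma zero_simps:
  "\<zero>\<^bsub>R\<^esub> \<in> carrier R" "\<zero>\<^bsub>A\<^esub> \<in> carrier A"
  "x \<in> carrier R \<Longrightarrow> \<zero>\<^bsub>R\<^esub> \<oplus>\<^bsub>R\<^esub> x = x" "a \<in> carrier A \<Longrightarrow> \<zero>\<^bsub>A\<^esub> \<oplus>\<^bsub>A\<^esub> a = a"
  "x \<in> carrier R \<Longrightarrow> x \<oplus>\<^bsub>R\<^esub> \<zero>\<^bsub>R\<^esub> = x" "a \<in> carrier A \<Longrightarrow> a \<oplus>\<^bsub>A\<^esub> \<zero>\<^bsub>A\<^esub> = a"
proof -
  interpret R: abelian_group R by (rule module_abelian_group[OF R_module])
  interpret A: abelian_group A by (rule module_abelian_group[OF A_module])
  show "\<zero>\<^bsub>R\<^esub> \<in> carrier R" "\<zero>\<^bsub>A\<^esub> \<in> carrier A"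
    "x \<in> carrier R \<Longrightarrow> \<zero>\<^bsub>R\<^esub> \<oplus>\<^bsub>R\<^esub> x = x" "a \<in> carrier A \<Longrightarrow> \<zero>\<^bsub>A\<^esub> \<oplus>\<^bsub>A\<^esub> a = a"
    "x \<in> carrier R \<Longrightarrow> x \<oplus>\<^bsub>R\<^esub> \<zero>\<^bsub>R\<^esub> = x" "a \<in> carrier A \<Longrightarrow> a \<oplus>\<^bsub>A\<^esub> \<zero>\<^bsub>A\<^esub> = a"
    by auto
qed

lemmas R_closed = add_mem[OF R_module] module_simps(1)[OF R_module] nonunital_algebra.m_closed[OF R_algebra]
lemmas A_closed = add_mem[OF A_module] module_simps(1)[OF A_module] nonunital_algebra.m_closed[OF A_algebra]

lemma action_closed: "a \<in> carrier A \<Longrightarrow> x \<in> carrier R \<Longrightarrow> l a x \<in> carrier R"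
  "a \<in> carrier A \<Longrightarrow> x \<in> carrier R \<Longrightarrow> r x a \<in> carrier R"
  using linear_mapD(1)[OF l_linear] linear_mapD(1)[OF r_linear] by auto

lemma \<rho>_closed: "x \<in> carrier R \<Longrightarrow> \<rho> x \<in> carrier A"
  using linear_mapD(1)[OF map_linear] .

lemma \<rho>_simps: "x \<in> carrier R \<Longrightarrow> y \<in> carrier R \<Longrightarrow> \<rho> (x \<oplus>\<^bsub>R\<^esub> y) = \<rho> x \<oplus>\<^bsub>A\<^esub> \<rho> y"
  "x \<in> carrier R \<Longrightarrow> \<rho> (c \<odot>\<^bsub>R\<^esub> x) = c \<odot>\<^bsub>A\<^esub> \<rho> x" "\<rho> \<zero>\<^bsub>R\<^esub> = \<zero>\<^bsub>A\<^esub>"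
  using linear_mapD(2,3)[OF map_linear] linear_map_zero[OF R_module A_module map_linear] by auto

lemma action_add:
  assumes "a \<in> carrier A" "x \<in> carrier R"
  shows "y \<in> carrier R \<Longrightarrow> l a (x \<oplus>\<^bsub>R\<^esub> y) = l a x \<oplus>\<^bsub>R\<^esub> l a y"
    and "b \<in> carrier A \<Longrightarrow> l (a \<oplus>\<^bsub>A\<^esub> b) x = l a x \<oplus>\<^bsub>R\<^esub> l b x"
    and "y \<in> carrier R \<Longrightarrow> r (x \<oplus>\<^bsub>R\<^esub> y) a = r x a \<oplus>\<^bsub>R\<^esub> r y a"
    and "b \<in> carrier A \<Longrightarrow> r x (a \<oplus>\<^bsub>A\<^esub> b) = r x a \<oplus>\<^bsub>R\<^esub> r x b"
  using assms linear_mapD(2)[OF l_linear] linear_mapD(2)[OF l_linear'] linear_mapD(2)[OF r_linear]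
    linear_mapD(2)[OF r_linear'] by auto

lemma action_smult:
  assumes "a \<in> carrier A" "x \<in> carrier R"
  shows "l a (c \<odot>\<^bsub>R\<^esub> x) = c \<odot>\<^bsub>R\<^esub> l a x" and "l (c \<odot>\<^bsub>A\<^esub> a) x = c \<odot>\<^bsub>R\<^esub> l a x"
    and "r (c \<odot>\<^bsub>R\<^esub> x) a = c \<odot>\<^bsub>R\<^esub> r x a" and "r x (c \<odot>\<^bsub>A\<^esub> a) = c \<odot>\<^bsub>R\<^esub> r x a"
  using assms linear_mapD(3)[OF l_linear] linear_mapD(3)[OF l_linear'] linear_mapD(3)[OF r_linear]
    linear_mapD(3)[OF r_linear'] by auto

lemmas R_mult = nonunital_algebra.m_assoc[OF R_algebra] nonunital_algebra.l_distr[OF R_algebra]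
  nonunital_algebra.r_distr[OF R_algebra] nonunital_algebra.smult_l[OF R_algebra]
  nonunital_algebra.smult_r[OF R_algebra]
lemmas A_mult = nonunital_algebra.m_assoc[OF A_algebra] nonunital_algebra.l_distr[OF A_algebra]
  nonunital_algebra.r_distr[OF A_algebra] nonunital_algebra.smult_l[OF A_algebra]
  nonunital_algebra.smult_r[OF A_algebra]
lemmas action_mult = l_assoc r_assoc lr_assoc l_mult lr_mult r_mult
lemmas closed = R_closed A_closed action_closed \<rho>_closed zero_simps(1,2)


subsection \<open>The levels of the nerve are algebras\<close>

lemma nerve_carrier_0: "x \<in> carrier (N 0) \<longleftrightarrow> (\<exists>a\<in>carrier A. x = ([], a))"
  by (auto simp: nerve_level_def)

lemma nerve_carrier_Suc:
  "x \<in> carrier (N (Suc n)) \<longleftrightarrow> (\<exists>s\<in>carrier R. \<exists>y\<in>carrier (N n). x = tuple_cons s y)"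
proof
  assume "x \<in> carrier (N (Suc n))"
  then obtain rs a where x: "x = (rs, a)" "length rs = Suc n" "set rs \<subseteq> carrier R" "a \<in> carrier A"
    by (auto simp: nerve_level_def)
  then obtain s rs' where "rs = s # rs'" by (cases rs) auto
  with x show "\<exists>s\<in>carrier R. \<exists>y\<in>carrier (N n). x = tuple_cons s y"
    by (intro bexI[of _ s] bexI[of _ "(rs', a)"]) (auto simp: nerve_level_def tuple_cons_def)
qed (auto simp: nerve_level_def tuple_cons_def)

lemma tuple_cons_mem: "tuple_cons s y \<in> carrier (N (Suc n)) \<longleftrightarrow> s \<in> carrier R \<and> y \<in> carrier (N n)"
  by (auto simp: nerve_level_def tuple_cons_def)

lemma nerve_Nil_simps:
  "([], a) \<in> carrier (N 0) \<longleftrightarrow> a \<in> carrier A"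
  "([], a) \<oplus>\<^bsub>N n\<^esub> ([], b) = ([], a \<oplus>\<^bsub>A\<^esub> b)" "([], a) \<otimes>\<^bsub>N n\<^esub> ([], b) = ([], a \<otimes>\<^bsub>A\<^esub> b)"
  "c \<odot>\<^bsub>N n\<^esub> ([], a) = ([], c \<odot>\<^bsub>A\<^esub> a)" "\<zero>\<^bsub>N 0\<^esub> = ([], \<zero>\<^bsub>A\<^esub>)" "anchor M ([], a) = a"
  by (simp_all add: nerve_level_def anchor_def)

lemma nerve_cons_simps:
  "tuple_cons s x \<oplus>\<^bsub>N (Suc n)\<^esub> tuple_cons t y = tuple_cons (s \<oplus>\<^bsub>R\<^esub> t) (x \<oplus>\<^bsub>N n\<^esub> y)"
  "c \<odot>\<^bsub>N (Suc n)\<^esub> tuple_cons s x = tuple_cons (c \<odot>\<^bsub>R\<^esub> s) (c \<odot>\<^bsub>N n\<^esub> x)"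
  "\<zero>\<^bsub>N (Suc n)\<^esub> = tuple_cons \<zero>\<^bsub>R\<^esub> \<zero>\<^bsub>N n\<^esub>"
  "tuple_cons s x \<otimes>\<^bsub>N (Suc n)\<^esub> tuple_cons t y =
    tuple_cons ((s \<otimes>\<^bsub>R\<^esub> t \<oplus>\<^bsub>R\<^esub> l (anchor M x) t) \<oplus>\<^bsub>R\<^esub> r s (anchor M y)) (x \<otimes>\<^bsub>N n\<^esub> y)"
  "anchor M (tuple_cons s x) = \<rho> s \<oplus>\<^bsub>A\<^esub> anchor M x"
  by (auto simp: nerve_level_def tuple_cons_def anchor_def case_prod_unfold Let_def)

lemma nerve_module: "module (scalars :: 'k ring) (N n)"
proof (induction n)
  case 0
  have "abelian_group (N 0)"
  proof (rule abelian_groupI)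
    fix x assume "x \<in> carrier (N 0)"
    then obtain a where a: "x = ([], a)" "a \<in> carrier A" by (auto simp: nerve_carrier_0)
    interpret A: abelian_group A by (rule module_abelian_group[OF A_module])
    show "\<exists>y\<in>carrier (N 0). y \<oplus>\<^bsub>N 0\<^esub> x = \<zero>\<^bsub>N 0\<^esub>"
      by (rule bexI[of _ "([], \<ominus>\<^bsub>A\<^esub> a)"]) (simp_all add: a nerve_Nil_simps A.l_neg)
  qed (auto simp: nerve_carrier_0 nerve_Nil_simps A_closed zero_simps A_ac(2) intro: A_ac(1))
  then show ?case
    by (rule module_scalarsI)
      (auto simp: nerve_carrier_0 nerve_Nil_simps module_simps[OF A_module] module_smult_add[OF A_module])
next
  case (Suc n)
  interpret Nn: module "scalars :: 'k ring" "N n" by (rule Suc)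
  have "abelian_group (N (Suc n))"
  proof (rule abelian_groupI)
    fix x assume "x \<in> carrier (N (Suc n))"
    then obtain s y where x: "x = tuple_cons s y" "s \<in> carrier R" "y \<in> carrier (N n)"
      by (auto simp: nerve_carrier_Suc)
    interpret R: abelian_group R by (rule module_abelian_group[OF R_module])
    show "\<exists>z\<in>carrier (N (Suc n)). z \<oplus>\<^bsub>N (Suc n)\<^esub> x = \<zero>\<^bsub>N (Suc n)\<^esub>"
      by (rule bexI[of _ "tuple_cons (\<ominus>\<^bsub>R\<^esub> s) (\<ominus>\<^bsub>N n\<^esub> y)"])
        (simp_all add: x nerve_cons_simps tuple_cons_mem R.l_neg Nn.M.l_neg)
  qed (auto simp: nerve_carrier_Suc nerve_cons_simps R_closed zero_simps R_ac(2) Nn.M.a_assoc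
      intro: R_ac(1) Nn.M.a_comm)
  then show ?case
    by (rule module_scalarsI)
      (auto simp: nerve_carrier_Suc nerve_cons_simps module_simps[OF R_module]
        module_smult_add[OF R_module] module_simps[OF Suc] module_smult_add[OF Suc])
qed

lemma anchor_closed: "x \<in> carrier (N n) \<Longrightarrow> anchor M x \<in> carrier A"
  by (induction n arbitrary: x) (auto simp: nerve_carrier_0 nerve_carrier_Suc nerve_Nil_simps
      nerve_cons_simps closed)

lemma anchor_add: "x \<in> carrier (N n) \<Longrightarrow> y \<in> carrier (N n) \<Longrightarrow>
    anchor M (x \<oplus>\<^bsub>N n\<^esub> y) = anchor M x \<oplus>\<^bsub>A\<^esub> anchor M y"
proof (induction n arbitrary: x y)
  case (Suc n)
  then show ?case
    by (auto simp: nerve_carrier_Suc nerve_cons_simps closed \<rho>_simps A_ac anchor_closed[of _ n])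
qed (auto simp: nerve_carrier_0 nerve_Nil_simps)

lemma anchor_smult: "x \<in> carrier (N n) \<Longrightarrow> anchor M (c \<odot>\<^bsub>N n\<^esub> x) = c \<odot>\<^bsub>A\<^esub> anchor M x"
proof (induction n arbitrary: x)
  case (Suc n)
  then show ?case
    by (auto simp: nerve_carrier_Suc nerve_cons_simps closed \<rho>_simps anchor_closed[of _ n]
        module_smult_add[OF A_module])
qed (auto simp: nerve_carrier_0 nerve_Nil_simps)

lemma nerve_mult_closed: "x \<in> carrier (N n) \<Longrightarrow> y \<in> carrier (N n) \<Longrightarrow> x \<otimes>\<^bsub>N n\<^esub> y \<in> carrier (N n)"
proof (induction n arbitrary: x y)
  case (Suc n)
  then show ?case
    by (auto simp: nerve_carrier_Suc nerve_cons_simps closed anchor_closed[of _ n])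
qed (auto simp: nerve_carrier_0 nerve_Nil_simps closed)

text \<open>Multiplicativity is \<open>\<rho>(s t + u t + s v) + u v = (\<rho> s + u) (\<rho> t + v)\<close>, where \<open>u\<close> and \<open>v\<close> are
  the anchors of the tails.\<close>

lemma anchor_mult: "x \<in> carrier (N n) \<Longrightarrow> y \<in> carrier (N n) \<Longrightarrow>
    anchor M (x \<otimes>\<^bsub>N n\<^esub> y) = anchor M x \<otimes>\<^bsub>A\<^esub> anchor M y"
proof (induction n arbitrary: x y)
  case (Suc n)
  then show ?case
    by (auto simp: nerve_carrier_Suc nerve_cons_simps closed \<rho>_simps map_mult map_l map_r A_mult A_ac
        anchor_closed[of _ n])
qed (auto simp: nerve_carrier_0 nerve_Nil_simps)

text \<open>A level is the semidirect product of \<open>R\<close> with the previous one, which acts through the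
  algebra homomorphism \<open>anchor\<close>.\<close>

lemma nerve_mult_assoc:
  "x \<in> carrier (N n) \<Longrightarrow> y \<in> carrier (N n) \<Longrightarrow> z \<in> carrier (N n) \<Longrightarrow>
    (x \<otimes>\<^bsub>N n\<^esub> y) \<otimes>\<^bsub>N n\<^esub> z = x \<otimes>\<^bsub>N n\<^esub> (y \<otimes>\<^bsub>N n\<^esub> z)"
proof (induction n arbitrary: x y z)
  case (Suc n)
  then show ?case
    by (auto simp: nerve_carrier_Suc nerve_cons_simps closed anchor_closed[of _ n] anchor_mult[of _ n]
        R_mult action_mult action_add R_ac)
qed (auto simp: nerve_carrier_0 nerve_Nil_simps A_mult)

lemma nerve_distr:
  "x \<in> carrier (N n) \<Longrightarrow> y \<in> carrier (N n) \<Longrightarrow> z \<in> carrier (N n) \<Longrightarrow>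
    (x \<oplus>\<^bsub>N n\<^esub> y) \<otimes>\<^bsub>N n\<^esub> z = x \<otimes>\<^bsub>N n\<^esub> z \<oplus>\<^bsub>N n\<^esub> y \<otimes>\<^bsub>N n\<^esub> z \<and>
    z \<otimes>\<^bsub>N n\<^esub> (x \<oplus>\<^bsub>N n\<^esub> y) = z \<otimes>\<^bsub>N n\<^esub> x \<oplus>\<^bsub>N n\<^esub> z \<otimes>\<^bsub>N n\<^esub> y"
proof (induction n arbitrary: x y z)
  case (Suc n)
  then show ?case
    by (auto simp: nerve_carrier_Suc nerve_cons_simps closed anchor_closed[of _ n] anchor_add[of _ n]
        R_mult action_add R_ac)
qed (auto simp: nerve_carrier_0 nerve_Nil_simps A_mult)

lemma nerve_smult:
  "x \<in> carrier (N n) \<Longrightarrow> y \<in> carrier (N n) \<Longrightarrow>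
    (c \<odot>\<^bsub>N n\<^esub> x) \<otimes>\<^bsub>N n\<^esub> y = c \<odot>\<^bsub>N n\<^esub> (x \<otimes>\<^bsub>N n\<^esub> y) \<and>
    x \<otimes>\<^bsub>N n\<^esub> (c \<odot>\<^bsub>N n\<^esub> y) = c \<odot>\<^bsub>N n\<^esub> (x \<otimes>\<^bsub>N n\<^esub> y)"
proof (induction n arbitrary: x y)
  case (Suc n)
  then show ?case
    by (auto simp: nerve_carrier_Suc nerve_cons_simps closed anchor_closed[of _ n] anchor_smult[of _ n]
        R_mult action_smult module_smult_add[OF R_module])
qed (auto simp: nerve_carrier_0 nerve_Nil_simps A_mult)

lemma nerve_algebra: "nonunital_algebra (N n)"
  by (intro nonunital_algebra.intro nerve_module nonunital_algebra_axioms.intro)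
    (simp_all add: nerve_mult_closed nerve_mult_assoc nerve_distr nerve_smult)


subsection \<open>Faces\<close>

lemma face_0: "nerve_face M n 0 (tuple_cons s x) = x"
  by (simp add: nerve_face_def tuple_cons_def)

lemma face_1_Nil: "nerve_face M (Suc 0) (Suc 0) (tuple_cons s ([], a)) = ([], \<rho> s \<oplus>\<^bsub>A\<^esub> a)"
  by (simp add: nerve_face_def tuple_cons_def)

lemma face_1_cons:
  "nerve_face M (Suc (Suc n)) (Suc 0) (tuple_cons s (tuple_cons t x)) = tuple_cons (s \<oplus>\<^bsub>R\<^esub> t) x"
  by (simp add: nerve_face_def tuple_cons_def case_prod_unfold)

lemma face_Suc_Suc:
  assumes "x \<in> carrier (N (Suc n))"
  shows "nerve_face M (Suc (Suc n)) (Suc (Suc i)) (tuple_cons s x) =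
    tuple_cons s (nerve_face M (Suc n) (Suc i) x)"
proof -
  obtain rs a where "x = (rs, a)" by (cases x)
  moreover then have "rs \<noteq> []" using assms by (auto simp: nerve_level_def)
  ultimately show ?thesis by (simp add: nerve_face_def tuple_cons_def)
qed

text \<open>All properties are proved in one induction. The product of the first components involves the
  anchors of the tails, so that a face acting on the tail is multiplicative because it preserves
  anchors; the face of index \<open>0\<close>, which does not, never acts on a tail.\<close>

lemma nerve_face_hom:
  assumes "i \<le> Suc n" "x \<in> carrier (N (Suc n))"
  shows "nerve_face M (Suc n) i x \<in> carrier (N n) \<and>
    (0 < i \<longrightarrow> anchor M (nerve_face M (Suc n) i x) = anchor M x) \<and>
    (\<forall>c. nerve_face M (Suc n) i (c \<odot>\<^bsub>N (Suc n)\<^esub> x) = c \<odot>\<^bsub>N n\<^esub> nerve_face M (Suc n) i x) \<and>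
    (\<forall>y\<in>carrier (N (Suc n)).
       nerve_face M (Suc n) i (x \<oplus>\<^bsub>N (Suc n)\<^esub> y) = nerve_face M (Suc n) i x \<oplus>\<^bsub>N n\<^esub> nerve_face M (Suc n) i y \<and>
       nerve_face M (Suc n) i (x \<otimes>\<^bsub>N (Suc n)\<^esub> y) = nerve_face M (Suc n) i x \<otimes>\<^bsub>N n\<^esub> nerve_face M (Suc n) i y)"
  using assms
proof (induction n arbitrary: i x)
  case 0
  then have "i = 0 \<or> i = Suc 0" by auto
  then show ?case
    using 0 by (auto simp: nerve_carrier_0 nerve_carrier_Suc nerve_Nil_simps nerve_cons_simps face_0
        face_1_Nil closed \<rho>_simps map_mult map_l map_r A_mult A_ac module_smult_add[OF A_module])
next
  case (Suc n)
  consider "i = 0" | "i = Suc 0" | i' where "i = Suc (Suc i')" "Suc i' \<le> Suc n"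
    using Suc.prems(1) by (metis Suc_le_mono not0_implies_Suc)
  then show ?case
  proof cases
    case 1
    then show ?thesis
      using Suc.prems(2) by (auto simp: nerve_carrier_Suc[of _ "Suc n"] nerve_cons_simps face_0)
  next
    case 2
    then show ?thesis
      using Suc.prems(2) by (auto simp: nerve_carrier_Suc nerve_cons_simps face_1_cons closed
          anchor_closed[of _ n] \<rho>_simps R_mult action_add peiffer_l peiffer_r R_ac A_ac
          module_smult_add[OF R_module])
  next
    case 3
    obtain s x' where x: "x = tuple_cons s x'" "s \<in> carrier R" "x' \<in> carrier (N (Suc n))"
      using Suc.prems(2) by (auto simp: nerve_carrier_Suc[of _ "Suc n"])
    let ?d = "nerve_face M (Suc n) (Suc i')"
    have IH: "?d z \<in> carrier (N n)" "anchor M (?d z) = anchor M z" "?d (c \<odot>\<^bsub>N (Suc n)\<^esub> z) = c \<odot>\<^bsub>N n\<^esub> ?d z"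
      "w \<in> carrier (N (Suc n)) \<Longrightarrow> ?d (z \<oplus>\<^bsub>N (Suc n)\<^esub> w) = ?d z \<oplus>\<^bsub>N n\<^esub> ?d w"
      "w \<in> carrier (N (Suc n)) \<Longrightarrow> ?d (z \<otimes>\<^bsub>N (Suc n)\<^esub> w) = ?d z \<otimes>\<^bsub>N n\<^esub> ?d w"
      if "z \<in> carrier (N (Suc n))" for c z w
      using Suc.IH[OF 3(2) that] by simp_all
    note cl = nerve_mult_closed[of _ "Suc n"] module_simps(1)[OF nerve_module, of _ "Suc n"]
      add_mem[OF nerve_module, of _ "Suc n"]
    show ?thesis
    proof (intro conjI allI ballI impI)
      fix y assume "y \<in> carrier (N (Suc (Suc n)))"
      then obtain t y' where y: "y = tuple_cons t y'" "t \<in> carrier R" "y' \<in> carrier (N (Suc n))"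
        unfolding nerve_carrier_Suc[of _ "Suc n"] by blast
      show "nerve_face M (Suc (Suc n)) i (x \<oplus>\<^bsub>N (Suc (Suc n))\<^esub> y) =
          nerve_face M (Suc (Suc n)) i x \<oplus>\<^bsub>N (Suc n)\<^esub> nerve_face M (Suc (Suc n)) i y"
        using x y by (simp add: 3(1) nerve_cons_simps face_Suc_Suc cl IH)
      show "nerve_face M (Suc (Suc n)) i (x \<otimes>\<^bsub>N (Suc (Suc n))\<^esub> y) =
          nerve_face M (Suc (Suc n)) i x \<otimes>\<^bsub>N (Suc n)\<^esub> nerve_face M (Suc (Suc n)) i y"
        using x y by (simp add: 3(1) nerve_cons_simps face_Suc_Suc cl IH)
    qed (use x in \<open>simp_all add: 3(1) nerve_cons_simps face_Suc_Suc cl IH tuple_cons_mem\<close>)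
  qed
qed

lemma nerve_face_face:
  assumes "i \<le> j" "j \<le> Suc n" "x \<in> carrier (N (Suc (Suc n)))"
  shows "nerve_face M (Suc n) i (nerve_face M (Suc (Suc n)) (Suc j) x) =
    nerve_face M (Suc n) j (nerve_face M (Suc (Suc n)) i x)"
  using assms
proof (induction n arbitrary: i j x)
  case 0
  then have "i = 0 \<and> j = 0 \<or> i = 0 \<and> j = Suc 0 \<or> i = Suc 0 \<and> j = Suc 0" by auto
  then show ?case
    using 0(3) face_Suc_Suc[of _ 0 0]
    by (auto simp: nerve_carrier_0 nerve_carrier_Suc face_0 face_1_Nil face_1_cons \<rho>_simps A_ac closed
        tuple_cons_mem nerve_Nil_simps)
next
  case (Suc n)
  obtain s x' where x: "x = tuple_cons s x'" "s \<in> carrier R" "x' \<in> carrier (N (Suc (Suc n)))"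
    using Suc.prems(3) by (auto simp: nerve_carrier_Suc[of _ "Suc (Suc n)"])
  obtain t x'' where x': "x' = tuple_cons t x''" "t \<in> carrier R" "x'' \<in> carrier (N (Suc n))"
    using x(3) by (auto simp: nerve_carrier_Suc[of _ "Suc n"])
  obtain u y where x'': "x'' = tuple_cons u y" "u \<in> carrier R" "y \<in> carrier (N n)"
    using x'(3) by (auto simp: nerve_carrier_Suc[of _ n])
  have d: "nerve_face M (Suc (Suc n)) k x' \<in> carrier (N (Suc n))" if "k \<le> Suc (Suc n)" for k
    using nerve_face_hom[OF that x(3)] by simp
  show ?case
  proof (cases i)
    case 0
    then show ?thesis
    proof (cases j)
      case 0
      then show ?thesis using \<open>i = 0\<close> by (simp add: x x' face_0 face_1_cons)
    next
      case (Suc j')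
      then show ?thesis using \<open>i = 0\<close> face_Suc_Suc[OF x(3), of j'] by (simp add: x face_0)
    qed
  next
    case (Suc i')
    then obtain j' where j: "j = Suc j'" "i' \<le> j'" "j' \<le> Suc n" using Suc.prems by (cases j) auto
    have fs: "nerve_face M (Suc (Suc (Suc n))) (Suc (Suc k)) (tuple_cons s x') =
        tuple_cons s (nerve_face M (Suc (Suc n)) (Suc k) x')" for k
      by (rule face_Suc_Suc[OF x(3)])
    have fs': "nerve_face M (Suc (Suc n)) (Suc (Suc k)) (tuple_cons p z) =
        tuple_cons p (nerve_face M (Suc n) (Suc k) z)" if "z \<in> carrier (N (Suc n))" for k p z
      by (rule face_Suc_Suc[OF that])
    show ?thesis
    proof (cases i')
      case 0
      show ?thesis
      proof (cases j')
        case 0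
        then show ?thesis
          using \<open>i = Suc i'\<close> \<open>i' = 0\<close> j x(2) x'(2) x''(2)
          by (simp add: x(1) x'(1) x''(1) fs[unfolded x'(1) x''(1)] face_1_cons R_ac closed)
      next
        case (Suc j'')
        have "nerve_face M (Suc (Suc n)) (Suc (Suc j'')) x' = tuple_cons t (nerve_face M (Suc n) (Suc j'') x'')"
          unfolding x'(1) by (rule fs'[OF x'(3)])
        then show ?thesis
          using \<open>i = Suc i'\<close> \<open>i' = 0\<close> j Suc
          by (simp add: x(1) fs) (simp add: x'(1) face_1_cons fs'[OF x'(3)])
      qed
    next
      case (Suc i'')
      then obtain j'' where j'': "j' = Suc j''" using j by (cases j') auto
      have "nerve_face M (Suc n) i' (nerve_face M (Suc (Suc n)) (Suc j') x') =
          nerve_face M (Suc n) j' (nerve_face M (Suc (Suc n)) i' x')"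
        by (rule Suc.IH[OF j(2,3) x(3)])
      then show ?thesis
        using \<open>i = Suc i'\<close> Suc j j'' d[of "Suc j'"] d[of i']
        by (simp add: x(1) fs fs')
    qed
  qed
qed

lemma is_presimplicial_nerve: "is_presimplicial (nerve M)"
  unfolding is_presimplicial_def nerve_def simplicial_algebra.simps
  using nerve_algebra nerve_face_hom nerve_face_face
  by (auto intro!: linear_mapI)

end


section \<open>Chains of low degree\<close>

text \<open>Chains of degree \<open>0\<close> are elements of the algebra; \<open>letter\<close> and \<open>chain0\<close> send an element to
  its chain, \<open>letter_value\<close> and \<open>chain0_value\<close> are their inverses.\<close>

definition letter :: "('k::field, 'a) module \<Rightarrow> 'a \<Rightarrow> ('a list \<Rightarrow>\<^sub>0 'k) set" where
  "letter B b = tensor_class B (Suc 0) (Poly_Mapping.single [b] 1)"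

definition letter_value :: "('k::field, 'a) module \<Rightarrow> ('a list \<Rightarrow>\<^sub>0 'k) set \<Rightarrow> 'a" where
  "letter_value B = tensor_lift B hd"

definition chain0 :: "('k::field, 'a) module \<Rightarrow> 'a \<Rightarrow> nat \<Rightarrow> ('a list \<Rightarrow>\<^sub>0 'k) set" where
  "chain0 B b = (\<lambda>p\<in>{..0}. letter B b)"

definition chain0_value :: "('k::field, 'a) module \<Rightarrow> (nat \<Rightarrow> ('a list \<Rightarrow>\<^sub>0 'k) set) \<Rightarrow> 'a" where
  "chain0_value B x = letter_value B (x 0)"

definition chain1 :: "('k::field, 'a) module \<Rightarrow> 'a \<Rightarrow> 'a \<Rightarrow> nat \<Rightarrow> ('a list \<Rightarrow>\<^sub>0 'k) set" where
  "chain1 B a b = (\<lambda>p\<in>{..Suc 0}. if p = 0 then tensor_class B (Suc (Suc 0)) (Poly_Mapping.single [a, b] 1)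
     else \<zero>\<^bsub>tensor_power B (Suc 0)\<^esub>)"

text \<open>On a tensor of two factors \<open>a\<close> and \<open>b\<close> this is \<open>a b - b a\<close>.\<close>

definition commutator_map :: "('k::field, 'a) module \<Rightarrow> ('a list \<Rightarrow>\<^sub>0 'k) set \<Rightarrow> 'a" where
  "commutator_map B x = letter_value B (tensor_op B (Suc 0) (hochschild_b B) x)"

lemma words_1: "w \<in> tensor_words B (Suc 0) \<longleftrightarrow> (\<exists>b\<in>carrier B. w = [b])"
  by (auto simp: tensor_words_def length_Suc_conv)

lemma words_2: "w \<in> tensor_words B (Suc (Suc 0)) \<longleftrightarrow> (\<exists>a\<in>carrier B. \<exists>b\<in>carrier B. w = [a, b])"
  by (auto simp: tensor_words_def length_Suc_conv)

context
  fixes B :: "('k::field, 'a) module"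
  assumes B: "nonunital_algebra B"
begin

interpretation B: nonunital_algebra B by (rule B)

lemma mB: "module (scalars :: 'k ring) B" by (rule algebra_module[OF B])

lemma multilinear_hd: "multilinear B (Suc 0) B hd"
  by (auto simp: multilinear_def words_1 linear_map_id[OF B])

lemma linear_map_letter_value: "linear_map (tensor_power B (Suc 0)) B (letter_value B)"
  unfolding letter_value_def by (rule linear_map_tensor_lift[OF mB mB multilinear_hd])

lemma letter_value_letter: "b \<in> carrier B \<Longrightarrow> letter_value B (letter B b) = b"
  unfolding letter_value_def letter_def
  by (subst tensor_lift_word[OF mB mB multilinear_hd]) (auto simp: words_1)

lemma letter_mem: "b \<in> carrier B \<Longrightarrow> letter B b \<in> carrier (tensor_power B (Suc 0))"
  unfolding letter_def by (rule tensor_class_mem[OF mB]) (auto simp: words_1)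

lemma linear_map_letter: "linear_map B (tensor_power B (Suc 0)) (letter B)"
proof (rule linear_mapI)
  note R = lin_span_superset[of _ "tensor_generators B (Suc 0)" "free_space (tensor_words B (Suc 0))",
      folded tensor_relations_span]
  have k: "Poly_Mapping.keys (Poly_Mapping.single [x] c :: 'a list \<Rightarrow>\<^sub>0 'k) \<subseteq> tensor_words B (Suc 0)"
    if "x \<in> carrier B" for x c
    using that by (auto simp: words_1)
  fix x y and c :: 'k assume x: "x \<in> carrier B"
  then show "letter B x \<in> carrier (tensor_power B (Suc 0))" by (rule letter_mem)
  have "Poly_Mapping.single ([x][0 := c \<odot>\<^bsub>B\<^esub> x]) 1 - Poly_Mapping.single ([x][0 := x]) c \<in> tensor_generators B (Suc 0)"
    unfolding tensor_generators_def using x words_1 by blast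
  then have "Poly_Mapping.single [c \<odot>\<^bsub>B\<^esub> x] 1 - Poly_Mapping.single [x] c \<in> tensor_relations B (Suc 0)"
    using R by simp
  then show "letter B (c \<odot>\<^bsub>B\<^esub> x) = c \<odot>\<^bsub>tensor_power B (Suc 0)\<^esub> letter B x"
    using tensor_class_eq_iff[OF mB k k] tensor_class_smult[OF mB k, of x c 1] x
    by (simp add: letter_def module_simps(1)[OF mB])
  assume y: "y \<in> carrier B"
  have "Poly_Mapping.single ([x][0 := x \<oplus>\<^bsub>B\<^esub> y]) 1 - Poly_Mapping.single ([x][0 := x]) 1 -
      Poly_Mapping.single ([x][0 := y]) (1 :: 'k) \<in> tensor_generators B (Suc 0)"
    unfolding tensor_generators_def using x y words_1 by blast
  then have "Poly_Mapping.single [x \<oplus>\<^bsub>B\<^esub> y] 1 - (Poly_Mapping.single [x] 1 + Poly_Mapping.single [y] 1) \<in>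
      tensor_relations B (Suc 0)"
    using R by (simp add: algebra_simps)
  then show "letter B (x \<oplus>\<^bsub>B\<^esub> y) = letter B x \<oplus>\<^bsub>tensor_power B (Suc 0)\<^esub> letter B y"
    using tensor_class_eq_iff[OF mB k subset_trans[OF Poly_Mapping.keys_add Un_least[OF k k]]]
      tensor_class_add[OF mB k k, of x y 1 1] x y
    by (simp add: letter_def add_mem[OF mB])
qed

lemma letter_letter_value:
  assumes "x \<in> carrier (tensor_power B (Suc 0))"
  shows "letter B (letter_value B x) = x"
proof -
  have id: "linear_map (tensor_power B (Suc 0)) (tensor_power B (Suc 0)) (\<lambda>x. x)"
    by (rule linear_mapI) simp_all
  show ?thesis
  proof (rule linear_map_tensor_eqI[OF mB tensor_power_module[OF mB]
        linear_map_comp[OF linear_map_letter_value linear_map_letter] id _ assms])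
    fix w assume "w \<in> tensor_words B (Suc 0)"
    then obtain b where "b \<in> carrier B" "w = [b]" by (auto simp: words_1)
    then show "letter B (letter_value B (tensor_class B (Suc 0) (Poly_Mapping.single w 1))) =
        tensor_class B (Suc 0) (Poly_Mapping.single w 1)"
      using letter_value_letter by (simp add: letter_def)
  qed
qed

lemma tensor_class_diff:
  assumes "Poly_Mapping.keys f \<subseteq> tensor_words B n" "Poly_Mapping.keys g \<subseteq> tensor_words B n"
  shows "tensor_class B n (f - g) = tensor_class B n f \<ominus>\<^bsub>tensor_power B n\<^esub> tensor_class B n g"
  using linear_map_diff[OF free_space_module tensor_power_module[OF mB] linear_map_tensor_class[OF mB], of f n g]
    assms by (simp add: free_space_simps free_space_diff)

lemma tensor_op_t_1:
  assumes "x \<in> carrier (tensor_power B (Suc 0))"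
  shows "tensor_op B (Suc 0) (row_op (Suc 0) 0) x = \<zero>\<^bsub>tensor_power B (Suc 0)\<^esub>"
proof (rule tensor_op_zero[OF mB mB tensor_operator_row_op[OF B] _ assms])
  fix f :: "'a list \<Rightarrow>\<^sub>0 'k" assume f: "Poly_Mapping.keys f \<subseteq> tensor_words B (Suc 0)"
  have "cyclic_t f = f"
    using cyclic_t_pow_Suc[OF B f] by simp
  then show "row_op (Suc 0) 0 f = 0" by (simp add: row_op_def)
qed

lemma hochschild_b_word_2:
  "hochschild_b B (Poly_Mapping.single [a, b] 1) =
    Poly_Mapping.single [a \<otimes>\<^bsub>B\<^esub> b] 1 - Poly_Mapping.single [b \<otimes>\<^bsub>B\<^esub> a] (1 :: 'k)"
  by (simp add: hochschild_b_def bprime_def single_uminus)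

lemma linear_map_commutator_map: "linear_map (tensor_power B (Suc (Suc 0))) B (commutator_map B)"
  unfolding commutator_map_def[abs_def]
  by (rule linear_map_comp[OF linear_map_tensor_op[OF mB mB tensor_operator_hochschild_b[OF B]]
        linear_map_letter_value])

lemma tensor_op_b_word_2:
  assumes "a \<in> carrier B" "b \<in> carrier B"
  shows "tensor_op B (Suc 0) (hochschild_b B) (tensor_class B (Suc (Suc 0)) (Poly_Mapping.single [a, b] 1)) =
    letter B ((a \<otimes>\<^bsub>B\<^esub> b) \<ominus>\<^bsub>B\<^esub> (b \<otimes>\<^bsub>B\<^esub> a))"
proof -
  have ab: "a \<otimes>\<^bsub>B\<^esub> b \<in> carrier B" "b \<otimes>\<^bsub>B\<^esub> a \<in> carrier B" using assms B.m_closed by auto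
  have "tensor_op B (Suc 0) (hochschild_b B) (tensor_class B (Suc (Suc 0)) (Poly_Mapping.single [a, b] 1)) =
      tensor_class B (Suc 0) (Poly_Mapping.single [a \<otimes>\<^bsub>B\<^esub> b] 1 - Poly_Mapping.single [b \<otimes>\<^bsub>B\<^esub> a] 1)"
    using tensor_op_class[OF mB mB tensor_operator_hochschild_b[OF B], of "Poly_Mapping.single [a, b] 1" 0] assms
    by (simp add: hochschild_b_word_2 words_2)
  also have "\<dots> = letter B (a \<otimes>\<^bsub>B\<^esub> b) \<ominus>\<^bsub>tensor_power B (Suc 0)\<^esub> letter B (b \<otimes>\<^bsub>B\<^esub> a)"
    using ab by (subst tensor_class_diff) (auto simp: letter_def words_1)
  also have "\<dots> = letter B ((a \<otimes>\<^bsub>B\<^esub> b) \<ominus>\<^bsub>B\<^esub> (b \<otimes>\<^bsub>B\<^esub> a))"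
    using linear_map_diff[OF mB tensor_power_module[OF mB] linear_map_letter ab] by simp
  finally show ?thesis .
qed

lemma commutator_map_word:
  assumes "a \<in> carrier B" "b \<in> carrier B"
  shows "commutator_map B (tensor_class B (Suc (Suc 0)) (Poly_Mapping.single [a, b] 1)) =
    (a \<otimes>\<^bsub>B\<^esub> b) \<ominus>\<^bsub>B\<^esub> (b \<otimes>\<^bsub>B\<^esub> a)"
  using assms B.m_closed
  by (simp add: commutator_map_def tensor_op_b_word_2 letter_value_letter diff_mem[OF mB])

context
  fixes J :: "nat set"
  assumes J: "0 \<in> J"
begin

lemma chain_space_0:
  "x \<in> carrier (chain_space (cyclic_total J B) 0) \<longleftrightarrow>
    x \<in> extensional {..0} \<and> x 0 \<in> carrier (tensor_power B (Suc 0))"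
  using J by (auto simp: cyclic_total_space direct_sum_simps PiE_iff cyclic_bicomplex_simps)

lemma linear_map_chain0: "linear_map B (chain_space (cyclic_total J B) 0) (chain0 B)"
  unfolding cyclic_total_space
  by (rule linear_map_direct_sumI[OF _ mB])
    (use J linear_map_letter in \<open>auto simp: chain0_def cyclic_bicomplex_simps\<close>)

lemma linear_map_chain0_value: "linear_map (chain_space (cyclic_total J B) 0) B (chain0_value B)"
proof -
  have "linear_map (chain_space (cyclic_total J B) 0) (tensor_power B (Suc 0)) (\<lambda>x. x 0)"
    using linear_map_component[of 0 "{..0}" "\<lambda>p. bispace (cyclic_bicomplex J B) p (0 - p)"] J
    by (simp add: cyclic_total_space cyclic_bicomplex_simps)
  then show ?thesis
    unfolding chain0_value_def[abs_def] by (rule linear_map_comp[OF _ linear_map_letter_value])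
qed

lemma chain0_value_chain0: "b \<in> carrier B \<Longrightarrow> chain0_value B (chain0 B b) = b"
  by (simp add: chain0_def chain0_value_def letter_value_letter)

lemma chain0_chain0_value:
  assumes "x \<in> carrier (chain_space (cyclic_total J B) 0)"
  shows "chain0 B (chain0_value B x) = x"
  using assms
  by (intro extensionalityI[of _ "{..0}"])
    (auto simp: chain_space_0 chain0_def chain0_value_def letter_letter_value)

lemma chain0_cases:
  assumes "x \<in> carrier (chain_space (cyclic_total J B) 0)"
  obtains b where "b \<in> carrier B" "x = chain0 B b"
  using chain0_chain0_value[OF assms] linear_mapD(1)[OF linear_map_chain0_value assms] by metis

lemma chain1_mem:
  assumes "a \<in> carrier B" "b \<in> carrier B"
  shows "chain1 B a b \<in> carrier (chain_space (cyclic_total J B) (Suc 0))"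
  using assms J tensor_class_mem[OF mB, of "Poly_Mapping.single [a, b] 1" "Suc (Suc 0)"]
    zero_mem[OF tensor_power_module[OF mB]]
  by (auto simp: chain1_def cyclic_total_space direct_sum_simps cyclic_bicomplex_simps words_2 zero_space_def)

text \<open>In degree \<open>0\<close> the boundary consists of the commutators alone: on \<open>B\<close> itself \<open>1 - t\<close> is
  zero.\<close>

lemma diff_chain_1:
  assumes "x \<in> carrier (chain_space (cyclic_total J B) (Suc 0))"
  shows "diff (cyclic_total J B) (Suc 0) x = (\<lambda>p\<in>{..0}. tensor_op B (Suc 0) (hochschild_b B) (x 0))"
proof -
  have x0: "x 0 \<in> carrier (tensor_power B (Suc (Suc 0)))" and x1: "x (Suc 0) \<in> carrier (tensor_power B (Suc 0))"
    using cyclic_total_component(2)[OF B assms, of 0] cyclic_total_component(2)[OF B assms, of "Suc 0"] by auto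
  interpret TP: module scalars "tensor_power B (Suc 0)" by (rule tensor_power_module[OF mB])
  have "tensor_op B (Suc 0) (hochschild_b B) (x 0) \<in> carrier (tensor_power B (Suc 0))"
    using linear_mapD(1)[OF linear_map_tensor_op[OF mB mB tensor_operator_hochschild_b[OF B]] x0] .
  then show ?thesis
    unfolding cyclic_total_diff
    by (intro restrict_ext) (auto simp: tensor_op_t_1[OF x1] column_op_def cyclic_space_add[OF B])
qed

lemma chain0_value_diff:
  assumes "x \<in> carrier (chain_space (cyclic_total J B) (Suc 0))"
  shows "chain0_value B (diff (cyclic_total J B) (Suc 0) x) = commutator_map B (x 0)"
  by (simp add: diff_chain_1[OF assms] chain0_value_def commutator_map_def)

lemma diff_chain1:
  assumes "a \<in> carrier B" "b \<in> carrier B"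
  shows "diff (cyclic_total J B) (Suc 0) (chain1 B a b) = chain0 B ((a \<otimes>\<^bsub>B\<^esub> b) \<ominus>\<^bsub>B\<^esub> (b \<otimes>\<^bsub>B\<^esub> a))"
  unfolding diff_chain_1[OF chain1_mem[OF assms]]
  by (simp add: chain0_def chain1_def tensor_op_b_word_2[OF assms])

end

end


section \<open>The augmentation onto the cokernel\<close>

context crossed_module
begin

abbreviation "I \<equiv> image_ideal M"

lemma I_subspace: "submodule I scalars A"
  unfolding image_ideal_def
  by (rule subspace_image[OF R_module A_module map_linear subspace_carrier[OF R_module]])

lemma I_carrier: "x \<in> I \<Longrightarrow> x \<in> carrier A"
  using \<rho>_closed by (auto simp: image_ideal_def)

lemma I_ideal: "x \<in> I \<Longrightarrow> a \<in> carrier A \<Longrightarrow> x \<otimes>\<^bsub>A\<^esub> a \<in> I" "x \<in> I \<Longrightarrow> a \<in> carrier A \<Longrightarrow> a \<otimes>\<^bsub>A\<^esub> x \<in> I"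
  using action_closed by (auto simp: image_ideal_def simp flip: map_l map_r)

lemma Coker_module: "module scalars (Coker M)"
  unfolding Coker_def by (rule quot_module[OF A_module I_subspace])

lemma Coker_carrier: "carrier (Coker M) = (\<lambda>a. I +>\<^bsub>A\<^esub> a) ` carrier A"
  by (simp add: Coker_def quot_carrier)

lemmas Coker_add = quot_add[OF A_module I_subspace, folded Coker_def]
lemmas Coker_smult = quot_smult[OF A_module I_subspace, folded Coker_def]
lemmas linear_map_Coker = linear_map_coset[OF A_module I_subspace, folded Coker_def]

lemma Coker_mult:
  assumes a: "a \<in> carrier A" and b: "b \<in> carrier A"
  shows "(I +>\<^bsub>A\<^esub> a) \<otimes>\<^bsub>Coker M\<^esub> (I +>\<^bsub>A\<^esub> b) = I +>\<^bsub>A\<^esub> (a \<otimes>\<^bsub>A\<^esub> b)"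
proof -
  have cong: "I +>\<^bsub>A\<^esub> (a' \<otimes>\<^bsub>A\<^esub> b') = I +>\<^bsub>A\<^esub> (a \<otimes>\<^bsub>A\<^esub> b)"
    if "a' \<in> I +>\<^bsub>A\<^esub> a" "b' \<in> I +>\<^bsub>A\<^esub> b" for a' b'
  proof -
    obtain x y where xy: "x \<in> I" "y \<in> I" "a' = x \<oplus>\<^bsub>A\<^esub> a" "b' = y \<oplus>\<^bsub>A\<^esub> b"
      using \<open>a' \<in> I +>\<^bsub>A\<^esub> a\<close> \<open>b' \<in> I +>\<^bsub>A\<^esub> b\<close> by (auto simp: a_r_coset_def')
    note xyc = I_carrier[OF xy(1)] I_carrier[OF xy(2)]
    define u where "u = x \<otimes>\<^bsub>A\<^esub> y \<oplus>\<^bsub>A\<^esub> (x \<otimes>\<^bsub>A\<^esub> b \<oplus>\<^bsub>A\<^esub> a \<otimes>\<^bsub>A\<^esub> y)"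
    have u: "u \<in> I"
      unfolding u_def using xy xyc a b by (intro subspaceD(3)[OF A_module I_subspace] I_ideal)
    have "a' \<otimes>\<^bsub>A\<^esub> b' = u \<oplus>\<^bsub>A\<^esub> a \<otimes>\<^bsub>A\<^esub> b"
      using xyc a b by (simp add: xy(3,4) u_def A_mult A_closed A_ac)
    moreover have "(u \<oplus>\<^bsub>A\<^esub> a \<otimes>\<^bsub>A\<^esub> b) \<in> I +>\<^bsub>A\<^esub> (a \<otimes>\<^bsub>A\<^esub> b)" using u by (auto simp: a_r_coset_def')
    ultimately show ?thesis
      using abelian_subgroup.a_repr_independence'[OF subspace_abelian_subgroup[OF A_module I_subspace],
          of "a' \<otimes>\<^bsub>A\<^esub> b'" "a \<otimes>\<^bsub>A\<^esub> b"] a b A_closed(3) by simp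
  qed
  have "(I +>\<^bsub>A\<^esub> a) \<otimes>\<^bsub>Coker M\<^esub> (I +>\<^bsub>A\<^esub> b) =
      (\<Union>a'\<in>I +>\<^bsub>A\<^esub> a. \<Union>b'\<in>I +>\<^bsub>A\<^esub> b. I +>\<^bsub>A\<^esub> (a' \<otimes>\<^bsub>A\<^esub> b'))"
    by (simp add: Coker_def quot_def rcoset_mult_def)
  also have "\<dots> = (\<Union>a'\<in>I +>\<^bsub>A\<^esub> a. \<Union>b'\<in>I +>\<^bsub>A\<^esub> b. I +>\<^bsub>A\<^esub> (a \<otimes>\<^bsub>A\<^esub> b))"
    using cong by (intro SUP_cong refl)
  also have "\<dots> = I +>\<^bsub>A\<^esub> (a \<otimes>\<^bsub>A\<^esub> b)"
    using coset_self[OF A_module I_subspace a] coset_self[OF A_module I_subspace b] by auto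
  finally show ?thesis .
qed

lemma Coker_algebra: "nonunital_algebra (Coker M)"
  by (intro nonunital_algebra.intro Coker_module nonunital_algebra_axioms.intro)
    (auto simp: Coker_carrier Coker_mult Coker_add Coker_smult A_mult A_closed)

abbreviation "bicx J \<equiv> simplicial_bicomplex J (nerve M)"

definition proj :: "'r list \<times> 'a \<Rightarrow> 'a set" where
  "proj = (\<lambda>(rs, a). I +>\<^bsub>A\<^esub> a)"

lemma proj_simps: "proj ([], a) = I +>\<^bsub>A\<^esub> a"
  by (simp add: proj_def)

lemma linear_map_proj: "linear_map (N 0) (Coker M) proj"
  by (rule linear_mapI)
    (auto simp: nerve_carrier_0 proj_simps nerve_Nil_simps Coker_carrier Coker_add Coker_smult)

lemma cyclic_operator_proj: "cyclic_operator (N 0) (Coker M) (map_op proj)"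
  by (rule cyclic_operator_map_op[OF nerve_algebra Coker_algebra linear_map_proj])
    (auto simp: nerve_carrier_0 proj_simps nerve_Nil_simps Coker_mult)

lemma coker_chain_map_eq: "coker_chain_map M = (\<lambda>n x. levelwise (Coker M) (map_op proj) n (x 0))"
  by (intro ext) (simp add: coker_chain_map_def cyclic_map_levelwise proj_def)

lemma proj_faces:
  assumes "x \<in> carrier (N (Suc 0))"
  shows "proj (nerve_face M (Suc 0) 0 x) = proj (nerve_face M (Suc 0) (Suc 0) x)"
proof -
  obtain s a where x: "x = tuple_cons s ([], a)" "s \<in> carrier R" "a \<in> carrier A"
    using assms by (auto simp: nerve_carrier_Suc nerve_carrier_0)
  have "\<rho> s \<oplus>\<^bsub>A\<^esub> a \<in> I +>\<^bsub>A\<^esub> a" using x by (auto simp: a_r_coset_def' image_ideal_def)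
  then have "I +>\<^bsub>A\<^esub> a = I +>\<^bsub>A\<^esub> (\<rho> s \<oplus>\<^bsub>A\<^esub> a)"
    using abelian_subgroup.a_repr_independence'[OF subspace_abelian_subgroup[OF A_module I_subspace]] x(3) by blast
  then show ?thesis by (simp add: x face_0 face_1_Nil proj_simps)
qed

lemma simplicial_op_1: "simplicial_op (nerve M) (Suc 0) f =
    map_op (nerve_face M (Suc 0) 0) f - map_op (nerve_face M (Suc 0) (Suc 0)) f"
  by (simp add: simplicial_op_def nerve_def)


subsection \<open>A linear section of the nerve\<close>

text \<open>A linear map \<open>s\<close> with \<open>\<rho> \<circ> s \<circ> \<rho> = \<rho>\<close> exists because \<open>k\<close> is a field.\<close>

definition sec :: "'a \<Rightarrow> 'r" where
  "sec = (SOME s. linear_map A R s \<and> (\<forall>x\<in>carrier R. \<rho> (s (\<rho> x)) = \<rho> x))"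

lemma sec: "linear_map A R sec" "x \<in> carrier R \<Longrightarrow> \<rho> (sec (\<rho> x)) = \<rho> x"
proof -
  have "linear_map A R sec \<and> (\<forall>x\<in>carrier R. \<rho> (sec (\<rho> x)) = \<rho> x)"
    unfolding sec_def by (rule someI_ex[OF ex_generalized_inverse[OF R_module A_module map_linear]])
  then show "linear_map A R sec" "x \<in> carrier R \<Longrightarrow> \<rho> (sec (\<rho> x)) = \<rho> x" by auto
qed

lemmas sec_simps = linear_mapD[OF sec(1)]

text \<open>The value depends only on the class of an element modulo the image of \<open>\<rho>\<close>, so that \<open>red\<close>
  factors through a section of the projection.\<close>

definition red :: "'a \<Rightarrow> 'a" where
  "red a = a \<ominus>\<^bsub>A\<^esub> \<rho> (sec a)"

lemma red_closed: "a \<in> carrier A \<Longrightarrow> red a \<in> carrier A"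
  by (simp add: red_def diff_mem[OF A_module] sec_simps \<rho>_closed)

lemma linear_map_red: "linear_map A A red"
proof -
  obtain j :: "'a \<Rightarrow> ('a \<Rightarrow>\<^sub>0 'k)" where "embedding A j" using ex_embedding[OF A_module] by blast
  note j = embeddingD[OF this A_module]
  show ?thesis
  proof (rule linear_mapI)
    fix x y c assume x: "x \<in> carrier A"
    then show "red x \<in> carrier A" by (rule red_closed)
    have "j (red (c \<odot>\<^bsub>A\<^esub> x)) = j (c \<odot>\<^bsub>A\<^esub> red x)"
      using x by (simp add: red_def j closed sec_simps diff_mem[OF A_module] \<rho>_simps fscale_diff)
    then show "red (c \<odot>\<^bsub>A\<^esub> x) = c \<odot>\<^bsub>A\<^esub> red x"
      by (rule iffD1[OF j(1), rotated 2]) (simp_all add: x closed red_closed)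
    assume y: "y \<in> carrier A"
    have "j (red (x \<oplus>\<^bsub>A\<^esub> y)) = j (red x \<oplus>\<^bsub>A\<^esub> red y)"
      using x y by (simp add: red_def j closed sec_simps diff_mem[OF A_module] \<rho>_simps)
    then show "red (x \<oplus>\<^bsub>A\<^esub> y) = red x \<oplus>\<^bsub>A\<^esub> red y"
      by (rule iffD1[OF j(1), rotated 2]) (simp_all add: x y closed red_closed)
  qed
qed

lemma red_I: "x \<in> I \<Longrightarrow> red x = \<zero>\<^bsub>A\<^esub>"
  by (auto simp: image_ideal_def red_def sec(2) diff_eq_zero_iff[OF A_module] \<rho>_closed)

lemma \<rho>_sec_red: "a \<in> carrier A \<Longrightarrow> \<rho> (sec a) \<oplus>\<^bsub>A\<^esub> red a = a"
proof -
  assume a: "a \<in> carrier A"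
  obtain j :: "'a \<Rightarrow> ('a \<Rightarrow>\<^sub>0 'k)" where "embedding A j" using ex_embedding[OF A_module] by blast
  note j = embeddingD[OF this A_module]
  have "j (\<rho> (sec a) \<oplus>\<^bsub>A\<^esub> red a) = j a"
    using a by (simp add: red_def j closed sec_simps diff_mem[OF A_module])
  then show ?thesis
    by (rule iffD1[OF j(1), rotated 2]) (simp_all add: a closed red_closed sec_simps)
qed

lemma proj_red: "a \<in> carrier A \<Longrightarrow> I +>\<^bsub>A\<^esub> red a = I +>\<^bsub>A\<^esub> a"
proof -
  assume a: "a \<in> carrier A"
  have "a = \<rho> (sec a) \<oplus>\<^bsub>A\<^esub> red a" using \<rho>_sec_red[OF a] by simp
  then have "a \<in> I +>\<^bsub>A\<^esub> red a" using sec_simps(1)[OF a] by (auto simp: a_r_coset_def' image_ideal_def)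
  then show ?thesis
    using abelian_subgroup.a_repr_independence'[OF subspace_abelian_subgroup[OF A_module I_subspace]]
      red_closed[OF a] by blast
qed

definition red0 :: "'r list \<times> 'a \<Rightarrow> 'r list \<times> 'a" where
  "red0 x = ([], red (snd x))"

text \<open>The linear map \<open>h\<close> that contracts the rows: its last face is the identity, its first face
  factors through the cokernel.\<close>

definition homotopy :: "'r list \<times> 'a \<Rightarrow> 'r list \<times> 'a" where
  "homotopy x = tuple_cons (sec (snd x)) (red0 x)"

definition coker_sec :: "'a set \<Rightarrow> 'r list \<times> 'a" where
  "coker_sec = quot_lift (\<lambda>a. ([], red a))"

lemma linear_map_Nil: "linear_map A (N 0) (\<lambda>a. ([], a))"
  by (rule linear_mapI) (auto simp: nerve_Nil_simps)

lemma coker_sec_coset: "a \<in> carrier A \<Longrightarrow> coker_sec (I +>\<^bsub>A\<^esub> a) = ([], red a)"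
  and linear_map_coker_sec: "linear_map (Coker M) (N 0) coker_sec"
proof -
  note lin = linear_map_comp[OF linear_map_red linear_map_Nil]
  have 0: "([], red x) = \<zero>\<^bsub>N 0\<^esub>" if "x \<in> I" for x using that by (simp add: red_I nerve_Nil_simps)
  show "a \<in> carrier A \<Longrightarrow> coker_sec (I +>\<^bsub>A\<^esub> a) = ([], red a)"
    unfolding coker_sec_def by (rule quot_lift_coset[OF A_module I_subspace nerve_module lin 0])
  show "linear_map (Coker M) (N 0) coker_sec"
    unfolding coker_sec_def Coker_def by (rule linear_map_quot_lift[OF A_module I_subspace nerve_module lin 0])
qed

lemma linear_map_red0: "linear_map (N 0) (N 0) red0"
  by (rule linear_mapI)
    (auto simp: red0_def nerve_carrier_0 nerve_Nil_simps linear_mapD[OF linear_map_red])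

lemma linear_map_homotopy: "linear_map (N 0) (N (Suc 0)) homotopy"
  by (rule linear_mapI)
    (auto simp: homotopy_def red0_def nerve_carrier_0 nerve_Nil_simps nerve_cons_simps tuple_cons_mem
      linear_mapD[OF linear_map_red] sec_simps)

lemma homotopy_faces:
  assumes "x \<in> carrier (N 0)"
  shows "nerve_face M (Suc 0) 0 (homotopy x) = red0 x" "nerve_face M (Suc 0) (Suc 0) (homotopy x) = x"
  using assms \<rho>_sec_red by (auto simp: homotopy_def face_0 face_1_Nil red0_def nerve_carrier_0)

lemma coker_sec_proj: "x \<in> carrier (N 0) \<Longrightarrow> coker_sec (proj x) = red0 x"
  by (auto simp: nerve_carrier_0 proj_simps coker_sec_coset red0_def)

lemma proj_coker_sec: "u \<in> carrier (Coker M) \<Longrightarrow> proj (coker_sec u) = u"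
  by (auto simp: Coker_carrier coker_sec_coset proj_simps proj_red)

lemma graded_proj: "graded_operator (N 0) (Coker M) (map_op proj)"
  and graded_coker_sec: "graded_operator (Coker M) (N 0) (map_op coker_sec)"
  and graded_red0: "graded_operator (N 0) (N 0) (map_op red0)"
  and graded_homotopy: "graded_operator (N 0) (N (Suc 0)) (map_op homotopy)"
  by (rule graded_operator_map_op; simp add: nerve_module Coker_module linear_map_proj
      linear_map_coker_sec linear_map_red0 linear_map_homotopy)+

lemma graded_simplicial_op: "graded_operator (N (Suc m)) (N m) (simplicial_op (nerve M) (Suc m))"
  using cyclic_operator_graded[OF cyclic_operator_simplicial_op[OF is_presimplicial_nerve]] by (simp add: nerve_def)

context
  fixes J :: "nat set"
  assumes J: "lower_closed J"
begin

lemma bispace_B: "bispace (bicx J) m n = chain_space (cyclic_total J (N m)) n"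
  by (simp add: simplicial_bicomplex_simps nerve_def)

lemma hdiff_B:
  "x \<in> carrier (bispace (bicx J) (Suc m) n) \<Longrightarrow> hdiff (bicx J) (Suc m) n x = levelwise (N m) (simplicial_op (nerve M) (Suc m)) n x"
  using simplicial_hdiff[OF is_presimplicial_nerve, of x J m n] by (simp add: nerve_def)

lemma vdiff_B: "vdiff (bicx J) m (Suc n) x =
    ((-1) ^ m) \<odot>\<^bsub>chain_space (cyclic_total J (N m)) n\<^esub> diff (cyclic_total J (N m)) (Suc n) x"
  by (simp add: simplicial_bicomplex_simps nerve_def)

lemma vdiff_0:
  assumes "x \<in> carrier (bispace (bicx J) 0 (Suc n))"
  shows "vdiff (bicx J) 0 (Suc n) x = diff (cyclic_total J (N 0)) (Suc n) x"
  using assms linear_mapD(1)[OF is_complexD(2)[OF is_complex_cyclic_total[OF nerve_algebra J]]]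
  by (simp add: vdiff_B bispace_B module_simps(2)[OF cyclic_total_module[OF nerve_algebra]])

lemma proj_hdiff:
  assumes x: "x \<in> carrier (bispace (bicx J) (Suc 0) n)"
  shows "levelwise (Coker M) (map_op proj) n (hdiff (bicx J) (Suc 0) n x) = \<zero>\<^bsub>chain_space (cyclic_total J (Coker M)) n\<^esub>"
proof -
  have x': "x \<in> carrier (chain_space (cyclic_total J (N (Suc 0))) n)" using x by (simp add: bispace_B)
  have "levelwise (Coker M) (map_op proj) n (hdiff (bicx J) (Suc 0) n x) =
      levelwise (Coker M) (\<lambda>f. map_op proj (simplicial_op (nerve M) (Suc 0) f)) n x"
    unfolding hdiff_B[OF x]
    by (rule levelwise_comp[OF nerve_algebra nerve_algebra Coker_algebra graded_proj graded_simplicial_op x'])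
  also have "\<dots> = levelwise (Coker M) (\<lambda>f. 0) n x"
  proof (rule levelwise_cong[OF nerve_algebra Coker_algebra graded_operator_comp[OF graded_proj graded_simplicial_op]
        graded_operator_zero[OF Coker_module] _ x'])
    fix k w assume "w \<in> tensor_words (N (Suc 0)) k"
    then have "map proj (map (nerve_face M (Suc 0) 0) w) = map proj (map (nerve_face M (Suc 0) (Suc 0)) w)"
      using proj_faces by (auto simp: tensor_words_def subset_iff)
    then show "map_op proj (simplicial_op (nerve M) (Suc 0) (Poly_Mapping.single w 1)) = 0"
      by (simp only: simplicial_op_1 map_op_single lin_opD(5)[OF lin_op_map_op] right_minus_eq)
  qed
  also have "\<dots> = \<zero>\<^bsub>chain_space (cyclic_total J (Coker M)) n\<^esub>"
    by (rule levelwise_zero[OF nerve_algebra Coker_algebra x'])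
  finally show ?thesis .
qed

text \<open>A linear section of the projection, applied to all tensor factors, gives preimages.\<close>

lemma proj_surj:
  "levelwise (Coker M) (map_op proj) n ` carrier (bispace (bicx J) 0 n) = carrier (chain_space (cyclic_total J (Coker M)) n)"
proof (intro equalityI subsetI)
  fix y assume y: "y \<in> carrier (chain_space (cyclic_total J (Coker M)) n)"
  have "levelwise (Coker M) (map_op proj) n (levelwise (N 0) (map_op coker_sec) n y) =
      levelwise (Coker M) (\<lambda>f. map_op proj (map_op coker_sec f)) n y"
    by (rule levelwise_comp[OF Coker_algebra nerve_algebra Coker_algebra graded_proj graded_coker_sec y])
  also have "\<dots> = levelwise (Coker M) (\<lambda>f. f) n y"
  proof (rule levelwise_cong[OF Coker_algebra Coker_algebra graded_operator_comp[OF graded_proj graded_coker_sec] _ _ y])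
    show "graded_operator (Coker M) (Coker M) (\<lambda>f. f)"
      by (simp add: graded_operator_def tensor_operator_id)
    fix k w assume "w \<in> tensor_words (Coker M) k"
    then have "map proj (map coker_sec w) = w"
      using proj_coker_sec by (auto simp: tensor_words_def subset_iff intro!: map_idI)
    then show "map_op proj (map_op coker_sec (Poly_Mapping.single w 1)) = Poly_Mapping.single w 1"
      by (simp only: map_op_single)
  qed
  also have "\<dots> = y" by (rule levelwise_id[OF Coker_algebra y])
  finally show "y \<in> levelwise (Coker M) (map_op proj) n ` carrier (bispace (bicx J) 0 n)"
    using linear_mapD(1)[OF linear_map_levelwise[OF Coker_algebra nerve_algebra graded_coker_sec] y]
    by (metis bispace_B image_eqI)
qed (use linear_mapD(1)[OF linear_map_levelwise[OF nerve_algebra Coker_algebra graded_proj]] in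
    \<open>auto simp: bispace_B\<close>)

text \<open>The first face of the homotopy factors through the cokernel, where the given chain is zero;
  the last face contributes the chain itself, with the sign \<open>-1\<close> of the simplicial differential.\<close>

lemma hdiff_homotopy:
  assumes x: "x \<in> carrier (bispace (bicx J) 0 n)"
    and gx: "levelwise (Coker M) (map_op proj) n x = \<zero>\<^bsub>chain_space (cyclic_total J (Coker M)) n\<^esub>"
  shows "hdiff (bicx J) (Suc 0) n (levelwise (N (Suc 0)) (map_op homotopy) n x) = \<ominus>\<^bsub>bispace (bicx J) 0 n\<^esub> x"
proof -
  note mN = nerve_module[of 0]
  have x': "x \<in> carrier (chain_space (cyclic_total J (N 0)) n)" using x by (simp add: bispace_B)
  let ?V = "chain_space (cyclic_total J (N 0)) n"
  interpret V: module scalars ?V by (rule cyclic_total_module[OF nerve_algebra])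
  have hx: "levelwise (N (Suc 0)) (map_op homotopy) n x \<in> carrier (bispace (bicx J) (Suc 0) n)"
    unfolding bispace_B by (rule linear_mapD(1)[OF linear_map_levelwise[OF nerve_algebra nerve_algebra graded_homotopy] x'])
  have gid: "graded_operator (N 0) (N 0) (\<lambda>f. fscale (- 1) f)"
    by (rule graded_operator_fscale[OF mN]) (simp add: graded_operator_def tensor_operator_id)
  have gid': "graded_operator (N 0) (N 0) (\<lambda>f. f)" by (simp add: graded_operator_def tensor_operator_id)
  have red: "levelwise (N 0) (map_op red0) n x = \<zero>\<^bsub>?V\<^esub>"
  proof -
    have "levelwise (N 0) (map_op red0) n x = levelwise (N 0) (\<lambda>f. map_op coker_sec (map_op proj f)) n x"
    proof (rule levelwise_cong[OF nerve_algebra nerve_algebra graded_red0 graded_operator_comp[OF graded_coker_sec graded_proj] _ x'])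
      fix k w assume "w \<in> tensor_words (N 0) k"
      then have "map red0 w = map coker_sec (map proj w)"
        using coker_sec_proj by (auto simp: tensor_words_def subset_iff)
      then show "map_op red0 (Poly_Mapping.single w 1) = map_op coker_sec (map_op proj (Poly_Mapping.single w 1))"
        by (simp only: map_op_single)
    qed
    also have "\<dots> = levelwise (N 0) (map_op coker_sec) n (levelwise (Coker M) (map_op proj) n x)"
      by (rule levelwise_comp[OF nerve_algebra Coker_algebra nerve_algebra graded_coker_sec graded_proj x', symmetric])
    also have "\<dots> = \<zero>\<^bsub>?V\<^esub>"
      unfolding gx by (rule linear_map_zero[OF cyclic_total_module[OF Coker_algebra] cyclic_total_module[OF nerve_algebra]
            linear_map_levelwise[OF Coker_algebra nerve_algebra graded_coker_sec]])
    finally show ?thesis .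
  qed
  have "hdiff (bicx J) (Suc 0) n (levelwise (N (Suc 0)) (map_op homotopy) n x) =
      levelwise (N 0) (\<lambda>f. simplicial_op (nerve M) (Suc 0) (map_op homotopy f)) n x"
    unfolding hdiff_B[OF hx]
    by (rule levelwise_comp[OF nerve_algebra nerve_algebra nerve_algebra graded_simplicial_op graded_homotopy x'])
  also have "\<dots> = levelwise (N 0) (\<lambda>f. map_op red0 f + fscale (- 1) f) n x"
  proof (rule levelwise_cong[OF nerve_algebra nerve_algebra graded_operator_comp[OF graded_simplicial_op graded_homotopy]
        graded_operator_add[OF mN graded_red0 gid] _ x'])
    fix k w assume "w \<in> tensor_words (N 0) k"
    then have "map (nerve_face M (Suc 0) 0) (map homotopy w) = map red0 w"
      "map (nerve_face M (Suc 0) (Suc 0)) (map homotopy w) = w"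
      using homotopy_faces by (auto simp: tensor_words_def subset_iff intro!: map_idI)
    then show "simplicial_op (nerve M) (Suc 0) (map_op homotopy (Poly_Mapping.single w 1)) =
        map_op red0 (Poly_Mapping.single w 1) + fscale (- 1) (Poly_Mapping.single w 1)"
      by (simp only: simplicial_op_1 map_op_single) (simp add: single_uminus)
  qed
  also have "\<dots> = levelwise (N 0) (map_op red0) n x \<oplus>\<^bsub>?V\<^esub> levelwise (N 0) (\<lambda>f. fscale (- 1) f) n x"
    by (rule levelwise_add[OF nerve_algebra nerve_algebra graded_red0 gid x', symmetric])
  also have "levelwise (N 0) (\<lambda>f. fscale (- 1) f) n x = (- 1) \<odot>\<^bsub>?V\<^esub> levelwise (N 0) (\<lambda>f. f) n x"
    by (rule levelwise_smult[OF nerve_algebra nerve_algebra gid' x', symmetric])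
  also have "levelwise (N 0) (\<lambda>f. f) n x = x" by (rule levelwise_id[OF nerve_algebra x'])
  also have "(- 1) \<odot>\<^bsub>?V\<^esub> x = \<ominus>\<^bsub>?V\<^esub> x"
    by (rule minus_conv_smult[OF cyclic_total_module[OF nerve_algebra] x', symmetric])
  finally show ?thesis using x' by (simp add: red bispace_B)
qed

end

end


section \<open>The first homology of the kernel of the augmentation\<close>

context crossed_module
begin

definition first :: "'r list \<times> 'a \<Rightarrow> 'r" where
  "first x = hd (fst x)"

lemma first_cons [simp]: "first (tuple_cons s x) = s"
  by (simp add: first_def tuple_cons_def)

lemma linear_map_first: "linear_map (N (Suc n)) R first"
  by (rule linear_mapI) (auto simp: nerve_carrier_Suc nerve_cons_simps)

lemma nerve_1_cases:
  assumes "x \<in> carrier (N (Suc 0))"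
  obtains s a where "s \<in> carrier R" "a \<in> carrier A" "x = tuple_cons s ([], a)"
  using assms by (auto simp: nerve_carrier_Suc nerve_carrier_0)

lemma nerve_1_mem: "tuple_cons s ([], a) \<in> carrier (N (Suc 0)) \<longleftrightarrow> s \<in> carrier R \<and> a \<in> carrier A"
  by (simp add: tuple_cons_mem nerve_Nil_simps)

text \<open>The bracket of an element of \<open>A\<close> with one of \<open>R\<close>; the subspace \<open>[A, Ker \<rho>]\<close> is spanned by
  its values on the kernel.\<close>

definition act_comm :: "'a \<Rightarrow> 'r \<Rightarrow> 'r" where
  "act_comm a x = l a x \<ominus>\<^bsub>R\<^esub> r x a"

definition kercomm :: "'r set" where
  "kercomm = lin_span (Ker M) {act_comm a x | a x. a \<in> carrier A \<and> x \<in> carrier (Ker M)}"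

lemma Ker_mod_commutators_eq: "Ker_mod_commutators M = quot (Ker M) kercomm"
  by (simp add: Ker_mod_commutators_def kercomm_def act_comm_def)

lemma act_comm_closed: "a \<in> carrier A \<Longrightarrow> x \<in> carrier R \<Longrightarrow> act_comm a x \<in> carrier R"
  by (simp add: act_comm_def diff_mem[OF R_module] action_closed)

lemma Ker_carrier: "x \<in> carrier (Ker M) \<longleftrightarrow> x \<in> carrier R \<and> \<rho> x = \<zero>\<^bsub>A\<^esub>"
  by (simp add: Ker_def a_kernel_eq)

lemma Ker_subspace: "submodule (carrier (Ker M)) scalars R"
  using subspace_kernel[OF R_module A_module map_linear] by (simp add: Ker_def a_kernel_eq)

lemma Ker_module: "module scalars (Ker M)"
  using subspace_module[OF R_module Ker_subspace] by (simp add: Ker_def)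

lemma Ker_simps:
  "x \<oplus>\<^bsub>Ker M\<^esub> y = x \<oplus>\<^bsub>R\<^esub> y" "\<zero>\<^bsub>Ker M\<^esub> = \<zero>\<^bsub>R\<^esub>" "c \<odot>\<^bsub>Ker M\<^esub> x = c \<odot>\<^bsub>R\<^esub> x"
  "W +>\<^bsub>Ker M\<^esub> x = W +>\<^bsub>R\<^esub> x"
  by (simp_all add: Ker_def)

lemma act_comm_Ker:
  assumes "a \<in> carrier A" "x \<in> carrier (Ker M)"
  shows "act_comm a x \<in> carrier (Ker M)"
proof -
  have x: "x \<in> carrier R" "\<rho> x = \<zero>\<^bsub>A\<^esub>" using assms(2) by (auto simp: Ker_carrier)
  have "a \<otimes>\<^bsub>A\<^esub> \<zero>\<^bsub>A\<^esub> = \<zero>\<^bsub>A\<^esub>" "\<zero>\<^bsub>A\<^esub> \<otimes>\<^bsub>A\<^esub> a = \<zero>\<^bsub>A\<^esub>"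
    using linear_map_zero[OF A_module A_module linear_map_mult_left[OF A_algebra assms(1)]]
      linear_map_zero[OF A_module A_module linear_map_mult_right[OF A_algebra assms(1)]] by auto
  then have "\<rho> (act_comm a x) = \<zero>\<^bsub>A\<^esub>"
    using x assms(1)
    by (simp add: act_comm_def linear_map_diff[OF R_module A_module map_linear] action_closed map_l map_r
        diff_eq_zero_iff[OF A_module] closed)
  then show ?thesis using x assms(1) by (simp add: Ker_carrier act_comm_closed)
qed

lemma kercomm_subspace: "submodule kercomm scalars (Ker M)"
  unfolding kercomm_def by (rule subspace_lin_span[OF Ker_module]) (auto simp: act_comm_Ker)

lemma kercomm_subspace_R: "submodule kercomm scalars R"
  using subspaceD[OF Ker_module kercomm_subspace]
  by (intro subspaceI[OF R_module]) (auto simp: Ker_simps Ker_carrier)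

lemma act_comm_mem: "a \<in> carrier A \<Longrightarrow> x \<in> carrier (Ker M) \<Longrightarrow> act_comm a x \<in> kercomm"
  unfolding kercomm_def by (rule lin_span_superset) auto

lemma Q_module: "module scalars (Ker_mod_commutators M)"
  unfolding Ker_mod_commutators_eq by (rule quot_module[OF Ker_module kercomm_subspace])

text \<open>Here \<open>\<rho> s + a\<close> is the anchor of \<open>(s, a)\<close>. Because \<open>\<rho>(s) t = s t = s \<rho>(t)\<close>, the terms \<open>s t\<close>
  and \<open>t s\<close> are absorbed into brackets of \<open>A\<close> with \<open>R\<close>.\<close>

lemma first_commutator:
  assumes "s \<in> carrier R" "a \<in> carrier A" "t \<in> carrier R" "b \<in> carrier A"
  shows "first ((tuple_cons s ([], a) \<otimes>\<^bsub>N (Suc 0)\<^esub> tuple_cons t ([], b)) \<ominus>\<^bsub>N (Suc 0)\<^esub>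
      (tuple_cons t ([], b) \<otimes>\<^bsub>N (Suc 0)\<^esub> tuple_cons s ([], a))) =
    act_comm (\<rho> s \<oplus>\<^bsub>A\<^esub> a) t \<ominus>\<^bsub>R\<^esub> act_comm b s"
proof -
  obtain j :: "'r \<Rightarrow> ('r \<Rightarrow>\<^sub>0 'k)" where "embedding R j" using ex_embedding[OF R_module] by blast
  note j = embeddingD[OF this R_module]
  have mem: "tuple_cons s ([], a) \<otimes>\<^bsub>N (Suc 0)\<^esub> tuple_cons t ([], b) \<in> carrier (N (Suc 0))"
    "tuple_cons t ([], b) \<otimes>\<^bsub>N (Suc 0)\<^esub> tuple_cons s ([], a) \<in> carrier (N (Suc 0))"
    using assms by (auto simp: nerve_1_mem intro!: nerve_mult_closed)
  have "j (first ((tuple_cons s ([], a) \<otimes>\<^bsub>N (Suc 0)\<^esub> tuple_cons t ([], b)) \<ominus>\<^bsub>N (Suc 0)\<^esub>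
      (tuple_cons t ([], b) \<otimes>\<^bsub>N (Suc 0)\<^esub> tuple_cons s ([], a)))) =
    j (act_comm (\<rho> s \<oplus>\<^bsub>A\<^esub> a) t \<ominus>\<^bsub>R\<^esub> act_comm b s)"
    unfolding linear_map_diff[OF nerve_module R_module linear_map_first mem]
    using assms
    by (simp add: nerve_cons_simps nerve_Nil_simps j closed act_comm_def diff_mem[OF R_module]
        action_add peiffer_l peiffer_r)
  then show ?thesis
    by (rule iffD1[OF j(1), rotated 2])
      (use assms linear_mapD(1)[OF linear_map_first diff_mem[OF nerve_module mem]] in
        \<open>simp_all add: diff_mem[OF R_module] act_comm_closed closed\<close>)
qed

text \<open>The bracket of \<open>(s, a)\<close> and \<open>(t, b)\<close> in level \<open>1\<close> differs from the
  difference of the brackets of the liftings of the two faces by commutators of \<open>A\<close> with the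
  elements \<open>s - sec (\<rho> s)\<close> and \<open>t - sec (\<rho> t)\<close> of the kernel of \<open>\<rho>\<close>.  Writing \<open>[a, x]\<close> for
  \<open>act_comm a x\<close>, the terms left over cancel by bilinearity and \<open>[\<rho> x, y] = - [\<rho> y, x]\<close>.\<close>

lemma bracket_homotopy:
  assumes s: "s \<in> carrier R" and a: "a \<in> carrier A" and t: "t \<in> carrier R" and b: "b \<in> carrier A"
  defines "br \<equiv> \<lambda>a b. act_comm a (sec b) \<ominus>\<^bsub>R\<^esub> act_comm (red b) (sec a)"
  shows "(act_comm (\<rho> s \<oplus>\<^bsub>A\<^esub> a) t \<ominus>\<^bsub>R\<^esub> act_comm b s) \<oplus>\<^bsub>R\<^esub>
      (br a b \<ominus>\<^bsub>R\<^esub> br (\<rho> s \<oplus>\<^bsub>A\<^esub> a) (\<rho> t \<oplus>\<^bsub>A\<^esub> b)) =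
    act_comm (\<rho> s \<oplus>\<^bsub>A\<^esub> a) (t \<ominus>\<^bsub>R\<^esub> sec (\<rho> t)) \<ominus>\<^bsub>R\<^esub> act_comm b (s \<ominus>\<^bsub>R\<^esub> sec (\<rho> s))"
proof -
  obtain j :: "'r \<Rightarrow> ('r \<Rightarrow>\<^sub>0 'k)" where "embedding R j" using ex_embedding[OF R_module] by blast
  note j = embeddingD[OF this R_module]
  define c where "c a x = j (act_comm a x)" for a x
  note cl = closed act_comm_closed diff_mem[OF R_module] diff_mem[OF A_module] sec_simps(1) red_closed
  have c_add: "c (a \<oplus>\<^bsub>A\<^esub> b) x = c a x + c b x" if "a \<in> carrier A" "b \<in> carrier A" "x \<in> carrier R" for a b x
    using that by (simp add: c_def act_comm_def j cl action_add)
  have c_add': "c a (x \<oplus>\<^bsub>R\<^esub> y) = c a x + c a y" if "a \<in> carrier A" "x \<in> carrier R" "y \<in> carrier R" for a x y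
    using that by (simp add: c_def act_comm_def j cl action_add)
  have c_smult: "c ((- 1) \<odot>\<^bsub>A\<^esub> a) x = - c a x" "c a ((- 1) \<odot>\<^bsub>R\<^esub> x) = - c a x"
    if "a \<in> carrier A" "x \<in> carrier R" for a x
    using that by (simp_all add: c_def act_comm_def j cl action_smult)
  have c_diff: "c (a \<ominus>\<^bsub>A\<^esub> b) x = c a x - c b x" if "a \<in> carrier A" "b \<in> carrier A" "x \<in> carrier R" for a b x
    using that by (simp add: a_minus_def minus_conv_smult[OF A_module] c_add cl c_smult)
  have c_diff': "c a (x \<ominus>\<^bsub>R\<^esub> y) = c a x - c a y" if "a \<in> carrier A" "x \<in> carrier R" "y \<in> carrier R" for a x y
    using that by (simp add: a_minus_def minus_conv_smult[OF R_module] c_add' cl c_smult)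
  have c_anti: "c (\<rho> x) y = - c (\<rho> y) x" if "x \<in> carrier R" "y \<in> carrier R" for x y
    using that by (simp add: c_def act_comm_def j cl peiffer_l peiffer_r)
  have \<rho>\<sigma>: "\<rho> (sec (\<rho> x)) = \<rho> x" if "x \<in> carrier R" for x using sec(2)[OF that] .
  have anti: "c (\<rho> (sec b)) (sec (\<rho> s)) = - c (\<rho> s) (sec b)"
    using c_anti[of "sec b" "sec (\<rho> s)"] s b by (simp add: cl \<rho>\<sigma>)
  let ?\<alpha> = "\<rho> s \<oplus>\<^bsub>A\<^esub> a" and ?\<beta> = "\<rho> t \<oplus>\<^bsub>A\<^esub> b"
  have br: "j (br x y) = c x (sec y) - c y (sec x) + c (\<rho> (sec y)) (sec x)" if "x \<in> carrier A" "y \<in> carrier A" for x y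
    using that by (simp add: br_def j cl flip: c_def) (simp add: red_def c_diff cl)
  have br_cl: "br x y \<in> carrier R" if "x \<in> carrier A" "y \<in> carrier A" for x y
    using that by (simp add: br_def cl)
  have "j ((act_comm ?\<alpha> t \<ominus>\<^bsub>R\<^esub> act_comm b s) \<oplus>\<^bsub>R\<^esub> (br a b \<ominus>\<^bsub>R\<^esub> br ?\<alpha> ?\<beta>)) =
      (c ?\<alpha> t - c b s) + (j (br a b) - j (br ?\<alpha> ?\<beta>))"
    using s a t b by (simp add: j cl br_cl c_def)
  also have "\<dots> = c ?\<alpha> (t \<ominus>\<^bsub>R\<^esub> sec (\<rho> t)) - c b (s \<ominus>\<^bsub>R\<^esub> sec (\<rho> s))"
    using s a t b
    by (simp add: br cl c_add c_add' c_diff' sec_simps(2) \<rho>_simps \<rho>\<sigma> anti)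
  also have "\<dots> = j (act_comm ?\<alpha> (t \<ominus>\<^bsub>R\<^esub> sec (\<rho> t)) \<ominus>\<^bsub>R\<^esub> act_comm b (s \<ominus>\<^bsub>R\<^esub> sec (\<rho> s)))"
    using s a t b by (simp add: j cl c_def)
  finally show ?thesis
    by (rule iffD1[OF j(1), rotated 2]) (use s a t b in \<open>simp_all add: cl br_cl\<close>)
qed

lemma sub_sec_Ker: "x \<in> carrier R \<Longrightarrow> x \<ominus>\<^bsub>R\<^esub> sec (\<rho> x) \<in> carrier (Ker M)"
  by (simp add: Ker_carrier diff_mem[OF R_module] sec_simps \<rho>_closed sec(2) diff_eq_zero_iff[OF A_module]
      linear_map_diff[OF R_module A_module map_linear])

text \<open>For a horizontal cycle the second summand is zero: this bounds the vertical boundaries of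
  horizontal cycles by \<open>[A, Ker \<rho>]\<close>. On words it is \<open>bracket_homotopy\<close>.\<close>

lemma first_commutator_homotopy:
  assumes \<xi>: "\<xi> \<in> carrier (tensor_power (N (Suc 0)) (Suc (Suc 0)))"
  shows "first (commutator_map (N (Suc 0)) \<xi>) \<oplus>\<^bsub>R\<^esub> first (commutator_map (N (Suc 0))
      (tensor_op (N (Suc 0)) (Suc (Suc 0)) (map_op homotopy)
        (tensor_op (N 0) (Suc (Suc 0)) (simplicial_op (nerve M) (Suc 0)) \<xi>))) \<in> kercomm"
proof (rule tensor_power_induct[OF nerve_module R_module _ kercomm_subspace_R _ \<xi>])
  note m0 = nerve_module[of 0] and m1 = nerve_module[of "Suc 0"]
  note op = graded_operatorD[OF graded_simplicial_op[of 0], of "Suc (Suc 0)"]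
    and hop = graded_operatorD[OF graded_homotopy, of "Suc (Suc 0)"]
  note cm = linear_map_commutator_map[OF nerve_algebra, of "Suc 0"]
  note fcm = linear_map_comp[OF cm linear_map_first]
  show "linear_map (tensor_power (N (Suc 0)) (Suc (Suc 0))) R (\<lambda>\<xi>. first (commutator_map (N (Suc 0)) \<xi>) \<oplus>\<^bsub>R\<^esub>
      first (commutator_map (N (Suc 0)) (tensor_op (N (Suc 0)) (Suc (Suc 0)) (map_op homotopy)
        (tensor_op (N 0) (Suc (Suc 0)) (simplicial_op (nerve M) (Suc 0)) \<xi>))))"
    by (intro linear_map_add[OF tensor_power_module[OF m1] R_module] fcm
        linear_map_comp[OF linear_map_comp[OF linear_map_tensor_op[OF m1 m0 op] linear_map_tensor_op[OF m0 m1 hop]] fcm])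
  fix w assume "w \<in> tensor_words (N (Suc 0)) (Suc (Suc 0))"
  then obtain x y where xy: "x \<in> carrier (N (Suc 0))" "y \<in> carrier (N (Suc 0))" and w: "w = [x, y]"
    by (auto simp: words_2)
  obtain s a where x: "s \<in> carrier R" "a \<in> carrier A" "x = tuple_cons s ([], a)" using nerve_1_cases[OF xy(1)] .
  obtain t b where y: "t \<in> carrier R" "b \<in> carrier A" "y = tuple_cons t ([], b)" using nerve_1_cases[OF xy(2)] .
  let ?\<alpha> = "\<rho> s \<oplus>\<^bsub>A\<^esub> a" and ?\<beta> = "\<rho> t \<oplus>\<^bsub>A\<^esub> b"
  \<comment> \<open>The elements \<open>h a\<close>, \<open>h b\<close> and \<open>h \<alpha>\<close>, \<open>h \<beta>\<close> lift the faces of \<open>x\<close> and \<open>y\<close> to level \<open>1\<close>.\<close>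
  define h where "h a = tuple_cons (sec a) ([], red a)" for a
  have h: "h a \<in> carrier (N (Suc 0))" if "a \<in> carrier A" for a
    using that by (simp add: h_def nerve_1_mem sec_simps red_closed)
  have \<alpha>\<beta>: "?\<alpha> \<in> carrier A" "?\<beta> \<in> carrier A" using x y by (simp_all add: closed)
  have k: "Poly_Mapping.keys (Poly_Mapping.single [p, q] (1 :: 'k)) \<subseteq> tensor_words (N n) (Suc (Suc 0))"
    if "p \<in> carrier (N n)" "q \<in> carrier (N n)" for p q n
    using that by (auto simp: words_2)
  have "tensor_op (N (Suc 0)) (Suc (Suc 0)) (map_op homotopy)
        (tensor_op (N 0) (Suc (Suc 0)) (simplicial_op (nerve M) (Suc 0))
          (tensor_class (N (Suc 0)) (Suc (Suc 0)) (Poly_Mapping.single w 1))) =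
      tensor_class (N (Suc 0)) (Suc (Suc 0))
        (map_op homotopy (simplicial_op (nerve M) (Suc 0) (Poly_Mapping.single [x, y] 1)))"
    using tensor_op_class[OF m1 m0 op k[OF xy]]
      tensor_op_class[OF m0 m1 hop tensor_operatorD(2)[OF op k[OF xy]]] by (simp add: w)
  also have "map_op homotopy (simplicial_op (nerve M) (Suc 0) (Poly_Mapping.single [x, y] 1)) =
      Poly_Mapping.single [h a, h b] (1 :: 'k) - Poly_Mapping.single [h ?\<alpha>, h ?\<beta>] 1"
    by (simp add: simplicial_op_1 lin_opD(5)[OF lin_op_map_op] x y face_0 face_1_Nil homotopy_def red0_def h_def)
  also have "tensor_class (N (Suc 0)) (Suc (Suc 0)) \<dots> =
      tensor_class (N (Suc 0)) (Suc (Suc 0)) (Poly_Mapping.single [h a, h b] 1) \<ominus>\<^bsub>tensor_power (N (Suc 0)) (Suc (Suc 0))\<^esub>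
      tensor_class (N (Suc 0)) (Suc (Suc 0)) (Poly_Mapping.single [h ?\<alpha>, h ?\<beta>] 1)"
    by (rule tensor_class_diff[OF nerve_algebra]) (use x y \<alpha>\<beta> h k in auto)
  finally have second: "first (commutator_map (N (Suc 0)) (tensor_op (N (Suc 0)) (Suc (Suc 0)) (map_op homotopy)
        (tensor_op (N 0) (Suc (Suc 0)) (simplicial_op (nerve M) (Suc 0))
          (tensor_class (N (Suc 0)) (Suc (Suc 0)) (Poly_Mapping.single w 1))))) =
      first (commutator_map (N (Suc 0)) (tensor_class (N (Suc 0)) (Suc (Suc 0)) (Poly_Mapping.single [h a, h b] 1)))
      \<ominus>\<^bsub>R\<^esub> first (commutator_map (N (Suc 0)) (tensor_class (N (Suc 0)) (Suc (Suc 0)) (Poly_Mapping.single [h ?\<alpha>, h ?\<beta>] 1)))"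
    using linear_map_diff[OF tensor_power_module[OF m1] R_module fcm tensor_class_mem[OF m1 k[OF h h]]
        tensor_class_mem[OF m1 k[OF h h]], of a b ?\<alpha> ?\<beta>] x y \<alpha>\<beta> by simp
  have br: "first (commutator_map (N (Suc 0)) (tensor_class (N (Suc 0)) (Suc (Suc 0)) (Poly_Mapping.single [h p, h q] 1)))
      = act_comm p (sec q) \<ominus>\<^bsub>R\<^esub> act_comm (red q) (sec p)" if "p \<in> carrier A" "q \<in> carrier A" for p q
    using that first_commutator[of "sec p" "red p" "sec q" "red q"] h
    by (simp add: commutator_map_word[OF nerve_algebra] sec_simps red_closed \<rho>_sec_red) (simp add: h_def \<rho>_sec_red)
  have "first (commutator_map (N (Suc 0)) (tensor_class (N (Suc 0)) (Suc (Suc 0)) (Poly_Mapping.single w 1))) =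
      act_comm ?\<alpha> t \<ominus>\<^bsub>R\<^esub> act_comm b s"
    using commutator_map_word[OF nerve_algebra xy] first_commutator x y by (simp add: w)
  then have "first (commutator_map (N (Suc 0)) (tensor_class (N (Suc 0)) (Suc (Suc 0)) (Poly_Mapping.single w 1))) \<oplus>\<^bsub>R\<^esub>
      first (commutator_map (N (Suc 0)) (tensor_op (N (Suc 0)) (Suc (Suc 0)) (map_op homotopy)
        (tensor_op (N 0) (Suc (Suc 0)) (simplicial_op (nerve M) (Suc 0))
          (tensor_class (N (Suc 0)) (Suc (Suc 0)) (Poly_Mapping.single w 1))))) =
      act_comm ?\<alpha> (t \<ominus>\<^bsub>R\<^esub> sec (\<rho> t)) \<ominus>\<^bsub>R\<^esub> act_comm b (s \<ominus>\<^bsub>R\<^esub> sec (\<rho> s))"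
    using bracket_homotopy[OF x(1,2) y(1,2)] br[OF x(2) y(2)] br[OF \<alpha>\<beta>] by (simp add: second)
  moreover have "act_comm ?\<alpha> (t \<ominus>\<^bsub>R\<^esub> sec (\<rho> t)) \<ominus>\<^bsub>R\<^esub> act_comm b (s \<ominus>\<^bsub>R\<^esub> sec (\<rho> s)) \<in> kercomm"
    using x y \<alpha>\<beta> by (intro subspaceD(6)[OF R_module kercomm_subspace_R] act_comm_mem sub_sec_Ker)
  ultimately show "first (commutator_map (N (Suc 0)) (tensor_class (N (Suc 0)) (Suc (Suc 0)) (Poly_Mapping.single w 1))) \<oplus>\<^bsub>R\<^esub>
      first (commutator_map (N (Suc 0)) (tensor_op (N (Suc 0)) (Suc (Suc 0)) (map_op homotopy)
        (tensor_op (N 0) (Suc (Suc 0)) (simplicial_op (nerve M) (Suc 0))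
          (tensor_class (N (Suc 0)) (Suc (Suc 0)) (Poly_Mapping.single w 1))))) \<in> kercomm"
    by simp
qed

end


section \<open>The exact sequences and the homology in degree zero\<close>

context crossed_module
begin

abbreviation "comC \<equiv> commutator_space (Coker M)"

lemma Coker_diff:
  assumes "a \<in> carrier A" "b \<in> carrier A"
  shows "(I +>\<^bsub>A\<^esub> a) \<ominus>\<^bsub>Coker M\<^esub> (I +>\<^bsub>A\<^esub> b) = I +>\<^bsub>A\<^esub> (a \<ominus>\<^bsub>A\<^esub> b)"
  using linear_map_diff[OF A_module Coker_module linear_map_Coker assms] by simp

lemma comC_subspace: "submodule comC scalars (Coker M)"
  unfolding commutator_space_def
  by (rule subspace_lin_span[OF Coker_module])
    (auto intro!: diff_mem[OF Coker_module] nonunital_algebra.m_closed[OF Coker_algebra])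

lemma comC_mem:
  assumes "a \<in> carrier A" "b \<in> carrier A"
  shows "I +>\<^bsub>A\<^esub> ((a \<otimes>\<^bsub>A\<^esub> b) \<ominus>\<^bsub>A\<^esub> (b \<otimes>\<^bsub>A\<^esub> a)) \<in> comC"
proof -
  have "(I +>\<^bsub>A\<^esub> a) \<otimes>\<^bsub>Coker M\<^esub> (I +>\<^bsub>A\<^esub> b) \<ominus>\<^bsub>Coker M\<^esub> (I +>\<^bsub>A\<^esub> b) \<otimes>\<^bsub>Coker M\<^esub> (I +>\<^bsub>A\<^esub> a) \<in> comC"
    unfolding commutator_space_def using assms by (intro lin_span_superset) (auto simp: Coker_carrier)
  then show ?thesis using assms by (simp add: Coker_mult Coker_diff A_closed)
qed

context
  fixes J :: "nat set"
  assumes J: "lower_closed J" and J0: "0 \<in> J"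
begin

abbreviation "TJ \<equiv> crossed_total J M"

lemmas bispace_BJ = bispace_B[OF J] and hdiff_BJ = hdiff_B[OF J] and vdiff_BJ = vdiff_B[OF J]

lemma is_bicomplex_BJ: "is_bicomplex (bicx J)"
  by (rule is_bicomplex_simplicial[OF is_presimplicial_nerve J])

lemmas BJ_module = is_bicomplexD(1)[OF is_bicomplex_BJ]

lemma chain0_mem: "x \<in> carrier (N m) \<Longrightarrow> chain0 (N m) x \<in> carrier (bispace (bicx J) m 0)"
  unfolding bispace_BJ by (rule linear_mapD(1)[OF linear_map_chain0[OF nerve_algebra J0]])

lemma chain1_mem': "x \<in> carrier (N m) \<Longrightarrow> y \<in> carrier (N m) \<Longrightarrow> chain1 (N m) x y \<in> carrier (bispace (bicx J) m (Suc 0))"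
  unfolding bispace_BJ by (rule chain1_mem[OF nerve_algebra J0])

lemma linear_map_chain0': "linear_map (N m) (bispace (bicx J) m 0) (chain0 (N m))"
  unfolding bispace_BJ by (rule linear_map_chain0[OF nerve_algebra J0])

lemma word_1_keys: "x \<in> carrier V \<Longrightarrow> Poly_Mapping.keys (Poly_Mapping.single [x] c) \<subseteq> tensor_words V (Suc 0)"
  by (auto simp: words_1)

lemma hdiff_chain0_1:
  assumes x: "x \<in> carrier (N (Suc 0))"
  shows "hdiff (bicx J) (Suc 0) 0 (chain0 (N (Suc 0)) x) =
    chain0 (N 0) (nerve_face M (Suc 0) 0 x \<ominus>\<^bsub>N 0\<^esub> nerve_face M (Suc 0) (Suc 0) x)"
  unfolding hdiff_BJ[OF chain0_mem[OF x]] unfolding levelwise_def chain0_def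
proof (rule restrict_ext)
  fix p :: nat assume "p \<in> {..0}"
  let ?d = "\<lambda>i. nerve_face M (Suc 0) i x"
  have d: "?d 0 \<in> carrier (N 0)" "?d (Suc 0) \<in> carrier (N 0)" using nerve_face_hom[OF _ x] by auto
  have "tensor_op (N 0) (Suc 0) (simplicial_op (nerve M) (Suc 0)) (letter (N (Suc 0)) x) =
      tensor_class (N 0) (Suc 0) (simplicial_op (nerve M) (Suc 0) (Poly_Mapping.single [x] 1))"
    unfolding letter_def
    by (rule tensor_op_class[OF nerve_module nerve_module graded_operatorD[OF graded_simplicial_op] word_1_keys[OF x]])
  also have "\<dots> = tensor_class (N 0) (Suc 0) (Poly_Mapping.single [?d 0] 1 - Poly_Mapping.single [?d (Suc 0)] 1)"
    by (simp add: simplicial_op_1)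
  also have "\<dots> = letter (N 0) (?d 0) \<ominus>\<^bsub>tensor_power (N 0) (Suc 0)\<^esub> letter (N 0) (?d (Suc 0))"
    unfolding letter_def by (rule tensor_class_diff[OF nerve_algebra word_1_keys[OF d(1)] word_1_keys[OF d(2)]])
  also have "\<dots> = letter (N 0) (?d 0 \<ominus>\<^bsub>N 0\<^esub> ?d (Suc 0))"
    by (rule linear_map_diff[OF nerve_module tensor_power_module[OF nerve_module] linear_map_letter[OF nerve_algebra] d, symmetric])
  finally show "tensor_op (N 0) (Suc (0 - p)) (simplicial_op (nerve M) (Suc 0)) ((\<lambda>p\<in>{..0}. letter (N (Suc 0)) x) p) =
      letter (N 0) (?d 0 \<ominus>\<^bsub>N 0\<^esub> ?d (Suc 0))"
    using \<open>p \<in> {..0}\<close> by simp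
qed

lemma hdiff_chain0_2:
  assumes x: "x \<in> carrier (N (Suc (Suc 0)))"
  shows "hdiff (bicx J) (Suc (Suc 0)) 0 (chain0 (N (Suc (Suc 0))) x) =
    chain0 (N (Suc 0)) ((nerve_face M (Suc (Suc 0)) 0 x \<ominus>\<^bsub>N (Suc 0)\<^esub> nerve_face M (Suc (Suc 0)) (Suc 0) x)
      \<oplus>\<^bsub>N (Suc 0)\<^esub> nerve_face M (Suc (Suc 0)) (Suc (Suc 0)) x)"
  unfolding hdiff_BJ[OF chain0_mem[OF x]] unfolding levelwise_def chain0_def
proof (rule restrict_ext)
  fix p :: nat assume "p \<in> {..0}"
  let ?N = "N (Suc 0)"
  let ?d = "\<lambda>i. nerve_face M (Suc (Suc 0)) i x"
  have d: "?d 0 \<in> carrier ?N" "?d (Suc 0) \<in> carrier ?N" "?d (Suc (Suc 0)) \<in> carrier ?N"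
    using nerve_face_hom[OF _ x] by auto
  note l = linear_map_letter[OF nerve_algebra, of "Suc 0"]
  have "tensor_op ?N (Suc 0) (simplicial_op (nerve M) (Suc (Suc 0))) (letter (N (Suc (Suc 0))) x) =
      tensor_class ?N (Suc 0) (simplicial_op (nerve M) (Suc (Suc 0)) (Poly_Mapping.single [x] 1))"
    unfolding letter_def
    by (rule tensor_op_class[OF nerve_module nerve_module graded_operatorD[OF graded_simplicial_op] word_1_keys[OF x]])
  also have "simplicial_op (nerve M) (Suc (Suc 0)) (Poly_Mapping.single [x] (1 :: 'k)) =
      (Poly_Mapping.single [?d 0] 1 - Poly_Mapping.single [?d (Suc 0)] 1) + Poly_Mapping.single [?d (Suc (Suc 0))] 1"
    by (simp add: simplicial_op_def nerve_def single_uminus)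
  also have "tensor_class ?N (Suc 0) \<dots> =
      tensor_class ?N (Suc 0) (Poly_Mapping.single [?d 0] 1 - Poly_Mapping.single [?d (Suc 0)] 1)
      \<oplus>\<^bsub>tensor_power ?N (Suc 0)\<^esub> letter ?N (?d (Suc (Suc 0)))"
    unfolding letter_def
    by (rule tensor_class_add[OF nerve_module _ word_1_keys[OF d(3)], symmetric])
      (rule subset_trans[OF Poly_Mapping.keys_diff Un_least[OF word_1_keys[OF d(1)] word_1_keys[OF d(2)]]])
  also have "tensor_class ?N (Suc 0) (Poly_Mapping.single [?d 0] 1 - Poly_Mapping.single [?d (Suc 0)] 1) =
      letter ?N (?d 0) \<ominus>\<^bsub>tensor_power ?N (Suc 0)\<^esub> letter ?N (?d (Suc 0))"
    unfolding letter_def by (rule tensor_class_diff[OF nerve_algebra word_1_keys[OF d(1)] word_1_keys[OF d(2)]])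
  also have "\<dots> = letter ?N (?d 0 \<ominus>\<^bsub>?N\<^esub> ?d (Suc 0))"
    by (rule linear_map_diff[OF nerve_module tensor_power_module[OF nerve_module] l d(1,2), symmetric])
  also have "letter ?N (?d 0 \<ominus>\<^bsub>?N\<^esub> ?d (Suc 0)) \<oplus>\<^bsub>tensor_power ?N (Suc 0)\<^esub> letter ?N (?d (Suc (Suc 0))) =
      letter ?N ((?d 0 \<ominus>\<^bsub>?N\<^esub> ?d (Suc 0)) \<oplus>\<^bsub>?N\<^esub> ?d (Suc (Suc 0)))"
    by (rule linear_mapD(2)[OF l diff_mem[OF nerve_module d(1,2)] d(3), symmetric])
  finally show "tensor_op ?N (Suc (0 - p)) (simplicial_op (nerve M) (Suc (Suc 0)))
      ((\<lambda>p\<in>{..0}. letter (N (Suc (Suc 0))) x) p) =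
      letter ?N ((?d 0 \<ominus>\<^bsub>?N\<^esub> ?d (Suc 0)) \<oplus>\<^bsub>?N\<^esub> ?d (Suc (Suc 0)))"
    using \<open>p \<in> {..0}\<close> by simp
qed

text \<open>The faces of \<open>(s, a)\<close> are \<open>a\<close> and \<open>\<rho> s + a\<close>.\<close>

lemma hdiff_chain0_eq_zero_iff:
  assumes s: "s \<in> carrier R" and a: "a \<in> carrier A"
  shows "hdiff (bicx J) (Suc 0) 0 (chain0 (N (Suc 0)) (tuple_cons s ([], a))) = \<zero>\<^bsub>bispace (bicx J) 0 0\<^esub> \<longleftrightarrow> \<rho> s = \<zero>\<^bsub>A\<^esub>"
proof -
  have x: "tuple_cons s ([], a) \<in> carrier (N (Suc 0))" using s a by (simp add: nerve_1_mem)
  have mem: "([], a) \<in> carrier (N 0)" "([], \<rho> s \<oplus>\<^bsub>A\<^esub> a) \<in> carrier (N 0)"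
    using s a by (simp_all add: nerve_Nil_simps closed)
  let ?u = "([], a) \<ominus>\<^bsub>N 0\<^esub> ([], \<rho> s \<oplus>\<^bsub>A\<^esub> a)"
  have u: "?u \<in> carrier (N 0)" using mem by (rule diff_mem[OF nerve_module])
  have "chain0 (N 0) ?u = \<zero>\<^bsub>bispace (bicx J) 0 0\<^esub> \<longleftrightarrow> ?u = \<zero>\<^bsub>N 0\<^esub>"
    using chain0_value_chain0[OF nerve_algebra J0 u]
      linear_map_zero[OF BJ_module nerve_module linear_map_chain0_value[OF nerve_algebra J0, of 0, folded bispace_BJ]]
      linear_map_zero[OF nerve_module BJ_module linear_map_chain0', of 0] by metis
  also have "\<dots> \<longleftrightarrow> a = \<rho> s \<oplus>\<^bsub>A\<^esub> a" using mem by (simp add: diff_eq_zero_iff[OF nerve_module])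
  also have "\<dots> \<longleftrightarrow> \<rho> s = \<zero>\<^bsub>A\<^esub>"
  proof -
    obtain j :: "'a \<Rightarrow> ('a \<Rightarrow>\<^sub>0 'k)" where "embedding A j" using ex_embedding[OF A_module] by blast
    note j = embeddingD[OF this A_module]
    have "a = \<rho> s \<oplus>\<^bsub>A\<^esub> a \<longleftrightarrow> j a = j (\<rho> s \<oplus>\<^bsub>A\<^esub> a)" using s a by (subst j(1)) (auto simp: closed)
    also have "\<dots> \<longleftrightarrow> j (\<rho> s) = j \<zero>\<^bsub>A\<^esub>" using s a by (simp add: j(2,6) closed)
    also have "\<dots> \<longleftrightarrow> \<rho> s = \<zero>\<^bsub>A\<^esub>" using s by (subst j(1)) (auto simp: closed)
    finally show ?thesis .
  qed
  finally show ?thesis by (simp add: hdiff_chain0_1[OF x] face_0 face_1_Nil)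
qed

definition Z1 :: "(nat \<Rightarrow> (('r list \<times> 'a) list \<Rightarrow>\<^sub>0 'k) set) set" where
  "Z1 = {v \<in> carrier (bispace (bicx J) (Suc 0) 0). hdiff (bicx J) (Suc 0) 0 v = \<zero>\<^bsub>bispace (bicx J) 0 0\<^esub>}"

lemma bispace_cases:
  assumes "v \<in> carrier (bispace (bicx J) (Suc 0) 0)"
  obtains s a where "s \<in> carrier R" "a \<in> carrier A" "v = chain0 (N (Suc 0)) (tuple_cons s ([], a))"
  using chain0_cases[OF nerve_algebra J0 assms[unfolded bispace_BJ]] nerve_1_cases by metis

lemma Z1_cases:
  assumes "v \<in> Z1"
  obtains s a where "s \<in> carrier (Ker M)" "a \<in> carrier A" "v = chain0 (N (Suc 0)) (tuple_cons s ([], a))"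
proof -
  have v: "v \<in> carrier (bispace (bicx J) (Suc 0) 0)" using assms by (simp add: Z1_def)
  obtain s a where sa: "s \<in> carrier R" "a \<in> carrier A" "v = chain0 (N (Suc 0)) (tuple_cons s ([], a))"
    using bispace_cases[OF v] .
  then have "s \<in> carrier (Ker M)"
    using assms hdiff_chain0_eq_zero_iff[OF sa(1,2)] by (simp add: Z1_def Ker_carrier)
  with sa that show ?thesis by blast
qed

lemma chain0_Z1: "s \<in> carrier (Ker M) \<Longrightarrow> a \<in> carrier A \<Longrightarrow> chain0 (N (Suc 0)) (tuple_cons s ([], a)) \<in> Z1"
  using hdiff_chain0_eq_zero_iff by (simp add: Z1_def Ker_carrier chain0_mem nerve_1_mem)

text \<open>Identifies the first homology of the kernel of the augmentation, by the \<open>R\<close>-component of a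
  horizontal cycle.\<close>

definition kernel_class :: "(nat \<Rightarrow> (('r list \<times> 'a) list \<Rightarrow>\<^sub>0 'k) set) \<Rightarrow> 'r set" where
  "kernel_class v = kercomm +>\<^bsub>R\<^esub> first (chain0_value (N (Suc 0)) v)"

lemma linear_map_first_value: "linear_map (bispace (bicx J) (Suc 0) 0) R (\<lambda>v. first (chain0_value (N (Suc 0)) v))"
  unfolding bispace_BJ by (rule linear_map_comp[OF linear_map_chain0_value[OF nerve_algebra J0] linear_map_first])

lemma first_value_chain0:
  "s \<in> carrier R \<Longrightarrow> a \<in> carrier A \<Longrightarrow> first (chain0_value (N (Suc 0)) (chain0 (N (Suc 0)) (tuple_cons s ([], a)))) = s"
  by (simp add: chain0_value_chain0[OF nerve_algebra J0] nerve_1_mem)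

lemma linear_map_kernel_class: "linear_map (bispace (bicx J) (Suc 0) 0\<lparr>carrier := Z1\<rparr>) (Ker_mod_commutators M) kernel_class"
proof -
  note l = linear_mapD[OF linear_map_first_value]
  have "linear_map (bispace (bicx J) (Suc 0) 0\<lparr>carrier := Z1\<rparr>) (Ker M) (\<lambda>v. first (chain0_value (N (Suc 0)) v))"
  proof (rule linear_mapI)
    fix v assume v: "v \<in> carrier (bispace (bicx J) (Suc 0) 0\<lparr>carrier := Z1\<rparr>)"
    then have "v \<in> Z1" by simp
    then obtain s a where "s \<in> carrier (Ker M)" "a \<in> carrier A" "v = chain0 (N (Suc 0)) (tuple_cons s ([], a))"
      by (rule Z1_cases)
    then show "first (chain0_value (N (Suc 0)) v) \<in> carrier (Ker M)"
      using first_value_chain0[of s a] by (simp add: Ker_carrier)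
  qed (use l in \<open>auto simp: Z1_def Ker_simps\<close>)
  from linear_map_comp[OF this linear_map_coset[OF Ker_module kercomm_subspace]]
  show ?thesis by (simp add: Ker_mod_commutators_eq kernel_class_def[abs_def] Ker_simps)
qed

lemma kernel_class_surj: "kernel_class ` Z1 = carrier (Ker_mod_commutators M)"
proof (intro equalityI subsetI)
  fix q assume "q \<in> carrier (Ker_mod_commutators M)"
  then obtain s where s: "s \<in> carrier (Ker M)" "q = kercomm +>\<^bsub>R\<^esub> s"
    by (auto simp: Ker_mod_commutators_eq quot_carrier Ker_simps)
  then have "q = kernel_class (chain0 (N (Suc 0)) (tuple_cons s ([], \<zero>\<^bsub>A\<^esub>)))"
    using first_value_chain0[of s "\<zero>\<^bsub>A\<^esub>"] by (simp add: kernel_class_def Ker_carrier zero_simps)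
  then show "q \<in> kernel_class ` Z1" using chain0_Z1[OF s(1)] zero_simps(2) by blast
qed (use linear_mapD(1)[OF linear_map_kernel_class] in auto)

lemma kernel_class_zero_iff:
  assumes "s \<in> carrier (Ker M)" "a \<in> carrier A"
  shows "kernel_class (chain0 (N (Suc 0)) (tuple_cons s ([], a))) = \<zero>\<^bsub>Ker_mod_commutators M\<^esub> \<longleftrightarrow> s \<in> kercomm"
  using assms first_value_chain0[of s a] coset_eq_subspace_iff[OF R_module kercomm_subspace_R, of s]
  by (simp add: kernel_class_def Ker_mod_commutators_eq quot_zero Ker_carrier)

lemma mult_zero:
  "x \<in> carrier R \<Longrightarrow> x \<otimes>\<^bsub>R\<^esub> \<zero>\<^bsub>R\<^esub> = \<zero>\<^bsub>R\<^esub>" "x \<in> carrier R \<Longrightarrow> \<zero>\<^bsub>R\<^esub> \<otimes>\<^bsub>R\<^esub> x = \<zero>\<^bsub>R\<^esub>"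
  "a \<in> carrier A \<Longrightarrow> a \<otimes>\<^bsub>A\<^esub> \<zero>\<^bsub>A\<^esub> = \<zero>\<^bsub>A\<^esub>" "a \<in> carrier A \<Longrightarrow> \<zero>\<^bsub>A\<^esub> \<otimes>\<^bsub>A\<^esub> a = \<zero>\<^bsub>A\<^esub>"
  "a \<in> carrier A \<Longrightarrow> l a \<zero>\<^bsub>R\<^esub> = \<zero>\<^bsub>R\<^esub>" "x \<in> carrier R \<Longrightarrow> r x \<zero>\<^bsub>A\<^esub> = \<zero>\<^bsub>R\<^esub>"
  "x \<in> carrier R \<Longrightarrow> l \<zero>\<^bsub>A\<^esub> x = \<zero>\<^bsub>R\<^esub>" "a \<in> carrier A \<Longrightarrow> r \<zero>\<^bsub>R\<^esub> a = \<zero>\<^bsub>R\<^esub>"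
  using linear_map_zero[OF R_module R_module linear_map_mult_left[OF R_algebra]]
    linear_map_zero[OF R_module R_module linear_map_mult_right[OF R_algebra]]
    linear_map_zero[OF A_module A_module linear_map_mult_left[OF A_algebra]]
    linear_map_zero[OF A_module A_module linear_map_mult_right[OF A_algebra]]
    linear_map_zero[OF R_module R_module l_linear] linear_map_zero[OF A_module R_module r_linear']
    linear_map_zero[OF A_module R_module l_linear'] linear_map_zero[OF R_module R_module r_linear]
  by auto

text \<open>The tensor \<open>(k, 0) \<otimes> (0, a)\<close> is a horizontal cycle, as both faces send it to zero because
  they kill \<open>(k, 0)\<close>. Its vertical boundary is \<open>(a k - k a, 0)\<close>, the vertical differential having
  the sign \<open>-1\<close> in simplicial degree \<open>1\<close>.\<close>

lemma commutator_is_vdiff: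
  assumes k: "k \<in> carrier (Ker M)" and a: "a \<in> carrier A"
  shows "chain0 (N (Suc 0)) (tuple_cons (act_comm a k) ([], \<zero>\<^bsub>A\<^esub>)) \<in>
    vdiff (bicx J) (Suc 0) (Suc 0) ` {x \<in> carrier (bispace (bicx J) (Suc 0) (Suc 0)). hdiff (bicx J) (Suc 0) (Suc 0) x = \<zero>\<^bsub>bispace (bicx J) 0 (Suc 0)\<^esub>}"
proof -
  let ?N = "N (Suc 0)" and ?X = "tuple_cons k ([], \<zero>\<^bsub>A\<^esub>)" and ?Y = "tuple_cons \<zero>\<^bsub>R\<^esub> ([], a)"
  have kR: "k \<in> carrier R" "\<rho> k = \<zero>\<^bsub>A\<^esub>" using k by (auto simp: Ker_carrier)
  have X: "?X \<in> carrier ?N" and Y: "?Y \<in> carrier ?N" using kR a by (simp_all add: nerve_1_mem zero_simps)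
  let ?x = "chain1 ?N ?X ?Y"
  have x: "?x \<in> carrier (bispace (bicx J) (Suc 0) (Suc 0))" by (rule chain1_mem'[OF X Y])
  have "hdiff (bicx J) (Suc 0) (Suc 0) ?x = \<zero>\<^bsub>bispace (bicx J) 0 (Suc 0)\<^esub>"
    unfolding hdiff_BJ[OF x] bispace_BJ levelwise_def cyclic_total_space direct_sum_simps
      cyclic_space_add[OF nerve_algebra]
  proof (rule restrict_ext)
    fix p assume "p \<in> {..Suc 0}"
    then consider "p = 0" | "p = Suc 0" by fastforce
    then show "tensor_op (N 0) (Suc (Suc 0 - p)) (simplicial_op (nerve M) (Suc 0)) (?x p) =
        \<zero>\<^bsub>tensor_power (N 0) (Suc (Suc 0 - p))\<^esub>"
    proof cases
      case 1
      have "simplicial_op (nerve M) (Suc 0) (Poly_Mapping.single [?X, ?Y] (1 :: 'k)) = 0"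
        using a kR by (simp add: simplicial_op_1 face_0 face_1_Nil zero_simps \<rho>_simps)
      then show ?thesis
        using 1 tensor_op_class[OF nerve_module nerve_module graded_operatorD[OF graded_simplicial_op],
            of "Poly_Mapping.single [?X, ?Y] 1" 0 "Suc (Suc 0)"] X Y
        by (simp add: chain1_def words_2 tensor_class_zero[OF nerve_module])
    next
      case 2
      then show ?thesis
        using linear_map_zero[OF tensor_power_module[OF nerve_module] tensor_power_module[OF nerve_module]
            linear_map_tensor_op[OF nerve_module nerve_module graded_operatorD[OF graded_simplicial_op]], of 0 "Suc 0"]
        by (simp add: chain1_def)
    qed
  qed
  moreover have "vdiff (bicx J) (Suc 0) (Suc 0) ?x = chain0 ?N (tuple_cons (act_comm a k) ([], \<zero>\<^bsub>A\<^esub>))"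
  proof -
    have mem: "?X \<otimes>\<^bsub>?N\<^esub> ?Y \<in> carrier ?N" "?Y \<otimes>\<^bsub>?N\<^esub> ?X \<in> carrier ?N"
      using X Y by (auto intro: nerve_mult_closed)
    have mult: "?X \<otimes>\<^bsub>?N\<^esub> ?Y = tuple_cons (r k a) ([], \<zero>\<^bsub>A\<^esub>)" "?Y \<otimes>\<^bsub>?N\<^esub> ?X = tuple_cons (l a k) ([], \<zero>\<^bsub>A\<^esub>)"
      using kR a by (simp_all add: nerve_cons_simps nerve_Nil_simps mult_zero zero_simps action_closed)
    have cl: "l a k \<in> carrier R" "r k a \<in> carrier R" using a kR by (simp_all add: action_closed)
    have z: "- 1 \<odot>\<^bsub>A\<^esub> \<zero>\<^bsub>A\<^esub> = \<zero>\<^bsub>A\<^esub>" by (rule module_smult_zero[OF A_module])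
    have "(- 1) \<odot>\<^bsub>?N\<^esub> ((?X \<otimes>\<^bsub>?N\<^esub> ?Y) \<ominus>\<^bsub>?N\<^esub> (?Y \<otimes>\<^bsub>?N\<^esub> ?X)) =
        (- 1) \<odot>\<^bsub>?N\<^esub> ((?X \<otimes>\<^bsub>?N\<^esub> ?Y) \<oplus>\<^bsub>?N\<^esub> (- 1) \<odot>\<^bsub>?N\<^esub> (?Y \<otimes>\<^bsub>?N\<^esub> ?X))"
      using minus_conv_smult[OF nerve_module mem(2)] by (simp add: a_minus_def)
    also have "\<dots> = tuple_cons ((- 1) \<odot>\<^bsub>R\<^esub> (r k a \<oplus>\<^bsub>R\<^esub> (- 1) \<odot>\<^bsub>R\<^esub> l a k)) ([], \<zero>\<^bsub>A\<^esub>)"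
      unfolding mult by (simp add: nerve_cons_simps nerve_Nil_simps z zero_simps)
    also have "(- 1) \<odot>\<^bsub>R\<^esub> (r k a \<oplus>\<^bsub>R\<^esub> (- 1) \<odot>\<^bsub>R\<^esub> l a k) = act_comm a k"
    proof -
      obtain j :: "'r \<Rightarrow> ('r \<Rightarrow>\<^sub>0 'k)" where "embedding R j" using ex_embedding[OF R_module] by blast
      note j = embeddingD[OF this R_module]
      have "j ((- 1) \<odot>\<^bsub>R\<^esub> (r k a \<oplus>\<^bsub>R\<^esub> (- 1) \<odot>\<^bsub>R\<^esub> l a k)) = j (act_comm a k)"
        using cl by (simp add: act_comm_def j R_closed)
      then show ?thesis
        by (rule iffD1[OF j(1), rotated 2]) (use cl a kR in \<open>simp_all add: R_closed act_comm_closed\<close>)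
    qed
    finally show ?thesis
      using linear_mapD(3)[OF linear_map_chain0[OF nerve_algebra J0] diff_mem[OF nerve_module mem], of "- 1"]
      by (simp add: vdiff_BJ diff_chain1[OF nerve_algebra J0 X Y])
  qed
  ultimately show ?thesis using x by (metis (mono_tags, lifting) image_eqI mem_Collect_eq)
qed

lemma kernel_class_kernel:
  "{v \<in> Z1. kernel_class v = \<zero>\<^bsub>Ker_mod_commutators M\<^esub>} =
    {hdiff (bicx J) (Suc (Suc 0)) 0 y \<oplus>\<^bsub>bispace (bicx J) (Suc 0) 0\<^esub> vdiff (bicx J) (Suc 0) (Suc 0) x | x y.
       y \<in> carrier (bispace (bicx J) (Suc (Suc 0)) 0) \<and> x \<in> carrier (bispace (bicx J) (Suc 0) (Suc 0)) \<and>
       hdiff (bicx J) (Suc 0) (Suc 0) x = \<zero>\<^bsub>bispace (bicx J) 0 (Suc 0)\<^esub>}"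
proof (intro equalityI subsetI)
  let ?N = "N (Suc 0)"
  note hlin = is_bicomplexD(2)[OF is_bicomplex_BJ] and vlin = is_bicomplexD(3)[OF is_bicomplex_BJ]
  {
    fix v assume "v \<in> {v \<in> Z1. kernel_class v = \<zero>\<^bsub>Ker_mod_commutators M\<^esub>}"
    then have v: "v \<in> Z1" "kernel_class v = \<zero>\<^bsub>Ker_mod_commutators M\<^esub>" by auto
    obtain k a where k: "k \<in> carrier (Ker M)" and a: "a \<in> carrier A" and v_eq: "v = chain0 ?N (tuple_cons k ([], a))"
      using Z1_cases[OF v(1)] .
    have kc: "k \<in> kercomm" using v(2) kernel_class_zero_iff[OF k a] by (simp add: v_eq)
    have kR: "k \<in> carrier R" using k by (simp add: Ker_carrier)
    let ?U = "vdiff (bicx J) (Suc 0) (Suc 0) ` {x \<in> carrier (bispace (bicx J) (Suc 0) (Suc 0)). hdiff (bicx J) (Suc 0) (Suc 0) x = \<zero>\<^bsub>bispace (bicx J) 0 (Suc 0)\<^esub>}"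
    have U: "submodule ?U scalars (bispace (bicx J) (Suc 0) 0)"
      by (rule subspace_image[OF BJ_module BJ_module vlin subspace_kernel[OF BJ_module BJ_module hlin]])
    have "linear_map (Ker M) ?N (\<lambda>k. tuple_cons k ([], \<zero>\<^bsub>A\<^esub>))"
      by (rule linear_mapI) (auto simp: Ker_carrier Ker_simps nerve_1_mem nerve_cons_simps nerve_Nil_simps zero_simps
          module_smult_zero[OF A_module])
    from linear_map_comp[OF this linear_map_chain0'[of "Suc 0"]]
    have lin: "linear_map (Ker M) (bispace (bicx J) (Suc 0) 0) (\<lambda>k. chain0 ?N (tuple_cons k ([], \<zero>\<^bsub>A\<^esub>)))" .
    have "chain0 ?N (tuple_cons k ([], \<zero>\<^bsub>A\<^esub>)) \<in> ?U"
      by (rule linear_map_lin_span[OF Ker_module BJ_module lin U _ _ kc[unfolded kercomm_def]])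
        (use commutator_is_vdiff act_comm_Ker in auto)
    then obtain x where vx: "chain0 ?N (tuple_cons k ([], \<zero>\<^bsub>A\<^esub>)) = vdiff (bicx J) (Suc 0) (Suc 0) x"
      and "x \<in> {x \<in> carrier (bispace (bicx J) (Suc 0) (Suc 0)). hdiff (bicx J) (Suc 0) (Suc 0) x = \<zero>\<^bsub>bispace (bicx J) 0 (Suc 0)\<^esub>}"
      by (rule imageE)
    then have x: "x \<in> carrier (bispace (bicx J) (Suc 0) (Suc 0))" "hdiff (bicx J) (Suc 0) (Suc 0) x = \<zero>\<^bsub>bispace (bicx J) 0 (Suc 0)\<^esub>"
      by blast+
    \<comment> \<open>Its three faces in level \<open>1\<close> are all equal to \<open>(0, a)\<close>, so that \<open>(0, a)\<close> is its boundary.\<close>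
    let ?y = "tuple_cons \<zero>\<^bsub>R\<^esub> (tuple_cons \<zero>\<^bsub>R\<^esub> ([], a))"
    have y: "?y \<in> carrier (N (Suc (Suc 0)))" and y1: "tuple_cons \<zero>\<^bsub>R\<^esub> ([], a) \<in> carrier ?N"
      using a by (simp_all add: tuple_cons_mem nerve_Nil_simps zero_simps)
    interpret Nn: module scalars ?N by (rule nerve_module)
    have "hdiff (bicx J) (Suc (Suc 0)) 0 (chain0 (N (Suc (Suc 0))) ?y) = chain0 ?N (tuple_cons \<zero>\<^bsub>R\<^esub> ([], a))"
      using a y1 diff_eq_zero_iff[OF nerve_module y1 y1]
      by (simp add: hdiff_chain0_2[OF y] face_0 face_1_cons face_Suc_Suc[OF y1] face_1_Nil zero_simps \<rho>_simps)
    moreover have "chain0 ?N (tuple_cons \<zero>\<^bsub>R\<^esub> ([], a)) \<oplus>\<^bsub>bispace (bicx J) (Suc 0) 0\<^esub> chain0 ?N (tuple_cons k ([], \<zero>\<^bsub>A\<^esub>)) = v"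
    proof -
      have "tuple_cons k ([], \<zero>\<^bsub>A\<^esub>) \<in> carrier ?N" using kR by (simp add: nerve_1_mem zero_simps)
      from linear_mapD(2)[OF linear_map_chain0' y1 this] show ?thesis
        using a kR by (simp add: v_eq nerve_cons_simps nerve_Nil_simps zero_simps)
    qed
    ultimately have "v = hdiff (bicx J) (Suc (Suc 0)) 0 (chain0 (N (Suc (Suc 0))) ?y) \<oplus>\<^bsub>bispace (bicx J) (Suc 0) 0\<^esub> vdiff (bicx J) (Suc 0) (Suc 0) x"
      unfolding vx by (simp only:)
    then show "v \<in> {hdiff (bicx J) (Suc (Suc 0)) 0 y \<oplus>\<^bsub>bispace (bicx J) (Suc 0) 0\<^esub> vdiff (bicx J) (Suc 0) (Suc 0) x | x y.
       y \<in> carrier (bispace (bicx J) (Suc (Suc 0)) 0) \<and> x \<in> carrier (bispace (bicx J) (Suc 0) (Suc 0)) \<and>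
       hdiff (bicx J) (Suc 0) (Suc 0) x = \<zero>\<^bsub>bispace (bicx J) 0 (Suc 0)\<^esub>}"
      using x chain0_mem[OF y] by blast
  next
    fix v assume "v \<in> {hdiff (bicx J) (Suc (Suc 0)) 0 y \<oplus>\<^bsub>bispace (bicx J) (Suc 0) 0\<^esub> vdiff (bicx J) (Suc 0) (Suc 0) x | x y.
       y \<in> carrier (bispace (bicx J) (Suc (Suc 0)) 0) \<and> x \<in> carrier (bispace (bicx J) (Suc 0) (Suc 0)) \<and>
       hdiff (bicx J) (Suc 0) (Suc 0) x = \<zero>\<^bsub>bispace (bicx J) 0 (Suc 0)\<^esub>}"
    then obtain x y where y: "y \<in> carrier (bispace (bicx J) (Suc (Suc 0)) 0)" and x: "x \<in> carrier (bispace (bicx J) (Suc 0) (Suc 0))"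
      and hx: "hdiff (bicx J) (Suc 0) (Suc 0) x = \<zero>\<^bsub>bispace (bicx J) 0 (Suc 0)\<^esub>"
      and v: "v = hdiff (bicx J) (Suc (Suc 0)) 0 y \<oplus>\<^bsub>bispace (bicx J) (Suc 0) 0\<^esub> vdiff (bicx J) (Suc 0) (Suc 0) x" by blast
    note h = linear_mapD[OF hlin] and w = linear_mapD[OF vlin]
    have hy: "hdiff (bicx J) (Suc (Suc 0)) 0 y \<in> carrier (bispace (bicx J) (Suc 0) 0)" and vx: "vdiff (bicx J) (Suc 0) (Suc 0) x \<in> carrier (bispace (bicx J) (Suc 0) 0)"
      using h(1)[OF y] w(1)[OF x] .
    have v_mem: "v \<in> carrier (bispace (bicx J) (Suc 0) 0)" unfolding v by (rule add_mem[OF BJ_module hy vx])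
    interpret B00: module scalars "bispace (bicx J) 0 0" by (rule BJ_module)
    have "hdiff (bicx J) (Suc 0) 0 (vdiff (bicx J) (Suc 0) (Suc 0) x) = \<zero>\<^bsub>bispace (bicx J) 0 0\<^esub>"
      using is_bicomplexD(6)[OF is_bicomplex_BJ x] hx linear_map_zero[OF BJ_module BJ_module vlin, of 0 0] h(1)[OF vx] by simp
    then have vZ: "v \<in> Z1"
      using v_mem h(2)[OF hy vx] is_bicomplexD(4)[OF is_bicomplex_BJ y] by (simp add: Z1_def v)
    obtain t where t: "t \<in> carrier (N (Suc (Suc 0)))" and y_eq: "y = chain0 (N (Suc (Suc 0))) t"
      using chain0_cases[OF nerve_algebra J0 y[unfolded bispace_BJ]] .
    obtain s1 s2 a where s: "s1 \<in> carrier R" "s2 \<in> carrier R" "a \<in> carrier A" "t = tuple_cons s1 (tuple_cons s2 ([], a))"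
      using t by (auto simp: nerve_carrier_Suc nerve_carrier_0)
    have t1: "tuple_cons s2 ([], a) \<in> carrier ?N" using s by (simp add: nerve_1_mem)
    have d: "nerve_face M (Suc (Suc 0)) 0 t \<in> carrier ?N" "nerve_face M (Suc (Suc 0)) (Suc 0) t \<in> carrier ?N"
      "nerve_face M (Suc (Suc 0)) (Suc (Suc 0)) t \<in> carrier ?N"
      using nerve_face_hom[OF _ t] by auto
    have "first (chain0_value ?N (hdiff (bicx J) (Suc (Suc 0)) 0 y)) =
        (first (nerve_face M (Suc (Suc 0)) 0 t) \<ominus>\<^bsub>R\<^esub> first (nerve_face M (Suc (Suc 0)) (Suc 0) t))
        \<oplus>\<^bsub>R\<^esub> first (nerve_face M (Suc (Suc 0)) (Suc (Suc 0)) t)"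
      unfolding y_eq hdiff_chain0_2[OF t]
        chain0_value_chain0[OF nerve_algebra J0 add_mem[OF nerve_module diff_mem[OF nerve_module d(1,2)] d(3)]]
        linear_mapD(2)[OF linear_map_first diff_mem[OF nerve_module d(1,2)] d(3)]
        linear_map_diff[OF nerve_module R_module linear_map_first d(1,2)] ..
    \<comment> \<open>The image of level \<open>2\<close> has no \<open>R\<close>-component.\<close>
    also have "\<dots> = (s2 \<ominus>\<^bsub>R\<^esub> (s1 \<oplus>\<^bsub>R\<^esub> s2)) \<oplus>\<^bsub>R\<^esub> s1"
      by (simp add: s(4) face_0 face_1_cons face_Suc_Suc[OF t1])
    also have "\<dots> = \<zero>\<^bsub>R\<^esub>"
    proof -
      obtain j :: "'r \<Rightarrow> ('r \<Rightarrow>\<^sub>0 'k)" where "embedding R j" using ex_embedding[OF R_module] by blast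
      note j = embeddingD[OF this R_module]
      have "j ((s2 \<ominus>\<^bsub>R\<^esub> (s1 \<oplus>\<^bsub>R\<^esub> s2)) \<oplus>\<^bsub>R\<^esub> s1) = j \<zero>\<^bsub>R\<^esub>" using s by (simp add: j closed diff_mem[OF R_module])
      then show ?thesis by (rule iffD1[OF j(1), rotated 2]) (use s in \<open>simp_all add: closed diff_mem[OF R_module]\<close>)
    qed
    finally have first_hy: "first (chain0_value ?N (hdiff (bicx J) (Suc (Suc 0)) 0 y)) = \<zero>\<^bsub>R\<^esub>" .
    have x': "x \<in> carrier (chain_space (cyclic_total J ?N) (Suc 0))" using x by (simp add: bispace_BJ)
    have x0: "x 0 \<in> carrier (tensor_power ?N (Suc (Suc 0)))"
      using cyclic_total_component(2)[OF nerve_algebra x', of 0] by simp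
    have "tensor_op (N 0) (Suc (Suc 0)) (simplicial_op (nerve M) (Suc 0)) (x 0) = hdiff (bicx J) (Suc 0) (Suc 0) x 0"
      by (simp add: hdiff_BJ[OF x] levelwise_def)
    also have "\<dots> = \<zero>\<^bsub>tensor_power (N 0) (Suc (Suc 0))\<^esub>"
      by (simp add: hx bispace_BJ cyclic_total_space direct_sum_simps cyclic_space_add[OF nerve_algebra])
    finally have opx: "tensor_op (N 0) (Suc (Suc 0)) (simplicial_op (nerve M) (Suc 0)) (x 0) = \<zero>\<^bsub>tensor_power (N 0) (Suc (Suc 0))\<^esub>" .
    note fcm = linear_map_comp[OF linear_map_commutator_map[OF nerve_algebra] linear_map_first]
    have "first (commutator_map ?N (tensor_op ?N (Suc (Suc 0)) (map_op homotopy)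
        (tensor_op (N 0) (Suc (Suc 0)) (simplicial_op (nerve M) (Suc 0)) (x 0)))) = \<zero>\<^bsub>R\<^esub>"
      unfolding opx
      by (rule linear_map_zero[OF tensor_power_module[OF nerve_module] R_module
            linear_map_comp[OF linear_map_tensor_op[OF nerve_module nerve_module graded_operatorD[OF graded_homotopy]] fcm]])
    then have cm: "first (commutator_map ?N (x 0)) \<in> kercomm"
      using first_commutator_homotopy[OF x0] linear_mapD(1)[OF fcm x0] by (simp add: zero_simps)
    have "first (chain0_value ?N (vdiff (bicx J) (Suc 0) (Suc 0) x)) = (- 1) \<odot>\<^bsub>R\<^esub> first (commutator_map ?N (x 0))"
    proof -
      have dx: "diff (cyclic_total J ?N) (Suc 0) x \<in> carrier (bispace (bicx J) (Suc 0) 0)"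
        unfolding bispace_BJ
        using linear_mapD(1)[OF is_complexD(2)[OF is_complex_cyclic_total[OF nerve_algebra J]] x'] .
      show ?thesis
        using linear_mapD(3)[OF linear_map_first_value dx, of "- 1"]
        by (simp add: vdiff_BJ chain0_value_diff[OF nerve_algebra J0 x'] bispace_BJ)
    qed
    then have "first (chain0_value ?N v) \<in> kercomm"
      using subspaceD(4)[OF R_module kercomm_subspace_R cm, of "- 1"] linear_mapD(2)[OF linear_map_first_value hy vx] first_hy
        subspaceD(1)[OF R_module kercomm_subspace_R] by (simp add: v zero_simps)
    moreover have "first (chain0_value ?N v) \<in> carrier R" using linear_mapD(1)[OF linear_map_first_value v_mem] .
    ultimately show "v \<in> {v \<in> Z1. kernel_class v = \<zero>\<^bsub>Ker_mod_commutators M\<^esub>}"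
      using vZ coset_eq_subspace_iff[OF R_module kercomm_subspace_R] by (simp add: kernel_class_def Ker_mod_commutators_eq quot_zero)
  }
qed

text \<open>The augmentation and the contraction of its rows provide the data required by
  \<open>five_term_exact\<close>.\<close>

lemma exact_sequence_crossed:
  "\<exists>\<delta> \<epsilon>. exact_sequence5
    (homology TJ (Suc (Suc 0))) (homology_map (cyclic_total J (Coker M)) (coker_chain_map M) (Suc (Suc 0)))
    (homology (cyclic_total J (Coker M)) (Suc (Suc 0))) \<delta> (Ker_mod_commutators M) \<epsilon>
    (homology TJ (Suc 0)) (homology_map (cyclic_total J (Coker M)) (coker_chain_map M) (Suc 0))
    (homology (cyclic_total J (Coker M)) (Suc 0))"
  unfolding coker_chain_map_eq crossed_total_def
proof (rule five_term_exact[OF is_bicomplex_BJ is_complex_cyclic_total[OF Coker_algebra J] _ _ _ _ _ _ Q_module Z1_def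
      linear_map_kernel_class kernel_class_surj kernel_class_kernel])
  show "linear_map (bispace (bicx J) 0 n) (chain_space (cyclic_total J (Coker M)) n) (levelwise (Coker M) (map_op proj) n)" for n
    unfolding bispace_BJ by (rule linear_map_levelwise[OF nerve_algebra Coker_algebra graded_proj])
  show "levelwise (Coker M) (map_op proj) n (vdiff (bicx J) 0 (Suc n) x) =
      diff (cyclic_total J (Coker M)) (Suc n) (levelwise (Coker M) (map_op proj) (Suc n) x)"
    if "x \<in> carrier (bispace (bicx J) 0 (Suc n))" for n x
    unfolding vdiff_0[OF J that]
    by (rule levelwise_diff[OF nerve_algebra Coker_algebra cyclic_operator_proj that[unfolded bispace_BJ]])
  show "linear_map (bispace (bicx J) 0 n) (bispace (bicx J) (Suc 0) n) (levelwise (N (Suc 0)) (map_op homotopy) n)" for n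
    unfolding bispace_BJ by (rule linear_map_levelwise[OF nerve_algebra nerve_algebra graded_homotopy])
qed (rule proj_hdiff[OF J] proj_surj[OF J] hdiff_homotopy[OF J]; assumption?)+


subsection \<open>Degree zero\<close>

text \<open>Degree \<open>0\<close> of the total complex is a copy of \<open>A\<close>; \<open>total0\<close> sends an element to its chain,
  and \<open>total0_value\<close> gives its class in \<open>C / [C, C]\<close>, for \<open>C\<close> the cokernel.\<close>

definition total0 :: "'a \<Rightarrow> nat \<Rightarrow> nat \<Rightarrow> (('r list \<times> 'a) list \<Rightarrow>\<^sub>0 'k) set" where
  "total0 a = (\<lambda>m\<in>{..0}. chain0 (N 0) ([], a))"

definition total0_value :: "(nat \<Rightarrow> nat \<Rightarrow> (('r list \<times> 'a) list \<Rightarrow>\<^sub>0 'k) set) \<Rightarrow> 'a set set" where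
  "total0_value x = comC +>\<^bsub>Coker M\<^esub> proj (chain0_value (N 0) (x 0))"

lemma T_complex: "is_complex TJ"
  unfolding crossed_total_def by (rule is_complex_total[OF is_bicomplex_BJ])

lemmas T_module = is_complexD(1)[OF T_complex]

lemma T_0: "x \<in> carrier (chain_space TJ 0) \<longleftrightarrow> x \<in> extensional {..0} \<and> x 0 \<in> carrier (bispace (bicx J) 0 0)"
  by (auto simp: crossed_total_def total_space direct_sum_simps PiE_iff)

lemma linear_map_total0: "linear_map A (chain_space TJ 0) total0"
  unfolding crossed_total_def total_space
  by (rule linear_map_direct_sumI[OF _ A_module])
    (use linear_map_comp[OF linear_map_Nil linear_map_chain0'[of 0]] in \<open>auto simp: total0_def\<close>)

lemma total0_cases:
  assumes "x \<in> carrier (chain_space TJ 0)"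
  obtains a where "a \<in> carrier A" "x = total0 a"
proof -
  have x: "x \<in> extensional {..0}" "x 0 \<in> carrier (chain_space (cyclic_total J (N 0)) 0)"
    using assms by (auto simp: T_0 bispace_BJ)
  obtain b where b: "b \<in> carrier (N 0)" "x 0 = chain0 (N 0) b" using chain0_cases[OF nerve_algebra J0 x(2)] .
  then obtain a where "a \<in> carrier A" "b = ([], a)" by (auto simp: nerve_carrier_0)
  moreover have "x = total0 a"
    by (rule extensionalityI[of _ "{..0}"]) (use x b \<open>b = ([], a)\<close> in \<open>auto simp: total0_def\<close>)
  ultimately show ?thesis using that by blast
qed

lemma linear_map_total0_value: "linear_map (chain_space TJ 0) (quot (Coker M) comC) total0_value"
proof -
  have "linear_map (chain_space TJ 0) (bispace (bicx J) 0 0) (\<lambda>x. x 0)"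
    using linear_map_component[of 0 "{..0}" "\<lambda>p. bispace (bicx J) p (0 - p)"]
    by (simp add: crossed_total_def total_space)
  then have "linear_map (chain_space TJ 0) (N 0) (\<lambda>x. chain0_value (N 0) (x 0))"
    by (rule linear_map_comp) (simp add: bispace_BJ linear_map_chain0_value[OF nerve_algebra J0])
  from linear_map_comp[OF linear_map_comp[OF this linear_map_proj] linear_map_coset[OF Coker_module comC_subspace]]
  show ?thesis unfolding total0_value_def[abs_def] .
qed

lemma total0_value_total0: "a \<in> carrier A \<Longrightarrow> total0_value (total0 a) = comC +>\<^bsub>Coker M\<^esub> (I +>\<^bsub>A\<^esub> a)"
  by (simp add: total0_value_def total0_def chain0_value_chain0[OF nerve_algebra J0] nerve_Nil_simps proj_simps)

lemma total0_value_surj: "total0_value ` carrier (chain_space TJ 0) = carrier (quot (Coker M) comC)"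
proof (intro equalityI subsetI)
  fix u assume "u \<in> carrier (quot (Coker M) comC)"
  then obtain a where "a \<in> carrier A" "u = comC +>\<^bsub>Coker M\<^esub> (I +>\<^bsub>A\<^esub> a)"
    by (auto simp: quot_carrier Coker_carrier)
  then show "u \<in> total0_value ` carrier (chain_space TJ 0)"
    using total0_value_total0 linear_mapD(1)[OF linear_map_total0] by (metis image_eqI)
qed (use linear_mapD(1)[OF linear_map_total0_value] in auto)

lemma diff_T_1: "diff TJ (Suc 0) x = (\<lambda>m\<in>{..0}. hdiff (bicx J) (Suc 0) 0 (x (Suc 0)) \<oplus>\<^bsub>bispace (bicx J) 0 0\<^esub> vdiff (bicx J) 0 (Suc 0) (x 0))"
  unfolding crossed_total_def total_diff by (rule restrict_ext) simp

lemma T_1: "x \<in> carrier (chain_space TJ (Suc 0)) \<longleftrightarrow> x \<in> extensional {..Suc 0} \<and>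
    x 0 \<in> carrier (bispace (bicx J) 0 (Suc 0)) \<and> x (Suc 0) \<in> carrier (bispace (bicx J) (Suc 0) 0)"
  by (simp add: crossed_total_def total_space direct_sum_simps PiE_iff atMost_Suc) auto

text \<open>The faces of \<open>(s, 0)\<close> are \<open>0\<close> and \<open>\<rho> s\<close>, so \<open>- \<rho> s\<close> is a boundary.\<close>

lemma total0_image_boundary:
  assumes s: "s \<in> carrier R"
  shows "total0 (\<rho> s) \<in> boundaries TJ 0"
proof -
  note hl = is_bicomplexD(2)[OF is_bicomplex_BJ] and vl = is_bicomplexD(3)[OF is_bicomplex_BJ]
  note BM = BJ_module
  let ?t = "tuple_cons s ([], \<zero>\<^bsub>A\<^esub>)"
  have t: "?t \<in> carrier (N (Suc 0))" using s by (simp add: nerve_1_mem zero_simps)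
  have z: "([], \<zero>\<^bsub>A\<^esub>) \<in> carrier (N 0)" "([], \<rho> s) \<in> carrier (N 0)" using s by (simp_all add: nerve_Nil_simps closed)
  interpret B00: module scalars "bispace (bicx J) 0 0" by (rule BM)
  define X where "X = (\<lambda>m\<in>{..Suc 0}. if m = 0 then \<zero>\<^bsub>bispace (bicx J) 0 (Suc 0)\<^esub> else chain0 (N (Suc 0)) ?t)"
  have X: "X \<in> carrier (chain_space TJ (Suc 0))"
    using chain0_mem[OF t] zero_mem[OF BM] by (simp add: T_1 X_def)
  have "hdiff (bicx J) (Suc 0) 0 (X (Suc 0)) = chain0 (N 0) (([], \<zero>\<^bsub>A\<^esub>) \<ominus>\<^bsub>N 0\<^esub> ([], \<rho> s))"
    using s by (simp add: X_def hdiff_chain0_1[OF t] face_0 face_1_Nil closed zero_simps)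
  also have "([], \<zero>\<^bsub>A\<^esub>) \<ominus>\<^bsub>N 0\<^esub> ([], \<rho> s) = ([], \<zero>\<^bsub>A\<^esub> \<ominus>\<^bsub>A\<^esub> \<rho> s)"
    using linear_map_diff[OF A_module nerve_module linear_map_Nil, of "\<zero>\<^bsub>A\<^esub>" "\<rho> s"] s by (simp add: closed)
  finally have hX: "hdiff (bicx J) (Suc 0) 0 (X (Suc 0)) = chain0 (N 0) ([], \<zero>\<^bsub>A\<^esub> \<ominus>\<^bsub>A\<^esub> \<rho> s)" .
  have "vdiff (bicx J) 0 (Suc 0) (X 0) = \<zero>\<^bsub>bispace (bicx J) 0 0\<^esub>"
    using linear_map_zero[OF BM BM vl, of 0 0] by (simp add: X_def)
  moreover have "chain0 (N 0) ([], \<zero>\<^bsub>A\<^esub> \<ominus>\<^bsub>A\<^esub> \<rho> s) \<in> carrier (bispace (bicx J) 0 0)"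
    using s by (intro chain0_mem) (simp add: nerve_Nil_simps closed diff_mem[OF A_module])
  ultimately have "diff TJ (Suc 0) X = total0 (\<zero>\<^bsub>A\<^esub> \<ominus>\<^bsub>A\<^esub> \<rho> s)" by (simp add: diff_T_1 hX total0_def)
  then have b: "total0 (\<zero>\<^bsub>A\<^esub> \<ominus>\<^bsub>A\<^esub> \<rho> s) \<in> boundaries TJ 0"
    using X by (auto simp: boundaries_def intro: rev_image_eqI)
  have "\<zero>\<^bsub>A\<^esub> \<ominus>\<^bsub>A\<^esub> \<rho> s = (- 1) \<odot>\<^bsub>A\<^esub> \<rho> s"
    using s minus_conv_smult[OF A_module, of "\<rho> s"] by (simp add: a_minus_def closed zero_simps)
  then have "(- 1) \<odot>\<^bsub>A\<^esub> (\<zero>\<^bsub>A\<^esub> \<ominus>\<^bsub>A\<^esub> \<rho> s) = \<rho> s"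
    using s module_simps(5)[OF A_module, of "\<rho> s" "- 1" "- 1"] by (simp add: closed module_simps(2)[OF A_module])
  moreover have "(- 1) \<odot>\<^bsub>chain_space TJ 0\<^esub> total0 (\<zero>\<^bsub>A\<^esub> \<ominus>\<^bsub>A\<^esub> \<rho> s) \<in> boundaries TJ 0"
    by (rule subspaceD(4)[OF T_module boundaries_subspace[OF T_complex] b])
  ultimately show ?thesis
    using linear_mapD(3)[OF linear_map_total0, of "\<zero>\<^bsub>A\<^esub> \<ominus>\<^bsub>A\<^esub> \<rho> s" "- 1"] s
    by (simp add: closed diff_mem[OF A_module])
qed

lemma total0_commutator_boundary:
  assumes a: "a \<in> carrier A" and b: "b \<in> carrier A"
  shows "total0 ((a \<otimes>\<^bsub>A\<^esub> b) \<ominus>\<^bsub>A\<^esub> (b \<otimes>\<^bsub>A\<^esub> a)) \<in> boundaries TJ 0"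
proof -
  note hl = is_bicomplexD(2)[OF is_bicomplex_BJ]
  note BM = BJ_module
  have ab: "([], a) \<in> carrier (N 0)" "([], b) \<in> carrier (N 0)" using a b by (simp_all add: nerve_Nil_simps)
  let ?c = "(a \<otimes>\<^bsub>A\<^esub> b) \<ominus>\<^bsub>A\<^esub> (b \<otimes>\<^bsub>A\<^esub> a)"
  interpret B00: module scalars "bispace (bicx J) 0 0" by (rule BM)
  define X where "X = (\<lambda>m\<in>{..Suc 0}. if m = 0 then chain1 (N 0) ([], a) ([], b) else \<zero>\<^bsub>bispace (bicx J) (Suc 0) 0\<^esub>)"
  have X: "X \<in> carrier (chain_space TJ (Suc 0))"
    using chain1_mem'[OF ab] zero_mem[OF BM] by (simp add: T_1 X_def)
  have "vdiff (bicx J) 0 (Suc 0) (X 0) = chain0 (N 0) (([], a \<otimes>\<^bsub>A\<^esub> b) \<ominus>\<^bsub>N 0\<^esub> ([], b \<otimes>\<^bsub>A\<^esub> a))"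
    using diff_chain1[OF nerve_algebra J0 ab] vdiff_0[OF J chain1_mem'[OF ab]]
    by (simp add: X_def nerve_Nil_simps)
  also have "([], a \<otimes>\<^bsub>A\<^esub> b) \<ominus>\<^bsub>N 0\<^esub> ([], b \<otimes>\<^bsub>A\<^esub> a) = ([], ?c)"
    using linear_map_diff[OF A_module nerve_module linear_map_Nil, of "a \<otimes>\<^bsub>A\<^esub> b" "b \<otimes>\<^bsub>A\<^esub> a"] a b by (simp add: closed)
  finally have vX: "vdiff (bicx J) 0 (Suc 0) (X 0) = chain0 (N 0) ([], ?c)" .
  have "hdiff (bicx J) (Suc 0) 0 (X (Suc 0)) = \<zero>\<^bsub>bispace (bicx J) 0 0\<^esub>"
    using linear_map_zero[OF BM BM hl, of 0 0] by (simp add: X_def)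
  moreover have "chain0 (N 0) ([], ?c) \<in> carrier (bispace (bicx J) 0 0)"
    using a b by (intro chain0_mem) (simp add: nerve_Nil_simps closed diff_mem[OF A_module])
  ultimately have "diff TJ (Suc 0) X = total0 ?c" by (simp add: diff_T_1 vX total0_def)
  then show ?thesis using X by (auto simp: boundaries_def intro: rev_image_eqI)
qed

text \<open>Boundaries have value zero since the projection equates the two faces of level \<open>1\<close> and sends
  \<open>b\<close> of a tensor to a sum of commutators. Conversely, \<open>a \<mapsto> [a]\<close> into chains modulo boundaries
  kills the image of \<open>\<rho>\<close>; the induced map on the cokernel kills commutators, hence their span.\<close>

lemma total0_value_kernel: "boundaries TJ 0 = {x \<in> carrier (chain_space TJ 0). total0_value x = \<zero>\<^bsub>quot (Coker M) comC\<^esub>}"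
proof (intro equalityI subsetI)
  note BM = BJ_module
  note h = linear_mapD[OF is_bicomplexD(2)[OF is_bicomplex_BJ]]
    and v = linear_mapD[OF is_bicomplexD(3)[OF is_bicomplex_BJ]]
  have val: "linear_map (bispace (bicx J) 0 0) (Coker M) (\<lambda>x. proj (chain0_value (N 0) x))"
    unfolding bispace_BJ by (rule linear_map_comp[OF linear_map_chain0_value[OF nerve_algebra J0] linear_map_proj])
  fix x assume x: "x \<in> boundaries TJ 0"
  then obtain X where X: "X \<in> carrier (chain_space TJ (Suc 0))" "x = diff TJ (Suc 0) X" by (auto simp: boundaries_def)
  have X0: "X 0 \<in> carrier (bispace (bicx J) 0 (Suc 0))" and X1: "X (Suc 0) \<in> carrier (bispace (bicx J) (Suc 0) 0)"
    using X(1) by (auto simp: T_1)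
  obtain t where t: "t \<in> carrier (N (Suc 0))" "X (Suc 0) = chain0 (N (Suc 0)) t"
    using chain0_cases[OF nerve_algebra J0 X1[unfolded bispace_BJ]] .
  have d: "nerve_face M (Suc 0) 0 t \<in> carrier (N 0)" "nerve_face M (Suc 0) (Suc 0) t \<in> carrier (N 0)"
    using nerve_face_hom[OF _ t(1)] by auto
  have "proj (chain0_value (N 0) (hdiff (bicx J) (Suc 0) 0 (X (Suc 0)))) =
      proj (nerve_face M (Suc 0) 0 t) \<ominus>\<^bsub>Coker M\<^esub> proj (nerve_face M (Suc 0) (Suc 0) t)"
    using d by (simp add: t(2) hdiff_chain0_1[OF t(1)] chain0_value_chain0[OF nerve_algebra J0]
        diff_mem[OF nerve_module] linear_map_diff[OF nerve_module Coker_module linear_map_proj])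
  then have 1: "proj (chain0_value (N 0) (hdiff (bicx J) (Suc 0) 0 (X (Suc 0)))) = \<zero>\<^bsub>Coker M\<^esub>"
    using proj_faces[OF t(1)] d linear_mapD(1)[OF linear_map_proj] by (simp add: diff_eq_zero_iff[OF Coker_module])
  have X0': "X 0 \<in> carrier (chain_space (cyclic_total J (N 0)) (Suc 0))" using X0 by (simp add: bispace_BJ)
  have "proj (commutator_map (N 0) (X 0 0)) \<in> comC"
  proof (rule tensor_power_induct[OF nerve_module Coker_module linear_map_comp[OF linear_map_commutator_map[OF nerve_algebra] linear_map_proj] comC_subspace])
    show "X 0 0 \<in> carrier (tensor_power (N 0) (Suc (Suc 0)))"
      using cyclic_total_component(2)[OF nerve_algebra X0', of 0] by simp
    fix w assume "w \<in> tensor_words (N 0) (Suc (Suc 0))"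
    then obtain a b where ab: "a \<in> carrier A" "b \<in> carrier A" "w = [([], a), ([], b)]"
      by (auto simp: words_2 nerve_carrier_0)
    then have "commutator_map (N 0) (tensor_class (N 0) (Suc (Suc 0)) (Poly_Mapping.single w 1)) =
        ([], (a \<otimes>\<^bsub>A\<^esub> b) \<ominus>\<^bsub>A\<^esub> (b \<otimes>\<^bsub>A\<^esub> a))"
      using linear_map_diff[OF A_module nerve_module linear_map_Nil, of "a \<otimes>\<^bsub>A\<^esub> b" "b \<otimes>\<^bsub>A\<^esub> a"]
      by (simp add: commutator_map_word[OF nerve_algebra] nerve_Nil_simps closed)
    then show "proj (commutator_map (N 0) (tensor_class (N 0) (Suc (Suc 0)) (Poly_Mapping.single w 1))) \<in> comC"
      using comC_mem[OF ab(1,2)] by (simp add: proj_simps)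
  qed
  then have 2: "proj (chain0_value (N 0) (vdiff (bicx J) 0 (Suc 0) (X 0))) \<in> comC"
    using vdiff_0[OF J X0] chain0_value_diff[OF nerve_algebra J0 X0'] by simp
  interpret C: module scalars "Coker M" by (rule Coker_module)
  have "proj (chain0_value (N 0) (x 0)) \<in> comC"
    using 1 2 X0 X1 linear_mapD(2)[OF val h(1)[OF X1] v(1)[OF X0]] linear_mapD(1)[OF val v(1)[OF X0]]
    by (simp add: X(2) diff_T_1)
  moreover have "proj (chain0_value (N 0) (x 0)) \<in> carrier (Coker M)"
    using calculation subspaceD(1)[OF Coker_module comC_subspace] by blast
  ultimately show "x \<in> {x \<in> carrier (chain_space TJ 0). total0_value x = \<zero>\<^bsub>quot (Coker M) comC\<^esub>}"
    using x subspaceD(1)[OF T_module boundaries_subspace[OF T_complex]] coset_eq_subspace_iff[OF Coker_module comC_subspace]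
    by (simp add: total0_value_def quot_zero)
next
  fix x assume x: "x \<in> {x \<in> carrier (chain_space TJ 0). total0_value x = \<zero>\<^bsub>quot (Coker M) comC\<^esub>}"
  then obtain a where a: "a \<in> carrier A" "x = total0 a" using total0_cases by blast
  have bsub: "submodule (boundaries TJ 0) scalars (chain_space TJ 0)" by (rule boundaries_subspace[OF T_complex])
  have Qm: "module scalars (quot (chain_space TJ 0) (boundaries TJ 0))" by (rule quot_module[OF T_module bsub])
  define f where "f a = boundaries TJ 0 +>\<^bsub>chain_space TJ 0\<^esub> total0 a" for a
  have f: "linear_map A (quot (chain_space TJ 0) (boundaries TJ 0)) f"
    unfolding f_def by (rule linear_map_comp[OF linear_map_total0 linear_map_coset[OF T_module bsub]])
  have f0: "f a = \<zero>\<^bsub>quot (chain_space TJ 0) (boundaries TJ 0)\<^esub> \<longleftrightarrow> total0 a \<in> boundaries TJ 0" if "a \<in> carrier A" for a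
    using coset_eq_subspace_iff[OF T_module bsub linear_mapD(1)[OF linear_map_total0 that]] by (simp add: f_def quot_zero)
  have fI: "f y = \<zero>\<^bsub>quot (chain_space TJ 0) (boundaries TJ 0)\<^esub>" if "y \<in> I" for y
    using that total0_image_boundary f0[OF I_carrier[OF that]] by (auto simp: image_ideal_def)
  have fl: "linear_map (Coker M) (quot (chain_space TJ 0) (boundaries TJ 0)) (quot_lift f)"
    unfolding Coker_def by (rule linear_map_quot_lift[OF A_module I_subspace Qm f fI])
  have flc: "quot_lift f (I +>\<^bsub>A\<^esub> c) = f c" if "c \<in> carrier A" for c
    by (rule quot_lift_coset[OF A_module I_subspace Qm f fI that])
  have mem: "I +>\<^bsub>A\<^esub> a \<in> comC"
    using x a coset_eq_subspace_iff[OF Coker_module comC_subspace, of "I +>\<^bsub>A\<^esub> a"]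
    by (auto simp: total0_value_total0 quot_zero Coker_carrier)
  have "quot_lift f (I +>\<^bsub>A\<^esub> a) \<in> {\<zero>\<^bsub>quot (chain_space TJ 0) (boundaries TJ 0)\<^esub>}"
  proof (rule linear_map_lin_span[OF Coker_module Qm fl _ _ _ mem[unfolded commutator_space_def]])
    interpret Qi: module scalars "quot (chain_space TJ 0) (boundaries TJ 0)" by (rule Qm)
    show "submodule {\<zero>\<^bsub>quot (chain_space TJ 0) (boundaries TJ 0)\<^esub>} scalars (quot (chain_space TJ 0) (boundaries TJ 0))"
      by (rule subspaceI[OF Qm]) (auto simp: module_smult_zero[OF Qm])
    show "{x \<otimes>\<^bsub>Coker M\<^esub> y \<ominus>\<^bsub>Coker M\<^esub> y \<otimes>\<^bsub>Coker M\<^esub> x |x y. x \<in> carrier (Coker M) \<and> y \<in> carrier (Coker M)}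
        \<subseteq> carrier (Coker M)"
      by (auto intro!: diff_mem[OF Coker_module] nonunital_algebra.m_closed[OF Coker_algebra])
    fix u assume "u \<in> {x \<otimes>\<^bsub>Coker M\<^esub> y \<ominus>\<^bsub>Coker M\<^esub> y \<otimes>\<^bsub>Coker M\<^esub> x |x y. x \<in> carrier (Coker M) \<and> y \<in> carrier (Coker M)}"
    then obtain p q where pq: "p \<in> carrier A" "q \<in> carrier A"
      "u = (I +>\<^bsub>A\<^esub> p) \<otimes>\<^bsub>Coker M\<^esub> (I +>\<^bsub>A\<^esub> q) \<ominus>\<^bsub>Coker M\<^esub> (I +>\<^bsub>A\<^esub> q) \<otimes>\<^bsub>Coker M\<^esub> (I +>\<^bsub>A\<^esub> p)"
      unfolding Coker_carrier by blast
    then have c: "(p \<otimes>\<^bsub>A\<^esub> q) \<ominus>\<^bsub>A\<^esub> (q \<otimes>\<^bsub>A\<^esub> p) \<in> carrier A" and u: "u = I +>\<^bsub>A\<^esub> ((p \<otimes>\<^bsub>A\<^esub> q) \<ominus>\<^bsub>A\<^esub> (q \<otimes>\<^bsub>A\<^esub> p))"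
      by (simp_all add: Coker_mult Coker_diff A_closed diff_mem[OF A_module])
    show "quot_lift f u \<in> {\<zero>\<^bsub>quot (chain_space TJ 0) (boundaries TJ 0)\<^esub>}"
      using flc[OF c] f0[OF c] total0_commutator_boundary[OF pq(1,2)] by (simp add: u)
  qed
  then have "f a = \<zero>\<^bsub>quot (chain_space TJ 0) (boundaries TJ 0)\<^esub>" using flc[OF a(1)] by simp
  then show "x \<in> boundaries TJ 0" using f0[OF a(1)] a(2) by simp
qed

lemma homology_0_iso:
  "\<exists>\<phi>. linear_iso (homology TJ 0) (quot (Coker M) comC) \<phi> \<and>
    (\<forall>a\<in>carrier A. \<phi> (class0 J M a) = comC +>\<^bsub>Coker M\<^esub> (I +>\<^bsub>A\<^esub> a))"
proof (intro exI conjI ballI)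
  have V: "chain_space TJ 0\<lparr>carrier := cycles TJ 0\<rparr> = chain_space TJ 0" by (simp add: cycles_def)
  have Qm: "module scalars (quot (Coker M) comC)" by (rule quot_module[OF Coker_module comC_subspace])
  have H: "homology TJ 0 = quot (chain_space TJ 0) (boundaries TJ 0)" unfolding homology_def V ..
  show "linear_iso (homology TJ 0) (quot (Coker M) comC) (quot_lift total0_value)"
    unfolding H
    by (rule linear_iso_quot_lift[OF T_module boundaries_subspace[OF T_complex] Qm linear_map_total0_value
          total0_value_kernel total0_value_surj])
  fix a assume a: "a \<in> carrier A"
  have "class0 J M a = boundaries TJ 0 +>\<^bsub>chain_space TJ 0\<^esub> total0 a"
    by (simp add: class0_def total0_def chain0_def letter_def tensor_class_def pure_tensor_def)
  moreover have "quot_lift total0_value (boundaries TJ 0 +>\<^bsub>chain_space TJ 0\<^esub> total0 a) = total0_value (total0 a)"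
    by (rule quot_lift_coset[OF T_module boundaries_subspace[OF T_complex] Qm linear_map_total0_value _
          linear_mapD(1)[OF linear_map_total0 a]]) (use total0_value_kernel in auto)
  ultimately show "quot_lift total0_value (class0 J M a) = comC +>\<^bsub>Coker M\<^esub> (I +>\<^bsub>A\<^esub> a)"
    using total0_value_total0[OF a] by simp
qed

end

end

lemma direct_sum_cong: "(\<And>i. i \<in> I \<Longrightarrow> V i = W i) \<Longrightarrow> direct_sum I V = direct_sum I W"
  by (auto simp: direct_sum_def fun_eq_iff intro!: PiE_cong)

text \<open>Homology in degree \<open>0\<close> sees total degrees \<open>0\<close> and \<open>1\<close>, where the two cyclic bicomplexes have
  the same spaces and maps.\<close>

lemma homology_0_eq:
  fixes M :: "('k::field, 'r, 'a) crossed_module_data"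
  shows "HH_crossed M 0 = HC_crossed M 0"
proof -
  have C: "chain_space (cyclic_total {0, 1} A) n = chain_space (cyclic_total UNIV A) n" if "n \<le> Suc 0"
    for n and A :: "('k, 'r list \<times> 'a) module"
    unfolding cyclic_total_space using that
    by (intro direct_sum_cong) (auto simp: cyclic_bicomplex_simps)
  have d: "diff (cyclic_total {0, 1} A) (Suc 0) = diff (cyclic_total UNIV A) (Suc 0)"
    for A :: "('k, 'r list \<times> 'a) module"
    by (intro ext) (simp add: cyclic_total_diff cyclic_bicomplex_simps cong: restrict_cong)
  have space: "chain_space (crossed_total {0, 1} M) n = chain_space (crossed_total UNIV M) n" if "n \<le> Suc 0" for n
    unfolding crossed_total_def total_space simplicial_bicomplex_simps using that
    by (intro direct_sum_cong C) auto
  have h: "hdiff (simplicial_bicomplex {0, 1} (nerve M)) (Suc 0) 0 = hdiff (simplicial_bicomplex UNIV (nerve M)) (Suc 0) 0"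
    by (intro ext) (simp add: simplicial_bicomplex_def Let_def C[of 0, simplified])
  have v: "vdiff (simplicial_bicomplex {0, 1} (nerve M)) 0 (Suc 0) = vdiff (simplicial_bicomplex UNIV (nerve M)) 0 (Suc 0)"
    by (intro ext) (simp add: simplicial_bicomplex_def C[of 0, simplified] d[simplified])
  have b: "bispace (simplicial_bicomplex {0, 1} (nerve M)) 0 0 = bispace (simplicial_bicomplex UNIV (nerve M)) 0 0"
    unfolding simplicial_bicomplex_simps by (rule C) simp
  have D: "diff (crossed_total {0, 1} M) (Suc 0) = diff (crossed_total UNIV M) (Suc 0)"
    unfolding crossed_total_def by (intro ext) (simp add: total_diff h[simplified] v[simplified] b[simplified] cong: restrict_cong)
  show ?thesis
    unfolding HH_crossed_def HC_crossed_def homology_def boundaries_def cycles_def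
    by (simp add: space[of 0, simplified] space[of "Suc 0", simplified] D[simplified])
qed

theorem theorem3p3p1:
  fixes M :: "('k::field, 'r, 'a) crossed_module_data"
  assumes "crossed_module M"
  shows
    "(\<exists>\<delta> \<epsilon>. exact_sequence5
        (HH_crossed M 2) (HH_coker_map M 2) (HH (Coker M) 2) \<delta>
        (Ker_mod_commutators M) \<epsilon> (HH_crossed M 1) (HH_coker_map M 1) (HH (Coker M) 1)) \<and>
     (\<exists>\<delta> \<epsilon>. exact_sequence5
        (HC_crossed M 2) (HC_coker_map M 2) (HC (Coker M) 2) \<delta>
        (Ker_mod_commutators M) \<epsilon> (HC_crossed M 1) (HC_coker_map M 1) (HC (Coker M) 1)) \<and>
     HH_crossed M 0 = HC_crossed M 0 \<and>
     (\<exists>\<phi>. linear_iso (HH_crossed M 0) (quot (Coker M) (commutator_space (Coker M))) \<phi> \<and>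
       (\<forall>a\<in>carrier (target M). \<phi> (class0 {0, 1} M a) =
          commutator_space (Coker M) +>\<^bsub>Coker M\<^esub> (image_ideal M +>\<^bsub>target M\<^esub> a)))"
proof -
  interpret crossed_module M by fact
  have J: "lower_closed {0, 1}" "lower_closed UNIV" by (auto simp: lower_closed_def)
  show ?thesis
    using exact_sequence_crossed[OF J(1)] exact_sequence_crossed[OF J(2)] homology_0_eq[of M]
      homology_0_iso[OF J(1)]
    by (simp add: HH_crossed_def HC_crossed_def HH_coker_map_def HC_coker_map_def HH_def HC_def
        numeral_2_eq_2)
qed

end
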